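(* Fix $\lambda\in\{1,1.5,2,2.5,3\}$, $\mu\in\mathbb{R}$ and $\sigma>0$, and let $X_1,X_2,\ldots$ be i.i.d. with the $\mathrm{EPD}_\lambda(\mu,\sigma)$ distribution (the null hypothesis). Let $Z(S_\lambda)$, $Z^*(S_\lambda)$, $Z(K_\lambda^{\mathrm{net}})$, $Z^*(K_\lambda^{\mathrm{net}})$ and $X_\lambda^{\mathrm{APD}}$ be the statistics computed from $X_1,\ldots,X_n$ as defined in the context. Then, as $n\to\infty$, $$\frac{Z(S_\lambda)}{Z^*(S_\lambda)}\xrightarrow{\ \mathrm{a.s.}\ }1,\qquad \frac{Z(K_\lambda^{\mathrm{net}})}{Z^*(K_\lambda^{\mathrm{net}})}\xrightarrow{\ \mathcal P\ }1,$$ $$\begin{pmatrix} Z(S_\lambda)\\ Z(K_\lambda^{\mathrm{net}})\end{pmatrix}\xrightarrow{\ \mathcal{D}\ }\mathcal{N}_2\left(\begin{pmatrix}0\\0\end{pmatrix},\begin{pmatrix}1&0\\0&1\end{pmatrix}\right)\quad\text{and}\quad X_\lambda^{\mathrm{APD}}\xrightarrow{\ \mathcal{D}\ }\chi_2^2 .$$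
   Context: $\mathrm{EPD}_\lambda(\mu,\sigma)$ is the distribution on $\mathbb{R}$ with density $g_\lambda(x\mid\mu,\sigma)=\frac{1}{2\sigma\lambda^{1/\lambda}\Gamma(1+1/\lambda)}\exp\left(-\frac1\lambda\left|\frac{x-\mu}{\sigma}\right|^\lambda\right)$. Estimators (computed from $X_1,\dots,X_n$): $\hat\mu_\lambda$ is the sample median if $\lambda=1$ (central order statistic if $n$ is odd, arithmetic mean of the two central order statistics if $n$ is even), and for $\lambda>1$ it is the unique solution $m$ of $\sum_{i=1}^n|X_i-m|^{\lambda-1}\mathrm{sign}(X_i-m)=0$ (the sample mean when $\lambda=2$). $\hat\sigma_\lambda=\left(\frac1n\sum_{i=1}^n|X_i-\hat\mu_\lambda|^\lambda\right)^{1/\lambda}$. With $\hat Y_i=\hat\sigma_\lambda^{-1}(X_i-\hat\mu_\lambda)$ and the convention $|y|^\lambda\log|y|=0$ at $y=0$: $S_\lambda=\frac1n\sum_{i=1}^n|\hat Y_i|^\lambda\mathrm{sign}(\hat Y_i)$, $K_\lambda=\frac1n\sum_{i=1}^n|\hat Y_i|^\lambda\log|\hat Y_i|$, $K_\lambda^{\mathrm{net}}=\max\big(0,K_\lambda-(\lambda/2)S_\lambda^2\big)$. $\psi=(\log\Gamma)'$ is the digamma function and $\psi_1=\psi'$ the trigamma function. Put $V_S=1+\lambda-\frac{\lambda^2}{\Gamma(2-1/\lambda)\Gamma(1/\lambda)}$, $E_K=\frac{\lambda+\log\lambda+\psi(1/\lambda)}{\lambda}$, $V_K=\frac{(1+1/\lambda)\psi_1(1+1/\lambda)-1}{\lambda}$.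 Statistics: $Z^*(S_\lambda)=\sqrt n\,V_S^{-1/2}S_\lambda$, $Z^*(K_\lambda^{\mathrm{net}})=\sqrt n\left[\tfrac1{16}E_K^{-3/2}V_K\right]^{-1/2}\left((K_\lambda^{\mathrm{net}})^{1/4}-E_K^{1/4}\right)$, $Z(S_\lambda)=\sqrt n\,S_\lambda\left[V_S\left(1+\frac{c_1}{n^{\alpha_1}}\right)\right]^{-1/2}$, $Z(K_\lambda^{\mathrm{net}})=\sqrt n\left((K_\lambda^{\mathrm{net}})^{1/4}-E_K^{1/4}\left(1+\frac{c_2}{n^{\alpha_2}}\right)\right)\left[\tfrac1{16}E_K^{-3/2}V_K\left(1+\frac{c_3}{n^{\alpha_3}}+\frac{c_4}{n^{\alpha_4}}\right)\right]^{-1/2}$, $X_\lambda^{\mathrm{APD}}=Z(S_\lambda)^2+Z(K_\lambda^{\mathrm{net}})^2$. The constants $(\alpha_1,c_1,\alpha_2,c_2,\alpha_3,c_3,\alpha_4,c_4)$ depend on $\lambda$ (and on the parity of $n$ if $\lambda=1$): $\lambda=1$, $n$ even: $(1.06,-1.856,1.01,-0.422,0.92,-1.950,2.3,39.349)$; $\lambda=1$, $n$ odd: $(1.03,-0.281,0.86,-0.198,1.04,-3.827,1.0,0)$; $\lambda=1.5$: $(0.99,-0.952,0.99,-0.637,0.55,-3.488,0.5,2.434)$; $\lambda=2$: $(0.99,-1.890,1.00,-0.788,1.05,-9.327,1.4,14.208)$; $\lambda=2.5$: $(0.99,-2.981,0.99,-0.844,1.10,-23.104,1.3,30.028)$; $\lambda=3$: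 $(0.97,-3.855,0.98,-0.880,1.14,-95.743,1.2,103.871)$. (The statistics are considered for $n$ large enough that the quantities under the square roots are positive.) $\chi_2^2$ is the chi-square distribution with 2 degrees of freedom; $\xrightarrow{\mathcal D}$, $\xrightarrow{\mathcal P}$, $\xrightarrow{\mathrm{a.s.}}$ denote convergence in distribution, in probability and almost surely. *)

theory Defs
  imports "HOL-Probability.Probability"
begin

definition EPD_density :: "real \<Rightarrow> real \<Rightarrow> real \<Rightarrow> real \<Rightarrow> real" where
  "EPD_density lam \<mu> \<sigma> x =
     1 / (2 * \<sigma> * lam powr (1 / lam) * Gamma (1 + 1 / lam))
     * exp (- (1 / lam) * \<bar>(x - \<mu>) / \<sigma>\<bar> powr lam)"

definition chi_square_distribution :: "nat \<Rightarrow> real measure" where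
  "chi_square_distribution k = density lborel (\<lambda>x. ennreal
     (if x > 0 then x powr (real k / 2 - 1) * exp (- x / 2) / (2 powr (real k / 2) * Gamma (real k / 2))
      else 0))"

text \<open>The nondegenerate multivariate normal law; it is meaningful for symmetric
  positive definite \<open>C\<close> only.\<close>

definition multivariate_normal :: "real ^ 'n \<Rightarrow> real ^ 'n ^ 'n \<Rightarrow> (real ^ 'n) measure" where
  "multivariate_normal m C = density lborel (\<lambda>x. ennreal
     (exp (- ((x - m) \<bullet> (matrix_inv C *v (x - m))) / 2) / sqrt ((2 * pi) ^ CARD('n) * det C)))"

text \<open>The library's \<open>weak_conv_m\<close> is defined through distribution functions and
  covers real-valued variables only. Measurability is part of both definitions below because
  \<open>measure\<close> and the Bochner integral return default values on nonmeasurable arguments.\<close>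

definition converges_in_distribution ::
  "'a measure \<Rightarrow> (nat \<Rightarrow> 'a \<Rightarrow> 'b::topological_space) \<Rightarrow> 'b measure \<Rightarrow> bool" where
  "converges_in_distribution M Z N \<longleftrightarrow>
     (\<forall>n. Z n \<in> borel_measurable M) \<and>
     (\<forall>f :: 'b \<Rightarrow> real. continuous_on UNIV f \<longrightarrow> bounded (range f) \<longrightarrow>
        (\<lambda>n. \<integral>\<omega>. f (Z n \<omega>) \<partial>M) \<longlonglongrightarrow> (\<integral>z. f z \<partial>N))"

definition converges_in_probability ::
  "'a measure \<Rightarrow> (nat \<Rightarrow> 'a \<Rightarrow> real) \<Rightarrow> real \<Rightarrow> bool" where
  "converges_in_probability M Z c \<longleftrightarrow>
     (\<forall>n. Z n \<in> borel_measurable M) \<and>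
     (\<forall>\<epsilon>>0. (\<lambda>n. measure M {\<omega> \<in> space M. \<bar>Z n \<omega> - c\<bar> > \<epsilon>}) \<longlonglongrightarrow> 0)"

text \<open>Samples are sequences \<open>x :: nat \<Rightarrow> real\<close>, and the sample of size \<open>n\<close> consists of
  \<open>x 0, \<dots>, x (n - 1)\<close>, so that \<open>x i\<close> is the observation with number \<open>i + 1\<close>.\<close>

definition sample_median :: "nat \<Rightarrow> (nat \<Rightarrow> real) \<Rightarrow> real" where
  "sample_median n x = (let xs = sort (map x [0..<n]) in
     if odd n then xs ! (n div 2) else (xs ! (n div 2 - 1) + xs ! (n div 2)) / 2)"

definition mu_hat :: "real \<Rightarrow> nat \<Rightarrow> (nat \<Rightarrow> real) \<Rightarrow> real" where
  "mu_hat lam n x =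
     (if lam = 1 then sample_median n x
      else (THE m. (\<Sum>i<n. \<bar>x i - m\<bar> powr (lam - 1) * sgn (x i - m)) = 0))"

definition sigma_hat :: "real \<Rightarrow> nat \<Rightarrow> (nat \<Rightarrow> real) \<Rightarrow> real" where
  "sigma_hat lam n x = ((1 / real n) * (\<Sum>i<n. \<bar>x i - mu_hat lam n x\<bar> powr lam)) powr (1 / lam)"

definition Y_hat :: "real \<Rightarrow> nat \<Rightarrow> (nat \<Rightarrow> real) \<Rightarrow> nat \<Rightarrow> real" where
  "Y_hat lam n x i = (x i - mu_hat lam n x) / sigma_hat lam n x"

definition S_stat :: "real \<Rightarrow> nat \<Rightarrow> (nat \<Rightarrow> real) \<Rightarrow> real" where
  "S_stat lam n x = (1 / real n) * (\<Sum>i<n. \<bar>Y_hat lam n x i\<bar> powr lam * sgn (Y_hat lam n x i))"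

text \<open>Since \<open>0 powr lam = 0\<close>, the summands below vanish where \<open>Y_hat\<close> does,
  whatever the value of \<open>ln 0\<close>.\<close>

definition K_stat :: "real \<Rightarrow> nat \<Rightarrow> (nat \<Rightarrow> real) \<Rightarrow> real" where
  "K_stat lam n x = (1 / real n) * (\<Sum>i<n. \<bar>Y_hat lam n x i\<bar> powr lam * ln \<bar>Y_hat lam n x i\<bar>)"

definition K_net :: "real \<Rightarrow> nat \<Rightarrow> (nat \<Rightarrow> real) \<Rightarrow> real" where
  "K_net lam n x = max 0 (K_stat lam n x - (lam / 2) * (S_stat lam n x)\<^sup>2)"

definition V_S :: "real \<Rightarrow> real" where
  "V_S lam = 1 + lam - lam\<^sup>2 / (Gamma (2 - 1 / lam) * Gamma (1 / lam))"

definition E_K :: "real \<Rightarrow> real" where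
  "E_K lam = (lam + ln lam + Digamma (1 / lam)) / lam"

definition V_K :: "real \<Rightarrow> real" where
  "V_K lam = ((1 + 1 / lam) * Polygamma 1 (1 + 1 / lam) - 1) / lam"

definition Z_star_S :: "real \<Rightarrow> nat \<Rightarrow> (nat \<Rightarrow> real) \<Rightarrow> real" where
  "Z_star_S lam n x = sqrt (real n) * V_S lam powr (-1/2) * S_stat lam n x"

definition Z_star_K :: "real \<Rightarrow> nat \<Rightarrow> (nat \<Rightarrow> real) \<Rightarrow> real" where
  "Z_star_K lam n x =
     sqrt (real n) * (1 / 16 * E_K lam powr (-3/2) * V_K lam) powr (-1/2)
     * (K_net lam n x powr (1/4) - E_K lam powr (1/4))"

text \<open>The finite-sample correction constants, in the order
  \<open>(\<alpha>\<^sub>1, c\<^sub>1, \<alpha>\<^sub>2, c\<^sub>2, \<alpha>\<^sub>3, c\<^sub>3, \<alpha>\<^sub>4, c\<^sub>4)\<close>; the value for other \<open>lam\<close> is a dummy.\<close>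

definition APD_constants ::
  "real \<Rightarrow> nat \<Rightarrow> real \<times> real \<times> real \<times> real \<times> real \<times> real \<times> real \<times> real" where
  "APD_constants lam n =
     (if lam = 1 \<and> even n then (1.06, -1.856, 1.01, -0.422, 0.92, -1.950, 2.3, 39.349)
      else if lam = 1 \<and> odd n then (1.03, -0.281, 0.86, -0.198, 1.04, -3.827, 1.0, 0)
      else if lam = 1.5 then (0.99, -0.952, 0.99, -0.637, 0.55, -3.488, 0.5, 2.434)
      else if lam = 2 then (0.99, -1.890, 1.00, -0.788, 1.05, -9.327, 1.4, 14.208)
      else if lam = 2.5 then (0.99, -2.981, 0.99, -0.844, 1.10, -23.104, 1.3, 30.028)
      else if lam = 3 then (0.97, -3.855, 0.98, -0.880, 1.14, -95.743, 1.2, 103.871)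
      else (1, 0, 1, 0, 1, 0, 1, 0))"

text \<open>For finitely many small \<open>n\<close> the bracketed variance corrections can be nonpositive.
  The corresponding statistics then have junk values, which do not affect limits in \<open>n\<close>.\<close>

definition Z_S :: "real \<Rightarrow> nat \<Rightarrow> (nat \<Rightarrow> real) \<Rightarrow> real" where
  "Z_S lam n x = (case APD_constants lam n of (\<alpha>\<^sub>1, c\<^sub>1, \<alpha>\<^sub>2, c\<^sub>2, \<alpha>\<^sub>3, c\<^sub>3, \<alpha>\<^sub>4, c\<^sub>4) \<Rightarrow>
     sqrt (real n) * S_stat lam n x * (V_S lam * (1 + c\<^sub>1 / real n powr \<alpha>\<^sub>1)) powr (-1/2))"

definition Z_K :: "real \<Rightarrow> nat \<Rightarrow> (nat \<Rightarrow> real) \<Rightarrow> real" where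
  "Z_K lam n x = (case APD_constants lam n of (\<alpha>\<^sub>1, c\<^sub>1, \<alpha>\<^sub>2, c\<^sub>2, \<alpha>\<^sub>3, c\<^sub>3, \<alpha>\<^sub>4, c\<^sub>4) \<Rightarrow>
     sqrt (real n)
     * (K_net lam n x powr (1/4) - E_K lam powr (1/4) * (1 + c\<^sub>2 / real n powr \<alpha>\<^sub>2))
     * (1 / 16 * E_K lam powr (-3/2) * V_K lam
        * (1 + c\<^sub>3 / real n powr \<alpha>\<^sub>3 + c\<^sub>4 / real n powr \<alpha>\<^sub>4)) powr (-1/2))"

definition X_APD :: "real \<Rightarrow> nat \<Rightarrow> (nat \<Rightarrow> real) \<Rightarrow> real" where
  "X_APD lam n x = (Z_S lam n x)\<^sup>2 + (Z_K lam n x)\<^sup>2"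

end

theory Submission
  imports Defs
begin

text \<open>
  Put \<open>Y i = (X i - \<mu>) / \<sigma>\<close> and \<open>T n = (mu_hat - \<mu>) / \<sigma>\<close>. The score
  \<open>\<Sum>i<n. spow (lam - 1) (Y i - t)\<close> is monotone in \<open>t\<close>, and its increments at \<open>t = h / sqrt n\<close>
  concentrate around a linear function of \<open>h\<close>; hence \<open>sqrt n * T n\<close> is asymptotically a normalized
  sum. For \<open>lam = 1\<close> the score is discontinuous, so its mean is differentiated by translating the
  density instead of the score.

  By invariance under scaling both statistics are smooth functions of the means of
  \<open>spow lam\<close>, \<open>\<bar>y\<bar> powr lam\<close> and \<open>\<bar>y\<bar> powr lam * ln \<bar>y\<bar>\<close> at \<open>Y i - T n\<close>. First-order expansions of these
  means and the delta method replace the statistics by sums of i.i.d. terms that are odd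
  (\<open>S_influence\<close>) and even (\<open>K_influence\<close>), hence uncorrelated, with variances \<open>V_S\<close> and \<open>V_K\<close>;
  the central limit theorem in every direction gives the bivariate limit.

  Since the quotient of the two skewness statistics is \<open>0\<close> when the skewness is \<open>0\<close>, the almost sure
  statement needs that this has probability zero for \<open>n \<ge> 3\<close>: with all but one observation
  fixed, the skewness numerator is a function of the estimate with countably many simple zeros, and
  its zeros can be degenerate for every choice of the free observation only if two observations
  coincide.
\<close>

section \<open>Signed powers\<close>

text \<open>The quotient of the two skewness statistics is the deterministic factor
  \<open>R1 n\<close> wherever the skewness is nonzero, so its limit is almost sure. The correction
  of the kurtosis statistic is also additive: its quotient contains \<open>w n / ZK n\<close>, which
  is small only where \<open>ZK n\<close> stays away from 0. That limit is in probability and rests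
  on the normal limit of \<open>ZK\<close> having little mass near 0. The additive correction is
  multiplied by \<open>sqrt n\<close>, so its exponent has to exceed 1/2; for the other exponents
  positivity is enough. To first order, estimating the location affects the skewness alone: the
  coefficient of the estimation error is the mean of a derivative, and the derivatives of even
  functions are odd. Estimating the scale affects the kurtosis alone and produces the multiple of
  \<open>\<bar>y\<bar> powr lam\<close> in \<open>K_influence\<close>. The squared skewness inside
  the net kurtosis is of order 1/n and disappears. The random shift is handled without a uniform law
  of large numbers: by monotonicity for the score, and by a supremum over small shifts for the
  smooth means.\<close>

definition spow :: "real \<Rightarrow> real \<Rightarrow> real" where
  "spow p x = \<bar>x\<bar> powr p * sgn x"

lemma spow_0 [simp]: "spow p 0 = 0"
  by (simp add: spow_def)

lemma spow_pos: "0 < x \<Longrightarrow> spow p x = x powr p"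
  by (simp add: spow_def)

lemma spow_neg: "x < 0 \<Longrightarrow> spow p x = - ((- x) powr p)"
  by (simp add: spow_def)

lemma spow_minus [simp]: "spow p (- x) = - spow p x"
  by (simp add: spow_def sgn_minus)

lemma abs_spow [simp]: "\<bar>spow p x\<bar> = \<bar>x\<bar> powr p"
  by (cases "x = 0") (auto simp: spow_def abs_mult abs_sgn_eq)

lemma spow_exponent_0: "spow 0 x = sgn x"
  by (cases "x = 0") (auto simp: spow_def)

lemma spow_exponent_1: "spow 1 x = x"
  by (cases "x = 0") (auto simp: spow_def abs_mult_sgn)

lemma spow_mult: "0 < c \<Longrightarrow> spow p (c * x) = c powr p * spow p x"
  by (simp add: spow_def abs_mult powr_mult sgn_mult)

lemma spow_divide: "0 < c \<Longrightarrow> spow p (x / c) = spow p x / c powr p"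
  using spow_mult[of "1 / c" p x] by (simp add: powr_divide)

lemma spow_measurable [measurable]: "spow p \<in> borel_measurable borel"
  unfolding spow_def[abs_def] by measurable

lemma spow_mono:
  assumes "0 \<le> p" "x \<le> y" shows "spow p x \<le> spow p y"
proof -
  consider "0 < x" | "x \<le> 0" "0 \<le> y" | "y < 0" by linarith
  then show ?thesis
  proof cases
    case 1 then show ?thesis using assms by (simp add: spow_pos powr_mono2)
  next
    case 2
    have "spow p x \<le> 0" using 2 by (cases "x = 0") (auto simp: spow_neg)
    moreover have "0 \<le> spow p y" using 2 by (cases "y = 0") (auto simp: spow_pos)
    ultimately show ?thesis by linarith
  next
    case 3 then show ?thesis using assms by (simp add: spow_neg powr_mono2)
  qed
qed

lemma spow_strict_mono:
  assumes "0 < p" "x < y" shows "spow p x < spow p y"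
proof -
  consider "0 < x" | "x \<le> 0" "0 \<le> y" | "y < 0" by linarith
  then show ?thesis
  proof cases
    case 1 then show ?thesis using assms by (simp add: spow_pos powr_less_mono2)
  next
    case 2
    then have "x < 0 \<or> 0 < y" using assms by linarith
    then show ?thesis
    proof
      assume "x < 0"
      then have "spow p x < 0" by (simp add: spow_neg)
      moreover have "0 \<le> spow p y" using 2 by (cases "y = 0") (auto simp: spow_pos)
      ultimately show ?thesis by linarith
    next
      assume "0 < y"
      then have "0 < spow p y" by (simp add: spow_pos)
      moreover have "spow p x \<le> 0" using 2 by (cases "x = 0") (auto simp: spow_neg)
      ultimately show ?thesis by linarith
    qed
  next
    case 3 then show ?thesis using assms by (simp add: spow_neg powr_less_mono2)
  qed
qed

lemma spow_inverse: "0 < p \<Longrightarrow> spow (1 / p) (spow p x) = x"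
  by (rule linorder_cases[of x 0]) (auto simp: spow_pos spow_neg powr_powr)

lemma DERIV_powr_pos:
  "0 < (x::real) \<Longrightarrow> ((\<lambda>x. x powr p) has_real_derivative p * x powr (p - 1)) (at x)"
  by (auto intro!: derivative_eq_intros simp: powr_diff)

lemma DERIV_abs_powr:
  assumes "x \<noteq> 0"
  shows "((\<lambda>x. \<bar>x\<bar> powr p) has_real_derivative p * spow (p - 1) x) (at x)"
proof (cases "0 < x")
  case True
  show ?thesis
    by (rule has_field_derivative_transform_within_open
        [where f = "\<lambda>x. x powr p" and S = "{0<..}"])
      (use True DERIV_powr_pos[of x p] in \<open>auto simp: spow_pos\<close>)
next
  case False
  then have x: "x < 0" using assms by simp
  have "((\<lambda>x. (- x) powr p) has_real_derivative (p * (- x) powr (p - 1)) * (- 1)) (at x)"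
    using x by (intro DERIV_chain2[OF DERIV_powr_pos]) (auto intro!: derivative_eq_intros)
  note D = this
  show ?thesis
    by (rule has_field_derivative_transform_within_open
        [where f = "\<lambda>x. (- x) powr p" and S = "{..<0}"])
      (use D x in \<open>auto simp: spow_neg\<close>)
qed

lemma DERIV_spow:
  assumes "x \<noteq> 0"
  shows "(spow p has_real_derivative p * \<bar>x\<bar> powr (p - 1)) (at x)"
proof (cases "0 < x")
  case True
  show ?thesis
    by (rule has_field_derivative_transform_within_open
        [where f = "\<lambda>x. x powr p" and S = "{0<..}"])
      (use True DERIV_powr_pos[of x p] in \<open>auto simp: spow_pos\<close>)
next
  case False
  then have x: "x < 0" using assms by simp
  have "((\<lambda>x. - ((- x) powr p)) has_real_derivative - ((p * (- x) powr (p - 1)) * (- 1))) (at x)"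
    using x by (intro DERIV_minus DERIV_chain2[OF DERIV_powr_pos]) (auto intro!: derivative_eq_intros)
  note D = this
  show ?thesis
    by (rule has_field_derivative_transform_within_open
        [where f = "\<lambda>x. - ((- x) powr p)" and S = "{..<0}"])
      (use D x in \<open>auto simp: spow_neg\<close>)
qed

lemma continuous_abs_powr: "0 < p \<Longrightarrow> continuous_on UNIV (\<lambda>x::real. \<bar>x\<bar> powr p)"
  by (intro continuous_on_powr' continuous_intros) auto

lemma continuous_spow:
  assumes "0 < p" shows "continuous_on UNIV (spow p)"
proof -
  have "isCont (spow p) x" for x
  proof (cases "x = 0")
    case True
    have "isCont (\<lambda>x::real. \<bar>x\<bar> powr p) 0"
      using continuous_abs_powr[OF assms] by (simp add: continuous_on_eq_continuous_at)
    then have "((\<lambda>x::real. \<bar>spow p x\<bar>) \<longlongrightarrow> 0) (at 0)"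
      by (simp add: isCont_def)
    then have "(spow p \<longlongrightarrow> 0) (at 0)"
      by (rule tendsto_rabs_zero_cancel)
    then show ?thesis using True by (simp add: isCont_def)
  qed (auto intro: DERIV_isCont DERIV_spow)
  then show ?thesis by (simp add: continuous_on_eq_continuous_at)
qed

text \<open>Mean value theorem on the open interval, so that 0 may be an endpoint. For
  \<open>1 \<le> p\<close> the derivative is monotone and hence bounded by its value at the larger
  endpoint.\<close>

lemma powr_diff_le:
  fixes a b :: real
  assumes p: "1 \<le> p" and "0 \<le> a" "0 \<le> b"
  shows "\<bar>b powr p - a powr p\<bar> \<le> p * max a b powr (p - 1) * \<bar>b - a\<bar>"
proof -
  have *: "\<bar>b powr p - a powr p\<bar> \<le> p * b powr (p - 1) * \<bar>b - a\<bar>" if "0 \<le> a" "a < b" for a b :: real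
  proof -
    have c: "continuous_on {a..b} (\<lambda>x. x powr p)"
      using that p by (intro continuous_on_powr' continuous_intros) auto
    have d: "(\<lambda>x. x powr p) differentiable (at x)" if "a < x" for x
      using that \<open>0 \<le> a\<close> DERIV_powr_pos[of x p] by (auto simp: real_differentiable_def)
    obtain l z where z: "a < z" "z < b" "DERIV (\<lambda>x. x powr p) z :> l"
      and eq: "b powr p - a powr p = (b - a) * l"
      using MVT[OF \<open>a < b\<close> c d] by blast
    have l: "l = p * z powr (p - 1)"
      using DERIV_unique[OF z(3) DERIV_powr_pos] z that by simp
    have "z powr (p - 1) \<le> b powr (p - 1)" using z that p by (intro powr_mono2) auto
    then have "(b - a) * l \<le> p * b powr (p - 1) * (b - a)"
      using p that by (simp add: l mult.commute mult_left_mono)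
    moreover have "0 \<le> (b - a) * l" using p that l by simp
    ultimately show ?thesis using eq that by simp
  qed
  consider "a < b" | "a = b" | "b < a" by linarith
  then show ?thesis
  proof cases
    case 1 then show ?thesis using *[of a b] assms by simp
  next
    case 3 then show ?thesis using *[of b a] assms by (simp add: abs_minus_commute)
  qed simp
qed

lemma abs_powr_diff_le:
  fixes a b p :: real
  assumes p: "1 \<le> p"
  shows "\<bar>\<bar>b\<bar> powr p - \<bar>a\<bar> powr p\<bar> \<le> p * max \<bar>a\<bar> \<bar>b\<bar> powr (p - 1) * \<bar>b - a\<bar>"
proof -
  have "\<bar>\<bar>b\<bar> powr p - \<bar>a\<bar> powr p\<bar> \<le> p * max \<bar>a\<bar> \<bar>b\<bar> powr (p - 1) * \<bar>\<bar>b\<bar> - \<bar>a\<bar>\<bar>"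
    by (rule powr_diff_le[OF p]) auto
  also have "\<dots> \<le> p * max \<bar>a\<bar> \<bar>b\<bar> powr (p - 1) * \<bar>b - a\<bar>"
    using p by (intro mult_left_mono) auto
  finally show ?thesis .
qed

text \<open>For arguments of the same sign this is the bound for absolute values. Otherwise
  \<open>\<bar>a\<bar> + \<bar>b\<bar> = \<bar>b - a\<bar>\<close>, so the two powers can be
  estimated separately.\<close>

lemma spow_diff_le:
  assumes p: "1 \<le> p"
  shows "\<bar>spow p b - spow p a\<bar> \<le> p * max \<bar>a\<bar> \<bar>b\<bar> powr (p - 1) * \<bar>b - a\<bar>"
proof (cases "a * b > 0")
  case True
  then have "\<bar>spow p b - spow p a\<bar> = \<bar>\<bar>b\<bar> powr p - \<bar>a\<bar> powr p\<bar>"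
    by (auto simp: zero_less_mult_iff spow_pos spow_neg)
  then show ?thesis using abs_powr_diff_le[OF p, of b a] by simp
next
  case False
  have pw: "\<bar>x\<bar> powr p \<le> max \<bar>a\<bar> \<bar>b\<bar> powr (p - 1) * \<bar>x\<bar>" if "\<bar>x\<bar> \<le> max \<bar>a\<bar> \<bar>b\<bar>" for x
  proof (cases "x = 0")
    case False
    have "\<bar>x\<bar> powr p = \<bar>x\<bar> powr (p - 1) * \<bar>x\<bar>" using False by (simp add: powr_diff)
    also have "\<dots> \<le> max \<bar>a\<bar> \<bar>b\<bar> powr (p - 1) * \<bar>x\<bar>"
      using that p by (intro mult_right_mono powr_mono2) auto
    finally show ?thesis .
  qed simp
  have "\<bar>spow p b - spow p a\<bar> \<le> \<bar>b\<bar> powr p + \<bar>a\<bar> powr p"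
    using abs_triangle_ineq4[of "spow p b" "spow p a"] by simp
  also have "\<dots> \<le> max \<bar>a\<bar> \<bar>b\<bar> powr (p - 1) * \<bar>b\<bar> + max \<bar>a\<bar> \<bar>b\<bar> powr (p - 1) * \<bar>a\<bar>"
    by (intro add_mono pw) auto
  also have "\<dots> = max \<bar>a\<bar> \<bar>b\<bar> powr (p - 1) * (\<bar>b\<bar> + \<bar>a\<bar>)" by (simp add: algebra_simps)
  also have "\<bar>b\<bar> + \<bar>a\<bar> = \<bar>b - a\<bar>"
    using False by (auto simp: not_less mult_le_0_iff)
  also have "max \<bar>a\<bar> \<bar>b\<bar> powr (p - 1) * \<bar>b - a\<bar> \<le> p * max \<bar>a\<bar> \<bar>b\<bar> powr (p - 1) * \<bar>b - a\<bar>"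
    using p by (intro mult_right_mono) (auto simp: mult_le_cancel_right1)
  finally show ?thesis .
qed

section \<open>Powers times logarithms\<close>

definition logpow :: "real \<Rightarrow> real \<Rightarrow> real" where
  "logpow p x = \<bar>x\<bar> powr p * ln \<bar>x\<bar>"

lemma logpow_minus [simp]: "logpow p (- x) = logpow p x"
  by (simp add: logpow_def)

lemma logpow_measurable [measurable]: "logpow p \<in> borel_measurable borel"
  unfolding logpow_def[abs_def] by measurable

lemma DERIV_ln_abs: "x \<noteq> 0 \<Longrightarrow> ((\<lambda>x. ln \<bar>x\<bar>) has_real_derivative 1 / x) (at x)"
proof -
  assume "x \<noteq> 0"
  show ?thesis
  proof (cases "0 < x")
    case True
    show ?thesis
      by (rule has_field_derivative_transform_within_open[where f = ln and S = "{0<..}"])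
        (use True DERIV_ln_divide[of x] in auto)
  next
    case False
    then have x: "x < 0" using \<open>x \<noteq> 0\<close> by simp
    have "((\<lambda>x. ln (- x)) has_real_derivative 1 / x) (at x)"
      using x by (auto intro!: derivative_eq_intros)
    then show ?thesis
      by (rule has_field_derivative_transform_within_open[where S = "{..<0}"]) (use x in auto)
  qed
qed

lemma DERIV_logpow:
  assumes "x \<noteq> 0"
  shows "(logpow p has_real_derivative (p * spow (p - 1) x * ln \<bar>x\<bar> + spow (p - 1) x)) (at x)"
proof -
  have "\<bar>x\<bar> powr p * (1 / x) = spow (p - 1) x"
    using assms by (cases "0 < x") (auto simp: spow_pos spow_neg powr_diff)
  then show ?thesis
    unfolding logpow_def[abs_def]
    using DERIV_mult[OF DERIV_abs_powr[OF assms, of p] DERIV_ln_abs[OF assms]] by (simp add: add.commute)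
qed

text \<open>The inequality \<open>ln u \<le> u - 1\<close> at
  \<open>u = 1 / sqrt \<bar>x\<bar>\<close> bounds the logarithm at the price of half of the factor
  \<open>\<bar>x\<bar>\<close>. What remains tends to 0, which gives continuity of
  \<open>logpow\<close> at 0.\<close>

lemma abs_logpow_le_sqrt:
  assumes "1 \<le> p" "\<bar>x\<bar> \<le> 1"
  shows "\<bar>logpow p x\<bar> \<le> 2 * sqrt \<bar>x\<bar>"
proof (cases "x = 0")
  case False
  define r where "r = sqrt \<bar>x\<bar>"
  have r: "0 < r" "r \<le> 1" "\<bar>x\<bar> = r * r" using False assms by (auto simp: r_def)
  have "ln (1 / r) \<le> 1 / r - 1" using r by (intro ln_le_minus_one) auto
  then have "- ln r \<le> 1 / r" using r by (simp add: ln_div)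
  then have l: "\<bar>ln \<bar>x\<bar>\<bar> \<le> 2 / r"
    using r by (simp add: ln_mult)
  have "\<bar>x\<bar> powr p \<le> \<bar>x\<bar> powr 1" using False assms by (intro powr_mono') auto
  then have "\<bar>logpow p x\<bar> \<le> (r * r) * (2 / r)"
    unfolding logpow_def abs_mult using l r by (intro mult_mono) auto
  also have "\<dots> = 2 * r" using r by simp
  finally show ?thesis by (simp add: r_def)
qed (simp add: logpow_def)

lemma continuous_logpow:
  assumes "1 \<le> p" shows "continuous_on UNIV (logpow p)"
proof -
  have "isCont (logpow p) x" for x
  proof (cases "x = 0")
    case True
    have "((\<lambda>x. 2 * sqrt \<bar>x\<bar>) \<longlongrightarrow> 2 * sqrt \<bar>0\<bar>) (at 0)" by (intro tendsto_intros)
    then have "((\<lambda>x. 2 * sqrt \<bar>x\<bar>) \<longlongrightarrow> 0) (at 0)" by simp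
    moreover have "eventually (\<lambda>x. norm (logpow p x) \<le> 2 * sqrt \<bar>x\<bar>) (at 0)"
      unfolding eventually_at
      by (rule exI[of _ 1]) (use abs_logpow_le_sqrt[OF assms] in \<open>auto simp: dist_real_def\<close>)
    ultimately have "(logpow p \<longlongrightarrow> 0) (at 0)" by (rule Lim_null_comparison[rotated])
    then show ?thesis using True by (simp add: isCont_def logpow_def)
  qed (auto intro: DERIV_isCont DERIV_logpow)
  then show ?thesis by (simp add: continuous_on_eq_continuous_at)
qed

text \<open>The Lipschitz constant may depend on \<open>a\<close> only, while \<open>b\<close> may
  be 0, and for \<open>p = 1\<close> the derivative is unbounded near 0. The mean value theorem is
  therefore used only for \<open>a / 2 \<le> b\<close>, where \<open>ln b\<close> cannot fall far
  below \<open>ln a\<close>. Otherwise \<open>a \<le> 2 * \<bar>b - a\<bar>\<close>, and each of the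
  two terms is bounded by itself with a factor \<open>a\<close>.\<close>

lemma powr_mult_ln_diff_le:
  fixes a b :: real
  assumes p: "1 \<le> p" and a: "0 < a" and b: "0 \<le> b" and ab: "\<bar>b - a\<bar> \<le> 1"
  shows "\<bar>b powr p * ln b - a powr p * ln a\<bar>
    \<le> \<bar>b - a\<bar> * (4 * p * (a + 1) powr (p - 1) * (\<bar>ln a\<bar> + a + 1))"
proof (cases "a / 2 \<le> b")
  case True
  define K where "K = 4 * p * (a + 1) powr (p - 1) * (\<bar>ln a\<bar> + a + 1)"
  have "norm (b powr p * ln b - a powr p * ln a) \<le> K * norm (b - a)"
  proof (rule field_differentiable_bound[where S = "{a/2..a+1}"
        and f' = "\<lambda>z. p * z powr (p - 1) * ln z + z powr (p - 1)"])
    fix z assume z: "z \<in> {a/2..a+1}"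
    then have z0: "0 < z" using a by auto
    have eq: "1 / z * z powr p = z powr (p - 1)" using z0 by (simp add: powr_diff)
    have D: "((\<lambda>z. z powr p * ln z) has_real_derivative (p * z powr (p - 1) * ln z + 1 / z * z powr p)) (at z)"
      using DERIV_mult[OF DERIV_powr_pos[OF z0] DERIV_ln_divide[OF z0]] by (simp add: mult.commute)
    show "((\<lambda>z. z powr p * ln z) has_real_derivative (p * z powr (p - 1) * ln z + z powr (p - 1)))
        (at z within {a/2..a+1})"
      by (rule has_field_derivative_at_within[OF D[unfolded eq]])
    have "ln z \<le> a" using ln_le_minus_one[OF z0] z by simp
    moreover have "ln (a / 2) \<le> ln z" using z a by simp
    moreover have "ln 2 \<le> (1::real)" using ln_le_minus_one[of "2::real"] by simp
    moreover have "ln (a / 2) = ln a - ln 2" using a by (simp add: ln_div)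
    ultimately have lz: "\<bar>ln z\<bar> \<le> \<bar>ln a\<bar> + a + 1" using a by linarith
    have "norm (p * z powr (p - 1) * ln z + z powr (p - 1)) = z powr (p - 1) * \<bar>p * ln z + 1\<bar>"
      by (subst abs_mult_pos') (simp_all add: algebra_simps)
    also have "\<dots> \<le> (a + 1) powr (p - 1) * (2 * p * (\<bar>ln a\<bar> + a + 1))"
    proof (intro mult_mono powr_mono2)
      have "\<bar>p * ln z + 1\<bar> \<le> p * \<bar>ln z\<bar> + 1"
        using abs_triangle_ineq[of "p * ln z" 1] p by (simp add: abs_mult)
      also have "\<dots> \<le> p * (\<bar>ln a\<bar> + a + 1) + p * (\<bar>ln a\<bar> + a + 1)"
      proof (intro add_mono mult_left_mono lz)
        show "1 \<le> p * (\<bar>ln a\<bar> + a + 1)" using mult_mono[of 1 p 1 "\<bar>ln a\<bar> + a + 1"] p a by simp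
      qed (use p in auto)
      finally show "\<bar>p * ln z + 1\<bar> \<le> 2 * p * (\<bar>ln a\<bar> + a + 1)" by simp
    qed (use p z z0 in auto)
    also have "\<dots> \<le> K" using p a by (simp add: K_def mult_ac)
    finally show "norm (p * z powr (p - 1) * ln z + z powr (p - 1)) \<le> K" .
  qed (use a b ab True in auto)
  then show ?thesis by (simp add: K_def mult_ac)
next
  case False
  have d: "a \<le> 2 * \<bar>b - a\<bar>" using False a by (simp add: abs_if)
  have ge: "\<bar>b powr p * ln b\<bar> \<le> (a + 1) powr (p - 1) * (a * \<bar>ln a\<bar> + a)"
  proof (cases "b = 0")
    case False': False
    then have b0: "0 < b" using b by simp
    \<comment> \<open>After multiplication by \<open>b\<close> this confines
      \<open>b * (ln a - ln b)\<close> to the interval from 0 to \<open>a\<close>, however small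
      \<open>b\<close> is.\<close>
    have "ln (a / b) \<le> a / b - 1" using a b0 by (intro ln_le_minus_one) auto
    then have "b * (ln a - ln b) \<le> b * (a / b - 1)" using a b0 by (simp add: ln_div)
    then have 1: "b * (ln a - ln b) \<le> a" using b0 by (simp add: algebra_simps)
    have 2: "0 \<le> b * (ln a - ln b)" using a b0 False by simp
    have "b * \<bar>ln b\<bar> = \<bar>b * ln a - b * (ln a - ln b)\<bar>" using b0 by (simp add: abs_mult algebra_simps)
    also have "\<dots> \<le> \<bar>b * ln a\<bar> + b * (ln a - ln b)" using 2 by linarith
    also have "\<dots> \<le> a * \<bar>ln a\<bar> + a"
      using 1 b0 False a by (intro add_mono) (auto simp: abs_mult intro!: mult_right_mono)
    finally have 3: "b * \<bar>ln b\<bar> \<le> a * \<bar>ln a\<bar> + a" .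
    have "b powr p = b powr (p - 1) * b" using b0 by (simp add: powr_diff)
    then have "\<bar>b powr p * ln b\<bar> = b powr (p - 1) * (b * \<bar>ln b\<bar>)" using b0 by (simp add: abs_mult)
    also have "\<dots> \<le> (a + 1) powr (p - 1) * (a * \<bar>ln a\<bar> + a)"
      using 3 b0 False a p by (intro mult_mono powr_mono2) auto
    finally show ?thesis .
  qed (use a in simp)
  have "a powr p = a powr (p - 1) * a" using a by (simp add: powr_diff)
  then have "\<bar>a powr p * ln a\<bar> = a powr (p - 1) * (a * \<bar>ln a\<bar>)" using a by (simp add: abs_mult)
  also have "\<dots> \<le> (a + 1) powr (p - 1) * (a * \<bar>ln a\<bar>)"
    using a p by (intro mult_right_mono powr_mono2) auto
  finally have ga: "\<bar>a powr p * ln a\<bar> \<le> (a + 1) powr (p - 1) * (a * \<bar>ln a\<bar>)" .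
  have "\<bar>b powr p * ln b - a powr p * ln a\<bar> \<le> (a + 1) powr (p - 1) * (a * \<bar>ln a\<bar> + a) + (a + 1) powr (p - 1) * (a * \<bar>ln a\<bar>)"
    using ge ga by linarith
  also have "\<dots> = a * ((a + 1) powr (p - 1) * (2 * \<bar>ln a\<bar> + 1))" by (simp add: algebra_simps)
  also have "\<dots> \<le> (2 * \<bar>b - a\<bar>) * ((a + 1) powr (p - 1) * (2 * \<bar>ln a\<bar> + 1))"
    using d by (intro mult_right_mono) auto
  also have "\<dots> = \<bar>b - a\<bar> * ((a + 1) powr (p - 1) * (4 * \<bar>ln a\<bar> + 2))" by (simp add: algebra_simps)
  also have "\<dots> \<le> \<bar>b - a\<bar> * ((a + 1) powr (p - 1) * (4 * p * (\<bar>ln a\<bar> + a + 1)))"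
  proof (intro mult_left_mono)
    have "4 * \<bar>ln a\<bar> + 2 \<le> 4 * (\<bar>ln a\<bar> + a + 1)" using a by simp
    also have "\<dots> \<le> 4 * p * (\<bar>ln a\<bar> + a + 1)" using p a by (intro mult_right_mono) auto
    finally show "4 * \<bar>ln a\<bar> + 2 \<le> 4 * p * (\<bar>ln a\<bar> + a + 1)" .
  qed auto
  finally show ?thesis by (simp only: mult_ac)
qed

text \<open>The factor of \<open>\<bar>t\<bar>\<close> depends on \<open>y\<close> alone and is
  square integrable under the exponential power law in spite of the logarithm; it serves as the
  local Lipschitz constant in the shift expansion.\<close>

lemma logpow_diff_le:
  assumes p: "1 \<le> p" and y: "y \<noteq> 0" and t: "\<bar>t\<bar> \<le> 1"
  shows "\<bar>logpow p (y - t) - logpow p y\<bar>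
    \<le> \<bar>t\<bar> * (4 * p * (\<bar>y\<bar> + 1) powr (p - 1) * (\<bar>ln \<bar>y\<bar>\<bar> + \<bar>y\<bar> + 1))"
proof -
  have d: "\<bar>\<bar>y - t\<bar> - \<bar>y\<bar>\<bar> \<le> \<bar>t\<bar>" by linarith
  have "\<bar>logpow p (y - t) - logpow p y\<bar>
      \<le> \<bar>\<bar>y - t\<bar> - \<bar>y\<bar>\<bar> * (4 * p * (\<bar>y\<bar> + 1) powr (p - 1) * (\<bar>ln \<bar>y\<bar>\<bar> + \<bar>y\<bar> + 1))"
    unfolding logpow_def using y t d by (intro powr_mult_ln_diff_le[OF p]) auto
  also have "\<dots> \<le> \<bar>t\<bar> * (4 * p * (\<bar>y\<bar> + 1) powr (p - 1) * (\<bar>ln \<bar>y\<bar>\<bar> + \<bar>y\<bar> + 1))"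
    using d p by (intro mult_right_mono) auto
  finally show ?thesis .
qed

section \<open>Stochastic order symbols\<close>

text \<open>This is O_P(1). The bound is asked only eventually in \<open>n\<close>, with
  \<open>C\<close> chosen before \<open>n\<close>, so estimates valid from some sample size on apply
  directly.\<close>

definition bounded_in_probability :: "'a measure \<Rightarrow> (nat \<Rightarrow> 'a \<Rightarrow> real) \<Rightarrow> bool" where
  "bounded_in_probability M Z \<longleftrightarrow> (\<forall>n. Z n \<in> borel_measurable M) \<and>
     (\<forall>\<epsilon>>0. \<exists>C. \<forall>\<^sub>F n in sequentially. measure M {\<omega> \<in> space M. \<bar>Z n \<omega>\<bar> > C} \<le> \<epsilon>)"

lemma conv_prob_measurable: "converges_in_probability M Z c \<Longrightarrow> Z n \<in> borel_measurable M"
  by (simp add: converges_in_probability_def)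

lemma bounded_in_prob_measurable: "bounded_in_probability M Z \<Longrightarrow> Z n \<in> borel_measurable M"
  by (simp add: bounded_in_probability_def)

context prob_space
begin

lemma conv_probD:
  assumes "converges_in_probability M Z c" "\<epsilon> > 0" "\<delta> > 0"
  shows "\<forall>\<^sub>F n in sequentially. prob {\<omega> \<in> space M. \<bar>Z n \<omega> - c\<bar> > \<epsilon>} < \<delta>"
  using assms unfolding converges_in_probability_def by (auto intro: order_tendstoD)

text \<open>Working form of the definition: outside exceptional events of small probability a
  deterministic inequality has to be shown pointwise. The events may depend on both
  tolerances.\<close>

lemma conv_probI:
  assumes [measurable]: "\<And>n. Z n \<in> borel_measurable M"
    and A: "\<And>\<epsilon> \<delta>. \<epsilon> > 0 \<Longrightarrow> \<delta> > 0 \<Longrightarrow> \<exists>A. \<forall>\<^sub>F n in sequentially. A n \<in> events \<and> prob (A n) \<le> \<delta> \<and>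
      (\<forall>\<omega>\<in>space M - A n. \<bar>Z n \<omega> - c\<bar> \<le> \<epsilon>)"
  shows "converges_in_probability M Z c"
  unfolding converges_in_probability_def
proof (intro conjI allI impI)
  fix \<epsilon> :: real assume "\<epsilon> > 0"
  show "(\<lambda>n. prob {\<omega> \<in> space M. \<bar>Z n \<omega> - c\<bar> > \<epsilon>}) \<longlonglongrightarrow> 0"
  proof (rule order_tendstoI)
    fix a :: real assume "a > 0"
    then obtain A where A: "\<forall>\<^sub>F n in sequentially. A n \<in> events \<and> prob (A n) \<le> a / 2 \<and>
      (\<forall>\<omega>\<in>space M - A n. \<bar>Z n \<omega> - c\<bar> \<le> \<epsilon>)" using A[of \<epsilon> "a/2"] \<open>\<epsilon> > 0\<close> by auto
    show "\<forall>\<^sub>F n in sequentially. prob {\<omega> \<in> space M. \<bar>Z n \<omega> - c\<bar> > \<epsilon>} < a"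
      using A
    proof eventually_elim
      case (elim n)
      then have "prob {\<omega> \<in> space M. \<bar>Z n \<omega> - c\<bar> > \<epsilon>} \<le> prob (A n)"
        by (intro finite_measure_mono) force+
      then show ?case using elim \<open>a > 0\<close> by linarith
    qed
  qed (auto intro!: always_eventually less_le_trans[OF _ measure_nonneg])
qed simp

lemma bounded_in_probD:
  assumes "bounded_in_probability M Z" "\<epsilon> > 0"
  obtains C where "C > 0" "\<forall>\<^sub>F n in sequentially. prob {\<omega> \<in> space M. \<bar>Z n \<omega>\<bar> > C} \<le> \<epsilon>"
proof -
  have [measurable]: "\<And>n. Z n \<in> borel_measurable M" using assms by (simp add: bounded_in_probability_def)
  obtain C where C: "\<forall>\<^sub>F n in sequentially. prob {\<omega> \<in> space M. \<bar>Z n \<omega>\<bar> > C} \<le> \<epsilon>"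
    using assms unfolding bounded_in_probability_def by auto
  have "\<forall>\<^sub>F n in sequentially. prob {\<omega> \<in> space M. \<bar>Z n \<omega>\<bar> > max C 1} \<le> \<epsilon>"
    using C
  proof eventually_elim
    case (elim n)
    have "prob {\<omega> \<in> space M. \<bar>Z n \<omega>\<bar> > max C 1} \<le> prob {\<omega> \<in> space M. \<bar>Z n \<omega>\<bar> > C}"
      by (intro finite_measure_mono) auto
    then show ?case using elim by simp
  qed
  then show ?thesis using that[of "max C 1"] by auto
qed

lemma bounded_in_probI:
  assumes [measurable]: "\<And>n. Z n \<in> borel_measurable M"
    and A: "\<And>\<epsilon>. \<epsilon> > 0 \<Longrightarrow> \<exists>A C. \<forall>\<^sub>F n in sequentially. A n \<in> events \<and> prob (A n) \<le> \<epsilon> \<and>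
      (\<forall>\<omega>\<in>space M - A n. \<bar>Z n \<omega>\<bar> \<le> C)"
  shows "bounded_in_probability M Z"
  unfolding bounded_in_probability_def
proof (intro conjI allI impI)
  fix \<epsilon> :: real assume "\<epsilon> > 0"
  then obtain A C where A: "\<forall>\<^sub>F n in sequentially. A n \<in> events \<and> prob (A n) \<le> \<epsilon> \<and>
      (\<forall>\<omega>\<in>space M - A n. \<bar>Z n \<omega>\<bar> \<le> C)" using A[of \<epsilon>] by blast
  have "\<forall>\<^sub>F n in sequentially. prob {\<omega> \<in> space M. \<bar>Z n \<omega>\<bar> > C} \<le> \<epsilon>"
    using A
  proof eventually_elim
    case (elim n)
    then have "prob {\<omega> \<in> space M. \<bar>Z n \<omega>\<bar> > C} \<le> prob (A n)"
      by (intro finite_measure_mono) force+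
    then show ?case using elim by linarith
  qed
  then show "\<exists>C. \<forall>\<^sub>F n in sequentially. prob {\<omega> \<in> space M. \<bar>Z n \<omega>\<bar> > C} \<le> \<epsilon>" by blast
qed simp

section \<open>Calculus of o_P and O_P, moment criteria and the delta method\<close>

lemma conv_prob_add:
  assumes Z: "converges_in_probability M Z a" and W: "converges_in_probability M W b"
  shows "converges_in_probability M (\<lambda>n \<omega>. Z n \<omega> + W n \<omega>) (a + b)"
proof (rule conv_probI)
  note [measurable] = conv_prob_measurable[OF Z] conv_prob_measurable[OF W]
  show "(\<lambda>\<omega>. Z n \<omega> + W n \<omega>) \<in> borel_measurable M" for n by measurable
  fix \<epsilon> \<delta> :: real assume pos: "\<epsilon> > 0" "\<delta> > 0"
  define A where "A n = {\<omega> \<in> space M. \<bar>Z n \<omega> - a\<bar> > \<epsilon>/2} \<union> {\<omega> \<in> space M. \<bar>W n \<omega> - b\<bar> > \<epsilon>/2}" for n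
  have "\<forall>\<^sub>F n in sequentially. A n \<in> events \<and> prob (A n) \<le> \<delta> \<and>
      (\<forall>\<omega>\<in>space M - A n. \<bar>Z n \<omega> + W n \<omega> - (a + b)\<bar> \<le> \<epsilon>)"
    using conv_probD[OF Z half_gt_zero[OF pos(1)] half_gt_zero[OF pos(2)]]
      conv_probD[OF W half_gt_zero[OF pos(1)] half_gt_zero[OF pos(2)]]
  proof eventually_elim
    case (elim n)
    have "prob (A n) \<le> prob {\<omega> \<in> space M. \<bar>Z n \<omega> - a\<bar> > \<epsilon>/2} + prob {\<omega> \<in> space M. \<bar>W n \<omega> - b\<bar> > \<epsilon>/2}"
      unfolding A_def by (intro measure_Un_le) measurable
    moreover have "A n \<in> events" unfolding A_def by measurable
    moreover have "\<bar>z + w - (a + b)\<bar> \<le> \<epsilon>" if "\<bar>z - a\<bar> \<le> \<epsilon>/2" "\<bar>w - b\<bar> \<le> \<epsilon>/2" for z w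
      using that by linarith
    ultimately show ?case using elim pos by (auto simp: A_def not_less)
  qed
  then show "\<exists>A. \<forall>\<^sub>F n in sequentially. A n \<in> events \<and> prob (A n) \<le> \<delta> \<and>
      (\<forall>\<omega>\<in>space M - A n. \<bar>Z n \<omega> + W n \<omega> - (a + b)\<bar> \<le> \<epsilon>)" by blast
qed

lemma conv_prob_mono:
  assumes Z: "converges_in_probability M Z 0" and [measurable]: "\<And>n. W n \<in> borel_measurable M"
    and le: "\<forall>\<^sub>F n in sequentially. \<forall>\<omega>\<in>space M. \<bar>W n \<omega> - b\<bar> \<le> \<bar>Z n \<omega>\<bar>"
  shows "converges_in_probability M W b"
proof (rule conv_probI)
  note [measurable] = conv_prob_measurable[OF Z]
  fix \<epsilon> \<delta> :: real assume pos: "\<epsilon> > 0" "\<delta> > 0"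
  have "\<forall>\<^sub>F n in sequentially. {\<omega> \<in> space M. \<bar>Z n \<omega>\<bar> > \<epsilon>} \<in> events \<and> prob {\<omega> \<in> space M. \<bar>Z n \<omega>\<bar> > \<epsilon>} \<le> \<delta> \<and>
      (\<forall>\<omega>\<in>space M - {\<omega> \<in> space M. \<bar>Z n \<omega>\<bar> > \<epsilon>}. \<bar>W n \<omega> - b\<bar> \<le> \<epsilon>)"
    using conv_probD[OF Z pos] le
  proof eventually_elim
    case (elim n) then show ?case by force
  qed
  then show "\<exists>A. \<forall>\<^sub>F n in sequentially. A n \<in> events \<and> prob (A n) \<le> \<delta> \<and> (\<forall>\<omega>\<in>space M - A n. \<bar>W n \<omega> - b\<bar> \<le> \<epsilon>)"
    by (rule exI[of _ "\<lambda>n. {\<omega> \<in> space M. \<bar>Z n \<omega>\<bar> > \<epsilon>}"])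
qed fact

lemma conv_prob_cong:
  assumes Z: "converges_in_probability M Z c" and [measurable]: "\<And>n. W n \<in> borel_measurable M"
    and eq: "\<forall>\<^sub>F n in sequentially. \<forall>\<omega>\<in>space M. W n \<omega> = Z n \<omega>"
  shows "converges_in_probability M W c"
proof -
  note [measurable] = conv_prob_measurable[OF Z]
  have "converges_in_probability M (\<lambda>n \<omega>. Z n \<omega> - c) 0"
    using Z by (auto simp: converges_in_probability_def)
  then show ?thesis
    by (rule conv_prob_mono) (use eq in \<open>auto elim!: eventually_mono\<close>)
qed

lemma conv_prob_cmult:
  assumes Z: "converges_in_probability M Z 0"
  shows "converges_in_probability M (\<lambda>n \<omega>. a * Z n \<omega>) 0"
proof (rule conv_probI)
  note [measurable] = conv_prob_measurable[OF Z]
  show "(\<lambda>\<omega>. a * Z n \<omega>) \<in> borel_measurable M" for n by measurable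
  fix \<epsilon> \<delta> :: real assume pos: "\<epsilon> > 0" "\<delta> > 0"
  let ?e = "\<epsilon> / (\<bar>a\<bar> + 1)"
  have e: "?e > 0" using pos by simp
  have "\<forall>\<^sub>F n in sequentially. {\<omega> \<in> space M. \<bar>Z n \<omega>\<bar> > ?e} \<in> events \<and> prob {\<omega> \<in> space M. \<bar>Z n \<omega>\<bar> > ?e} \<le> \<delta> \<and>
      (\<forall>\<omega>\<in>space M - {\<omega> \<in> space M. \<bar>Z n \<omega>\<bar> > ?e}. \<bar>a * Z n \<omega> - 0\<bar> \<le> \<epsilon>)"
    using conv_probD[OF Z e pos(2)]
  proof eventually_elim
    case (elim n)
    have "\<bar>a * z\<bar> \<le> \<epsilon>" if "\<bar>z\<bar> \<le> ?e" for z
    proof -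
      have "\<bar>a * z\<bar> \<le> (\<bar>a\<bar> + 1) * ?e" unfolding abs_mult using that by (intro mult_mono) auto
      then show ?thesis by simp
    qed
    then show ?case using elim by (auto simp: not_less)
  qed
  then show "\<exists>A. \<forall>\<^sub>F n in sequentially. A n \<in> events \<and> prob (A n) \<le> \<delta> \<and> (\<forall>\<omega>\<in>space M - A n. \<bar>a * Z n \<omega> - 0\<bar> \<le> \<epsilon>)"
    by (rule exI[of _ "\<lambda>n. {\<omega> \<in> space M. \<bar>Z n \<omega>\<bar> > ?e}"])
qed

lemma conv_prob_diff:
  assumes Z: "converges_in_probability M Z 0" and W: "converges_in_probability M W 0"
  shows "converges_in_probability M (\<lambda>n \<omega>. Z n \<omega> - W n \<omega>) 0"
  using conv_prob_add[OF Z conv_prob_cmult[OF W, of "-1"]] by simp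

lemma conv_prob_const:
  assumes "a \<longlonglongrightarrow> c" shows "converges_in_probability M (\<lambda>n \<omega>. a n) c"
proof (rule conv_probI)
  fix \<epsilon> \<delta> :: real assume pos: "\<epsilon> > 0" "\<delta> > 0"
  have "\<forall>\<^sub>F n in sequentially. dist (a n) c < \<epsilon>" using assms pos by (auto simp: tendsto_iff)
  then have "\<forall>\<^sub>F n in sequentially. {} \<in> events \<and> prob {} \<le> \<delta> \<and> (\<forall>\<omega>\<in>space M - {}. \<bar>a n - c\<bar> \<le> \<epsilon>)"
    by eventually_elim (use pos in \<open>auto simp: dist_real_def\<close>)
  then show "\<exists>A. \<forall>\<^sub>F n in sequentially. A n \<in> events \<and> prob (A n) \<le> \<delta> \<and> (\<forall>\<omega>\<in>space M - A n. \<bar>a n - c\<bar> \<le> \<epsilon>)"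
    by (rule exI[of _ "\<lambda>n. {}"])
qed simp

lemma conv_prob_mult_bounded:
  assumes Z: "converges_in_probability M Z 0" and W: "bounded_in_probability M W"
  shows "converges_in_probability M (\<lambda>n \<omega>. Z n \<omega> * W n \<omega>) 0"
proof (rule conv_probI)
  note [measurable] = conv_prob_measurable[OF Z] bounded_in_prob_measurable[OF W]
  show "(\<lambda>\<omega>. Z n \<omega> * W n \<omega>) \<in> borel_measurable M" for n by measurable
  fix \<epsilon> \<delta> :: real assume pos: "\<epsilon> > 0" "\<delta> > 0"
  obtain C where C: "C > 0" "\<forall>\<^sub>F n in sequentially. prob {\<omega> \<in> space M. \<bar>W n \<omega>\<bar> > C} \<le> \<delta>/2"
    using bounded_in_probD[OF W, of "\<delta>/2"] pos by auto
  define A where "A n = {\<omega> \<in> space M. \<bar>Z n \<omega>\<bar> > \<epsilon>/C} \<union> {\<omega> \<in> space M. \<bar>W n \<omega>\<bar> > C}" for n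
  have "\<epsilon>/C > 0" "\<delta>/2 > 0" using pos C by auto
  from conv_probD[OF Z this] C(2)
  have "\<forall>\<^sub>F n in sequentially. A n \<in> events \<and> prob (A n) \<le> \<delta> \<and>
      (\<forall>\<omega>\<in>space M - A n. \<bar>Z n \<omega> * W n \<omega> - 0\<bar> \<le> \<epsilon>)"
  proof eventually_elim
    case (elim n)
    have "prob (A n) \<le> prob {\<omega> \<in> space M. \<bar>Z n \<omega>\<bar> > \<epsilon>/C} + prob {\<omega> \<in> space M. \<bar>W n \<omega>\<bar> > C}"
      unfolding A_def by (intro measure_Un_le) measurable
    moreover have "A n \<in> events" unfolding A_def by measurable
    moreover have "\<bar>z * w\<bar> \<le> \<epsilon>" if "\<bar>z\<bar> \<le> \<epsilon>/C" "\<bar>w\<bar> \<le> C" for z w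
    proof -
      have "\<bar>z * w\<bar> \<le> \<epsilon>/C * C" unfolding abs_mult using that pos C by (intro mult_mono) auto
      then show ?thesis using C by simp
    qed
    ultimately show ?case using elim by (auto simp: A_def not_less)
  qed
  then show "\<exists>A. \<forall>\<^sub>F n in sequentially. A n \<in> events \<and> prob (A n) \<le> \<delta> \<and> (\<forall>\<omega>\<in>space M - A n. \<bar>Z n \<omega> * W n \<omega> - 0\<bar> \<le> \<epsilon>)"
    by (rule exI[of _ A])
qed

lemma bounded_in_prob_add_conv:
  assumes W: "bounded_in_probability M W" and D: "converges_in_probability M D 0"
  shows "bounded_in_probability M (\<lambda>n \<omega>. W n \<omega> + D n \<omega>)"
proof (rule bounded_in_probI)
  note [measurable] = conv_prob_measurable[OF D] bounded_in_prob_measurable[OF W]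
  show "(\<lambda>\<omega>. W n \<omega> + D n \<omega>) \<in> borel_measurable M" for n by measurable
  fix \<epsilon> :: real assume pos: "\<epsilon> > 0"
  obtain C where C: "C > 0" "\<forall>\<^sub>F n in sequentially. prob {\<omega> \<in> space M. \<bar>W n \<omega>\<bar> > C} \<le> \<epsilon>/2"
    using bounded_in_probD[OF W, of "\<epsilon>/2"] pos by auto
  define A where "A n = {\<omega> \<in> space M. \<bar>D n \<omega>\<bar> > 1} \<union> {\<omega> \<in> space M. \<bar>W n \<omega>\<bar> > C}" for n
  have "\<forall>\<^sub>F n in sequentially. A n \<in> events \<and> prob (A n) \<le> \<epsilon> \<and>
      (\<forall>\<omega>\<in>space M - A n. \<bar>W n \<omega> + D n \<omega>\<bar> \<le> C + 1)"
    using conv_probD[OF D zero_less_one half_gt_zero[OF pos]] C(2)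
  proof eventually_elim
    case (elim n)
    have "prob (A n) \<le> prob {\<omega> \<in> space M. \<bar>D n \<omega>\<bar> > 1} + prob {\<omega> \<in> space M. \<bar>W n \<omega>\<bar> > C}"
      unfolding A_def by (intro measure_Un_le) measurable
    moreover have "A n \<in> events" unfolding A_def by measurable
    ultimately show ?case using elim pos by (auto simp: A_def)
  qed
  then show "\<exists>A C. \<forall>\<^sub>F n in sequentially. A n \<in> events \<and> prob (A n) \<le> \<epsilon> \<and>
      (\<forall>\<omega>\<in>space M - A n. \<bar>W n \<omega> + D n \<omega>\<bar> \<le> C)" by blast
qed

lemma bounded_in_prob_cmult:
  assumes W: "bounded_in_probability M W"
  shows "bounded_in_probability M (\<lambda>n \<omega>. a * W n \<omega>)"
proof (rule bounded_in_probI)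
  note [measurable] = bounded_in_prob_measurable[OF W]
  show "(\<lambda>\<omega>. a * W n \<omega>) \<in> borel_measurable M" for n by measurable
  fix \<epsilon> :: real assume pos: "\<epsilon> > 0"
  obtain C where C: "C > 0" "\<forall>\<^sub>F n in sequentially. prob {\<omega> \<in> space M. \<bar>W n \<omega>\<bar> > C} \<le> \<epsilon>"
    using bounded_in_probD[OF W pos] by auto
  have "\<forall>\<^sub>F n in sequentially. {\<omega> \<in> space M. \<bar>W n \<omega>\<bar> > C} \<in> events \<and>
      prob {\<omega> \<in> space M. \<bar>W n \<omega>\<bar> > C} \<le> \<epsilon> \<and>
      (\<forall>\<omega>\<in>space M - {\<omega> \<in> space M. \<bar>W n \<omega>\<bar> > C}. \<bar>a * W n \<omega>\<bar> \<le> \<bar>a\<bar> * C)"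
    using C(2)
  proof eventually_elim
    case (elim n) then show ?case by (auto simp: abs_mult not_less intro!: mult_left_mono)
  qed
  then show "\<exists>A C. \<forall>\<^sub>F n in sequentially. A n \<in> events \<and> prob (A n) \<le> \<epsilon> \<and>
      (\<forall>\<omega>\<in>space M - A n. \<bar>a * W n \<omega>\<bar> \<le> C)"
    by (intro exI[of _ "\<lambda>n. {\<omega> \<in> space M. \<bar>W n \<omega>\<bar> > C}"] exI[of _ "\<bar>a\<bar> * C"])
qed

lemma prob_abs_gt_le_second_moment:
  assumes [measurable]: "Z \<in> borel_measurable M" and i: "integrable M (\<lambda>\<omega>. (Z \<omega>)\<^sup>2)" and c: "0 < c"
  shows "prob {\<omega> \<in> space M. \<bar>Z \<omega>\<bar> > c} \<le> expectation (\<lambda>\<omega>. (Z \<omega>)\<^sup>2) / c\<^sup>2"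
proof -
  have "prob {\<omega> \<in> space M. \<bar>Z \<omega>\<bar> > c} \<le> prob {\<omega> \<in> space M. c\<^sup>2 \<le> (Z \<omega>)\<^sup>2}"
  proof (intro finite_measure_mono)
    show "{\<omega> \<in> space M. \<bar>Z \<omega>\<bar> > c} \<subseteq> {\<omega> \<in> space M. c\<^sup>2 \<le> (Z \<omega>)\<^sup>2}"
      using c by (auto simp: abs_le_square_iff[symmetric])
  qed measurable
  also have "\<dots> \<le> expectation (\<lambda>\<omega>. (Z \<omega>)\<^sup>2) / c\<^sup>2"
    using c i by (intro integral_Markov_inequality_measure[where A = "{}"]) auto
  finally show ?thesis .
qed

lemma prob_gt_le_first_moment:
  assumes [measurable]: "Z \<in> borel_measurable M" and i: "integrable M Z"
    and nn: "\<And>\<omega>. \<omega> \<in> space M \<Longrightarrow> 0 \<le> Z \<omega>" and c: "0 < c"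
  shows "prob {\<omega> \<in> space M. Z \<omega> > c} \<le> expectation Z / c"
proof -
  have "prob {\<omega> \<in> space M. Z \<omega> > c} \<le> prob {\<omega> \<in> space M. c \<le> Z \<omega>}"
    by (intro finite_measure_mono) auto
  also have "\<dots> \<le> expectation Z / c"
    using c i nn by (intro integral_Markov_inequality_measure[where A = "{}"]) auto
  finally show ?thesis .
qed

lemma conv_prob_second_moment:
  assumes [measurable]: "\<And>n. Z n \<in> borel_measurable M" and i: "\<And>n. integrable M (\<lambda>\<omega>. (Z n \<omega>)\<^sup>2)"
    and l: "(\<lambda>n. expectation (\<lambda>\<omega>. (Z n \<omega>)\<^sup>2)) \<longlonglongrightarrow> 0"
  shows "converges_in_probability M Z 0"
  unfolding converges_in_probability_def
proof (intro conjI allI impI)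
  fix \<epsilon> :: real assume "\<epsilon> > 0"
  have L: "(\<lambda>n. expectation (\<lambda>\<omega>. (Z n \<omega>)\<^sup>2) / \<epsilon>\<^sup>2) \<longlonglongrightarrow> 0"
    by (rule tendsto_divide_zero[OF l])
  have "prob {\<omega> \<in> space M. \<bar>Z n \<omega>\<bar> > \<epsilon>} \<le> expectation (\<lambda>\<omega>. (Z n \<omega>)\<^sup>2) / \<epsilon>\<^sup>2" for n
    by (rule prob_abs_gt_le_second_moment[OF assms(1) i \<open>\<epsilon> > 0\<close>])
  then show "(\<lambda>n. prob {\<omega> \<in> space M. \<bar>Z n \<omega> - 0\<bar> > \<epsilon>}) \<longlonglongrightarrow> 0"
    by (intro Lim_null_comparison[OF always_eventually L]) simp
qed simp

lemma bounded_in_prob_second_moment: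
  assumes [measurable]: "\<And>n. Z n \<in> borel_measurable M" and i: "\<And>n. integrable M (\<lambda>\<omega>. (Z n \<omega>)\<^sup>2)"
    and l: "\<And>n. expectation (\<lambda>\<omega>. (Z n \<omega>)\<^sup>2) \<le> B"
  shows "bounded_in_probability M Z"
  unfolding bounded_in_probability_def
proof (intro conjI allI impI)
  fix \<epsilon> :: real assume e: "\<epsilon> > 0"
  define C where "C = sqrt ((\<bar>B\<bar> + 1) / \<epsilon>)"
  have C: "0 < C" "C\<^sup>2 = (\<bar>B\<bar> + 1) / \<epsilon>" using e by (auto simp: C_def)
  have "prob {\<omega> \<in> space M. \<bar>Z n \<omega>\<bar> > C} \<le> \<epsilon>" for n
  proof -
    have "prob {\<omega> \<in> space M. \<bar>Z n \<omega>\<bar> > C} \<le> expectation (\<lambda>\<omega>. (Z n \<omega>)\<^sup>2) / C\<^sup>2"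
      by (rule prob_abs_gt_le_second_moment) (use C i in auto)
    also have "\<dots> \<le> (\<bar>B\<bar> + 1) / C\<^sup>2" using l[of n] by (intro divide_right_mono) (linarith, simp)
    also have "\<dots> = \<epsilon>" using e unfolding C(2) by simp
    finally show ?thesis .
  qed
  then show "\<exists>C. \<forall>\<^sub>F n in sequentially. prob {\<omega> \<in> space M. \<bar>Z n \<omega>\<bar> > C} \<le> \<epsilon>"
    by (intro exI[of _ C] always_eventually) simp
qed simp

text \<open>Differentiability at the single point \<open>u\<close> suffices: outside an event of
  small probability \<open>U n\<close> lies within \<open>C / sqrt n\<close> of \<open>u\<close>,
  where the Taylor remainder is at most \<open>\<epsilon> / C\<close> times the distance. Total
  functions such as \<open>ln\<close> and \<open>inverse\<close> may thus be used whatever default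
  values they have elsewhere.\<close>

lemma delta_method:
  fixes U :: "nat \<Rightarrow> 'a \<Rightarrow> real"
  assumes b: "bounded_in_probability M (\<lambda>n \<omega>. sqrt n * (U n \<omega> - u))"
    and f: "(f has_real_derivative d) (at u)"
    and [measurable]: "f \<in> borel_measurable borel" "\<And>n. U n \<in> borel_measurable M"
  shows "converges_in_probability M
    (\<lambda>n \<omega>. sqrt n * (f (U n \<omega>) - f u) - d * (sqrt n * (U n \<omega> - u))) 0"
proof (rule conv_probI)
  fix \<epsilon> \<delta> :: real assume pos: "\<epsilon> > 0" "\<delta> > 0"
  obtain C where C: "C > 0" "\<forall>\<^sub>F n in sequentially. prob {\<omega> \<in> space M. \<bar>sqrt n * (U n \<omega> - u)\<bar> > C} \<le> \<delta>"
    using bounded_in_probD[OF b pos(2)] by auto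
  have e: "\<epsilon> / C > 0" using pos C by simp
  have "(f has_derivative (\<lambda>h. d * h)) (at u)" using f by (simp add: has_field_derivative_def)
  then obtain s where s: "s > 0" "\<And>y. \<bar>y - u\<bar> < s \<Longrightarrow> \<bar>f y - f u - d * (y - u)\<bar> \<le> \<epsilon> / C * \<bar>y - u\<bar>"
    using e unfolding has_derivative_at_alt by (auto simp: real_norm_def)
  have "(\<lambda>n. C / sqrt n) \<longlonglongrightarrow> 0" by (intro tendsto_divide_0[OF tendsto_const] filterlim_compose[OF filterlim_at_top_imp_at_infinity[OF filterlim_compose[OF sqrt_at_top]] filterlim_real_sequentially] filterlim_ident)
  then have "\<forall>\<^sub>F n in sequentially. C / sqrt (real n) < s" using s(1) by (rule order_tendstoD)
  with C(2) eventually_gt_at_top[of 0]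
  have "\<forall>\<^sub>F n in sequentially. {\<omega> \<in> space M. \<bar>sqrt n * (U n \<omega> - u)\<bar> > C} \<in> events \<and>
     prob {\<omega> \<in> space M. \<bar>sqrt n * (U n \<omega> - u)\<bar> > C} \<le> \<delta> \<and>
     (\<forall>\<omega>\<in>space M - {\<omega> \<in> space M. \<bar>sqrt n * (U n \<omega> - u)\<bar> > C}.
       \<bar>sqrt n * (f (U n \<omega>) - f u) - d * (sqrt n * (U n \<omega> - u)) - 0\<bar> \<le> \<epsilon>)"
  proof eventually_elim
    case (elim n)
    have "\<bar>sqrt n * (f y - f u) - d * (sqrt n * (y - u))\<bar> \<le> \<epsilon>" if y: "\<bar>sqrt n * (y - u)\<bar> \<le> C" for y
    proof -
      have sn: "sqrt n > 0" using elim by simp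
      have "\<bar>y - u\<bar> \<le> C / sqrt n" using y sn by (simp add: abs_mult pos_le_divide_eq mult.commute)
      then have "\<bar>f y - f u - d * (y - u)\<bar> \<le> \<epsilon> / C * \<bar>y - u\<bar>" using elim s(2) by simp
      then have le: "sqrt n * \<bar>f y - f u - d * (y - u)\<bar> \<le> sqrt n * (\<epsilon> / C * \<bar>y - u\<bar>)"
        using sn by (intro mult_left_mono) auto
      have eq: "sqrt n * (f y - f u) - d * (sqrt n * (y - u)) = sqrt n * (f y - f u - d * (y - u))"
        by (simp add: algebra_simps)
      have "\<bar>sqrt n * (f y - f u) - d * (sqrt n * (y - u))\<bar> = sqrt n * \<bar>f y - f u - d * (y - u)\<bar>"
        unfolding eq abs_mult using sn by simp
      also note le
      also have "sqrt n * (\<epsilon> / C * \<bar>y - u\<bar>) = \<epsilon> / C * \<bar>sqrt n * (y - u)\<bar>"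
        unfolding abs_mult using sn by simp
      also have "\<dots> \<le> \<epsilon> / C * C" using y e by (intro mult_left_mono) auto
      also have "\<dots> = \<epsilon>" using C by simp
      finally show ?thesis .
    qed
    then show ?case using elim by (auto simp: not_less)
  qed
  then show "\<exists>A. \<forall>\<^sub>F n in sequentially. A n \<in> events \<and> prob (A n) \<le> \<delta> \<and>
     (\<forall>\<omega>\<in>space M - A n. \<bar>sqrt n * (f (U n \<omega>) - f u) - d * (sqrt n * (U n \<omega> - u)) - 0\<bar> \<le> \<epsilon>)"
    by (rule exI[of _ "\<lambda>n. {\<omega> \<in> space M. \<bar>sqrt n * (U n \<omega> - u)\<bar> > C}"])
qed measurable

end

section \<open>Convergence in distribution from trigonometric moments\<close>

text \<open>Products are kept out of the generation, since limits of expectations pass only to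
  linear combinations. That the span is nevertheless an algebra follows from the product-to-sum
  formulas.\<close>

inductive_set trig_span :: "('b::real_inner \<Rightarrow> real) set" where
  cos: "(\<lambda>x. cos (a \<bullet> x)) \<in> trig_span"
| sin: "(\<lambda>x. sin (a \<bullet> x)) \<in> trig_span"
| scale: "f \<in> trig_span \<Longrightarrow> (\<lambda>x. c * f x) \<in> trig_span"
| add: "f \<in> trig_span \<Longrightarrow> g \<in> trig_span \<Longrightarrow> (\<lambda>x. f x + g x) \<in> trig_span"

lemma trig_span_const: "(\<lambda>_. c) \<in> trig_span"
  using trig_span.scale[OF trig_span.cos[of 0], of c] by simp

lemma trig_span_half_add: "f \<in> trig_span \<Longrightarrow> g \<in> trig_span \<Longrightarrow> (\<lambda>x. (f x + g x) / 2) \<in> trig_span"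
  using trig_span.scale[OF trig_span.add, of f g "1/2"] by simp

lemma trig_span_half_diff: "f \<in> trig_span \<Longrightarrow> g \<in> trig_span \<Longrightarrow> (\<lambda>x. (f x - g x) / 2) \<in> trig_span"
  using trig_span_half_add[OF _ trig_span.scale, of f g "-1"] by simp

lemma trig_span_mult_cos: "g \<in> trig_span \<Longrightarrow> (\<lambda>x. cos (a \<bullet> x) * g x) \<in> trig_span"
proof (induction rule: trig_span.induct)
  case (cos b)
  show ?case unfolding cos_times_cos inner_diff_left[symmetric] inner_add_left[symmetric]
    by (intro trig_span_half_add trig_span.cos)
next
  case (sin b)
  show ?case unfolding cos_times_sin inner_diff_left[symmetric] inner_add_left[symmetric]
    by (intro trig_span_half_diff trig_span.sin)
next
  case (scale f c)
  then show ?case using trig_span.scale[OF scale.IH, of c] by (simp add: mult.left_commute)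
next
  case (add f g)
  then show ?case using trig_span.add[OF add.IH] by (simp add: distrib_left)
qed

lemma trig_span_mult_sin: "g \<in> trig_span \<Longrightarrow> (\<lambda>x. sin (a \<bullet> x) * g x) \<in> trig_span"
proof (induction rule: trig_span.induct)
  case (cos b)
  show ?case unfolding sin_times_cos inner_diff_left[symmetric] inner_add_left[symmetric]
    by (intro trig_span_half_add trig_span.sin)
next
  case (sin b)
  show ?case unfolding sin_times_sin inner_diff_left[symmetric] inner_add_left[symmetric]
    by (intro trig_span_half_diff trig_span.cos)
next
  case (scale f c)
  then show ?case using trig_span.scale[OF scale.IH, of c] by (simp add: mult.left_commute)
next
  case (add f g)
  then show ?case using trig_span.add[OF add.IH] by (simp add: distrib_left)
qed

lemma trig_span_mult:
  assumes "f \<in> trig_span" "g \<in> trig_span" shows "(\<lambda>x. f x * g x) \<in> trig_span"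
  using assms(1)
proof (induction rule: trig_span.induct)
  case (scale f c)
  then show ?case using trig_span.scale[OF scale.IH, of c] by (simp add: mult.assoc)
next
  case (add f g)
  then show ?case using trig_span.add[OF add.IH] by (simp add: distrib_right)
qed (simp_all add: trig_span_mult_cos trig_span_mult_sin assms(2))

lemma trig_span_bounded: "f \<in> trig_span \<Longrightarrow> \<exists>B. \<forall>x. \<bar>f x\<bar> \<le> B"
proof (induction rule: trig_span.induct)
  case (cos a) show ?case by (intro exI[of _ 1]) simp
next
  case (sin a) show ?case by (intro exI[of _ 1]) simp
next
  case (scale f c)
  then obtain B where "\<And>x. \<bar>f x\<bar> \<le> B" by auto
  then show ?case by (intro exI[of _ "\<bar>c\<bar> * B"]) (auto simp: abs_mult intro: mult_left_mono)
next
  case (add f g)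
  then obtain B C where B: "\<And>x. \<bar>f x\<bar> \<le> B" and C: "\<And>x. \<bar>g x\<bar> \<le> C" by auto
  have "\<bar>f x + g x\<bar> \<le> B + C" for x using B[of x] C[of x] by linarith
  then show ?case by blast
qed

lemma trig_span_continuous: "f \<in> trig_span \<Longrightarrow> continuous_on S f"
  by (induction rule: trig_span.induct) (auto intro!: continuous_intros)

lemma trig_span_polynomial:
  assumes "real_polynomial_function (q :: real \<Rightarrow> real)" "p \<in> trig_span"
  shows "(\<lambda>x. q (p x)) \<in> trig_span"
  using assms(1)
proof (induction rule: real_polynomial_function.induct)
  case (linear f)
  obtain c where "f = (*) c"
    by (rule real_linearD[OF bounded_linear.linear[OF linear]])
  then show ?case using trig_span.scale[OF assms(2), of c] by (simp add: mult.commute)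
next
  case (const c) show ?case by (rule trig_span_const)
next
  case (add f g) show ?case by (rule trig_span.add[OF add.IH])
next
  case (mult f g) show ?case by (rule trig_span_mult[OF mult.IH])
qed

lemma function_ring_on_trig_span:
  assumes "compact S" shows "function_ring_on (trig_span :: ('b::euclidean_space \<Rightarrow> real) set) S"
proof
  fix x y :: 'b assume "x \<noteq> y"
  \<comment> \<open>The frequency makes the two phases differ by pi: sine and cosine both change
    sign, and they cannot both be 0, so one of them separates the points.\<close>
  define a where "a = (pi / (norm (x - y))\<^sup>2) *\<^sub>R (x - y)"
  have "a \<bullet> x - a \<bullet> y = a \<bullet> (x - y)" by (simp add: inner_diff_right)
  also have "\<dots> = pi" using \<open>x \<noteq> y\<close> by (simp add: a_def power2_norm_eq_inner)
  finally have eq: "a \<bullet> x = a \<bullet> y + pi" by simp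
  have "cos (a \<bullet> x) \<noteq> cos (a \<bullet> y) \<or> sin (a \<bullet> x) \<noteq> sin (a \<bullet> y)"
    unfolding eq cos_periodic_pi sin_periodic_pi using sin_zero_abs_cos_one[of "a \<bullet> y"] by auto
  then show "\<exists>f\<in>trig_span. f x \<noteq> f y"
    by (metis (no_types, lifting) trig_span.cos[of a] trig_span.sin[of a])
qed (rule assms trig_span_continuous trig_span_const trig_span_mult trig_span.add; assumption?)+

text \<open>The bound \<open>C + e\<close> must not depend on \<open>R\<close>: the approximant is
  chosen after the radius, and its bound then multiplies the probability of leaving the
  ball.\<close>

lemma trig_span_approx:
  fixes f :: "'b::euclidean_space \<Rightarrow> real"
  assumes f: "continuous_on UNIV f" and C: "\<And>x. \<bar>f x\<bar> \<le> C" and e: "0 < e"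
  obtains g where "g \<in> trig_span" "\<And>x. \<bar>g x\<bar> \<le> C + e" "\<And>x. norm x \<le> R \<Longrightarrow> \<bar>f x - g x\<bar> \<le> 2 * e"
proof -
  have C0: "0 \<le> C" using C[of 0] by linarith
  interpret function_ring_on "trig_span :: ('b \<Rightarrow> real) set" "cball 0 R"
    by (rule function_ring_on_trig_span) simp
  obtain p where p: "p \<in> trig_span" "\<And>x. x \<in> cball 0 R \<Longrightarrow> \<bar>f x - p x\<bar> < e"
    using Stone_Weierstrass_basic[OF continuous_on_subset[OF f] e] by auto
  obtain B where B: "\<And>x. \<bar>p x\<bar> \<le> B" using trig_span_bounded[OF p(1)] by auto
  text \<open>Composing with a polynomial close to the clamp function keeps the approximation on the
    ball and makes it bounded by \<open>C + e\<close> everywhere.\<close>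
  define h where "h = (\<lambda>u::real. max (- C) (min C u))"
  have h: "continuous_on {-B..B} h" unfolding h_def by (intro continuous_intros)
  obtain q where q: "real_polynomial_function q" "\<And>u. u \<in> {-B..B} \<Longrightarrow> \<bar>h u - q u\<bar> < e"
    using Stone_Weierstrass_real_polynomial_function[OF compact_Icc h e] by auto
  show ?thesis
  proof
    show "(\<lambda>x. q (p x)) \<in> trig_span" by (rule trig_span_polynomial[OF q(1) p(1)])
    have pB: "p x \<in> {-B..B}" for x using B[of x] by (simp add: abs_le_iff)
    show "\<bar>q (p x)\<bar> \<le> C + e" for x
    proof -
      have "\<bar>h (p x)\<bar> \<le> C" using C0 by (auto simp: h_def abs_le_iff)
      then show ?thesis using q(2)[OF pB[of x]] by linarith
    qed
    show "\<bar>f x - q (p x)\<bar> \<le> 2 * e" if "norm x \<le> R" for x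
    proof -
      have "\<bar>f x - h (p x)\<bar> \<le> \<bar>f x - p x\<bar>" 
        using abs_le_D1[OF C[of x]] abs_le_D2[OF C[of x]] by (auto simp: h_def max_def min_def abs_if)
      moreover have "\<bar>f x - p x\<bar> < e" using p(2)[of x] that by simp
      ultimately show ?thesis using q(2)[OF pB[of x]] by linarith
    qed
  qed
qed

lemma (in prob_space) expectation_diff_le_tail:
  fixes W :: "'a \<Rightarrow> 'b::euclidean_space"
  assumes [measurable]: "W \<in> borel_measurable M" "f \<in> borel_measurable borel" "g \<in> borel_measurable borel"
    and f: "\<And>x. \<bar>f x\<bar> \<le> C" and g: "\<And>x. \<bar>g x\<bar> \<le> D"
    and fg: "\<And>x. norm x \<le> R \<Longrightarrow> \<bar>f x - g x\<bar> \<le> a" and a: "0 \<le> a"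
  shows "\<bar>expectation (\<lambda>\<omega>. f (W \<omega>)) - expectation (\<lambda>\<omega>. g (W \<omega>))\<bar>
    \<le> a + (C + D) * prob {\<omega> \<in> space M. norm (W \<omega>) > R}"
proof -
  have fi: "integrable M (\<lambda>\<omega>. f (W \<omega>))" by (rule integrable_const_bound[where B = C]) (use f in auto)
  have gi: "integrable M (\<lambda>\<omega>. g (W \<omega>))" by (rule integrable_const_bound[where B = D]) (use g in auto)
  have CD: "0 \<le> C + D" using f[of 0] g[of 0] by linarith
  let ?A = "{\<omega> \<in> space M. norm (W \<omega>) > R}"
  have le: "\<bar>f (W \<omega>) - g (W \<omega>)\<bar> \<le> a + (C + D) * indicator ?A \<omega>" if "\<omega> \<in> space M" for \<omega>
  proof (cases "norm (W \<omega>) > R")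
    case True
    have "\<bar>f (W \<omega>) - g (W \<omega>)\<bar> \<le> C + D" using f[of "W \<omega>"] g[of "W \<omega>"] by linarith
    then show ?thesis using True that a by simp
  next
    case False then show ?thesis using fg[of "W \<omega>"] by simp
  qed
  have "integrable M (indicator ?A :: _ \<Rightarrow> real)"
    by (intro integrable_real_indicator) (auto simp: emeasure_eq_measure)
  then have E: "expectation (\<lambda>\<omega>. a + (C + D) * indicator ?A \<omega>) = a + (C + D) * prob ?A"
    by (simp add: prob_space)
  have "\<bar>expectation (\<lambda>\<omega>. f (W \<omega>)) - expectation (\<lambda>\<omega>. g (W \<omega>))\<bar>
      = \<bar>expectation (\<lambda>\<omega>. f (W \<omega>) - g (W \<omega>))\<bar>"
    using fi gi by simp
  also have "\<dots> \<le> expectation (\<lambda>\<omega>. \<bar>f (W \<omega>) - g (W \<omega>)\<bar>)" by (rule integral_abs_bound)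
  also have "\<dots> \<le> expectation (\<lambda>\<omega>. a + (C + D) * indicator ?A \<omega>)"
    using fi gi le by (intro integral_mono) (auto intro!: integrable_real_mult_indicator)
  also have "\<dots> = a + (C + D) * prob ?A" by (rule E)
  finally show ?thesis .
qed

text \<open>Continuity theorem with tightness as a hypothesis. A test function is compared with a
  trigonometric polynomial under the law of \<open>Z n\<close> and under \<open>N\<close>; between
  the two laws only the trigonometric polynomial has to converge.\<close>

theorem (in prob_space) converges_in_distribution_trigI:
  fixes Z :: "nat \<Rightarrow> 'a \<Rightarrow> 'b::euclidean_space"
  assumes N: "prob_space N" "sets N = sets borel"
    and Z[measurable]: "\<And>n. Z n \<in> borel_measurable M"
    and tight: "\<And>\<epsilon>. \<epsilon> > 0 \<Longrightarrow> \<exists>R. \<forall>\<^sub>F n in sequentially. prob {\<omega> \<in> space M. norm (Z n \<omega>) > R} \<le> \<epsilon>"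
    and cos: "\<And>a. (\<lambda>n. expectation (\<lambda>\<omega>. cos (a \<bullet> Z n \<omega>))) \<longlonglongrightarrow> (\<integral>z. cos (a \<bullet> z) \<partial>N)"
    and sin: "\<And>a. (\<lambda>n. expectation (\<lambda>\<omega>. sin (a \<bullet> Z n \<omega>))) \<longlonglongrightarrow> (\<integral>z. sin (a \<bullet> z) \<partial>N)"
  shows "converges_in_distribution M Z N"
  unfolding converges_in_distribution_def
proof (intro conjI allI impI)
  interpret N: prob_space N by fact
  note [measurable_cong] = N(2)
  have meas: "g \<in> borel_measurable borel" if "g \<in> trig_span" for g :: "'b \<Rightarrow> real"
    using that trig_span_continuous by (intro borel_measurable_continuous_onI)
  have bint: "integrable M (\<lambda>\<omega>. g (Z n \<omega>)) \<and> integrable N g" if g: "g \<in> trig_span" for g n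
  proof -
    note [measurable] = meas[OF g]
    obtain B where "\<And>x. \<bar>g x\<bar> \<le> B" using trig_span_bounded[OF g] by auto
    then show ?thesis
      by (intro conjI integrable_const_bound[where B = B] N.integrable_const_bound[where B = B]) auto
  qed
  have conv: "(\<lambda>n. expectation (\<lambda>\<omega>. g (Z n \<omega>))) \<longlonglongrightarrow> (\<integral>z. g z \<partial>N)" if "g \<in> trig_span" for g
    using that
  proof (induction rule: trig_span.induct)
    case (add f g)
    then show ?case using tendsto_add[OF add.IH] bint by simp
  qed (auto simp: cos sin intro!: tendsto_mult)
  fix f :: "'b \<Rightarrow> real" assume f: "continuous_on UNIV f" "bounded (range f)"
  obtain C where C: "\<And>x. \<bar>f x\<bar> \<le> C" using f(2) by (auto simp: bounded_iff)
  have C0: "0 \<le> C" using C[of 0] by linarith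
  have [measurable]: "f \<in> borel_measurable borel" using f(1) by (rule borel_measurable_continuous_onI)
  show "(\<lambda>n. expectation (\<lambda>\<omega>. f (Z n \<omega>))) \<longlonglongrightarrow> (\<integral>z. f z \<partial>N)"
  proof (rule tendstoI)
    fix d :: real assume d: "0 < d"
    \<comment> \<open>Each of the two comparisons costs \<open>K = (3 + 2 * C) * e\<close> and the
      convergence of the approximant costs \<open>e\<close>, together
      \<open>e * (7 + 4 * C)\<close>. The cap at 1 replaces \<open>C + e\<close> by
      \<open>C + 1\<close>; the additional 1 in the denominator makes the final inequality
      strict.\<close>
    define e where "e = min 1 (d / (7 + 4 * C + 1))"
    have e: "0 < e" "e \<le> 1" using d C0 by (auto simp: e_def)
    have ed: "e * (7 + 4 * C) < d"
    proof -
      have "e * (7 + 4 * C) < e * (7 + 4 * C + 1)" using e by simp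
      also have "\<dots> \<le> d / (7 + 4 * C + 1) * (7 + 4 * C + 1)"
        using C0 by (intro mult_right_mono) (auto simp: e_def)
      also have "\<dots> = d" using C0 by simp
      finally show ?thesis .
    qed
    define K where "K = 2 * e + (C + (C + 1)) * e"
    obtain R1 where R1: "\<forall>\<^sub>F n in sequentially. prob {\<omega> \<in> space M. norm (Z n \<omega>) > R1} \<le> e"
      using tight[OF e(1)] by auto
    have "(\<lambda>k. N.prob {z \<in> space N. norm z > real k}) \<longlonglongrightarrow> N.prob (\<Inter>k. {z \<in> space N. norm z > real k})"
      by (rule N.finite_Lim_measure_decseq) (auto simp: decseq_def)
    also have "(\<Inter>k. {z \<in> space N. norm z > real k}) = {}"
    proof (intro equals0I)
      fix z assume "z \<in> (\<Inter>k. {z \<in> space N. norm z > real k})"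
      then have "\<And>k::nat. real k < norm z" by auto
      then show False using reals_Archimedean2[of "norm z"] less_asym by blast
    qed
    finally have "(\<lambda>k. N.prob {z \<in> space N. norm z > real k}) \<longlonglongrightarrow> 0" by simp
    from order_tendstoD(2)[OF this e(1)] obtain k where k: "N.prob {z \<in> space N. norm z > real k} < e"
      by (auto simp: eventually_sequentially)
    define R where "R = max R1 (real k)"
    have RN: "N.prob {z \<in> space N. norm z > R} \<le> e"
      using N.finite_measure_mono[of "{z \<in> space N. norm z > R}" "{z \<in> space N. norm z > real k}"] k
      by (force simp: R_def)
    obtain g where g: "g \<in> trig_span" "\<And>x. \<bar>g x\<bar> \<le> C + e" "\<And>x. norm x \<le> R \<Longrightarrow> \<bar>f x - g x\<bar> \<le> 2 * e"
      using trig_span_approx[OF f(1) C e(1), where R = R] by blast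
    note [measurable] = meas[OF g(1)]
    have B1: "\<bar>N.expectation f - N.expectation g\<bar> \<le> 2 * e + (C + (C + e)) * N.prob {z \<in> space N. norm z > R}"
      by (rule N.expectation_diff_le_tail[where W = "\<lambda>z. z"]) (use C g e in auto)
    also have "\<dots> \<le> K"
      unfolding K_def using RN e C0 by (intro add_left_mono mult_mono) auto
    finally have B1: "\<bar>N.expectation f - N.expectation g\<bar> \<le> K" .
    have "\<forall>\<^sub>F n in sequentially. dist (expectation (\<lambda>\<omega>. g (Z n \<omega>))) (N.expectation g) < e"
      using conv[OF g(1)] e(1) by (rule tendstoD)
    with R1 show "\<forall>\<^sub>F n in sequentially. dist (expectation (\<lambda>\<omega>. f (Z n \<omega>))) (N.expectation f) < d"
    proof eventually_elim
      case (elim n)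
      have "prob {\<omega> \<in> space M. norm (Z n \<omega>) > R} \<le> prob {\<omega> \<in> space M. norm (Z n \<omega>) > R1}"
        by (intro finite_measure_mono) (auto simp: R_def)
      then have RM: "prob {\<omega> \<in> space M. norm (Z n \<omega>) > R} \<le> e" using elim by linarith
      have "\<bar>expectation (\<lambda>\<omega>. f (Z n \<omega>)) - expectation (\<lambda>\<omega>. g (Z n \<omega>))\<bar>
          \<le> 2 * e + (C + (C + e)) * prob {\<omega> \<in> space M. norm (Z n \<omega>) > R}"
        by (rule expectation_diff_le_tail) (use C g e in auto)
      also have "\<dots> \<le> K"
        unfolding K_def using RM e C0 by (intro add_left_mono mult_mono) auto
      finally have "\<bar>expectation (\<lambda>\<omega>. f (Z n \<omega>)) - expectation (\<lambda>\<omega>. g (Z n \<omega>))\<bar> \<le> K" .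
      with B1 elim have "dist (expectation (\<lambda>\<omega>. f (Z n \<omega>))) (N.expectation f)
          < K + K + e"
        unfolding dist_real_def by linarith
      also have "\<dots> = e * (7 + 4 * C)" by (simp add: K_def algebra_simps)
      finally show ?case using ed by linarith
    qed
  qed
qed measurable

section \<open>The standard normal law on Euclidean space\<close>

text \<open>Fubini in coordinates, through \<open>lborel\<close> as the image of a product of
  one-dimensional Lebesgue measures. The values are complex so that characteristic functions factor
  directly.\<close>

lemma lborel_integral_prod:
  fixes g :: "'b::euclidean_space \<Rightarrow> real \<Rightarrow> complex"
  assumes "\<And>b. b \<in> Basis \<Longrightarrow> integrable lborel (g b)"
  shows "(\<integral>x. (\<Prod>b\<in>Basis. g b ((x::'b) \<bullet> b)) \<partial>lborel) = (\<Prod>b\<in>Basis. \<integral>y. g b y \<partial>lborel)"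
    and "integrable lborel (\<lambda>x::'b. \<Prod>b\<in>Basis. g b (x \<bullet> b))"
proof -
  interpret product_sigma_finite "\<lambda>b::'b. lborel :: real measure" ..
  have [measurable]: "\<And>b. b \<in> Basis \<Longrightarrow> g b \<in> borel_measurable borel"
    using assms borel_measurable_integrable by force
  have T[measurable]: "(\<lambda>f. \<Sum>b\<in>Basis. f b *\<^sub>R b) \<in> (\<Pi>\<^sub>M b\<in>(Basis :: 'b set). (lborel :: real measure)) \<rightarrow>\<^sub>M borel"
    by measurable
  have P[measurable]: "(\<lambda>x::'b. \<Prod>b\<in>Basis. g b (x \<bullet> b)) \<in> borel_measurable borel"
    by (intro borel_measurable_prod) measurable
  have eq: "(\<Prod>b\<in>Basis. g b ((\<Sum>b\<in>Basis. f b *\<^sub>R b) \<bullet> b)) = (\<Prod>b\<in>Basis. g b (f b))" for f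
    by (intro prod.cong refl) simp
  show "(\<integral>x. (\<Prod>b\<in>Basis. g b ((x::'b) \<bullet> b)) \<partial>lborel) = (\<Prod>b\<in>Basis. \<integral>y. g b y \<partial>lborel)"
    by (subst lborel_eq) (simp only: integral_distr[OF T P] eq product_integral_prod[OF finite_Basis assms])
  show "integrable lborel (\<lambda>x::'b. \<Prod>b\<in>Basis. g b (x \<bullet> b))"
    by (subst lborel_eq) (simp only: integrable_distr_eq[OF T P] eq product_integrable_prod[OF finite_Basis assms])
qed

lemma matrix_inv_mat_1: "matrix_inv (mat 1 :: real^'n^'n) = mat 1"
  unfolding matrix_inv_def by (rule some_equality) (auto simp: matrix_mul_lid)

lemma std_normal_density_vec:
  fixes x :: "real^'n"
  shows "exp (- ((x - 0) \<bullet> (matrix_inv (mat 1) *v (x - 0))) / 2) / sqrt ((2 * pi) ^ CARD('n) * det (mat 1 :: real^'n^'n))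
    = (\<Prod>b\<in>Basis. std_normal_density (x \<bullet> b))"
proof -
  have "(\<Prod>b\<in>(Basis :: (real^'n) set). std_normal_density (x \<bullet> b))
      = (1 / sqrt (2 * pi)) ^ CARD('n) * exp (\<Sum>b\<in>Basis. - (x \<bullet> b)\<^sup>2 / 2)"
    unfolding std_normal_density_def prod.distrib by (simp add: exp_sum)
  also have "(\<Sum>b\<in>Basis. - (x \<bullet> b)\<^sup>2 / 2) = - (x \<bullet> x) / 2"
    unfolding euclidean_inner[of x x] by (simp add: sum_divide_distrib[symmetric] sum_negf power2_eq_square)
  also have "(1 / sqrt (2 * pi)) ^ CARD('n) = 1 / sqrt ((2 * pi) ^ CARD('n))"
    unfolding power_one_over real_sqrt_power ..
  finally show ?thesis by (simp add: matrix_inv_mat_1 matrix_vector_mul_lid)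
qed

lemma multivariate_normal_std:
  "multivariate_normal 0 (mat 1 :: real^'n^'n)
    = density lborel (\<lambda>x. ennreal (\<Prod>b\<in>Basis. std_normal_density (x \<bullet> b)))"
  unfolding multivariate_normal_def std_normal_density_vec ..

lemma sets_multivariate_normal_std: "sets (multivariate_normal 0 (mat 1 :: real^'n^'n)) = sets borel"
  by (simp add: multivariate_normal_std)

lemma multivariate_normal_std_cis:
  fixes a :: "real^'n"
  shows "(\<integral>z. (\<Prod>b\<in>Basis. std_normal_density (z \<bullet> b)) *\<^sub>R iexp (a \<bullet> z) \<partial>lborel) = of_real (exp (- (norm a)\<^sup>2 / 2))" (is ?A)
    and "integrable lborel (\<lambda>z. (\<Prod>b\<in>Basis. std_normal_density (z \<bullet> b)) *\<^sub>R iexp (a \<bullet> z))" (is ?B)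
proof -
  define g where "g b y = std_normal_density y *\<^sub>R iexp ((a \<bullet> b) * y)" for b :: "real^'n" and y
  have gi: "integrable lborel (g b)" for b
    unfolding g_def
    by (rule Bochner_Integration.integrable_bound[OF integrable_normal_density[of 1 0]]) auto
  have gI: "(\<integral>y. g b y \<partial>lborel) = of_real (exp (- (a \<bullet> b)\<^sup>2 / 2))" for b
    using char_std_normal_distribution
    by (simp add: char_def fun_eq_iff integral_density g_def)
  have eq: "(\<Prod>b\<in>Basis. std_normal_density (z \<bullet> b)) *\<^sub>R iexp (a \<bullet> z) = (\<Prod>b\<in>Basis. g b (z \<bullet> b))" for z :: "real^'n"
  proof -
    have "iexp (a \<bullet> z) = (\<Prod>b\<in>Basis. iexp ((a \<bullet> b) * (z \<bullet> b)))"
      unfolding euclidean_inner[of a z] by (simp add: sum_distrib_left exp_sum)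
    then show ?thesis by (simp add: g_def scaleR_conv_of_real prod.distrib)
  qed
  have "(\<Prod>b\<in>Basis. of_real (exp (- (a \<bullet> b)\<^sup>2 / 2))) = (of_real (exp (\<Sum>b\<in>Basis. - (a \<bullet> b)\<^sup>2 / 2)) :: complex)"
    by (simp add: exp_sum)
  also have "(\<Sum>b\<in>Basis. - (a \<bullet> b)\<^sup>2 / 2) = - (norm a)\<^sup>2 / 2"
    unfolding power2_norm_eq_inner euclidean_inner[of a a]
    by (simp add: sum_divide_distrib[symmetric] sum_negf power2_eq_square)
  finally show ?A
    unfolding eq using lborel_integral_prod(1)[of g, OF gi] by (simp add: gI)
  show ?B unfolding eq by (rule lborel_integral_prod(2)[OF gi])
qed

text \<open>The total mass is the characteristic function at 0.\<close>

lemma prob_space_multivariate_normal_std: "prob_space (multivariate_normal 0 (mat 1 :: real^'n^'n))"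
proof
  let ?f = "\<lambda>x::real^'n. \<Prod>b\<in>Basis. std_normal_density (x \<bullet> b)"
  have eq: "(\<lambda>z. ?f z *\<^sub>R iexp (0 \<bullet> z)) = (\<lambda>z. complex_of_real (?f z))"
    by (simp add: scaleR_conv_of_real fun_eq_iff)
  have i: "integrable lborel ?f"
    using multivariate_normal_std_cis(2)[of "0::real^'n"] unfolding eq complex_of_real_integrable_eq .
  have "complex_of_real (\<integral>x. ?f x \<partial>lborel) = 1"
    using multivariate_normal_std_cis(1)[of "0::real^'n"] unfolding eq integral_complex_of_real by simp
  then have "(\<integral>x. ?f x \<partial>lborel) = 1" by simp
  moreover have "(\<integral>\<^sup>+x. ennreal (?f x) \<partial>lborel) = ennreal (\<integral>x. ?f x \<partial>lborel)"
    by (rule nn_integral_eq_integral[OF i]) (auto intro!: prod_nonneg)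
  moreover have "?f \<in> borel_measurable borel" using i borel_measurable_integrable by force
  ultimately show "emeasure (multivariate_normal 0 (mat 1 :: real^'n^'n)) (space (multivariate_normal 0 (mat 1))) = 1"
    by (simp add: multivariate_normal_std emeasure_density)
qed

lemma multivariate_normal_std_trig:
  fixes a :: "real^'n"
  shows "(\<integral>z. cos (a \<bullet> z) \<partial>multivariate_normal 0 (mat 1)) = exp (- (norm a)\<^sup>2 / 2)"
    and "(\<integral>z. sin (a \<bullet> z) \<partial>multivariate_normal 0 (mat 1)) = 0"
proof -
  let ?f = "\<lambda>x::real^'n. \<Prod>b\<in>Basis. std_normal_density (x \<bullet> b)"
  have m[measurable]: "?f \<in> borel_measurable borel"
    by (intro borel_measurable_prod) measurable
  have "(\<integral>z. cos (a \<bullet> z) \<partial>multivariate_normal 0 (mat 1)) = (\<integral>z. ?f z * cos (a \<bullet> z) \<partial>lborel)"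
    unfolding multivariate_normal_std by (subst integral_density) (auto intro!: prod_nonneg AE_I2)
  also have "\<dots> = Re (\<integral>z. ?f z *\<^sub>R iexp (a \<bullet> z) \<partial>lborel)"
    by (subst integral_Re[OF multivariate_normal_std_cis(2), symmetric]) (simp add: Re_exp)
  finally show "(\<integral>z. cos (a \<bullet> z) \<partial>multivariate_normal 0 (mat 1)) = exp (- (norm a)\<^sup>2 / 2)"
    by (simp only: multivariate_normal_std_cis(1) Re_complex_of_real)
  have "(\<integral>z. sin (a \<bullet> z) \<partial>multivariate_normal 0 (mat 1)) = (\<integral>z. ?f z * sin (a \<bullet> z) \<partial>lborel)"
    unfolding multivariate_normal_std by (subst integral_density) (auto intro!: prod_nonneg AE_I2)
  also have "\<dots> = Im (\<integral>z. ?f z *\<^sub>R iexp (a \<bullet> z) \<partial>lborel)"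
    by (subst integral_Im[OF multivariate_normal_std_cis(2), symmetric]) (simp add: Im_exp)
  finally show "(\<integral>z. sin (a \<bullet> z) \<partial>multivariate_normal 0 (mat 1)) = 0"
    by (simp only: multivariate_normal_std_cis(1) Im_complex_of_real)
qed

section \<open>The squared norm of a standard bivariate normal vector\<close>

text \<open>The sign is reversed because the measures are compared on upper half-lines, which must
  have finite measure: \<open>- (z \<bullet> z) > x\<close> describes a disc of area
  \<open>pi * (- x)\<close> or the empty set, whereas \<open>z \<bullet> z > x\<close> has infinite
  area.\<close>

lemma distr_lborel_norm_square:
  "distr lborel borel (\<lambda>z::real^2. - (z \<bullet> z)) = density lborel (\<lambda>s. ennreal (pi * indicator {..<0} s))"
proof (rule measure_eqI_lessThan)
  let ?N = "distr lborel borel (\<lambda>z::real^2. - (z \<bullet> z))"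
  have e1: "emeasure ?N {x<..} = ennreal (pi * max 0 (- x))" for x
  proof -
    have "emeasure ?N {x<..} = emeasure lborel {z::real^2. z \<bullet> z < - x}"
      by (subst emeasure_distr) (auto intro!: arg_cong[where f = "emeasure lborel"])
    also have "{z::real^2. z \<bullet> z < - x} = (if x < 0 then ball 0 (sqrt (- x)) else {})"
    proof (cases "x < 0")
      case True
      have "ball (0 :: real^2) (sqrt (- x)) = {z. sqrt (z \<bullet> z) < sqrt (- x)}"
        by (simp only: ball_def dist_norm norm_eq_sqrt_inner diff_0 inner_minus_left inner_minus_right minus_minus)
      then show ?thesis using True by (simp only: real_sqrt_less_iff if_True)
    next
      case False
      have "\<not> z \<bullet> z < - x" for z :: "real^2" using inner_ge_zero[of z] False by linarith
      then show ?thesis using False by auto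
    qed
    also have "emeasure lborel \<dots> = ennreal (pi * max 0 (- x))"
      by (cases "x < 0") (auto simp: emeasure_ball unit_ball_vol_2 max_def)
    finally show ?thesis .
  qed
  show "emeasure ?N {x<..} < \<infinity>" for x unfolding e1 by simp
  show "emeasure ?N {x<..} = emeasure (density lborel (\<lambda>s. ennreal (pi * indicator {..<0} s))) {x<..}" for x
  proof -
    have "emeasure (density lborel (\<lambda>s. ennreal (pi * indicator {..<0} s))) {x<..}
        = (\<integral>\<^sup>+s. ennreal pi * indicator {x<..<0} s \<partial>lborel)"
      by (subst emeasure_density) (auto intro!: nn_integral_cong split: split_indicator)
    also have "\<dots> = ennreal (pi * max 0 (- x))"
      by (cases "x < 0") (auto simp: nn_integral_cmult_indicator max_def simp flip: ennreal_mult'')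
    finally show ?thesis unfolding e1 by simp
  qed
qed auto

text \<open>The normal density depends on \<open>z\<close> only through
  \<open>z \<bullet> z\<close>, and the image of Lebesgue measure under the squared norm has
  constant density \<open>pi\<close> on the positive axis. The factor 1/2 of the chi-square density
  is \<open>pi / (2 * pi)\<close>.\<close>

lemma distr_multivariate_normal_chi_square:
  "distr (multivariate_normal 0 (mat 1 :: real^2^2)) borel (\<lambda>z. z \<bullet> z) = chi_square_distribution 2"
proof (rule measure_eqI)
  show "sets (distr (multivariate_normal 0 (mat 1 :: real^2^2)) borel (\<lambda>z. z \<bullet> z)) = sets (chi_square_distribution 2)"
    by (simp add: chi_square_distribution_def)
  fix A assume "A \<in> sets (distr (multivariate_normal 0 (mat 1 :: real^2^2)) borel (\<lambda>z. z \<bullet> z))"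
  then have [measurable]: "A \<in> sets borel" by simp
  define g where "g u = ennreal (exp (u / 2) / (2 * pi)) * indicator A (- u)" for u :: real
  have [measurable]: "g \<in> borel_measurable borel" unfolding g_def by measurable
  have d: "exp (- ((x - 0) \<bullet> (matrix_inv (mat 1) *v (x - 0))) / 2) / sqrt ((2 * pi) ^ CARD(2) * det (mat 1 :: real^2^2))
      = exp (- (x \<bullet> x) / 2) / (2 * pi)" for x :: "real^2"
    by (simp add: matrix_inv_mat_1 matrix_vector_mul_lid real_sqrt_mult)
  have "emeasure (distr (multivariate_normal 0 (mat 1 :: real^2^2)) borel (\<lambda>z. z \<bullet> z)) A
      = emeasure (density lborel (\<lambda>x::real^2. ennreal (exp (- (x \<bullet> x) / 2) / (2 * pi)))) {x. x \<bullet> x \<in> A}"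
    unfolding multivariate_normal_def d by (subst emeasure_distr) (auto intro!: arg_cong2[where f = emeasure])
  also have "\<dots> = (\<integral>\<^sup>+x. g (- ((x::real^2) \<bullet> x)) \<partial>lborel)"
    by (subst emeasure_density) (auto simp: g_def indicator_def intro!: nn_integral_cong)
  also have "\<dots> = (\<integral>\<^sup>+s. g s \<partial>distr lborel borel (\<lambda>z::real^2. - (z \<bullet> z)))"
    by (subst nn_integral_distr) auto
  also have "\<dots> = (\<integral>\<^sup>+s. ennreal (pi * indicator {..<0} s) * g s \<partial>lborel)"
    unfolding distr_lborel_norm_square by (subst nn_integral_density) auto
  also have "\<dots> = (\<integral>\<^sup>+s. ennreal (pi * indicator {..<0} (- s)) * g (- s) \<partial>lborel)"
    by (subst nn_integral_real_affine[where c = "-1" and t = 0]) auto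
  also have "\<dots> = emeasure (chi_square_distribution 2) A"
    unfolding chi_square_distribution_def
  proof (subst emeasure_density)
    show "(\<integral>\<^sup>+s. ennreal (pi * indicator {..<0} (- s)) * g (- s) \<partial>lborel) =
      (\<integral>\<^sup>+x. ennreal (if 0 < x then x powr (real 2 / 2 - 1) * exp (- x / 2) / (2 powr (real 2 / 2) * Gamma (real 2 / 2)) else 0)
        * indicator A x \<partial>lborel)"
    proof (intro nn_integral_cong)
      fix s :: real
      have "ennreal pi * ennreal (exp (- s / 2) / (2 * pi)) = ennreal (exp (- s / 2) / 2)"
        by (subst ennreal_mult[symmetric]) auto
      then show "ennreal (pi * indicator {..<0} (- s)) * g (- s) =
        ennreal (if 0 < s then s powr (real 2 / 2 - 1) * exp (- s / 2) / (2 powr (real 2 / 2) * Gamma (real 2 / 2)) else 0)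
        * indicator A s"
        by (auto simp: g_def mult.assoc[symmetric] split: split_indicator)
    qed
  qed auto
  finally show "emeasure (distr (multivariate_normal 0 (mat 1 :: real^2^2)) borel (\<lambda>z. z \<bullet> z)) A
      = emeasure (chi_square_distribution 2) A" .
qed

text \<open>Continuous mapping: a bounded continuous function composed with the squared norm is an
  admissible test function on the plane.\<close>

lemma (in prob_space) converges_in_distribution_norm_square:
  fixes Z :: "nat \<Rightarrow> 'a \<Rightarrow> real^2"
  assumes conv: "converges_in_distribution M Z (multivariate_normal 0 (mat 1))"
  shows "weak_conv_m (\<lambda>n. distr M borel (\<lambda>\<omega>. Z n \<omega> \<bullet> Z n \<omega>)) (chi_square_distribution 2)"
proof -
  have Z[measurable]: "Z n \<in> borel_measurable M" for n
    using conv by (simp add: converges_in_distribution_def)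
  note [measurable_cong] = sets_multivariate_normal_std
  have D: "(\<lambda>n. expectation (\<lambda>\<omega>. h (Z n \<omega>))) \<longlonglongrightarrow> (\<integral>z. h z \<partial>multivariate_normal 0 (mat 1))"
    if "continuous_on UNIV h" "bounded (range h)" for h :: "real^2 \<Rightarrow> real"
    using conv that by (simp add: converges_in_distribution_def)
  have "real_distribution (distr M borel (\<lambda>\<omega>. Z n \<omega> \<bullet> Z n \<omega>))" for n
    by (intro real_distribution_distr) measurable
  moreover have "real_distribution (chi_square_distribution 2)"
    unfolding distr_multivariate_normal_chi_square[symmetric]
    by (intro prob_space.real_distribution_distr prob_space_multivariate_normal_std) measurable
  moreover have "(\<lambda>n. integral\<^sup>L (distr M borel (\<lambda>\<omega>. Z n \<omega> \<bullet> Z n \<omega>)) f) \<longlonglongrightarrow> integral\<^sup>L (chi_square_distribution 2) f"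
    if f: "\<And>x. isCont f x" "\<And>x. \<bar>f x\<bar> \<le> 1" for f :: "real \<Rightarrow> real"
  proof -
    have cf: "continuous_on UNIV f" using f(1) by (simp add: continuous_on_eq_continuous_at)
    have [measurable]: "f \<in> borel_measurable borel" using cf by (rule borel_measurable_continuous_onI)
    have c: "continuous_on UNIV (\<lambda>z::real^2. f (z \<bullet> z))"
      by (rule continuous_on_compose2[OF cf]) (auto intro!: continuous_intros)
    have b: "bounded (range (\<lambda>z::real^2. f (z \<bullet> z)))" using f(2) by (auto simp: bounded_iff)
    have "(\<lambda>n. expectation (\<lambda>\<omega>. f (Z n \<omega> \<bullet> Z n \<omega>))) \<longlonglongrightarrow> (\<integral>z. f ((z::real^2) \<bullet> z) \<partial>multivariate_normal 0 (mat 1))"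
      using D[OF c b] .
    then show ?thesis
      unfolding distr_multivariate_normal_chi_square[symmetric] by (simp add: integral_distr)
  qed
  ultimately show ?thesis
    by (intro integral_bdd_continuous_conv_imp_weak_conv) auto
qed

section \<open>Moments of the standardized exponential power distribution\<close>

text \<open>The substitution \<open>u = a * y powr lam\<close> turns the integral into
  \<open>Gamma ((p + 1) / lam)\<close>. It is carried out on the open half-line, where it is a
  bijection with the usual derivative and negative \<open>p\<close> causes no trouble.\<close>

lemma has_bochner_integral_powr_exp:
  fixes a lam p :: real
  assumes a: "0 < a" and lam: "0 < lam" and p: "-1 < p"
  shows "has_bochner_integral lborel (\<lambda>y. indicator {0..} y *\<^sub>R (\<bar>y\<bar> powr p * exp (- (a * \<bar>y\<bar> powr lam))))
    (a powr (- ((p + 1) / lam)) * Gamma ((p + 1) / lam) / lam)"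
proof -
  define s where "s = (p + 1) / lam"
  have s: "0 < s" using lam p by (simp add: s_def)
  define f where "f u = u powr (s - 1) / exp u" for u :: real
  define g where "g y = a * y powr lam" for y :: real
  have "(f has_integral Gamma s) {0..}" unfolding f_def by (rule Gamma_integral_real[OF s])
  then have f: "(f has_integral Gamma s) {0<..}"
    by (subst (asm) has_integral_spike_set_eq[where T = "{0<..}"]) (auto intro: negligible_subset[of "{0}"])
  have fa: "f absolutely_integrable_on {0<..}"
    using f by (intro nonnegative_absolutely_integrable_1) (auto simp: f_def has_integral_integrable)
  have g_img: "g ` {0<..} = {0<..}"
  proof (intro equalityI subsetI)
    fix u :: real assume "u \<in> {0<..}"
    then have "u = g ((u / a) powr (1 / lam))" "(u / a) powr (1 / lam) \<in> {0<..}"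
      using a lam by (auto simp: g_def powr_powr)
    then show "u \<in> g ` {0<..}" by blast
  qed (use a in \<open>auto simp: g_def\<close>)
  have inj: "inj_on g {0<..}"
  proof (rule inj_onI)
    fix x y assume xy: "x \<in> {0<..}" "y \<in> {0<..}" "g x = g y"
    then have "(x powr lam) powr (1 / lam) = (y powr lam) powr (1 / lam)" using a by (simp add: g_def)
    then show "x = y" using xy lam by (simp add: powr_powr)
  qed
  have der: "(g has_field_derivative a * (lam * y powr (lam - 1))) (at y within {0<..})" if "y \<in> {0<..}" for y
    unfolding g_def using that DERIV_cmult[OF DERIV_powr_pos[of y lam], of a]
    by (auto intro: has_field_derivative_at_within)
  have "(\<lambda>y. \<bar>a * (lam * y powr (lam - 1))\<bar> * f (g y)) absolutely_integrable_on {0<..} \<and>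
      integral {0<..} (\<lambda>y. \<bar>a * (lam * y powr (lam - 1))\<bar> * f (g y)) = Gamma s"
    using has_absolute_integral_change_of_variables_1'[of "{0<..}" g, OF _ der inj] fa f
    by (simp add: g_img integral_unique)
  then have ai: "(\<lambda>y. \<bar>a * (lam * y powr (lam - 1))\<bar> * f (g y)) absolutely_integrable_on {0<..}"
    and int: "integral {0<..} (\<lambda>y. \<bar>a * (lam * y powr (lam - 1))\<bar> * f (g y)) = Gamma s" by auto
  have eq: "\<bar>a * (lam * y powr (lam - 1))\<bar> * f (g y) = (lam * a powr s) * (\<bar>y\<bar> powr p * exp (- (a * \<bar>y\<bar> powr lam)))"
    if "y \<in> {0<..}" for y
  proof -
    have y: "0 < y" using that by simp
    have "lam - 1 + lam * (s - 1) = p" using lam by (simp add: s_def field_simps)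
    then have "y powr (lam - 1) * (y powr lam) powr (s - 1) = y powr p"
      by (simp add: powr_powr powr_add[symmetric])
    moreover have "a * a powr (s - 1) = a powr s" using a by (simp add: powr_diff)
    ultimately show ?thesis
      using a lam y by (simp add: f_def g_def powr_mult exp_minus field_simps)
  qed
  define h where "h y = indicator {0..} y *\<^sub>R (\<bar>y\<bar> powr p * exp (- (a * \<bar>y\<bar> powr lam)))" for y :: real
  have h: "h y = indicator {0<..} y *\<^sub>R (\<bar>y\<bar> powr p * exp (- (a * \<bar>y\<bar> powr lam)))" for y
    by (cases "y = 0") (auto simp: h_def split: split_indicator)
  have [measurable]: "h \<in> borel_measurable borel" unfolding h_def by measurable
  have "(\<lambda>y. (lam * a powr s) * (\<bar>y\<bar> powr p * exp (- (a * \<bar>y\<bar> powr lam)))) absolutely_integrable_on {0<..}"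
    using ai by (rule set_integrable_cong[THEN iffD1, rotated -1]) (use eq in auto)
  then have ai': "integrable lebesgue (\<lambda>y. (lam * a powr s) * h y)"
    unfolding set_integrable_def h by (simp add: mult_ac)
  then have i1: "integrable lebesgue h" using lam a by simp
  have "integral {0<..} (\<lambda>y. (lam * a powr s) * (\<bar>y\<bar> powr p * exp (- (a * \<bar>y\<bar> powr lam)))) = Gamma s"
    using int eq by (subst integral_cong[OF eq[symmetric]]) auto
  moreover have "(\<lambda>y. \<bar>y\<bar> powr p * exp (- (a * \<bar>y\<bar> powr lam))) absolutely_integrable_on {0<..}"
    using i1 unfolding set_integrable_def h .
  then have "integral\<^sup>L lebesgue h = integral {0<..} (\<lambda>y. \<bar>y\<bar> powr p * exp (- (a * \<bar>y\<bar> powr lam)))"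
    using set_lebesgue_integral_eq_integral(2) unfolding set_lebesgue_integral_def h by blast
  ultimately have "(lam * a powr s) * integral\<^sup>L lebesgue h = Gamma s" by simp
  then have i2: "integral\<^sup>L lebesgue h = a powr (- s) * Gamma s / lam"
    using a lam by (simp add: powr_minus field_simps)
  have "has_bochner_integral lborel h (a powr (- s) * Gamma s / lam)"
    using i1 i2 by (simp add: has_bochner_integral_iff integrable_completion integral_completion)
  then show ?thesis unfolding h_def s_def .
qed

lemma has_bochner_integral_abs_powr_exp:
  fixes a lam p :: real
  assumes a: "0 < a" and lam: "0 < lam" and p: "-1 < p"
  shows "has_bochner_integral lborel (\<lambda>y. \<bar>y\<bar> powr p * exp (- (a * \<bar>y\<bar> powr lam)))
    (2 * (a powr (- ((p + 1) / lam)) * Gamma ((p + 1) / lam) / lam))"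
  using has_bochner_integral_even_function[OF has_bochner_integral_powr_exp[OF assms]] by simp

definition epd :: "real \<Rightarrow> real measure" where
  "epd lam = density lborel (\<lambda>y. ennreal (EPD_density lam 0 1 y))"

lemma EPD_density_measurable [measurable]: "EPD_density lam m s \<in> borel_measurable borel"
  unfolding EPD_density_def[abs_def] by measurable

lemma sets_epd [simp, measurable_cong]: "sets (epd lam) = sets borel"
  by (simp add: epd_def)

lemma space_epd [simp]: "space (epd lam) = UNIV"
  by (simp add: epd_def)

lemma EPD_density_std:
  "EPD_density lam 0 1 y = 1 / (2 * lam powr (1 / lam) * Gamma (1 + 1 / lam)) * exp (- ((1 / lam) * \<bar>y\<bar> powr lam))"
  by (simp add: EPD_density_def)

lemma EPD_density_pos: "0 < lam \<Longrightarrow> 0 < s \<Longrightarrow> 0 < EPD_density lam m s y"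
  by (auto simp: EPD_density_def intro!: divide_pos_pos mult_pos_pos Gamma_real_pos add_pos_pos)

text \<open>Closed form of the absolute moment of order \<open>p\<close> of \<open>epd lam\<close>.
  The order is a real variable so that logarithmic moments can be obtained by differentiating in
  it.\<close>

definition epd_moment :: "real \<Rightarrow> real \<Rightarrow> real" where
  "epd_moment lam p = lam powr (p / lam) * Gamma ((p + 1) / lam) / Gamma (1 / lam)"

lemma Gamma_inverse_pos: "0 < (lam::real) \<Longrightarrow> 0 < Gamma (1 / lam)"
  by (simp add: Gamma_real_pos)

lemma Gamma_one_plus_inverse: "0 < (lam::real) \<Longrightarrow> Gamma (1 + 1 / lam) = Gamma (1 / lam) / lam"
  using Gamma_plus1[of "1 / lam"] nonpos_Ints_nonpos[of "1 / lam"] by (force simp: add.commute)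

lemma has_bochner_integral_epd_powr:
  assumes lam: "0 < lam" and p: "-1 < p"
  shows "has_bochner_integral (epd lam) (\<lambda>y. \<bar>y\<bar> powr p) (epd_moment lam p)"
proof -
  let ?c = "1 / (2 * lam powr (1 / lam) * Gamma (1 + 1 / lam))"
  have G0: "Gamma (1 / lam) > 0" using lam by (rule Gamma_inverse_pos)
  have c: "?c = lam / (2 * lam powr (1 / lam) * Gamma (1 / lam))"
    using lam by (simp add: Gamma_one_plus_inverse)
  have "(1 / lam) powr (- ((p + 1) / lam)) = lam powr ((p + 1) / lam)"
    using lam by (simp add: powr_minus powr_divide)
  moreover have "lam powr ((p + 1) / lam) = lam powr (p / lam) * lam powr (1 / lam)"
    by (simp add: powr_add[symmetric] add_divide_distrib)
  ultimately have "?c * (2 * ((1 / lam) powr (- ((p + 1) / lam)) * Gamma ((p + 1) / lam) / lam)) = epd_moment lam p"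
    unfolding c using lam G0 by (simp add: epd_moment_def field_simps)
  then have "has_bochner_integral lborel (\<lambda>y. ?c * (\<bar>y\<bar> powr p * exp (- ((1 / lam) * \<bar>y\<bar> powr lam)))) (epd_moment lam p)"
    using has_bochner_integral_mult_right[OF has_bochner_integral_abs_powr_exp[of "1 / lam" lam p], of ?c] lam p
    by simp
  then show ?thesis
    unfolding epd_def
  proof (intro has_bochner_integral_density)
    show "AE y in lborel. 0 \<le> EPD_density lam 0 1 y"
      using EPD_density_pos[OF lam, of 1 0] by (auto intro: less_imp_le)
  qed (auto simp: EPD_density_std mult_ac)
qed

lemma AE_epd_neq: "AE y in epd lam. y \<noteq> c"
  unfolding epd_def using AE_lborel_singleton[of c] by (subst AE_density) (auto elim: eventually_mono)

text \<open>The total mass is the moment of order 0. The function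
  \<open>\<bar>y\<bar> powr 0\<close> equals 1 only off \<open>y = 0\<close>, hence the detour
  through almost everywhere equality.\<close>

lemma prob_space_epd:
  assumes lam: "0 < lam" shows "prob_space (epd lam)"
proof
  have e0: "epd_moment lam 0 = 1" using lam less_imp_neq[OF Gamma_inverse_pos[OF lam]] by (simp add: epd_moment_def)
  have h: "has_bochner_integral (epd lam) (\<lambda>y. \<bar>y\<bar> powr 0) 1"
    using has_bochner_integral_epd_powr[OF lam, of 0] by (simp add: e0)
  have "emeasure (epd lam) (space (epd lam)) = (\<integral>\<^sup>+y. 1 \<partial>epd lam)" by simp
  also have "\<dots> = (\<integral>\<^sup>+y. ennreal (\<bar>y\<bar> powr 0) \<partial>epd lam)"
    by (intro nn_integral_cong_AE) (use AE_epd_neq[of 0 lam] in \<open>auto elim: eventually_mono\<close>)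
  also have "\<dots> = ennreal (\<integral>y. \<bar>y\<bar> powr 0 \<partial>epd lam)"
    using h by (intro nn_integral_eq_integral) (auto simp: has_bochner_integral_iff)
  also have "\<dots> = 1" using h by (simp add: has_bochner_integral_iff)
  finally show "emeasure (epd lam) (space (epd lam)) = 1" .
qed

lemma distr_epd_uminus: "distr (epd lam) borel uminus = epd lam"
proof (rule measure_eqI)
  fix A assume "A \<in> sets (distr (epd lam) borel uminus)"
  then have [measurable]: "A \<in> sets borel" by simp
  have [measurable]: "uminus -` A \<in> sets borel"
    using measurable_sets[of "uminus :: real \<Rightarrow> real" borel borel A] by simp
  have "emeasure (distr (epd lam) borel uminus) A = emeasure (epd lam) (uminus -` A)"
    by (subst emeasure_distr) auto
  also have "\<dots> = (\<integral>\<^sup>+y. ennreal (EPD_density lam 0 1 y) * indicator A (- y) \<partial>lborel)"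
    unfolding epd_def by (subst emeasure_density) (auto intro!: nn_integral_cong split: split_indicator)
  also have "\<dots> = (\<integral>\<^sup>+y. ennreal (EPD_density lam 0 1 (- y)) * indicator A y \<partial>lborel)"
    by (subst nn_integral_real_affine[where c = "-1" and t = 0]) auto
  also have "\<dots> = emeasure (epd lam) A"
    unfolding epd_def by (subst emeasure_density) (auto simp: EPD_density_def)
  finally show "emeasure (distr (epd lam) borel uminus) A = emeasure (epd lam) A" .
qed simp

lemma integral_epd_odd:
  fixes g :: "real \<Rightarrow> real"
  assumes [measurable]: "g \<in> borel_measurable borel" and odd: "\<And>y. g (- y) = - g y"
  shows "(\<integral>y. g y \<partial>epd lam) = 0"
proof -
  have "(\<integral>y. g y \<partial>epd lam) = (\<integral>y. g y \<partial>distr (epd lam) borel uminus)" by (simp add: distr_epd_uminus)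
  also have "\<dots> = (\<integral>y. g (- y) \<partial>epd lam)" by (subst integral_distr) auto
  finally show ?thesis by (simp add: odd)
qed

section \<open>Logarithmic moments\<close>

lemma abs_ln_le_powr:
  assumes u: "0 < (u::real)" and h: "0 < h"
  shows "\<bar>ln u\<bar> \<le> (u powr h + u powr (- h)) / h"
proof -
  have 1: "h * ln u \<le> u powr h" using ln_le_minus_one[of "u powr h"] u by (simp add: ln_powr)
  have 2: "- (h * ln u) \<le> u powr (- h)" using ln_le_minus_one[of "u powr (-h)"] u by (simp add: ln_powr)
  have "h * \<bar>ln u\<bar> = \<bar>h * ln u\<bar>" using h by (simp add: abs_mult)
  also have "\<dots> \<le> u powr h + u powr (- h)"
    using 1 2 powr_ge_zero[of u h] powr_ge_zero[of u "- h"] by linarith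
  finally show ?thesis using h by (simp add: field_simps)
qed

lemma integrable_epd_powr: "0 < lam \<Longrightarrow> -1 < p \<Longrightarrow> integrable (epd lam) (\<lambda>y. \<bar>y\<bar> powr p)"
  using has_bochner_integral_epd_powr by (auto simp: has_bochner_integral_iff)

text \<open>Every logarithmic factor is paid for with a small change of the exponent, upwards for
  large and downwards for small arguments; induction over the number of factors.\<close>

lemma integrable_epd_powr_abs_ln:
  assumes lam: "0 < lam" and p: "-1 < p"
  shows "integrable (epd lam) (\<lambda>y. \<bar>y\<bar> powr p * \<bar>ln \<bar>y\<bar>\<bar> ^ k)"
  using p
proof (induction k arbitrary: p)
  case 0 then show ?case using integrable_epd_powr[OF lam] by simp
next
  case (Suc k)
  \<comment> \<open>Half the distance to the critical exponent -1, so both \<open>p + h\<close> and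
    \<open>p - h\<close> remain admissible.\<close>
  define h where "h = (p + 1) / 2"
  have h: "0 < h" "-1 < p + h" "-1 < p - h" using Suc.prems by (auto simp: h_def field_simps)
  have i: "integrable (epd lam) (\<lambda>y. (\<bar>y\<bar> powr (p + h) * \<bar>ln \<bar>y\<bar>\<bar> ^ k + \<bar>y\<bar> powr (p - h) * \<bar>ln \<bar>y\<bar>\<bar> ^ k) / h)"
    using Suc.IH[OF h(2)] Suc.IH[OF h(3)] by simp
  show ?case
  proof (rule Bochner_Integration.integrable_bound[OF i])
    show "(\<lambda>y. \<bar>y\<bar> powr p * \<bar>ln \<bar>y\<bar>\<bar> ^ Suc k) \<in> borel_measurable (epd lam)" by measurable
    have "\<bar>y\<bar> powr p * \<bar>ln \<bar>y\<bar>\<bar> ^ Suc k \<le> (\<bar>y\<bar> powr (p + h) * \<bar>ln \<bar>y\<bar>\<bar> ^ k + \<bar>y\<bar> powr (p - h) * \<bar>ln \<bar>y\<bar>\<bar> ^ k) / h" for y :: real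
    proof (cases "y = 0")
      case False
      then have "\<bar>y\<bar> powr p * \<bar>ln \<bar>y\<bar>\<bar> ^ k * \<bar>ln \<bar>y\<bar>\<bar>
          \<le> \<bar>y\<bar> powr p * \<bar>ln \<bar>y\<bar>\<bar> ^ k * ((\<bar>y\<bar> powr h + \<bar>y\<bar> powr (- h)) / h)"
        by (intro mult_left_mono abs_ln_le_powr) (use h in auto)
      then show ?thesis using h by (simp add: powr_add powr_diff powr_minus field_simps)
    qed simp
    then show "AE y in epd lam. norm (\<bar>y\<bar> powr p * \<bar>ln \<bar>y\<bar>\<bar> ^ Suc k)
        \<le> norm ((\<bar>y\<bar> powr (p + h) * \<bar>ln \<bar>y\<bar>\<bar> ^ k + \<bar>y\<bar> powr (p - h) * \<bar>ln \<bar>y\<bar>\<bar> ^ k) / h)"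
      using h by (intro AE_I2) (simp add: abs_mult)
  qed
qed

lemma integrable_epd_powr_ln:
  assumes lam: "0 < lam" and p: "-1 < p"
  shows "integrable (epd lam) (\<lambda>y. \<bar>y\<bar> powr p * ln \<bar>y\<bar> ^ k)"
  by (rule Bochner_Integration.integrable_bound[OF integrable_epd_powr_abs_ln[OF assms, of k]])
    (auto simp: abs_mult power_abs)

lemma abs_exp_minus_one_le: "\<bar>exp x - 1\<bar> \<le> \<bar>x\<bar> * exp \<bar>x\<bar>" for x :: real
proof (cases "0 \<le> x")
  case True
  have "1 - x \<le> exp (- x)" using exp_ge_add_one_self[of "- x"] by simp
  then have "(1 - exp (- x)) * exp x \<le> x * exp x" by (intro mult_right_mono) auto
  then have "exp x - 1 \<le> x * exp x" by (simp add: left_diff_distrib exp_minus)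
  then show ?thesis using True by simp
next
  case False
  have "1 + x \<le> exp x" by (rule exp_ge_add_one_self)
  moreover have "(- x) * 1 \<le> (- x) * exp (- x)" using False by (intro mult_left_mono) auto
  ultimately have "1 - exp x \<le> (- x) * exp (- x)" by linarith
  then show ?thesis using False by simp
qed

text \<open>The majorant is free of \<open>t\<close>, as dominated convergence requires for
  differentiation under the integral in the exponent.\<close>

lemma powr_difference_quotient_le:
  assumes t: "t \<noteq> 0" "\<bar>t\<bar> \<le> h" and u: "0 \<le> (u::real)"
  shows "\<bar>(u powr (p + t) - u powr p) / t\<bar> \<le> (u powr (p + h) + u powr (p - h)) * \<bar>ln u\<bar>"
proof (cases "u = 0")
  case False
  then have u: "0 < u" using u by simp
  have "u powr (p + t) - u powr p = u powr p * (exp (t * ln u) - 1)"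
    using u by (simp add: powr_def exp_add[symmetric] algebra_simps)
  then have "\<bar>(u powr (p + t) - u powr p) / t\<bar> = u powr p * (\<bar>exp (t * ln u) - 1\<bar> / \<bar>t\<bar>)"
    by (simp add: abs_mult)
  also have "\<dots> \<le> u powr p * ((\<bar>t * ln u\<bar> * exp \<bar>t * ln u\<bar>) / \<bar>t\<bar>)"
    by (intro mult_left_mono divide_right_mono abs_exp_minus_one_le) auto
  also have "\<dots> = u powr p * \<bar>ln u\<bar> * exp \<bar>t * ln u\<bar>" using t by (simp add: abs_mult)
  also have "\<dots> \<le> u powr p * \<bar>ln u\<bar> * (u powr h + u powr (- h))"
  proof (intro mult_left_mono)
    have "exp \<bar>t * ln u\<bar> \<le> exp (h * \<bar>ln u\<bar>)" using t by (auto simp: abs_mult intro!: mult_right_mono)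
    also have "\<dots> \<le> u powr h + u powr (- h)" using u by (auto simp: powr_def abs_if)
    finally show "exp \<bar>t * ln u\<bar> \<le> u powr h + u powr (- h)" .
  qed auto
  also have "\<dots> = (u powr (p + h) + u powr (p - h)) * \<bar>ln u\<bar>"
    by (simp add: powr_add powr_diff powr_minus field_simps)
  finally show ?thesis .
qed simp

text \<open>Stated for every power \<open>k\<close> of the logarithm, so that the second logarithmic
  moment arises by applying it a second time.\<close>

lemma DERIV_epd_log_moment:
  assumes lam: "0 < lam" and p: "-1 < p"
  shows "((\<lambda>p. \<integral>y. \<bar>y\<bar> powr p * ln \<bar>y\<bar> ^ k \<partial>epd lam) has_real_derivative
    (\<integral>y. \<bar>y\<bar> powr p * ln \<bar>y\<bar> ^ Suc k \<partial>epd lam)) (at p)"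
proof -
  define h where "h = (p + 1) / 2"
  have h: "0 < h" "-1 < p + h" "-1 < p - h" using p by (auto simp: h_def field_simps)
  let ?I = "\<lambda>p. \<integral>y. \<bar>y\<bar> powr p * ln \<bar>y\<bar> ^ k \<partial>epd lam"
  have "((\<lambda>t. (?I (p + t) - ?I p) / t) \<longlongrightarrow> (\<integral>y. \<bar>y\<bar> powr p * ln \<bar>y\<bar> ^ Suc k \<partial>epd lam)) (at 0 within {-h<..<h})"
    unfolding tendsto_at_iff_sequentially comp_def
  proof (intro allI impI)
    fix X :: "nat \<Rightarrow> real" assume X: "\<forall>i. X i \<in> {-h<..<h} - {0}" "X \<longlonglongrightarrow> 0"
    have Xh: "X i \<noteq> 0" "\<bar>X i\<bar> \<le> h" "-1 < p + X i" for i using X(1)[rule_format, of i] h by auto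
    have eq: "(?I (p + X i) - ?I p) / X i
        = (\<integral>y. ((\<bar>y\<bar> powr (p + X i) - \<bar>y\<bar> powr p) / X i) * ln \<bar>y\<bar> ^ k \<partial>epd lam)" for i
      using integrable_epd_powr_ln[OF lam Xh(3)[of i], of k] integrable_epd_powr_ln[OF lam p, of k]
      by (simp add: diff_divide_distrib left_diff_distrib)
    show "(\<lambda>i. (?I (p + X i) - ?I p) / X i) \<longlonglongrightarrow> (\<integral>y. \<bar>y\<bar> powr p * ln \<bar>y\<bar> ^ Suc k \<partial>epd lam)"
      unfolding eq
    proof (rule integral_dominated_convergence
        [where w = "\<lambda>y. \<bar>y\<bar> powr (p + h) * \<bar>ln \<bar>y\<bar>\<bar> ^ Suc k + \<bar>y\<bar> powr (p - h) * \<bar>ln \<bar>y\<bar>\<bar> ^ Suc k"])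
      show "integrable (epd lam) (\<lambda>y. \<bar>y\<bar> powr (p + h) * \<bar>ln \<bar>y\<bar>\<bar> ^ Suc k + \<bar>y\<bar> powr (p - h) * \<bar>ln \<bar>y\<bar>\<bar> ^ Suc k)"
        using integrable_epd_powr_abs_ln[OF lam h(2), of "Suc k"] integrable_epd_powr_abs_ln[OF lam h(3), of "Suc k"]
        by (rule Bochner_Integration.integrable_add)
      show "AE y in epd lam. (\<lambda>i. (\<bar>y\<bar> powr (p + X i) - \<bar>y\<bar> powr p) / X i * ln \<bar>y\<bar> ^ k) \<longlonglongrightarrow> \<bar>y\<bar> powr p * ln \<bar>y\<bar> ^ Suc k"
        using AE_epd_neq[of 0 lam]
      proof eventually_elim
        case (elim y)
        have "((\<lambda>q. \<bar>y\<bar> powr q) has_real_derivative \<bar>y\<bar> powr p * ln \<bar>y\<bar>) (at p)"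
          using elim by (auto intro!: derivative_eq_intros)
        then have "((\<lambda>t. (\<bar>y\<bar> powr (p + t) - \<bar>y\<bar> powr p) / t) \<longlongrightarrow> \<bar>y\<bar> powr p * ln \<bar>y\<bar>) (at 0)"
          by (simp add: DERIV_def)
        then have "(\<lambda>i. (\<bar>y\<bar> powr (p + X i) - \<bar>y\<bar> powr p) / X i) \<longlonglongrightarrow> \<bar>y\<bar> powr p * ln \<bar>y\<bar>"
          using X Xh unfolding tendsto_at_iff_sequentially comp_def by auto
        from tendsto_mult_right[OF this, of "ln \<bar>y\<bar> ^ k"] show ?case by (simp add: mult.assoc)
      qed
      show "AE y in epd lam. norm ((\<bar>y\<bar> powr (p + X i) - \<bar>y\<bar> powr p) / X i * ln \<bar>y\<bar> ^ k)
          \<le> \<bar>y\<bar> powr (p + h) * \<bar>ln \<bar>y\<bar>\<bar> ^ Suc k + \<bar>y\<bar> powr (p - h) * \<bar>ln \<bar>y\<bar>\<bar> ^ Suc k" for i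
      proof (intro AE_I2)
        fix y :: real
        have "norm ((\<bar>y\<bar> powr (p + X i) - \<bar>y\<bar> powr p) / X i * ln \<bar>y\<bar> ^ k)
            = \<bar>(\<bar>y\<bar> powr (p + X i) - \<bar>y\<bar> powr p) / X i\<bar> * \<bar>ln \<bar>y\<bar>\<bar> ^ k"
          by (simp add: abs_mult power_abs)
        also have "\<dots> \<le> ((\<bar>y\<bar> powr (p + h) + \<bar>y\<bar> powr (p - h)) * \<bar>ln \<bar>y\<bar>\<bar>) * \<bar>ln \<bar>y\<bar>\<bar> ^ k"
          by (intro mult_right_mono powr_difference_quotient_le Xh) auto
        finally show "norm ((\<bar>y\<bar> powr (p + X i) - \<bar>y\<bar> powr p) / X i * ln \<bar>y\<bar> ^ k)
          \<le> \<bar>y\<bar> powr (p + h) * \<bar>ln \<bar>y\<bar>\<bar> ^ Suc k + \<bar>y\<bar> powr (p - h) * \<bar>ln \<bar>y\<bar>\<bar> ^ Suc k"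
          by (simp add: algebra_simps)
      qed
    qed measurable
  qed
  moreover have "at 0 within {-h<..<h} = at (0::real)"
    using h by (intro at_within_open) auto
  ultimately show ?thesis unfolding DERIV_def by (simp only:)
qed

lemma integral_epd_powr:
  "0 < lam \<Longrightarrow> -1 < p \<Longrightarrow> (\<integral>y. \<bar>y\<bar> powr p \<partial>epd lam) = epd_moment lam p"
  using has_bochner_integral_epd_powr by (auto simp: has_bochner_integral_iff)

text \<open>The derivative of \<open>ln (epd_moment lam p)\<close> with respect to
  \<open>p\<close>.\<close>

definition epd_log_factor :: "real \<Rightarrow> real \<Rightarrow> real" where
  "epd_log_factor lam p = (ln lam + Digamma ((p + 1) / lam)) / lam"

lemma Gamma_arg_pos: "0 < lam \<Longrightarrow> -1 < p \<Longrightarrow> (p + 1) / lam \<notin> \<int>\<^sub>\<le>\<^sub>0" for lam p :: real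
  using nonpos_Ints_nonpos[of "(p + 1) / lam"] by (force simp: divide_le_0_iff)

lemma DERIV_epd_moment:
  assumes lam: "0 < lam" and p: "-1 < p"
  shows "(epd_moment lam has_real_derivative epd_moment lam p * epd_log_factor lam p) (at p)"
proof -
  have "((\<lambda>p. Gamma ((p + 1) / lam)) has_real_derivative Gamma ((p + 1) / lam) * Digamma ((p + 1) / lam) * (1 / lam)) (at p)"
    using lam Gamma_arg_pos[OF assms]
    by (intro DERIV_chain2[OF has_field_derivative_Gamma]) (auto intro!: derivative_eq_intros)
  moreover have "((\<lambda>p. lam powr (p / lam)) has_real_derivative lam powr (p / lam) * ln lam * (1 / lam)) (at p)"
    using lam by (auto intro!: derivative_eq_intros)
  ultimately have "((\<lambda>p. lam powr (p / lam) * Gamma ((p + 1) / lam) / Gamma (1 / lam)) has_real_derivative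
    ((lam powr (p / lam) * ln lam * (1 / lam)) * Gamma ((p + 1) / lam)
      + (Gamma ((p + 1) / lam) * Digamma ((p + 1) / lam) * (1 / lam)) * lam powr (p / lam)) / Gamma (1 / lam)) (at p)"
    by (intro DERIV_cdivide DERIV_mult)
  then show ?thesis
    unfolding epd_moment_def[abs_def]
    by (rule DERIV_cong) (simp add: epd_log_factor_def add_divide_distrib algebra_simps)
qed

lemma DERIV_epd_log_factor:
  assumes lam: "0 < lam" and p: "-1 < p"
  shows "(epd_log_factor lam has_real_derivative Polygamma 1 ((p + 1) / lam) / lam\<^sup>2) (at p)"
proof -
  have "((\<lambda>p. Digamma ((p + 1) / lam)) has_real_derivative Polygamma (Suc 0) ((p + 1) / lam) * (1 / lam)) (at p)"
    using lam Gamma_arg_pos[OF assms]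
    by (intro DERIV_chain2[OF has_field_derivative_Polygamma]) (auto intro!: derivative_eq_intros)
  then have "((\<lambda>p. (ln lam + Digamma ((p + 1) / lam)) / lam) has_real_derivative
      (0 + Polygamma (Suc 0) ((p + 1) / lam) * (1 / lam)) / lam) (at p)"
    by (intro DERIV_cdivide DERIV_add DERIV_const)
  then show ?thesis
    unfolding epd_log_factor_def[abs_def] by (rule DERIV_cong) (simp add: power2_eq_square)
qed

text \<open>The moment of order \<open>p\<close> is differentiated twice over, under the integral
  sign and in its Gamma form, and the two derivatives agree. The squared logarithm below is treated
  in the same way, one derivative further.\<close>

lemma integral_epd_powr_ln:
  assumes lam: "0 < lam" and p: "-1 < p"
  shows "(\<integral>y. \<bar>y\<bar> powr p * ln \<bar>y\<bar> \<partial>epd lam) = epd_moment lam p * epd_log_factor lam p"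
proof -
  have "((\<lambda>p. \<integral>y. \<bar>y\<bar> powr p * ln \<bar>y\<bar> ^ 0 \<partial>epd lam) has_real_derivative
    (\<integral>y. \<bar>y\<bar> powr p * ln \<bar>y\<bar> ^ Suc 0 \<partial>epd lam)) (at p)"
    by (rule DERIV_epd_log_moment[OF assms])
  then have "(epd_moment lam has_real_derivative (\<integral>y. \<bar>y\<bar> powr p * ln \<bar>y\<bar> ^ Suc 0 \<partial>epd lam)) (at p)"
    by (rule has_field_derivative_transform_within_open[where S = "{-1<..}"])
      (use lam p in \<open>auto simp: integral_epd_powr\<close>)
  from DERIV_unique[OF this DERIV_epd_moment[OF assms]] show ?thesis by simp
qed

lemma integral_epd_powr_ln_square:
  assumes lam: "0 < lam" and p: "-1 < p"
  shows "(\<integral>y. \<bar>y\<bar> powr p * (ln \<bar>y\<bar>)\<^sup>2 \<partial>epd lam)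
    = epd_moment lam p * ((epd_log_factor lam p)\<^sup>2 + Polygamma 1 ((p + 1) / lam) / lam\<^sup>2)"
proof -
  have "((\<lambda>p. \<integral>y. \<bar>y\<bar> powr p * ln \<bar>y\<bar> ^ 1 \<partial>epd lam) has_real_derivative
    (\<integral>y. \<bar>y\<bar> powr p * ln \<bar>y\<bar> ^ Suc 1 \<partial>epd lam)) (at p)"
    by (rule DERIV_epd_log_moment[OF assms])
  then have "((\<lambda>p. epd_moment lam p * epd_log_factor lam p) has_real_derivative
      (\<integral>y. \<bar>y\<bar> powr p * ln \<bar>y\<bar> ^ Suc 1 \<partial>epd lam)) (at p)"
    by (rule has_field_derivative_transform_within_open[where S = "{-1<..}"])
      (use lam p in \<open>auto simp: integral_epd_powr_ln\<close>)
  from DERIV_unique[OF this DERIV_mult[OF DERIV_epd_moment[OF assms] DERIV_epd_log_factor[OF assms]]]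
  show ?thesis by (simp add: power2_eq_square algebra_simps)
qed

section \<open>Samples from the exponential power distribution\<close>

lemma powr_add_one_le:
  fixes a p :: real
  assumes "0 \<le> a" "0 \<le> p" shows "(a + 1) powr p \<le> 2 powr p * (a powr p + 1)"
proof -
  have "(a + 1) powr p \<le> (2 * max a 1) powr p" using assms by (intro powr_mono2) auto
  also have "\<dots> = 2 powr p * max a 1 powr p" using assms by (simp add: powr_mult)
  also have "\<dots> \<le> 2 powr p * (a powr p + 1)"
    by (intro mult_left_mono) (auto simp: max_def)
  finally show ?thesis .
qed

lemma integrable_epd_const: "0 < lam \<Longrightarrow> integrable (epd lam) (\<lambda>_. c :: real)"
  using finite_measure.integrable_const[OF prob_space.finite_measure[OF prob_space_epd]] .

lemma integrable_epd_powr_add_one: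
  assumes "0 < lam" "0 \<le> p" shows "integrable (epd lam) (\<lambda>y. (\<bar>y\<bar> + 1) powr p)"
proof (rule Bochner_Integration.integrable_bound)
  show "integrable (epd lam) (\<lambda>y. 2 powr p * (\<bar>y\<bar> powr p + 1))"
    using integrable_epd_powr[of lam p] integrable_epd_const[of lam 1] assms by simp
  show "AE y in epd lam. norm ((\<bar>y\<bar> + 1) powr p) \<le> norm (2 powr p * (\<bar>y\<bar> powr p + 1))"
    using powr_add_one_le[OF abs_ge_zero assms(2)] by (intro AE_I2) (simp add: abs_mult)
qed measurable

text \<open>The standardized sample, for arbitrary \<open>lam \<ge> 1\<close>; the five values of
  the theorem matter only for the correction constants.\<close>

locale iid_epd = prob_space M for M :: "'a measure" +
  fixes Y :: "nat \<Rightarrow> 'a \<Rightarrow> real" and lam :: real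
  assumes lam: "1 \<le> lam"
    and indep: "indep_vars (\<lambda>_. borel) Y UNIV"
    and distr_Y: "\<And>i. distr M borel (Y i) = epd lam"
begin

lemma lam_pos: "0 < lam" using lam by simp

lemma Y_measurable [measurable]: "Y i \<in> borel_measurable M"
  using indep by (simp add: indep_vars_def)

lemma expectation_Y:
  fixes g :: "real \<Rightarrow> real"
  assumes [measurable]: "g \<in> borel_measurable borel"
  shows "expectation (\<lambda>\<omega>. g (Y i \<omega>)) = (\<integral>y. g y \<partial>epd lam)"
  by (simp add: integral_distr flip: distr_Y[of i])

lemma integrable_Y:
  fixes g :: "real \<Rightarrow> real"
  assumes [measurable]: "g \<in> borel_measurable borel" and "integrable (epd lam) g"
  shows "integrable M (\<lambda>\<omega>. g (Y i \<omega>))"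
  using assms(2) by (simp add: integrable_distr_eq flip: distr_Y[of i])

lemma AE_Y_neq_0: "AE \<omega> in M. \<forall>i. Y i \<omega> \<noteq> 0"
proof (subst AE_all_countable, intro allI)
  fix i
  have "AE y in distr M borel (Y i). y \<noteq> 0" unfolding distr_Y by (rule AE_epd_neq)
  then show "AE \<omega> in M. Y i \<omega> \<noteq> 0" by (subst (asm) AE_distr_iff) auto
qed

lemma epd_integrable_square_imp:
  assumes "integrable (epd lam) (\<lambda>y. (g y)\<^sup>2)" "g \<in> borel_measurable borel"
  shows "integrable (epd lam) (g :: real \<Rightarrow> real)"
  by (rule finite_measure.square_integrable_imp_integrable[OF prob_space.finite_measure[OF prob_space_epd[OF lam_pos]]])
    (use assms in simp_all)

lemma expectation_Y_mult:
  fixes g h :: "real \<Rightarrow> real"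
  assumes [measurable]: "g \<in> borel_measurable borel" "h \<in> borel_measurable borel"
    and i: "integrable (epd lam) g" "integrable (epd lam) h" and ij: "i \<noteq> j"
  shows "expectation (\<lambda>\<omega>. g (Y i \<omega>) * h (Y j \<omega>)) = (\<integral>y. g y \<partial>epd lam) * (\<integral>y. h y \<partial>epd lam)"
    and "integrable M (\<lambda>\<omega>. g (Y i \<omega>) * h (Y j \<omega>))"
proof -
  define f where "f k = (if k = i then g else h)" for k
  have fm[measurable]: "f k \<in> borel_measurable borel" for k by (simp add: f_def)
  have "indep_vars (\<lambda>_. borel) (\<lambda>k \<omega>. f k (Y k \<omega>)) UNIV"
    by (rule indep_vars_compose2[OF indep]) measurable
  then have ind: "indep_vars (\<lambda>_. borel) (\<lambda>k \<omega>. f k (Y k \<omega>)) {i, j}"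
    by (rule indep_vars_subset) auto
  have int: "integrable M (\<lambda>\<omega>. f k (Y k \<omega>))" for k
    using i by (intro integrable_Y) (auto simp: f_def)
  have "expectation (\<lambda>\<omega>. \<Prod>k\<in>{i, j}. f k (Y k \<omega>)) = (\<Prod>k\<in>{i, j}. expectation (\<lambda>\<omega>. f k (Y k \<omega>)))"
    by (rule indep_vars_lebesgue_integral[OF _ ind int]) auto
  then show "expectation (\<lambda>\<omega>. g (Y i \<omega>) * h (Y j \<omega>)) = (\<integral>y. g y \<partial>epd lam) * (\<integral>y. h y \<partial>epd lam)"
    using ij by (simp add: f_def expectation_Y)
  have "integrable M (\<lambda>\<omega>. \<Prod>k\<in>{i, j}. f k (Y k \<omega>))"
    by (rule indep_vars_integrable[OF _ ind int]) auto
  then show "integrable M (\<lambda>\<omega>. g (Y i \<omega>) * h (Y j \<omega>))"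
    using ij by (simp add: f_def)
qed

definition sample_mean :: "(real \<Rightarrow> real) \<Rightarrow> nat \<Rightarrow> 'a \<Rightarrow> real" where
  "sample_mean g n \<omega> = (\<Sum>i<n. g (Y i \<omega>)) / real n"

lemma sample_mean_measurable [measurable]:
  assumes [measurable]: "g \<in> borel_measurable borel"
  shows "sample_mean g n \<in> borel_measurable M"
  unfolding sample_mean_def[abs_def] by measurable

lemma sample_mean_add: "sample_mean (\<lambda>y. g y + h y) n \<omega> = sample_mean g n \<omega> + sample_mean h n \<omega>"
  by (simp add: sample_mean_def sum.distrib add_divide_distrib)

lemma sample_mean_diff: "sample_mean (\<lambda>y. g y - h y) n \<omega> = sample_mean g n \<omega> - sample_mean h n \<omega>"
  by (simp add: sample_mean_def sum_subtractf diff_divide_distrib)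

lemma sample_mean_cmult: "sample_mean (\<lambda>y. c * g y) n \<omega> = c * sample_mean g n \<omega>"
  by (simp add: sample_mean_def sum_distrib_left)

lemma sample_mean_const: "0 < n \<Longrightarrow> sample_mean (\<lambda>y. c) n \<omega> = c"
  by (simp add: sample_mean_def)

lemma expectation_sum_square:
  assumes [measurable]: "h \<in> borel_measurable borel" and i: "integrable (epd lam) (\<lambda>y. (h y)\<^sup>2)"
    and z: "(\<integral>y. h y \<partial>epd lam) = 0"
  shows "integrable M (\<lambda>\<omega>. (\<Sum>i<n. h (Y i \<omega>))\<^sup>2) \<and>
    expectation (\<lambda>\<omega>. (\<Sum>i<n. h (Y i \<omega>))\<^sup>2) = real n * (\<integral>y. (h y)\<^sup>2 \<partial>epd lam)"
proof (induction n)
  case (Suc n)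
  have hi: "integrable (epd lam) h" by (rule epd_integrable_square_imp[OF i]) measurable
  have i1: "integrable M (\<lambda>\<omega>. h (Y i \<omega>) * h (Y n \<omega>))" "expectation (\<lambda>\<omega>. h (Y i \<omega>) * h (Y n \<omega>)) = 0" if "i < n" for i
    using expectation_Y_mult[of h h i n] hi that z by auto
  have i2: "integrable M (\<lambda>\<omega>. (h (Y n \<omega>))\<^sup>2)" by (rule integrable_Y[OF _ i]) measurable
  have e2: "expectation (\<lambda>\<omega>. (h (Y n \<omega>))\<^sup>2) = (\<integral>y. (h y)\<^sup>2 \<partial>epd lam)" by (rule expectation_Y) measurable
  have i3: "integrable M (\<lambda>\<omega>. \<Sum>i<n. h (Y i \<omega>) * h (Y n \<omega>))"
    "expectation (\<lambda>\<omega>. \<Sum>i<n. h (Y i \<omega>) * h (Y n \<omega>)) = 0"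
    using i1 by (auto simp: Bochner_Integration.integral_sum)
  have eq: "(\<Sum>i<Suc n. h (Y i \<omega>))\<^sup>2 = (\<Sum>i<n. h (Y i \<omega>))\<^sup>2 + 2 * (\<Sum>i<n. h (Y i \<omega>) * h (Y n \<omega>)) + (h (Y n \<omega>))\<^sup>2" for \<omega>
    by (simp add: power2_sum sum_distrib_right mult.assoc)
  show ?case
    unfolding eq using Suc i2 e2 i3 by (simp add: algebra_simps)
qed simp

text \<open>The bound is uniform in \<open>n\<close> and holds for each \<open>n\<close> separately.
  It may thus be applied to a function \<open>h\<close> that itself varies with \<open>n\<close>,
  which is how the increments of the score are controlled.\<close>

lemma second_moment_sample_mean:
  assumes [measurable]: "h \<in> borel_measurable borel" and i: "integrable (epd lam) (\<lambda>y. (h y)\<^sup>2)"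
  shows "integrable M (\<lambda>\<omega>. (sqrt n * (sample_mean h n \<omega> - (\<integral>y. h y \<partial>epd lam)))\<^sup>2)"
    and "expectation (\<lambda>\<omega>. (sqrt n * (sample_mean h n \<omega> - (\<integral>y. h y \<partial>epd lam)))\<^sup>2) \<le> (\<integral>y. (h y)\<^sup>2 \<partial>epd lam)"
proof -
  interpret E: prob_space "epd lam" by (rule prob_space_epd[OF lam_pos])
  have hi: "integrable (epd lam) h" by (rule epd_integrable_square_imp[OF i]) measurable
  define m where "m = (\<integral>y. h y \<partial>epd lam)"
  define k where "k y = h y - m" for y
  have [measurable]: "k \<in> borel_measurable borel" unfolding k_def by measurable
  have k2: "(k y)\<^sup>2 = (h y)\<^sup>2 - 2 * m * h y + m\<^sup>2" for y by (simp add: k_def power2_diff)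
  have ki: "integrable (epd lam) (\<lambda>y. (k y)\<^sup>2)" unfolding k2 using i hi by simp
  have kz: "(\<integral>y. k y \<partial>epd lam) = 0" unfolding k_def using hi E.prob_space by (simp add: m_def)
  have kv: "(\<integral>y. (k y)\<^sup>2 \<partial>epd lam) = (\<integral>y. (h y)\<^sup>2 \<partial>epd lam) - m\<^sup>2"
    unfolding k2 using i hi E.prob_space by (simp add: m_def power2_eq_square)
  have n0: "(sqrt n * (sample_mean h n \<omega> - m))\<^sup>2 = (\<Sum>i<n. k (Y i \<omega>))\<^sup>2 / real n" for \<omega>
  proof (cases "n = 0")
    case False
    then have "sample_mean h n \<omega> - m = (\<Sum>i<n. k (Y i \<omega>)) / real n"
      by (simp add: sample_mean_def k_def sum_subtractf diff_divide_distrib)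
    then show ?thesis using False by (simp add: power_mult_distrib power_divide) (simp add: power2_eq_square)
  qed simp
  note es = expectation_sum_square[of k n, OF _ ki kz]
  show "integrable M (\<lambda>\<omega>. (sqrt n * (sample_mean h n \<omega> - (\<integral>y. h y \<partial>epd lam)))\<^sup>2)"
    unfolding m_def[symmetric] n0 using es by simp
  have "expectation (\<lambda>\<omega>. (sqrt n * (sample_mean h n \<omega> - m))\<^sup>2) \<le> (\<integral>y. (k y)\<^sup>2 \<partial>epd lam)"
    unfolding n0 using es by (cases "n = 0") auto
  also have "\<dots> \<le> (\<integral>y. (h y)\<^sup>2 \<partial>epd lam)" unfolding kv by simp
  finally show "expectation (\<lambda>\<omega>. (sqrt n * (sample_mean h n \<omega> - (\<integral>y. h y \<partial>epd lam)))\<^sup>2) \<le> (\<integral>y. (h y)\<^sup>2 \<partial>epd lam)"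
    unfolding m_def .
qed

lemma bounded_in_prob_sample_mean:
  assumes [measurable]: "h \<in> borel_measurable borel" and i: "integrable (epd lam) (\<lambda>y. (h y)\<^sup>2)"
  shows "bounded_in_probability M (\<lambda>n \<omega>. sqrt n * (sample_mean h n \<omega> - (\<integral>y. h y \<partial>epd lam)))"
  by (rule bounded_in_prob_second_moment[OF _ second_moment_sample_mean[OF assms]]) measurable

lemma conv_prob_sample_mean:
  assumes [measurable]: "h \<in> borel_measurable borel" and i: "integrable (epd lam) (\<lambda>y. (h y)\<^sup>2)"
  shows "converges_in_probability M (sample_mean h) (\<integral>y. h y \<partial>epd lam)"
proof -
  have s: "(\<lambda>n. 1 / sqrt (real n)) \<longlonglongrightarrow> 0"
    by (intro tendsto_divide_0[OF tendsto_const] filterlim_at_top_imp_at_infinity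
        filterlim_compose[OF sqrt_at_top filterlim_real_sequentially])
  have "converges_in_probability M (\<lambda>n \<omega>. 1 / sqrt (real n) * (sqrt n * (sample_mean h n \<omega> - (\<integral>y. h y \<partial>epd lam)))) 0"
    by (rule conv_prob_mult_bounded[OF conv_prob_const[OF s] bounded_in_prob_sample_mean[OF assms]])
  then show ?thesis
    by (rule conv_prob_mono) (measurable, rule eventually_sequentiallyI[of 1], simp)
qed

end

section \<open>Translating the exponential power density\<close>

lemma abs_exp_minus_diff_le: "\<bar>exp (- u) - exp (- v)\<bar> \<le> \<bar>u - v\<bar> * max (exp (- u)) (exp (- v))" for u v :: real
proof -
  have *: "exp (- a) - exp (- b) \<le> (b - a) * exp (- a)" for a b :: real
  proof -
    have "1 + (a - b) \<le> exp (a - b)" by (rule exp_ge_add_one_self)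
    then have "(1 - exp (a - b)) * exp (- a) \<le> (b - a) * exp (- a)" by (intro mult_right_mono) (linarith, simp)
    then show ?thesis by (simp add: left_diff_distrib flip: exp_add)
  qed
  show ?thesis
  proof (cases "u \<le> v")
    case True
    then have "exp (- v) \<le> exp (- u)" by simp
    then show ?thesis using *[of u v] True by (simp add: max_def)
  next
    case False
    then have "exp (- u) \<le> exp (- v)" by simp
    then show ?thesis using *[of v u] False by (auto simp: max_def)
  qed
qed

text \<open>Replacing \<open>\<bar>x\<bar> powr lam\<close> by \<open>\<bar>x\<bar> - 1\<close>
  costs 1 in the exponent and the shift from \<open>x\<close> to \<open>y\<close> another 1, whence
  the factor \<open>exp (2 / lam)\<close>. The right-hand side is the same for all shifts of size at
  most 1.\<close>

lemma exp_neg_powr_le: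
  assumes lam: "1 \<le> lam" and x: "\<bar>x - y\<bar> \<le> (1::real)"
  shows "exp (- (\<bar>x\<bar> powr lam / lam)) \<le> exp (2 / lam) * exp (- ((1 / lam) * \<bar>y\<bar>))"
proof -
  have "\<bar>x\<bar> - 1 \<le> \<bar>x\<bar> powr lam"
  proof (cases "1 \<le> \<bar>x\<bar>")
    case True
    then have "\<bar>x\<bar> powr 1 \<le> \<bar>x\<bar> powr lam" using lam by (intro powr_mono) auto
    then show ?thesis using True by simp
  next
    case False then show ?thesis using powr_ge_zero[of "\<bar>x\<bar>" lam] by linarith
  qed
  moreover have "\<bar>y\<bar> - 1 \<le> \<bar>x\<bar>" using x by linarith
  ultimately have "(\<bar>y\<bar> - 2) / lam \<le> \<bar>x\<bar> powr lam / lam" using lam by (intro divide_right_mono) linarith+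
  then have "exp (- (\<bar>x\<bar> powr lam / lam)) \<le> exp (2 / lam + - ((1 / lam) * \<bar>y\<bar>))"
    by (simp add: diff_divide_distrib)
  then show ?thesis by (simp only: exp_add)
qed

context
  fixes lam :: real
  assumes lam: "1 \<le> lam"
begin

definition epd_const :: real where
  "epd_const = 1 / (2 * lam powr (1 / lam) * Gamma (1 + 1 / lam))"

lemma EPD_density_const: "EPD_density lam 0 1 y = epd_const * exp (- (\<bar>y\<bar> powr lam / lam))"
  unfolding EPD_density_std epd_const_def by simp

lemma epd_const_pos: "0 < epd_const"
  using EPD_density_pos[of lam 1 0 0] EPD_density_const[of 0] lam by simp

text \<open>The estimate works with differences of powers instead of a derivative, so the kink of
  the density at 0 for \<open>lam = 1\<close> does no harm.\<close>

lemma EPD_density_diff_le: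
  assumes t: "\<bar>t\<bar> \<le> 1"
  shows "\<bar>EPD_density lam 0 1 (y + t) - EPD_density lam 0 1 y\<bar>
    \<le> \<bar>t\<bar> * (epd_const * exp (2 / lam) * ((\<bar>y\<bar> + 1) powr (lam - 1) * exp (- ((1 / lam) * \<bar>y\<bar>))))"
proof -
  let ?e = "\<lambda>x. exp (- (\<bar>x\<bar> powr lam / lam))"
  have m: "max (?e (y + t)) (?e y) \<le> exp (2 / lam) * exp (- ((1 / lam) * \<bar>y\<bar>))"
    using exp_neg_powr_le[OF lam, of "y + t" y] exp_neg_powr_le[OF lam, of y y] t by simp
  have "\<bar>\<bar>y + t\<bar> powr lam - \<bar>y\<bar> powr lam\<bar> \<le> lam * max \<bar>y\<bar> \<bar>y + t\<bar> powr (lam - 1) * \<bar>t\<bar>"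
    using abs_powr_diff_le[OF lam, of "y + t" y] by simp
  also have "\<dots> \<le> lam * (\<bar>y\<bar> + 1) powr (lam - 1) * \<bar>t\<bar>"
    using lam t by (intro mult_right_mono mult_left_mono powr_mono2) auto
  finally have "\<bar>\<bar>y + t\<bar> powr lam / lam - \<bar>y\<bar> powr lam / lam\<bar> \<le> (\<bar>y\<bar> + 1) powr (lam - 1) * \<bar>t\<bar>"
    using lam by (simp add: diff_divide_distrib[symmetric] field_simps)
  then have "\<bar>?e (y + t) - ?e y\<bar> \<le> ((\<bar>y\<bar> + 1) powr (lam - 1) * \<bar>t\<bar>) * (exp (2 / lam) * exp (- ((1 / lam) * \<bar>y\<bar>)))"
    using m by (intro order_trans[OF abs_exp_minus_diff_le] mult_mono) (auto simp: le_max_iff_disj)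
  then have "epd_const * \<bar>?e (y + t) - ?e y\<bar>
      \<le> epd_const * (((\<bar>y\<bar> + 1) powr (lam - 1) * \<bar>t\<bar>) * (exp (2 / lam) * exp (- ((1 / lam) * \<bar>y\<bar>))))"
    using epd_const_pos by (intro mult_left_mono) auto
  moreover have "\<bar>EPD_density lam 0 1 (y + t) - EPD_density lam 0 1 y\<bar> = epd_const * \<bar>?e (y + t) - ?e y\<bar>"
    using epd_const_pos by (simp add: EPD_density_const abs_mult flip: right_diff_distrib)
  ultimately show ?thesis by (simp only: mult_ac)
qed

lemma DERIV_EPD_density:
  assumes "y \<noteq> 0"
  shows "(EPD_density lam 0 1 has_real_derivative - spow (lam - 1) y * EPD_density lam 0 1 y) (at y)"
proof -
  have "((\<lambda>y. epd_const * exp (- (\<bar>y\<bar> powr lam / lam))) has_real_derivative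
      epd_const * (exp (- (\<bar>y\<bar> powr lam / lam)) * (- (lam * spow (lam - 1) y / lam)))) (at y)"
    by (intro DERIV_cmult DERIV_fun_exp DERIV_minus DERIV_cdivide DERIV_abs_powr[OF assms])
  then show ?thesis
    unfolding EPD_density_const[abs_def] using lam by (auto elim: DERIV_cong)
qed

lemma integrable_powr_add_one_exp:
  assumes p: "0 \<le> p"
  shows "integrable lborel (\<lambda>y. (\<bar>y\<bar> + 1) powr p * exp (- ((1 / lam) * \<bar>y\<bar>)))"
proof (rule Bochner_Integration.integrable_bound)
  have i: "integrable lborel (\<lambda>y. \<bar>y\<bar> powr q * exp (- ((1 / lam) * \<bar>y\<bar> powr 1)))" if "-1 < q" for q
    using has_bochner_integral_abs_powr_exp[of "1 / lam" 1 q] lam that by (auto simp: has_bochner_integral_iff)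
  show "integrable lborel (\<lambda>y. 2 powr p * (\<bar>y\<bar> powr p * exp (- ((1 / lam) * \<bar>y\<bar> powr 1)) + \<bar>y\<bar> powr 0 * exp (- ((1 / lam) * \<bar>y\<bar> powr 1))))"
    using i[of p] i[of 0] p by (intro Bochner_Integration.integrable_mult_right Bochner_Integration.integrable_add) auto
  show "AE y in lborel. norm ((\<bar>y\<bar> + 1) powr p * exp (- ((1 / lam) * \<bar>y\<bar>)))
      \<le> norm (2 powr p * (\<bar>y\<bar> powr p * exp (- ((1 / lam) * \<bar>y\<bar> powr 1)) + \<bar>y\<bar> powr 0 * exp (- ((1 / lam) * \<bar>y\<bar> powr 1))))"
    using AE_lborel_singleton[of 0]
  proof eventually_elim
    case (elim y)
    have "(\<bar>y\<bar> + 1) powr p * exp (- ((1 / lam) * \<bar>y\<bar>)) \<le> (2 powr p * (\<bar>y\<bar> powr p + 1)) * exp (- ((1 / lam) * \<bar>y\<bar>))"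
      using powr_add_one_le[of "\<bar>y\<bar>" p] p by (intro mult_right_mono) auto
    also have "\<dots> = 2 powr p * (\<bar>y\<bar> powr p * exp (- ((1 / lam) * \<bar>y\<bar> powr 1)) + \<bar>y\<bar> powr 0 * exp (- ((1 / lam) * \<bar>y\<bar> powr 1)))"
      using elim by (simp add: algebra_simps)
    finally show ?case by (simp add: abs_mult)
  qed
qed measurable

text \<open>Substituting \<open>y + t\<close> for \<open>y\<close> moves the shift to the density
  \<open>f\<close>, and \<open>f' = - spow (lam - 1) * f\<close> off 0. The slope is therefore minus
  the second moment of the score, that is, minus the Fisher information for location.\<close>

lemma score_shift_mean:
  "((\<lambda>t. (\<integral>y. spow (lam - 1) (y - t) \<partial>epd lam) / t) \<longlongrightarrow> - epd_moment lam (2 * lam - 2)) (at 0)"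
proof -
  let ?f = "EPD_density lam 0 1" and ?g = "spow (lam - 1)"
  have lam_gt_0: "0 < lam" using lam by simp
  have fpos: "0 \<le> ?f y" for y using EPD_density_pos[OF lam_gt_0, of 1 0 y] by simp
  define G where "G y = epd_const * exp (2 / lam) * ((\<bar>y\<bar> + 1) powr (2 * lam - 2) * exp (- ((1 / lam) * \<bar>y\<bar>)))" for y
  have Gi: "integrable lborel G"
    unfolding G_def using lam by (intro Bochner_Integration.integrable_mult_right integrable_powr_add_one_exp) auto
  have bound: "\<bar>?g y * ((?f (y + t) - ?f y) / t)\<bar> \<le> G y" if t: "t \<noteq> 0" "\<bar>t\<bar> \<le> 1" for y t
  proof -
    have "\<bar>?g y * ((?f (y + t) - ?f y) / t)\<bar> = \<bar>y\<bar> powr (lam - 1) * (\<bar>?f (y + t) - ?f y\<bar> / \<bar>t\<bar>)"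
      by (simp add: abs_mult)
    also have "\<dots> \<le> (\<bar>y\<bar> + 1) powr (lam - 1) *
        (epd_const * exp (2 / lam) * ((\<bar>y\<bar> + 1) powr (lam - 1) * exp (- ((1 / lam) * \<bar>y\<bar>))))"
      using EPD_density_diff_le[OF t(2), of y] t lam epd_const_pos
      by (intro mult_mono powr_mono2) (auto simp: field_simps)
    also have "\<dots> = G y"
    proof -
      have "(\<bar>y\<bar> + 1) powr (lam - 1) * (\<bar>y\<bar> + 1) powr (lam - 1) = (\<bar>y\<bar> + 1) powr (2 * lam - 2)"
        by (simp add: powr_add[symmetric])
      then show ?thesis unfolding G_def by (simp add: mult_ac)
    qed
    finally show ?thesis .
  qed
  have gf: "integrable lborel (\<lambda>y. ?f y * ?g y)"
  proof -
    have "integrable (epd lam) ?g"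
      by (rule Bochner_Integration.integrable_bound[OF integrable_epd_powr[of lam "lam - 1"]]) (use lam in auto)
    then show ?thesis
      unfolding epd_def by (subst (asm) integrable_density) (auto simp: fpos intro!: AE_I2)
  qed
  have eq: "(\<integral>y. ?g (y - t) \<partial>epd lam) / t = (\<integral>y. ?g y * ((?f (y + t) - ?f y) / t) \<partial>lborel)" if t: "t \<noteq> 0" "\<bar>t\<bar> \<le> 1" for t
  proof -
    have i1: "integrable lborel (\<lambda>y. ?g y * ((?f (y + t) - ?f y) / t))"
      by (rule Bochner_Integration.integrable_bound[OF Gi])
        (use bound[OF t] in \<open>auto intro!: AE_I2 intro: order_trans[OF _ abs_ge_self]\<close>)
    \<comment> \<open>The score has mean 0, so subtracting this integral turns the shifted density
      into a difference quotient.\<close>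
    have z: "(\<integral>y. ?f y * ?g y \<partial>lborel) = 0"
    proof -
      have "(\<integral>y. ?g y \<partial>epd lam) = 0" by (rule integral_epd_odd) auto
      then show ?thesis unfolding epd_def by (subst (asm) integral_density) (auto simp: fpos intro!: AE_I2)
    qed
    have "(\<integral>y. ?g (y - t) \<partial>epd lam) = (\<integral>y. ?f y * ?g (y - t) \<partial>lborel)"
      unfolding epd_def by (subst integral_density) (auto simp: fpos intro!: AE_I2)
    also have "\<dots> = (\<integral>y. ?f (t + 1 * y) * ?g ((t + 1 * y) - t) \<partial>lborel)"
      by (subst lborel_integral_real_affine[of 1 _ t]) auto
    also have "\<dots> = (\<integral>y. t * (?g y * ((?f (y + t) - ?f y) / t)) + ?f y * ?g y \<partial>lborel)"
      using t by (intro Bochner_Integration.integral_cong) (auto simp: field_simps)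
    also have "\<dots> = (\<integral>y. t * (?g y * ((?f (y + t) - ?f y) / t)) \<partial>lborel) + (\<integral>y. ?f y * ?g y \<partial>lborel)"
      by (rule Bochner_Integration.integral_add[OF integrable_mult_right[OF i1] gf])
    also have "\<dots> = t * (\<integral>y. ?g y * ((?f (y + t) - ?f y) / t) \<partial>lborel)"
      unfolding z by (simp only: integral_mult_right_zero add_0_right)
    finally show ?thesis using t by simp
  qed
  have "((\<lambda>t. (\<integral>y. ?g (y - t) \<partial>epd lam) / t) \<longlongrightarrow> - epd_moment lam (2 * lam - 2)) (at 0 within {-1<..<1})"
    unfolding tendsto_at_iff_sequentially comp_def
  proof (intro allI impI)
    fix X :: "nat \<Rightarrow> real" assume X: "\<forall>i. X i \<in> {-1<..<1} - {0}" "X \<longlonglongrightarrow> 0"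
    have Xh: "X i \<noteq> 0" "\<bar>X i\<bar> \<le> 1" for i using X(1)[rule_format, of i] by auto
    have "(\<lambda>i. \<integral>y. ?g y * ((?f (y + X i) - ?f y) / X i) \<partial>lborel) \<longlonglongrightarrow> (\<integral>y. ?g y * (- ?g y * ?f y) \<partial>lborel)"
    proof (rule integral_dominated_convergence[where w = G])
      show "AE y in lborel. (\<lambda>i. ?g y * ((?f (y + X i) - ?f y) / X i)) \<longlonglongrightarrow> ?g y * (- ?g y * ?f y)"
        using AE_lborel_singleton[of 0]
      proof eventually_elim
        case (elim y)
        have "((\<lambda>h. (?f (y + h) - ?f y) / h) \<longlongrightarrow> - ?g y * ?f y) (at 0)"
          using DERIV_EPD_density[OF elim] by (simp add: DERIV_def)
        then have "(\<lambda>i. (?f (y + X i) - ?f y) / X i) \<longlonglongrightarrow> - ?g y * ?f y"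
          using X Xh unfolding tendsto_at_iff_sequentially comp_def by auto
        then show ?case by (rule tendsto_mult_left)
      qed
      show "AE y in lborel. norm (?g y * ((?f (y + X i) - ?f y) / X i)) \<le> G y" for i
        using bound[OF Xh] by (intro AE_I2) auto
    qed (use Gi in measurable)
    also have "(\<integral>y. ?g y * (- ?g y * ?f y) \<partial>lborel) = - (\<integral>y. ?f y * \<bar>y\<bar> powr (2 * lam - 2) \<partial>lborel)"
    proof -
      have "?g y * (- ?g y * ?f y) = - (?f y * \<bar>y\<bar> powr (2 * lam - 2))" for y
      proof -
        have "?g y * ?g y = \<bar>?g y\<bar> * \<bar>?g y\<bar>" by (simp only: abs_mult_self_eq)
        also have "\<dots> = \<bar>y\<bar> powr (2 * lam - 2)" by (simp add: powr_add[symmetric])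
        finally show ?thesis by (simp add: mult_ac)
      qed
      then show ?thesis by (simp only: Bochner_Integration.integral_minus)
    qed
    also have "(\<integral>y. ?f y * \<bar>y\<bar> powr (2 * lam - 2) \<partial>lborel) = (\<integral>y. \<bar>y\<bar> powr (2 * lam - 2) \<partial>epd lam)"
      unfolding epd_def by (subst integral_density) (auto simp: fpos intro!: AE_I2)
    also have "\<dots> = epd_moment lam (2 * lam - 2)"
      using lam by (intro integral_epd_powr) auto
    finally show "(\<lambda>i. (\<integral>y. ?g (y - X i) \<partial>epd lam) / X i) \<longlonglongrightarrow> - epd_moment lam (2 * lam - 2)"
      by (simp add: eq[OF Xh])
  qed
  moreover have "at 0 within {-1<..<1} = at (0::real)" by (intro at_within_open) auto
  ultimately show ?thesis by (simp only:)
qed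

lemma abs_spow_shift_le:
  assumes "0 \<le> p" "\<bar>t\<bar> \<le> 1" shows "\<bar>spow p (y - t)\<bar> \<le> (\<bar>y\<bar> + 1) powr p"
  using assms by (auto intro!: powr_mono2)

text \<open>Dominated convergence. The score is continuous off 0, also for \<open>lam = 1\<close>
  where it is the sign, and 0 is a null point of the law.\<close>

lemma score_shift_variance:
  assumes X: "X \<longlonglongrightarrow> 0" "\<And>n. \<bar>X n\<bar> \<le> 1"
  shows "(\<lambda>n. \<integral>y. (spow (lam - 1) (y - X n) - spow (lam - 1) y)\<^sup>2 \<partial>epd lam) \<longlonglongrightarrow> 0"
    and "integrable (epd lam) (\<lambda>y. (spow (lam - 1) (y - X n) - spow (lam - 1) y)\<^sup>2)"
proof -
  let ?g = "spow (lam - 1)"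
  have lam_gt_0: "0 < lam" using lam by simp
  define w where "w y = 4 * (\<bar>y\<bar> + 1) powr (2 * (lam - 1))" for y :: real
  have wi: "integrable (epd lam) w"
    unfolding w_def using lam by (intro Bochner_Integration.integrable_mult_right integrable_epd_powr_add_one) auto
  have bound: "(?g (y - X n) - ?g y)\<^sup>2 \<le> w y" for n y
  proof -
    have "\<bar>?g (y - X n) - ?g y\<bar> \<le> (\<bar>y\<bar> + 1) powr (lam - 1) + (\<bar>y\<bar> + 1) powr (lam - 1)"
      using abs_spow_shift_le[of "lam - 1" "X n" y] abs_spow_shift_le[of "lam - 1" 0 y] X(2)[of n] lam
      by (intro order_trans[OF abs_triangle_ineq4] add_mono) auto
    then have "\<bar>?g (y - X n) - ?g y\<bar> \<le> 2 * (\<bar>y\<bar> + 1) powr (lam - 1)" by simp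
    then have "(?g (y - X n) - ?g y)\<^sup>2 \<le> (2 * (\<bar>y\<bar> + 1) powr (lam - 1))\<^sup>2" by (rule abs_le_square_iff[THEN iffD1, OF order_trans]) simp
    also have "\<dots> = w y" by (simp add: w_def power_mult_distrib powr_power power2_eq_square powr_add[symmetric])
    finally show ?thesis .
  qed
  show "integrable (epd lam) (\<lambda>y. (?g (y - X n) - ?g y)\<^sup>2)"
    by (rule Bochner_Integration.integrable_bound[OF wi])
      (use bound in \<open>auto intro!: AE_I2 intro: order_trans[OF _ abs_ge_self]\<close>)
  have "(\<lambda>n. \<integral>y. (?g (y - X n) - ?g y)\<^sup>2 \<partial>epd lam) \<longlonglongrightarrow> (\<integral>y. 0 \<partial>epd lam)"
  proof (rule integral_dominated_convergence[where w = w])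
    show "AE y in epd lam. (\<lambda>n. (?g (y - X n) - ?g y)\<^sup>2) \<longlonglongrightarrow> 0"
      using AE_epd_neq[of 0 lam]
    proof eventually_elim
      case (elim y)
      have "(\<lambda>n. y - X n) \<longlonglongrightarrow> y - 0" by (intro tendsto_intros X)
      then have "(\<lambda>n. ?g (y - X n)) \<longlonglongrightarrow> ?g y"
        using isCont_tendsto_compose[OF DERIV_isCont[OF DERIV_spow[OF elim]]] by simp
      then have "(\<lambda>n. (?g (y - X n) - ?g y)\<^sup>2) \<longlonglongrightarrow> (?g y - ?g y)\<^sup>2" by (intro tendsto_intros)
      then show ?case by simp
    qed
    show "AE y in epd lam. norm ((?g (y - X n) - ?g y)\<^sup>2) \<le> w y" for n using bound by (intro AE_I2) simp
  qed (use wi in measurable)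
  then show "(\<lambda>n. \<integral>y. (?g (y - X n) - ?g y)\<^sup>2 \<partial>epd lam) \<longlonglongrightarrow> 0" by simp
qed

end

section \<open>Expansions of sample means at a random shift\<close>

text \<open>The worst relative error of the first-order expansion at \<open>y\<close> over nonzero
  shifts below \<open>1 / Suc k\<close>. Rational shifts make it a countable supremum, hence
  measurable; the value at 0 is a filler, because the functions in question need not be
  differentiable there.\<close>

definition shift_remainder :: "(real \<Rightarrow> real) \<Rightarrow> (real \<Rightarrow> real) \<Rightarrow> nat \<Rightarrow> real \<Rightarrow> real" where
  "shift_remainder g g' k y =
     (if y = 0 then 0 else (SUP q \<in> {q \<in> \<rat>. 0 < \<bar>q\<bar> \<and> \<bar>q\<bar> < 1 / real (Suc k)}. \<bar>g (y - q) - g y + q * g' y\<bar> / \<bar>q\<bar>))"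

text \<open>Differentiability is asked off 0 only, but the Lipschitz bound must survive shifts
  across 0. Square integrability of \<open>B\<close> provides both the majorant for the remainder
  and the law of large numbers for \<open>g'\<close>.\<close>

locale shift_expansion =
  fixes g g' B :: "real \<Rightarrow> real" and lam :: real
  assumes lam_pos: "0 < lam"
    and g_cont: "continuous_on UNIV g"
    and g'_meas [measurable]: "g' \<in> borel_measurable borel"
    and B_meas [measurable]: "B \<in> borel_measurable borel"
    and B_int: "integrable (epd lam) (\<lambda>y. (B y)\<^sup>2)"
    and g_deriv: "\<And>y. y \<noteq> 0 \<Longrightarrow> (g has_real_derivative g' y) (at y)"
    and g_lip: "\<And>y t. y \<noteq> 0 \<Longrightarrow> \<bar>t\<bar> \<le> 1 \<Longrightarrow> \<bar>g (y - t) - g y\<bar> \<le> \<bar>t\<bar> * B y"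
begin

abbreviation "dirs k \<equiv> {q::real. q \<in> \<rat> \<and> 0 < \<bar>q\<bar> \<and> \<bar>q\<bar> < 1 / real (Suc k)}"

lemma g_meas [measurable]: "g \<in> borel_measurable borel"
  using g_cont by (rule borel_measurable_continuous_onI)

lemma dirs_nonempty: "dirs k \<noteq> {}"
proof -
  have "0 < 1 / real (Suc k)" by simp
  from Rats_dense_in_real[OF this] obtain q where "q \<in> \<rat>" "0 < q" "q < 1 / real (Suc k)" by auto
  then show ?thesis by fastforce
qed

lemma dirs_bounds: "q \<in> dirs k \<Longrightarrow> 0 < \<bar>q\<bar> \<and> \<bar>q\<bar> \<le> 1"
proof -
  assume q: "q \<in> dirs k"
  have "1 / real (Suc k) \<le> 1" by simp
  moreover have "\<bar>q\<bar> < 1 / real (Suc k)" "0 < \<bar>q\<bar>" using q by blast+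
  ultimately show ?thesis by linarith
qed

lemma shift_remainder_eq:
  "y \<noteq> 0 \<Longrightarrow> shift_remainder g g' k y = (SUP q \<in> dirs k. \<bar>g (y - q) - g y + q * g' y\<bar> / \<bar>q\<bar>)"
  by (simp add: shift_remainder_def)

lemma g'_le_B:
  assumes "y \<noteq> 0" shows "\<bar>g' y\<bar> \<le> B y"
proof -
  have "((\<lambda>h. (g (y + h) - g y) / h) \<longlongrightarrow> g' y) (at 0)" using g_deriv[OF assms] by (simp add: DERIV_def)
  then have "((\<lambda>h. \<bar>(g (y + h) - g y) / h\<bar>) \<longlongrightarrow> \<bar>g' y\<bar>) (at 0)" by (rule tendsto_rabs)
  moreover have "\<forall>\<^sub>F h in at 0. \<bar>(g (y + h) - g y) / h\<bar> \<le> B y"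
    unfolding eventually_at
  proof (intro exI[of _ 1] conjI ballI impI)
    fix h :: real assume "h \<noteq> 0 \<and> dist h 0 < 1"
    then show "\<bar>(g (y + h) - g y) / h\<bar> \<le> B y"
      using g_lip[OF assms, of "- h"] by (simp add: divide_le_eq mult.commute)
  qed simp
  ultimately show ?thesis by (rule tendsto_upperbound) simp
qed

lemma quotient_le:
  assumes "y \<noteq> 0" "0 < \<bar>t\<bar>" "\<bar>t\<bar> \<le> 1"
  shows "\<bar>g (y - t) - g y + t * g' y\<bar> / \<bar>t\<bar> \<le> 2 * B y"
proof -
  have "\<bar>t * g' y\<bar> \<le> \<bar>t\<bar> * B y" unfolding abs_mult using g'_le_B[OF assms(1)] by (intro mult_left_mono) auto
  then have "\<bar>g (y - t) - g y + t * g' y\<bar> \<le> \<bar>t\<bar> * B y + \<bar>t\<bar> * B y"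
    using g_lip[OF assms(1,3)] by (intro order_trans[OF abs_triangle_ineq] add_mono)
  then show ?thesis using assms(2) by (simp add: divide_le_eq mult_ac)
qed

lemma bdd_quotient: "y \<noteq> 0 \<Longrightarrow> bdd_above ((\<lambda>q. \<bar>g (y - q) - g y + q * g' y\<bar> / \<bar>q\<bar>) ` dirs k)"
proof (rule bdd_aboveI2)
  fix q assume "y \<noteq> 0" "q \<in> dirs k"
  then show "\<bar>g (y - q) - g y + q * g' y\<bar> / \<bar>q\<bar> \<le> 2 * B y"
    using dirs_bounds[of q k] quotient_le[of y q] by blast
qed

lemma shift_remainder_measurable [measurable]: "shift_remainder g g' k \<in> borel_measurable borel"
proof -
  have "(\<lambda>y. if y = 0 then 0 else \<bar>g (y - q) - g y + q * g' y\<bar> / \<bar>q\<bar>) \<in> borel_measurable borel" for q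
    by measurable
  then have "(\<lambda>y. SUP q \<in> dirs k. if y = 0 then 0 else \<bar>g (y - q) - g y + q * g' y\<bar> / \<bar>q\<bar>) \<in> borel_measurable borel"
  proof (intro borel_measurable_cSUP)
    show "countable (dirs k)" by (rule countable_subset[OF _ countable_rat]) auto
    show "bdd_above ((\<lambda>q. if y = 0 then 0 else \<bar>g (y - q) - g y + q * g' y\<bar> / \<bar>q\<bar>) ` dirs k)" for y
      using bdd_quotient[of y k] by (cases "y = 0") auto
  qed
  also have "(\<lambda>y. SUP q \<in> dirs k. if y = 0 then 0 else \<bar>g (y - q) - g y + q * g' y\<bar> / \<bar>q\<bar>) = shift_remainder g g' k"
    using dirs_nonempty by (auto simp: shift_remainder_def fun_eq_iff)
  finally show ?thesis .
qed

lemma shift_remainder_le: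
  assumes "y \<noteq> 0" shows "shift_remainder g g' k y \<le> 2 * B y"
  unfolding shift_remainder_eq[OF assms]
proof (rule cSUP_least[OF dirs_nonempty])
  fix q assume "q \<in> dirs k"
  then show "\<bar>g (y - q) - g y + q * g' y\<bar> / \<bar>q\<bar> \<le> 2 * B y"
    using dirs_bounds[of q k] quotient_le[of y q] assms by blast
qed

lemma shift_remainder_nonneg: "0 \<le> shift_remainder g g' k y"
proof (cases "y = 0")
  case False
  obtain q where q: "q \<in> dirs k" using dirs_nonempty by blast
  have "0 \<le> \<bar>g (y - q) - g y + q * g' y\<bar> / \<bar>q\<bar>" by simp
  also have "\<dots> \<le> shift_remainder g g' k y"
    unfolding shift_remainder_eq[OF False] by (rule cSUP_upper[OF q bdd_quotient[OF False]])
  finally show ?thesis .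
qed (simp add: shift_remainder_def)

text \<open>Passage from rational to all shifts: by continuity of \<open>g\<close> the shifts
  violating the inequality form an open set, which would contain a rational one.\<close>

lemma shift_remainder_bound:
  assumes y: "y \<noteq> 0" and t: "\<bar>t\<bar> < 1 / real (Suc k)"
  shows "\<bar>g (y - t) - g y + t * g' y\<bar> \<le> \<bar>t\<bar> * shift_remainder g g' k y"
proof (cases "t = 0")
  case False
  let ?R = "shift_remainder g g' k y"
  let ?F = "\<lambda>s. \<bar>s\<bar> * ?R - \<bar>g (y - s) - g y + s * g' y\<bar>"
  have c: "continuous_on UNIV ?F"
    by (intro continuous_intros continuous_on_compose2[OF g_cont]) auto
  show ?thesis
  proof (rule ccontr)
    assume "\<not> ?thesis"
    then have "?F t < 0" by simp
    let ?U = "{s. ?F s < 0} \<inter> {s. 0 < \<bar>s\<bar>} \<inter> {s. \<bar>s\<bar> < 1 / real (Suc k)}"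
    have "open ?U"
      by (intro open_Int open_Collect_less c continuous_intros)
    moreover have "t \<in> ?U" using \<open>?F t < 0\<close> False t by simp
    ultimately obtain e where e: "0 < e" "ball t e \<subseteq> ?U" by (rule openE)
    obtain q where q: "q \<in> \<rat>" "t < q" "q < t + e" using Rats_dense_in_real[of t "t + e"] e(1) by auto
    then have "q \<in> ball t e" by (simp add: dist_real_def)
    then have qU: "q \<in> ?U" using e by blast
    then have "q \<in> dirs k" using q by simp
    then have "\<bar>g (y - q) - g y + q * g' y\<bar> / \<bar>q\<bar> \<le> ?R"
      unfolding shift_remainder_eq[OF y] by (rule cSUP_upper[OF _ bdd_quotient[OF y]])
    then have "0 \<le> ?F q" using qU by (simp add: divide_le_eq mult.commute)
    then show False using qU by auto
  qed
qed simp

lemma shift_remainder_tendsto_0: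
  assumes y: "y \<noteq> 0" shows "(\<lambda>k. shift_remainder g g' k y) \<longlonglongrightarrow> 0"
proof (rule tendstoI)
  fix e :: real assume e: "0 < e"
  have "((\<lambda>h. (g (y + h) - g y) / h) \<longlongrightarrow> g' y) (at 0)" using g_deriv[OF y] by (simp add: DERIV_def)
  then obtain d where d: "0 < d" "\<And>h. h \<noteq> 0 \<Longrightarrow> \<bar>h\<bar> < d \<Longrightarrow> \<bar>(g (y + h) - g y) / h - g' y\<bar> < e / 2"
    using e unfolding LIM_eq by (metis diff_zero half_gt_zero real_norm_def)
  have "\<forall>\<^sub>F k in sequentially. 1 / real (Suc k) < d"
    using order_tendstoD(2)[OF LIMSEQ_Suc[OF lim_1_over_n] d(1)] by simp
  then show "\<forall>\<^sub>F k in sequentially. dist (shift_remainder g g' k y) 0 < e"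
  proof eventually_elim
    case (elim k)
    have "shift_remainder g g' k y \<le> e / 2"
      unfolding shift_remainder_eq[OF y]
    proof (rule cSUP_least[OF dirs_nonempty])
      fix q assume q: "q \<in> dirs k"
      then have q': "q \<noteq> 0" "\<bar>- q\<bar> < d" using elim by auto
      have "(g (y + - q) - g y) / (- q) - g' y = - ((g (y - q) - g y + q * g' y) / q)"
        using q' by (simp add: field_simps)
      then have "\<bar>g (y - q) - g y + q * g' y\<bar> / \<bar>q\<bar> = \<bar>(g (y + - q) - g y) / (- q) - g' y\<bar>"
        by (simp only: abs_minus_cancel abs_divide)
      then show "\<bar>g (y - q) - g y + q * g' y\<bar> / \<bar>q\<bar> \<le> e / 2"
        using d(2)[of "- q"] q' by simp
    qed
    then show ?case using shift_remainder_nonneg[of k y] e by simp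
  qed
qed

lemma B_integrable: "integrable (epd lam) B"
  by (rule finite_measure.square_integrable_imp_integrable[OF prob_space.finite_measure[OF prob_space_epd[OF lam_pos]]])
    (use B_int in simp_all)

lemma AE_shift_remainder_le: "AE y in epd lam. \<bar>shift_remainder g g' k y\<bar> \<le> 2 * B y"
  using AE_epd_neq[of 0 lam] by eventually_elim (use shift_remainder_le shift_remainder_nonneg in auto)

lemma shift_remainder_integrable: "integrable (epd lam) (shift_remainder g g' k)"
proof (rule Bochner_Integration.integrable_bound[OF integrable_mult_right[OF B_integrable, of 2]])
  show "AE y in epd lam. norm (shift_remainder g g' k y) \<le> norm (2 * B y)"
    using AE_shift_remainder_le[of k] by eventually_elim (simp add: order_trans[OF _ abs_ge_self])
qed measurable

lemma shift_remainder_integral_tendsto: "(\<lambda>k. \<integral>y. shift_remainder g g' k y \<partial>epd lam) \<longlonglongrightarrow> 0"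
proof -
  have "(\<lambda>k. \<integral>y. shift_remainder g g' k y \<partial>epd lam) \<longlonglongrightarrow> (\<integral>y. 0 \<partial>epd lam)"
  proof (rule integral_dominated_convergence[where w = "\<lambda>y. 2 * B y"])
    show "AE y in epd lam. (\<lambda>k. shift_remainder g g' k y) \<longlonglongrightarrow> 0"
      using AE_epd_neq[of 0 lam] by eventually_elim (rule shift_remainder_tendsto_0)
    show "integrable (epd lam) (\<lambda>y. 2 * B y)" using B_integrable by simp
    show "AE y in epd lam. norm (shift_remainder g g' k y) \<le> 2 * B y" for k
      using AE_shift_remainder_le[of k] by simp
  qed measurable
  then show ?thesis by simp
qed

lemma g'_square_integrable: "integrable (epd lam) (\<lambda>y. (g' y)\<^sup>2)"
proof (rule Bochner_Integration.integrable_bound[OF B_int])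
  show "AE y in epd lam. norm ((g' y)\<^sup>2) \<le> norm ((B y)\<^sup>2)"
    using AE_epd_neq[of 0 lam]
  proof eventually_elim
    case (elim y)
    have "\<bar>g' y\<bar> \<le> \<bar>B y\<bar>" using g'_le_B[OF elim] by linarith
    then show ?case by (simp add: abs_le_square_iff)
  qed
qed measurable

end

context iid_epd
begin

text \<open>First \<open>k\<close> is fixed with the mean of \<open>shift_remainder g g' k\<close>
  small, and only then \<open>n\<close> grows. As soon as
  \<open>\<bar>T n \<omega>\<bar> < 1 / Suc k\<close>, the error is at most
  \<open>\<bar>T n \<omega>\<bar>\<close> times a sample mean of fixed nonnegative functions, which
  Markov's inequality controls; the dependence of the shift on the sample is thereby
  irrelevant.\<close>

theorem sample_mean_shift_expansion:
  assumes "shift_expansion g g' B lam"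
    and T[measurable]: "\<And>n. T n \<in> borel_measurable M"
    and tight: "bounded_in_probability M (\<lambda>n \<omega>. sqrt n * T n \<omega>)"
  shows "converges_in_probability M (\<lambda>n \<omega>. sqrt n * ((\<Sum>i<n. g (Y i \<omega> - T n \<omega>)) / n - sample_mean g n \<omega>)
    + (\<integral>y. g' y \<partial>epd lam) * (sqrt n * T n \<omega>)) 0"
proof (rule conv_probI)
  interpret shift_expansion g g' B lam by fact
  show "(\<lambda>\<omega>. sqrt n * ((\<Sum>i<n. g (Y i \<omega> - T n \<omega>)) / n - sample_mean g n \<omega>)
    + (\<integral>y. g' y \<partial>epd lam) * (sqrt n * T n \<omega>)) \<in> borel_measurable M" for n by measurable
  fix \<epsilon> \<delta> :: real assume pos: "\<epsilon> > 0" "\<delta> > 0"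
  define d where "d = (\<integral>y. g' y \<partial>epd lam)"
  \<comment> \<open>The pointwise expansion needs nonzero observations, so the null event of a zero
    observation joins the exceptional event.\<close>
  obtain N where N: "N \<in> null_sets M" "{\<omega> \<in> space M. \<exists>i. Y i \<omega> = 0} \<subseteq> N"
    using AE_Y_neq_0 by (elim AE_E) (auto simp: null_sets_def)
  obtain C where C: "C > 0" "\<forall>\<^sub>F n in sequentially. prob {\<omega> \<in> space M. \<bar>sqrt n * T n \<omega>\<bar> > C} \<le> \<delta> / 4"
    using bounded_in_probD[OF tight, of "\<delta>/4"] pos by auto
  \<comment> \<open>Two error terms of size at most \<open>C * a\<close> each: the remainder, and
    the deviation of the mean of \<open>g'\<close> from its expectation.\<close>
  define a where "a = \<epsilon> / (2 * C)"
  have a: "0 < a" using pos C by (simp add: a_def)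
  have "0 < a * \<delta> / 4" using a pos by simp
  from order_tendstoD(2)[OF shift_remainder_integral_tendsto this]
  obtain k where k: "(\<integral>y. shift_remainder g g' k y \<partial>epd lam) < a * \<delta> / 4"
    by (auto simp: eventually_sequentially)
  let ?R = "shift_remainder g g' k"
  have Rm: "prob {\<omega> \<in> space M. sample_mean ?R n \<omega> > a} \<le> \<delta> / 4" if n: "0 < n" for n
  proof -
    have i: "integrable M (\<lambda>\<omega>. ?R (Y i \<omega>))" for i by (rule integrable_Y[OF _ shift_remainder_integrable]) measurable
    have "expectation (sample_mean ?R n) = (\<Sum>i<n. expectation (\<lambda>\<omega>. ?R (Y i \<omega>))) / n"
      unfolding sample_mean_def[abs_def] using i by simp
    also have "\<dots> = (\<integral>y. ?R y \<partial>epd lam)" using n by (simp add: expectation_Y)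
    finally have e: "expectation (sample_mean ?R n) < a * \<delta> / 4" using k by simp
    have "prob {\<omega> \<in> space M. sample_mean ?R n \<omega> > a} \<le> expectation (sample_mean ?R n) / a"
      using a i shift_remainder_nonneg
      by (intro prob_gt_le_first_moment) (auto simp: sample_mean_def[abs_def] intro!: sum_nonneg divide_nonneg_nonneg)
    also have "\<dots> \<le> (a * \<delta> / 4) / a" using e a by (intro divide_right_mono) auto
    finally show ?thesis using a by simp
  qed
  have g'c: "converges_in_probability M (sample_mean g') d"
    unfolding d_def by (rule conv_prob_sample_mean[OF g'_meas g'_square_integrable])
  define A where "A n = {\<omega> \<in> space M. \<bar>sqrt n * T n \<omega>\<bar> > C} \<union> {\<omega> \<in> space M. sample_mean ?R n \<omega> > a}
      \<union> {\<omega> \<in> space M. \<bar>sample_mean g' n \<omega> - d\<bar> > a} \<union> N" for n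
  have "(\<lambda>n. C / sqrt (real n)) \<longlonglongrightarrow> 0"
    by (intro tendsto_divide_0[OF tendsto_const] filterlim_at_top_imp_at_infinity
        filterlim_compose[OF sqrt_at_top filterlim_real_sequentially])
  from order_tendstoD(2)[OF this, of "1 / real (Suc k)"]
  have "\<forall>\<^sub>F n in sequentially. C / sqrt (real n) < 1 / real (Suc k)" by simp
  moreover have "\<delta> / 4 > 0" using pos by simp
  note conv_probD[OF g'c a this]
  moreover note C(2) eventually_gt_at_top[of "0::nat"]
  ultimately have "\<forall>\<^sub>F n in sequentially. A n \<in> events \<and> prob (A n) \<le> \<delta> \<and>
    (\<forall>\<omega>\<in>space M - A n. \<bar>sqrt n * ((\<Sum>i<n. g (Y i \<omega> - T n \<omega>)) / n - sample_mean g n \<omega>) + d * (sqrt n * T n \<omega>) - 0\<bar> \<le> \<epsilon>)"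
  proof eventually_elim
    case (elim n)
    have sn: "0 < sqrt n" using elim by simp
    have m: "{\<omega> \<in> space M. \<bar>sqrt n * T n \<omega>\<bar> > C} \<in> events" "{\<omega> \<in> space M. sample_mean ?R n \<omega> > a} \<in> events"
      "{\<omega> \<in> space M. \<bar>sample_mean g' n \<omega> - d\<bar> > a} \<in> events"
      by measurable
    have mN: "N \<in> events" using N(1) by (rule null_setsD2)
    note m = m mN
    have AM: "A n \<in> events" unfolding A_def using m by auto
    have "prob (A n) \<le> prob {\<omega> \<in> space M. \<bar>sqrt n * T n \<omega>\<bar> > C} + prob {\<omega> \<in> space M. sample_mean ?R n \<omega> > a}
       + prob {\<omega> \<in> space M. \<bar>sample_mean g' n \<omega> - d\<bar> > a} + prob N"
      unfolding A_def using m
      by (intro order_trans[OF measure_Un_le] add_mono order_refl) auto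
    moreover have "prob N = 0" using N by (simp add: measure_eq_0_null_sets)
    ultimately have PA: "prob (A n) \<le> \<delta>" using elim Rm[OF elim(4)] pos by linarith
    have "\<bar>sqrt n * ((\<Sum>i<n. g (Y i \<omega> - T n \<omega>)) / n - sample_mean g n \<omega>) + d * (sqrt n * T n \<omega>) - 0\<bar> \<le> \<epsilon>"
      if w: "\<omega> \<in> space M - A n" for \<omega>
    proof -
      let ?t = "T n \<omega>"
      have h1: "\<bar>sqrt n * ?t\<bar> \<le> C" and h2: "sample_mean ?R n \<omega> \<le> a" and h3: "\<bar>sample_mean g' n \<omega> - d\<bar> \<le> a"
        and h4: "\<And>i. Y i \<omega> \<noteq> 0"
        using w N by (auto simp: A_def not_less)
      have "\<bar>?t\<bar> \<le> C / sqrt n" using h1 sn by (simp add: abs_mult pos_le_divide_eq mult.commute)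
      then have t: "\<bar>?t\<bar> < 1 / real (Suc k)" using elim by simp
      have "\<bar>\<Sum>i<n. g (Y i \<omega> - ?t) - g (Y i \<omega>) + ?t * g' (Y i \<omega>)\<bar> \<le> (\<Sum>i<n. \<bar>?t\<bar> * ?R (Y i \<omega>))"
        by (rule order_trans[OF sum_abs sum_mono]) (rule shift_remainder_bound[OF h4 t])
      then have "\<bar>\<Sum>i<n. g (Y i \<omega> - ?t) - g (Y i \<omega>) + ?t * g' (Y i \<omega>)\<bar> / n \<le> (\<bar>?t\<bar> * (\<Sum>i<n. ?R (Y i \<omega>))) / n"
        by (intro divide_right_mono) (simp_all add: sum_distrib_left)
      also have "\<dots> = \<bar>?t\<bar> * sample_mean ?R n \<omega>" by (simp add: sample_mean_def)
      finally have b1: "\<bar>(\<Sum>i<n. g (Y i \<omega> - ?t) - g (Y i \<omega>) + ?t * g' (Y i \<omega>)) / n\<bar> \<le> \<bar>?t\<bar> * sample_mean ?R n \<omega>"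
        by simp
      have e1: "(\<Sum>i<n. g (Y i \<omega> - ?t) - g (Y i \<omega>) + ?t * g' (Y i \<omega>)) / n
          = (\<Sum>i<n. g (Y i \<omega> - ?t)) / n - sample_mean g n \<omega> + ?t * sample_mean g' n \<omega>"
        by (simp add: sample_mean_def sum.distrib sum_subtractf sum_distrib_left[symmetric] add_divide_distrib diff_divide_distrib)
      have e2: "sqrt n * ((\<Sum>i<n. g (Y i \<omega> - ?t)) / n - sample_mean g n \<omega>) + d * (sqrt n * ?t)
          = sqrt n * ((\<Sum>i<n. g (Y i \<omega> - ?t)) / n - sample_mean g n \<omega> + ?t * sample_mean g' n \<omega>)
            - sqrt n * ?t * (sample_mean g' n \<omega> - d)"
        by (simp add: algebra_simps)
      have b2: "\<bar>sqrt n * ((\<Sum>i<n. g (Y i \<omega> - ?t)) / n - sample_mean g n \<omega> + ?t * sample_mean g' n \<omega>)\<bar>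
          \<le> \<bar>sqrt n * ?t\<bar> * sample_mean ?R n \<omega>"
        using mult_left_mono[OF b1[unfolded e1] less_imp_le[OF sn]] sn by (simp add: abs_mult mult.assoc)
      also have "\<dots> \<le> C * a"
        using h1 h2 C shift_remainder_nonneg
        by (intro mult_mono) (auto simp: sample_mean_def intro!: sum_nonneg divide_nonneg_nonneg)
      finally have b3: "\<bar>sqrt n * ((\<Sum>i<n. g (Y i \<omega> - ?t)) / n - sample_mean g n \<omega> + ?t * sample_mean g' n \<omega>)\<bar> \<le> C * a" .
      have b4: "\<bar>sqrt n * ?t * (sample_mean g' n \<omega> - d)\<bar> \<le> C * a"
        unfolding abs_mult[of "sqrt n * ?t"] using h1 h3 C by (intro mult_mono) auto
      have "\<bar>sqrt n * ((\<Sum>i<n. g (Y i \<omega> - ?t)) / n - sample_mean g n \<omega>) + d * (sqrt n * ?t)\<bar> \<le> C * a + C * a"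
        unfolding e2 using b3 b4 by (intro order_trans[OF abs_triangle_ineq4] add_mono)
      also have "\<dots> = \<epsilon>" using C by (simp add: a_def)
      finally show ?thesis by simp
    qed
    then show ?case using AM PA by blast
  qed
  then show "\<exists>A. \<forall>\<^sub>F n in sequentially. A n \<in> events \<and> prob (A n) \<le> \<delta> \<and>
    (\<forall>\<omega>\<in>space M - A n. \<bar>sqrt n * ((\<Sum>i<n. g (Y i \<omega> - T n \<omega>)) / n - sample_mean g n \<omega>)
    + (\<integral>y. g' y \<partial>epd lam) * (sqrt n * T n \<omega>) - 0\<bar> \<le> \<epsilon>)"
    unfolding d_def by (rule exI[of _ A])
qed

section \<open>Linearization of the location estimator\<close>

text \<open>The centered increment has second moment at most the mean square of
  \<open>spow (lam - 1) (Y - h / sqrt n) - spow (lam - 1) Y\<close>, which tends to 0. Its mean,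
  times \<open>sqrt n\<close>, tends to \<open>- epd_moment lam (2 * lam - 2) * h\<close> by the
  derivative of the shifted mean.\<close>

lemma score_increment:
  "converges_in_probability M (\<lambda>n \<omega>. sqrt n * ((\<Sum>i<n. spow (lam - 1) (Y i \<omega> - h / sqrt n)) / n
     - sample_mean (spow (lam - 1)) n \<omega>) + epd_moment lam (2 * lam - 2) * h) 0"
proof -
  let ?g = "spow (lam - 1)" and ?Q = "epd_moment lam (2 * lam - 2)"
  \<comment> \<open>Cutting off shifts larger than 1 changes finitely many \<open>n\<close> only and
    makes the bounds on translates available for every \<open>n\<close>.\<close>
  define X where "X n = (if \<bar>h / sqrt (real n)\<bar> \<le> 1 then h / sqrt (real n) else 0)" for n
  have s: "(\<lambda>n. h / sqrt (real n)) \<longlonglongrightarrow> 0"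
    by (intro tendsto_divide_0[OF tendsto_const] filterlim_at_top_imp_at_infinity
        filterlim_compose[OF sqrt_at_top filterlim_real_sequentially])
  have "\<forall>\<^sub>F n in sequentially. \<bar>h / sqrt (real n)\<bar> < 1"
    using order_tendstoD(2)[OF tendsto_rabs[OF s], of 1] by simp
  then have Xeq: "\<forall>\<^sub>F n in sequentially. X n = h / sqrt (real n)"
    by eventually_elim (simp add: X_def)
  have X0: "X \<longlonglongrightarrow> 0" by (rule Lim_transform_eventually[OF s]) (use Xeq in \<open>auto elim: eventually_mono\<close>)
  have X1: "\<bar>X n\<bar> \<le> 1" for n by (simp add: X_def)
  define H where "H n y = ?g (y - X n) - ?g y" for n y
  have [measurable]: "H n \<in> borel_measurable borel" for n unfolding H_def by measurable
  have H2: "integrable (epd lam) (\<lambda>y. (H n y)\<^sup>2)" for n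
    unfolding H_def by (rule score_shift_variance(2)[OF lam X0 X1])
  have HL: "(\<lambda>n. \<integral>y. (H n y)\<^sup>2 \<partial>epd lam) \<longlonglongrightarrow> 0"
    unfolding H_def by (rule score_shift_variance(1)[OF lam X0 X1])
  have c1: "converges_in_probability M (\<lambda>n \<omega>. sqrt n * (sample_mean (H n) n \<omega> - (\<integral>y. H n y \<partial>epd lam))) 0"
  proof (rule conv_prob_second_moment)
    show "integrable M (\<lambda>\<omega>. (sqrt n * (sample_mean (H n) n \<omega> - (\<integral>y. H n y \<partial>epd lam)))\<^sup>2)" for n
      by (rule second_moment_sample_mean[OF _ H2]) measurable
    show "(\<lambda>n. expectation (\<lambda>\<omega>. (sqrt n * (sample_mean (H n) n \<omega> - (\<integral>y. H n y \<partial>epd lam)))\<^sup>2)) \<longlonglongrightarrow> 0"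
    proof (rule Lim_null_comparison[OF always_eventually HL], intro allI)
      fix n
      show "norm (expectation (\<lambda>\<omega>. (sqrt n * (sample_mean (H n) n \<omega> - (\<integral>y. H n y \<partial>epd lam)))\<^sup>2)) \<le> (\<integral>y. (H n y)\<^sup>2 \<partial>epd lam)"
        using second_moment_sample_mean(2)[OF _ H2, of n n] by simp
    qed
  qed measurable
  have gi: "integrable (epd lam) ?g"
    by (rule Bochner_Integration.integrable_bound[OF integrable_epd_powr[of lam "lam - 1"]]) (use lam in auto)
  have g0: "(\<integral>y. ?g y \<partial>epd lam) = 0" by (rule integral_epd_odd) auto
  have Hint: "(\<integral>y. H n y \<partial>epd lam) = (\<integral>y. ?g (y - X n) \<partial>epd lam)" for n
  proof -
    have "integrable (epd lam) (H n)" by (rule epd_integrable_square_imp[OF H2]) measurable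
    then have "(\<integral>y. H n y + ?g y \<partial>epd lam) = (\<integral>y. H n y \<partial>epd lam) + (\<integral>y. ?g y \<partial>epd lam)"
      using gi by simp
    then show ?thesis by (simp add: g0 H_def)
  qed
  have c2: "(\<lambda>n. sqrt n * (\<integral>y. H n y \<partial>epd lam) + ?Q * h) \<longlonglongrightarrow> 0"
  proof (cases "h = 0")
    case True
    then show ?thesis by (simp add: Hint X_def g0)
  next
    case False
    have "\<forall>\<^sub>F n in sequentially. X n \<noteq> 0"
      using Xeq eventually_gt_at_top[of "0::nat"] by eventually_elim (use False in simp)
    then have "filterlim X (at 0) sequentially"
      by (simp add: filterlim_at X0)
    then have "(\<lambda>n. (\<integral>y. ?g (y - X n) \<partial>epd lam) / X n) \<longlonglongrightarrow> - ?Q"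
      by (rule filterlim_compose[OF score_shift_mean[OF lam]])
    then have "(\<lambda>n. h * ((\<integral>y. ?g (y - X n) \<partial>epd lam) / X n) + ?Q * h) \<longlonglongrightarrow> h * (- ?Q) + ?Q * h"
      by (intro tendsto_add tendsto_mult tendsto_const)
    then have "(\<lambda>n. h * ((\<integral>y. ?g (y - X n) \<partial>epd lam) / X n) + ?Q * h) \<longlonglongrightarrow> 0" by simp
    moreover have "\<forall>\<^sub>F n in sequentially. h * ((\<integral>y. ?g (y - X n) \<partial>epd lam) / X n) + ?Q * h
        = sqrt n * (\<integral>y. H n y \<partial>epd lam) + ?Q * h"
      using Xeq eventually_gt_at_top[of "0::nat"]
      by eventually_elim (simp add: Hint False)
    ultimately show ?thesis by (rule Lim_transform_eventually)
  qed
  have "converges_in_probability M (\<lambda>n \<omega>. sqrt n * (sample_mean (H n) n \<omega> - (\<integral>y. H n y \<partial>epd lam))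
      + (sqrt n * (\<integral>y. H n y \<partial>epd lam) + ?Q * h)) (0 + 0)"
    by (rule conv_prob_add[OF c1 conv_prob_const[OF c2]])
  then have "converges_in_probability M (\<lambda>n \<omega>. sqrt n * sample_mean (H n) n \<omega> + ?Q * h) 0"
    by (simp add: algebra_simps)
  then show ?thesis
  proof (rule conv_prob_cong)
    show "\<forall>\<^sub>F n in sequentially. \<forall>\<omega>\<in>space M. sqrt n * ((\<Sum>i<n. ?g (Y i \<omega> - h / sqrt n)) / n - sample_mean ?g n \<omega>) + ?Q * h
        = sqrt n * sample_mean (H n) n \<omega> + ?Q * h"
      using Xeq by eventually_elim (simp add: H_def[abs_def] sample_mean_def sum_subtractf diff_divide_distrib)
  qed measurable
qed

text \<open>A strict sign of the score tells on which side of \<open>t\<close> the estimator lies,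
  and \<open>up\<close> and \<open>lo\<close> record just this. The form covers the median, at which
  the score need not vanish.\<close>

theorem location_linearization:
  assumes T[measurable]: "\<And>n. T n \<in> borel_measurable M"
    and up: "\<And>n \<omega> t. 0 < n \<Longrightarrow> \<omega> \<in> space M \<Longrightarrow> (\<Sum>i<n. spow (lam - 1) (Y i \<omega> - t)) < 0 \<Longrightarrow> T n \<omega> \<le> t"
    and lo: "\<And>n \<omega> t. 0 < n \<Longrightarrow> \<omega> \<in> space M \<Longrightarrow> (\<Sum>i<n. spow (lam - 1) (Y i \<omega> - t)) > 0 \<Longrightarrow> t \<le> T n \<omega>"
  shows "converges_in_probability M (\<lambda>n \<omega>. sqrt n * T n \<omega>
     - 1 / epd_moment lam (2 * lam - 2) * (sqrt n * sample_mean (spow (lam - 1)) n \<omega>)) 0"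
proof (rule conv_probI)
  let ?g = "spow (lam - 1)"
  define Q where "Q = epd_moment lam (2 * lam - 2)"
  have Q: "0 < Q"
    using lam unfolding Q_def epd_moment_def
    by (intro divide_pos_pos mult_pos_pos) (auto intro!: Gamma_real_pos divide_pos_pos)
  define W where "W n \<omega> = 1 / Q * (sqrt n * sample_mean ?g n \<omega>)" for n \<omega>
  have W[measurable]: "W n \<in> borel_measurable M" for n unfolding W_def by measurable
  have g2: "integrable (epd lam) (\<lambda>y. (?g y)\<^sup>2)"
  proof -
    have "(?g y)\<^sup>2 = \<bar>y\<bar> powr ((lam - 1) + (lam - 1))" for y
      by (metis abs_spow power2_abs power2_eq_square powr_add)
    then show ?thesis using lam by (simp add: integrable_epd_powr)
  qed
  have g0: "(\<integral>y. ?g y \<partial>epd lam) = 0" by (rule integral_epd_odd) auto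
  have tight: "bounded_in_probability M W"
    unfolding W_def using bounded_in_prob_cmult[OF bounded_in_prob_sample_mean[OF _ g2], of "1 / Q"] by (simp add: g0)
  define D where "D h n \<omega> = sqrt n * ((\<Sum>i<n. ?g (Y i \<omega> - h / sqrt n)) / n - sample_mean ?g n \<omega>) + Q * h" for h :: real and n \<omega>
  have Dc: "converges_in_probability M (D h) 0" for h
    unfolding D_def Q_def by (rule score_increment)
  note [measurable] = conv_prob_measurable[OF Dc]
  show "(\<lambda>\<omega>. sqrt n * T n \<omega> - 1 / epd_moment lam (2 * lam - 2) * (sqrt n * sample_mean ?g n \<omega>)) \<in> borel_measurable M" for n
    by measurable
  fix \<epsilon> \<delta> :: real assume pos: "\<epsilon> > 0" "\<delta> > 0"
  obtain C where C: "C > 0" "\<forall>\<^sub>F n in sequentially. prob {\<omega> \<in> space M. \<bar>W n \<omega>\<bar> > C} \<le> \<delta> / 2"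
    using bounded_in_probD[OF tight, of "\<delta>/2"] pos by auto
  text \<open>The score is controlled simultaneously on a finite grid of mesh \<open>\<epsilon> / 2\<close>; since it is
    monotone in the shift, its sign at two neighbouring grid points locates the estimator.\<close>
  define m where "m = \<lceil>2 * C / \<epsilon>\<rceil> + 3"
  define h where "h j = real_of_int j * (\<epsilon> / 2)" for j
  let ?J = "{-m..m}"
  \<comment> \<open>The threshold is half of \<open>Q * \<epsilon> / 2\<close>, the least drift of
    the linear part at a grid point that is at least \<open>\<epsilon> / 2\<close> away from
    \<open>W n \<omega>\<close>; the sign of the score there is the sign of the drift.\<close>
  define A where "A n = {\<omega> \<in> space M. \<bar>W n \<omega>\<bar> > C} \<union> (\<Union>j\<in>?J. {\<omega> \<in> space M. \<bar>D (h j) n \<omega>\<bar> > Q * \<epsilon> / 4})" for n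
  have Qe: "0 < Q * \<epsilon> / 4" using Q pos by simp
  have "(\<lambda>n. \<Sum>j\<in>?J. prob {\<omega> \<in> space M. \<bar>D (h j) n \<omega>\<bar> > Q * \<epsilon> / 4}) \<longlonglongrightarrow> (\<Sum>j\<in>?J. 0)"
  proof (rule tendsto_sum)
    fix j
    show "(\<lambda>n. prob {\<omega> \<in> space M. \<bar>D (h j) n \<omega>\<bar> > Q * \<epsilon> / 4}) \<longlonglongrightarrow> 0"
      using Dc[of "h j"] Qe unfolding converges_in_probability_def diff_zero by blast
  qed
  then have "\<forall>\<^sub>F n in sequentially. (\<Sum>j\<in>?J. prob {\<omega> \<in> space M. \<bar>D (h j) n \<omega>\<bar> > Q * \<epsilon> / 4}) < \<delta> / 2"
    using pos by (intro order_tendstoD(2)) auto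
  with C(2) eventually_gt_at_top[of "0::nat"]
  have "\<forall>\<^sub>F n in sequentially. A n \<in> events \<and> prob (A n) \<le> \<delta> \<and>
    (\<forall>\<omega>\<in>space M - A n. \<bar>sqrt n * T n \<omega> - 1 / epd_moment lam (2 * lam - 2) * (sqrt n * sample_mean ?g n \<omega>) - 0\<bar> \<le> \<epsilon>)"
  proof eventually_elim
    case (elim n)
    have sn: "0 < sqrt n" using elim by simp
    have m1: "{\<omega> \<in> space M. \<bar>W n \<omega>\<bar> > C} \<in> events" "{\<omega> \<in> space M. \<bar>D (h j) n \<omega>\<bar> > Q * \<epsilon> / 4} \<in> events" for j
      by measurable
    have AM: "A n \<in> events" unfolding A_def using m1 by (intro sets.Un sets.finite_UN) auto
    have "prob (A n) \<le> prob {\<omega> \<in> space M. \<bar>W n \<omega>\<bar> > C} + prob (\<Union>j\<in>?J. {\<omega> \<in> space M. \<bar>D (h j) n \<omega>\<bar> > Q * \<epsilon> / 4})"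
      unfolding A_def using m1 by (intro measure_Un_le sets.finite_UN) auto
    also have "prob (\<Union>j\<in>?J. {\<omega> \<in> space M. \<bar>D (h j) n \<omega>\<bar> > Q * \<epsilon> / 4})
        \<le> (\<Sum>j\<in>?J. prob {\<omega> \<in> space M. \<bar>D (h j) n \<omega>\<bar> > Q * \<epsilon> / 4})"
      using m1 by (intro finite_measure_subadditive_finite) auto
    finally have PA: "prob (A n) \<le> \<delta>" using elim by simp
    have "\<bar>sqrt n * T n \<omega> - W n \<omega>\<bar> \<le> \<epsilon>" if w: "\<omega> \<in> space M - A n" for \<omega>
    proof -
      have h1: "\<bar>W n \<omega>\<bar> \<le> C" and h2: "\<And>j. j \<in> ?J \<Longrightarrow> \<bar>D (h j) n \<omega>\<bar> \<le> Q * \<epsilon> / 4"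
        using w by (auto simp: A_def not_less)
      have sum_eq: "sqrt n * ((\<Sum>i<n. ?g (Y i \<omega> - x / sqrt n)) / n) = Q * (W n \<omega> - x) + D x n \<omega>" for x
        using Q by (simp add: D_def W_def algebra_simps)
      define x where "x = 2 * W n \<omega> / \<epsilon>"
      have xb: "\<bar>x\<bar> \<le> 2 * C / \<epsilon>" using h1 pos by (simp add: x_def abs_mult divide_right_mono)
      have Wx: "W n \<omega> = x * (\<epsilon> / 2)" using pos by (simp add: x_def)
      have upper: "sqrt n * T n \<omega> \<le> W n \<omega> + \<epsilon>"
      proof -
        \<comment> \<open>Rounding up and adding 1 places the grid point above
          \<open>W n \<omega>\<close> by at least \<open>\<epsilon> / 2\<close> and at most
          \<open>\<epsilon>\<close>.\<close>
        define j where "j = \<lceil>x\<rceil> + 1"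
        have j: "j \<in> ?J" using xb unfolding j_def m_def by simp linarith
        have hj: "W n \<omega> + \<epsilon> / 2 \<le> h j" "h j \<le> W n \<omega> + \<epsilon>"
        proof -
          have "(x + 1) * (\<epsilon> / 2) \<le> h j" "h j \<le> (x + 2) * (\<epsilon> / 2)"
            unfolding h_def j_def using pos by (intro mult_right_mono; linarith)+
          then show "W n \<omega> + \<epsilon> / 2 \<le> h j" "h j \<le> W n \<omega> + \<epsilon>" unfolding Wx by (simp_all add: algebra_simps)
        qed
        have "Q * (W n \<omega> - h j) \<le> Q * (- (\<epsilon> / 2))" using hj Q by (intro mult_left_mono) auto
        then have "Q * (W n \<omega> - h j) + D (h j) n \<omega> < 0" using h2[OF j] Qe by (auto simp: abs_le_iff)
        then have "sqrt n * ((\<Sum>i<n. ?g (Y i \<omega> - h j / sqrt n)) / n) < 0" unfolding sum_eq .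
        then have "(\<Sum>i<n. ?g (Y i \<omega> - h j / sqrt n)) < 0"
          using elim by (simp add: mult_less_0_iff divide_less_0_iff)
        then have "T n \<omega> \<le> h j / sqrt n" using up[of n \<omega>] elim w by auto
        then have "sqrt n * T n \<omega> \<le> h j" using sn by (simp add: pos_le_divide_eq mult.commute)
        then show ?thesis using hj by linarith
      qed
      have lower: "W n \<omega> - \<epsilon> \<le> sqrt n * T n \<omega>"
      proof -
        define j where "j = \<lfloor>x\<rfloor> - 1"
        have j: "j \<in> ?J" using xb unfolding j_def m_def by simp linarith
        have hj: "h j \<le> W n \<omega> - \<epsilon> / 2" "W n \<omega> - \<epsilon> \<le> h j"
        proof -
          have "h j \<le> (x - 1) * (\<epsilon> / 2)" "(x - 2) * (\<epsilon> / 2) \<le> h j"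
            unfolding h_def j_def using pos by (intro mult_right_mono; linarith)+
          then show "h j \<le> W n \<omega> - \<epsilon> / 2" "W n \<omega> - \<epsilon> \<le> h j" unfolding Wx by (simp_all add: algebra_simps)
        qed
        have "Q * (\<epsilon> / 2) \<le> Q * (W n \<omega> - h j)" using hj Q by (intro mult_left_mono) auto
        then have "Q * (W n \<omega> - h j) + D (h j) n \<omega> > 0" using h2[OF j] Qe by (auto simp: abs_le_iff)
        then have "sqrt n * ((\<Sum>i<n. ?g (Y i \<omega> - h j / sqrt n)) / n) > 0" unfolding sum_eq .
        then have "(\<Sum>i<n. ?g (Y i \<omega> - h j / sqrt n)) > 0"
          using elim by (simp add: zero_less_mult_iff zero_less_divide_iff)
        then have "h j / sqrt n \<le> T n \<omega>" using lo[of n \<omega>] elim w by auto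
        then have "h j \<le> sqrt n * T n \<omega>" using sn by (simp add: pos_divide_le_eq mult.commute)
        then show ?thesis using hj by linarith
      qed
      show ?thesis using upper lower by linarith
    qed
    then show ?case using AM PA unfolding W_def Q_def by simp
  qed
  then show "\<exists>A. \<forall>\<^sub>F n in sequentially. A n \<in> events \<and> prob (A n) \<le> \<delta> \<and>
    (\<forall>\<omega>\<in>space M - A n. \<bar>sqrt n * T n \<omega> - 1 / epd_moment lam (2 * lam - 2) * (sqrt n * sample_mean ?g n \<omega>) - 0\<bar> \<le> \<epsilon>)"
    by (rule exI[of _ A])
qed

end

section \<open>The location estimator\<close>

lemma sum_sort_nth:
  fixes f :: "real \<Rightarrow> real"
  shows "(\<Sum>i<n. f (sort (map x [0..<n]) ! i)) = (\<Sum>i<n. f (x i))"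
proof -
  have "(\<Sum>i<n. f (sort (map x [0..<n]) ! i)) = sum_list (map f (sort (map x [0..<n])))"
    by (simp add: sum_list_sum_nth lessThan_atLeast0)
  also have "\<dots> = sum_mset (image_mset f (mset (map x [0..<n])))"
    by (simp flip: sum_mset_sum_list)
  also have "\<dots> = sum_list (map f (map x [0..<n]))"
    by (simp add: sum_mset_sum_list flip: mset_map del: map_map)
  also have "\<dots> = (\<Sum>i<n. f (x i))"
    by (simp add: interv_sum_list_conv_sum_set_nat lessThan_atLeast0 comp_def)
  finally show ?thesis .
qed

text \<open>With indices from 0, the entries \<open>k, ..., n - 1\<close> of the sorted list lie
  above \<open>t\<close> and contribute 1 each; the other \<open>k\<close> contribute at least
  -1.\<close>

lemma order_statistic_gt:
  assumes k: "k < n" and t: "t < sort (map x [0..<n]) ! k"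
  shows "real n - 2 * real k \<le> (\<Sum>i<n. sgn (x i - t))"
proof -
  let ?s = "sort (map x [0..<n])"
  have "(\<Sum>i<n. sgn (x i - t)) = (\<Sum>i<n. sgn (?s ! i - t))" by (simp add: sum_sort_nth[of "\<lambda>y. sgn (y - t)"])
  also have "\<dots> = (\<Sum>i\<in>{..<k} \<union> {k..<n}. sgn (?s ! i - t))" using k by (intro sum.cong) auto
  also have "\<dots> = (\<Sum>i<k. sgn (?s ! i - t)) + (\<Sum>i=k..<n. sgn (?s ! i - t))"
    by (rule sum.union_disjoint) auto
  also have "(\<Sum>i=k..<n. sgn (?s ! i - t)) = (\<Sum>i=k..<n. 1)"
  proof (intro sum.cong refl)
    fix i assume "i \<in> {k..<n}"
    then have "?s ! k \<le> ?s ! i" by (intro sorted_nth_mono) auto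
    then show "sgn (?s ! i - t) = 1" using t by simp
  qed
  also have "(\<Sum>i<k. sgn (?s ! i - t)) + (\<Sum>i=k..<n. 1) \<ge> (\<Sum>i<k. -1) + (\<Sum>i=k..<n. 1)"
    by (intro add_right_mono sum_mono) (auto simp: sgn_if)
  also have "(\<Sum>i<k. - 1 :: real) + (\<Sum>i=k..<n. 1) = real n - 2 * real k" using k by (simp add: of_nat_diff)
  finally show ?thesis .
qed

text \<open>Here the entry \<open>k\<close> itself lies below \<open>t\<close>, so
  \<open>k + 1\<close> terms equal -1; this is the extra 2.\<close>

lemma order_statistic_less:
  assumes k: "k < n" and t: "sort (map x [0..<n]) ! k < t"
  shows "(\<Sum>i<n. sgn (x i - t)) \<le> real n - 2 * real k - 2"
proof -
  let ?s = "sort (map x [0..<n])"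
  have "(\<Sum>i<n. sgn (x i - t)) = (\<Sum>i<n. sgn (?s ! i - t))" by (simp add: sum_sort_nth[of "\<lambda>y. sgn (y - t)"])
  also have "\<dots> = (\<Sum>i\<in>{..k} \<union> {Suc k..<n}. sgn (?s ! i - t))" using k by (intro sum.cong) auto
  also have "\<dots> = (\<Sum>i\<le>k. sgn (?s ! i - t)) + (\<Sum>i=Suc k..<n. sgn (?s ! i - t))"
    by (rule sum.union_disjoint) auto
  also have "(\<Sum>i\<le>k. sgn (?s ! i - t)) = (\<Sum>i\<le>k. -1)"
  proof (intro sum.cong refl)
    fix i assume "i \<in> {..k}"
    then have "?s ! i \<le> ?s ! k" using k by (intro sorted_nth_mono) auto
    then show "sgn (?s ! i - t) = - 1" using t by simp
  qed
  also have "(\<Sum>i\<le>k. - 1) + (\<Sum>i=Suc k..<n. sgn (?s ! i - t)) \<le> (\<Sum>i\<le>k. -1) + (\<Sum>i=Suc k..<n. 1)"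
    by (intro add_left_mono sum_mono) (auto simp: sgn_if)
  also have "(\<Sum>i\<le>k. - 1 :: real) + (\<Sum>i=Suc k..<n. 1) = real n - 2 * real k - 2" using k by (simp add: of_nat_diff)
  finally show ?thesis .
qed

text \<open>The strict sign matters for even \<open>n\<close>: between the two central order
  statistics the score is 0 and does not decide on which side of \<open>t\<close> their mean
  lies.\<close>

lemma sample_median_le:
  assumes n: "0 < n" and s: "(\<Sum>i<n. sgn (x i - t)) < 0" shows "sample_median n x \<le> t"
proof (rule ccontr)
  let ?s = "sort (map x [0..<n])"
  assume "\<not> ?thesis"
  then have m: "t < sample_median n x" by simp
  have k: "n div 2 < n" using n by simp
  have "t < ?s ! (n div 2)"
  proof (cases "odd n")
    case False
    have "?s ! (n div 2 - 1) \<le> ?s ! (n div 2)" using k by (intro sorted_nth_mono) auto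
    then show ?thesis using m False by (simp add: sample_median_def Let_def)
  qed (use m in \<open>simp add: sample_median_def Let_def\<close>)
  from order_statistic_gt[OF k this] have "real n - 2 * real (n div 2) < 0" using s by linarith
  then show False by simp
qed

lemma sample_median_ge:
  assumes n: "0 < n" and s: "0 < (\<Sum>i<n. sgn (x i - t))" shows "t \<le> sample_median n x"
proof (rule ccontr)
  let ?s = "sort (map x [0..<n])"
  assume "\<not> ?thesis"
  then have m: "sample_median n x < t" by simp
  show False
  proof (cases "odd n")
    case True
    then have "?s ! (n div 2) < t" using m by (simp add: sample_median_def Let_def)
    from order_statistic_less[OF _ this] have "0 < real n - 2 * real (n div 2) - 2" using s n by force
    then show False by simp
  next
    case False
    then have n2: "n div 2 - 1 < n" "Suc (n div 2 - 1) = n div 2" "2 * (n div 2) = n" using n by (auto elim!: evenE)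
    have "?s ! (n div 2 - 1) \<le> ?s ! (n div 2)" using n by (intro sorted_nth_mono) auto
    then have "?s ! (n div 2 - 1) < t" using m False by (simp add: sample_median_def Let_def)
    from order_statistic_less[OF n2(1) this] have "0 < real n - 2 * real (n div 2 - 1) - 2" using s by linarith
    moreover have "real n = 2 * real (n div 2 - 1) + 2" using n2 by linarith
    ultimately show False by simp
  qed
qed

text \<open>The median is one of finitely many linear functions of the sample (\<open>i = j\<close>
  for odd \<open>n\<close>). For \<open>lam = 1\<close> a vanishing skewness thus becomes one of
  finitely many linear relations.\<close>

lemma sample_median_average:
  assumes n: "0 < n" obtains i j where "i < n" "j < n" "sample_median n x = (x i + x j) / 2"
proof -
  let ?s = "sort (map x [0..<n])"
  have "\<exists>i<n. ?s ! k = x i" if "k < n" for k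
  proof -
    have "?s ! k \<in> set ?s" using that by (intro nth_mem) simp
    then show ?thesis by auto
  qed
  then have e: "\<And>k. k < n \<Longrightarrow> \<exists>i<n. ?s ! k = x i" by blast
  have k: "n div 2 < n" "n div 2 - 1 < n" using n by auto
  obtain i where i: "i < n" "?s ! (n div 2) = x i" using e[OF k(1)] by blast
  obtain j where j: "j < n" "?s ! (n div 2 - 1) = x j" using e[OF k(2)] by blast
  show thesis
  proof (cases "odd n")
    case True
    then have "sample_median n x = (x i + x i) / 2" by (simp add: sample_median_def Let_def i(2))
    then show thesis by (rule that[OF i(1) i(1)])
  next
    case False
    then have "sample_median n x = (x j + x i) / 2"
      unfolding sample_median_def Let_def i(2) j(2) by simp
    then show thesis by (rule that[OF j(1) i(1)])
  qed
qed

text \<open>The entry with index \<open>k\<close> is at most \<open>a\<close> if and only if more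
  than \<open>k\<close> observations are, and counting observations is measurable.\<close>

lemma order_statistic_measurable:
  fixes X :: "nat \<Rightarrow> 'a \<Rightarrow> real"
  assumes [measurable]: "\<And>i. i < n \<Longrightarrow> X i \<in> borel_measurable M" and k: "k < n"
  shows "(\<lambda>\<omega>. sort (map (\<lambda>i. X i \<omega>) [0..<n]) ! k) \<in> borel_measurable M"
  unfolding borel_measurable_iff_le
proof
  fix a :: real
  have "sort (map x [0..<n]) ! k \<le> a \<longleftrightarrow> real k < (\<Sum>i<n. indicator {..a} (x i))" for x
  proof -
    let ?s = "sort (map x [0..<n])"
    have "(\<Sum>i<n. indicator {..a} (x i)) = (\<Sum>i<n. indicator {..a} (?s ! i) :: real)"
      by (simp add: sum_sort_nth[of "indicator {..a}"])
    also have "\<dots> = (\<Sum>i\<in>{..k} \<union> {Suc k..<n}. indicator {..a} (?s ! i))" using k by (intro sum.cong) auto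
    also have "\<dots> = (\<Sum>i\<le>k. indicator {..a} (?s ! i)) + (\<Sum>i=Suc k..<n. indicator {..a} (?s ! i))"
      by (rule sum.union_disjoint) auto
    finally have eq: "(\<Sum>i<n. indicator {..a} (x i))
      = (\<Sum>i\<le>k. indicator {..a} (?s ! i)) + (\<Sum>i=Suc k..<n. indicator {..a} (?s ! i) :: real)" .
    show ?thesis
    proof
      assume le: "?s ! k \<le> a"
      have "(\<Sum>i\<le>k. indicator {..a} (?s ! i)) = (\<Sum>i\<le>k. 1 :: real)"
      proof (intro sum.cong refl)
        fix i assume "i \<in> {..k}"
        then have "?s ! i \<le> ?s ! k" using k by (intro sorted_nth_mono) auto
        then show "indicator {..a} (?s ! i) = (1 :: real)" using le by simp
      qed
      moreover have "(0::real) \<le> (\<Sum>i=Suc k..<n. indicator {..a} (?s ! i))" by (intro sum_nonneg) simp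
      ultimately show "real k < (\<Sum>i<n. indicator {..a} (x i))" unfolding eq by simp
    next
      assume lt: "real k < (\<Sum>i<n. indicator {..a} (x i))"
      show "?s ! k \<le> a"
      proof (rule ccontr)
        assume gt: "\<not> ?s ! k \<le> a"
        have z: "indicator {..a} (?s ! i) = (0 :: real)" if "k \<le> i" "i < n" for i
        proof -
          have "?s ! k \<le> ?s ! i" using that by (intro sorted_nth_mono) auto
          then show ?thesis using gt by simp
        qed
        have "(\<Sum>i=Suc k..<n. indicator {..a} (?s ! i)) = (0 :: real)" using z by (intro sum.neutral) auto
        moreover have "(\<Sum>i\<le>k. indicator {..a} (?s ! i)) = (\<Sum>i<k. indicator {..a} (?s ! i) :: real)"
          using z[of k] k by (simp add: lessThan_Suc_atMost[symmetric])
        moreover have "\<dots> \<le> (\<Sum>i<k. 1)" by (intro sum_mono) (auto split: split_indicator)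
        ultimately show False using lt unfolding eq by simp
      qed
    qed
  qed
  then show "{\<omega> \<in> space M. sort (map (\<lambda>i. X i \<omega>) [0..<n]) ! k \<le> a} \<in> sets M" by simp
qed

section \<open>The estimator as the root of the score, and its measurability\<close>

lemma mu_hat_1: "mu_hat 1 n x = sample_median n x"
  by (simp add: mu_hat_def)

text \<open>The score is continuous and strictly decreasing in the shift, nonnegative at
  \<open>- U\<close> and nonpositive at \<open>U\<close>, where \<open>U\<close> bounds all
  observations. This existence and uniqueness give meaning to the definite description.\<close>

lemma mu_hat_zero:
  assumes lam: "1 < lam" and n: "0 < n"
  shows "(\<Sum>i<n. spow (lam - 1) (x i - mu_hat lam n x)) = 0"
    and "\<And>m. (\<Sum>i<n. spow (lam - 1) (x i - m)) = 0 \<Longrightarrow> m = mu_hat lam n x"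
proof -
  let ?P = "\<lambda>m. \<Sum>i<n. spow (lam - 1) (x i - m)"
  have dec: "?P b < ?P a" if "a < b" for a b
    using that n lam by (intro sum_strict_mono spow_strict_mono) auto
  define U where "U = (\<Sum>i<n. \<bar>x i\<bar>)"
  have U: "\<bar>x i\<bar> \<le> U" if "i < n" for i
    unfolding U_def using that by (intro member_le_sum) auto
  have "\<exists>m. - U \<le> m \<and> m \<le> U \<and> ?P m = 0"
  proof (rule IVT2')
    have "spow (lam - 1) (x i - U) \<le> spow (lam - 1) 0" if "i < n" for i
      using U[OF that] lam by (intro spow_mono) auto
    then show "?P U \<le> 0" by (intro sum_nonpos) auto
    have "spow (lam - 1) 0 \<le> spow (lam - 1) (x i - - U)" if "i < n" for i
      using U[OF that] lam by (intro spow_mono) auto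
    then show "0 \<le> ?P (- U)" by (intro sum_nonneg) auto
    have "0 \<le> U" unfolding U_def by (intro sum_nonneg) auto
    then show "- U \<le> U" by simp
    show "continuous_on {- U..U} ?P"
      using lam by (intro continuous_on_sum continuous_on_compose2[OF continuous_spow] continuous_intros) auto
  qed
  then obtain m where m: "?P m = 0" by blast
  have uniq: "m' = m" if "?P m' = 0" for m'
    using dec[of m m'] dec[of m' m] m that by (cases m' m rule: linorder_cases) auto
  have mu: "mu_hat lam n x = (THE m. ?P m = 0)" using lam by (simp add: mu_hat_def spow_def)
  show "?P (mu_hat lam n x) = 0" unfolding mu by (rule theI[of "\<lambda>m. ?P m = 0", OF m uniq])
  show "m = mu_hat lam n x" if "?P m = 0" for m
    unfolding mu using the_equality[of "\<lambda>m. ?P m = 0", OF m uniq] uniq[OF that] by simp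
qed

lemma score_sum_antimono:
  assumes "1 \<le> lam" "a \<le> b"
  shows "(\<Sum>i<n. spow (lam - 1) (x i - b)) \<le> (\<Sum>i<n. spow (lam - 1) (x i - a))"
  using assms by (intro sum_mono spow_mono) auto

text \<open>Sublevel sets of the estimator are described by the score at a fixed shift;
  measurability of the definite description comes from here.\<close>

lemma mu_hat_le_iff:
  assumes lam: "1 < lam" and n: "0 < n"
  shows "mu_hat lam n x \<le> t \<longleftrightarrow> (\<Sum>i<n. spow (lam - 1) (x i - t)) \<le> 0"
proof
  assume "mu_hat lam n x \<le> t"
  then show "(\<Sum>i<n. spow (lam - 1) (x i - t)) \<le> 0"
    using score_sum_antimono[of lam "mu_hat lam n x" t x n] mu_hat_zero(1)[OF assms, of x] lam by simp
next
  assume le: "(\<Sum>i<n. spow (lam - 1) (x i - t)) \<le> 0"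
  show "mu_hat lam n x \<le> t"
  proof (rule ccontr)
    assume "\<not> ?thesis"
    then have "(\<Sum>i<n. spow (lam - 1) (x i - mu_hat lam n x)) < (\<Sum>i<n. spow (lam - 1) (x i - t))"
      using n lam by (intro sum_strict_mono spow_strict_mono) auto
    then show False using le mu_hat_zero(1)[OF assms, of x] by simp
  qed
qed

lemma mu_hat_le:
  assumes lam: "1 \<le> lam" and n: "0 < n" and s: "(\<Sum>i<n. spow (lam - 1) (x i - t)) < 0"
  shows "mu_hat lam n x \<le> t"
proof (cases "lam = 1")
  case True then show ?thesis using sample_median_le[OF n] s by (simp add: mu_hat_1 spow_exponent_0)
next
  case False then show ?thesis using mu_hat_le_iff[OF _ n] lam s by simp
qed

lemma mu_hat_ge:
  assumes lam: "1 \<le> lam" and n: "0 < n" and s: "0 < (\<Sum>i<n. spow (lam - 1) (x i - t))"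
  shows "t \<le> mu_hat lam n x"
proof (cases "lam = 1")
  case True then show ?thesis using sample_median_ge[OF n] s by (simp add: mu_hat_1 spow_exponent_0)
next
  case False then show ?thesis using mu_hat_le_iff[OF _ n, of lam x t] lam s by simp
qed

lemma mu_hat_cong: "(\<And>i. i < n \<Longrightarrow> x i = y i) \<Longrightarrow> mu_hat lam n x = mu_hat lam n y"
proof -
  assume eq: "\<And>i. i < n \<Longrightarrow> x i = y i"
  then have "map x [0..<n] = map y [0..<n]" by simp
  moreover have "(\<Sum>i<n. \<bar>x i - m\<bar> powr (lam - 1) * sgn (x i - m)) = (\<Sum>i<n. \<bar>y i - m\<bar> powr (lam - 1) * sgn (y i - m))" for m
    using eq by (intro sum.cong) auto
  ultimately show ?thesis by (simp only: mu_hat_def sample_median_def)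
qed

lemma mu_hat_measurable:
  assumes lam: "1 \<le> lam" and X[measurable]: "\<And>i. i < n \<Longrightarrow> X i \<in> borel_measurable M"
  shows "(\<lambda>\<omega>. mu_hat lam n (\<lambda>i. X i \<omega>)) \<in> borel_measurable M"
proof (cases "n = 0")
  case True
  then have "(\<lambda>\<omega>. mu_hat lam n (\<lambda>i. X i \<omega>)) = (\<lambda>\<omega>. mu_hat lam n (\<lambda>i. 0))"
    by (intro ext mu_hat_cong) simp
  then show ?thesis by simp
next
  case False
  then have n: "0 < n" by simp
  show ?thesis
  proof (cases "lam = 1")
    case True
    have [measurable]: "(\<lambda>\<omega>. sort (map (\<lambda>i. X i \<omega>) [0..<n]) ! (n div 2)) \<in> borel_measurable M"
      "(\<lambda>\<omega>. sort (map (\<lambda>i. X i \<omega>) [0..<n]) ! (n div 2 - Suc 0)) \<in> borel_measurable M"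
      using n by (auto intro!: order_statistic_measurable)
    show ?thesis
      unfolding True mu_hat_1 sample_median_def Let_def by (cases "odd n") auto
  next
    case False
    then have lam1: "1 < lam" using lam by simp
    show ?thesis
      unfolding borel_measurable_iff_le mu_hat_le_iff[OF lam1 n] by measurable
  qed
qed

section \<open>The numerator of the skewness statistic almost surely does not vanish\<close>

text \<open>A zero with nonzero derivative is isolated. Zeros isolated at distance
  \<open>1 / Suc k\<close> are told apart by the integer part of \<open>m * Suc k\<close>.\<close>

lemma countable_simple_zeros:
  fixes G :: "real \<Rightarrow> real"
  shows "countable {m. G m = 0 \<and> (\<exists>D. D \<noteq> 0 \<and> (G has_real_derivative D) (at m))}"
proof -
  define Z where "Z = {m. G m = 0 \<and> (\<exists>D. D \<noteq> 0 \<and> (G has_real_derivative D) (at m))}"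
  define iso where "iso k m \<longleftrightarrow> (\<forall>m'\<in>Z. \<bar>m' - m\<bar> < 1 / real (Suc k) \<longrightarrow> m' = m)" for k m
  have sub: "Z \<subseteq> (\<Union>k. {m \<in> Z. iso k m})"
  proof
    fix m assume m: "m \<in> Z"
    then obtain D where D: "G m = 0" "D \<noteq> 0" "(G has_real_derivative D) (at m)" unfolding Z_def by blast
    then have "((\<lambda>y. G y / (y - m)) \<longlongrightarrow> D) (at m)" by (simp add: has_field_derivative_iff)
    from tendsto_imp_eventually_ne[OF this D(2)]
    obtain e where e: "e > 0" "\<And>y. y \<noteq> m \<Longrightarrow> dist y m < e \<Longrightarrow> G y / (y - m) \<noteq> 0"
      unfolding eventually_at by auto
    obtain k :: nat where k: "1 / Suc k < e" using e(1) nat_approx_posE by blast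
    have "iso k m" unfolding iso_def
    proof (intro ballI impI, rule ccontr)
      fix m' assume m': "m' \<in> Z" "\<bar>m' - m\<bar> < 1 / real (Suc k)" "m' \<noteq> m"
      then have "G m' / (m' - m) \<noteq> 0" using k by (intro e(2)) (auto simp: dist_real_def)
      then show False using m'(1) by (simp add: Z_def)
    qed
    then show "m \<in> (\<Union>k. {m \<in> Z. iso k m})" using m by auto
  qed
  have "countable {m \<in> Z. iso k m}" for k
  proof -
    have "inj_on (\<lambda>m. \<lfloor>m * real (Suc k)\<rfloor>) {m \<in> Z. iso k m}"
    proof (rule inj_onI)
      fix a b assume ab: "a \<in> {m \<in> Z. iso k m}" "b \<in> {m \<in> Z. iso k m}" "\<lfloor>a * real (Suc k)\<rfloor> = \<lfloor>b * real (Suc k)\<rfloor>"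
      have "\<bar>a * Suc k - b * Suc k\<bar> < 1" using ab(3) by linarith
      then have "\<bar>a - b\<bar> * Suc k < 1" by (simp add: left_diff_distrib[symmetric] abs_mult)
      then have "\<bar>a - b\<bar> < 1 / real (Suc k)" by (simp add: pos_less_divide_eq)
      then show "a = b" using ab(1,2) by (simp add: iso_def)
    qed
    then show ?thesis by (rule countable_image_inj_on[rotated]) simp
  qed
  then have "countable (\<Union>k. {m \<in> Z. iso k m})" by simp
  then have "countable Z" using sub by (rule countable_subset[rotated])
  then show ?thesis unfolding Z_def .
qed

text \<open>By independence the joint law is a product. With the coordinate \<open>i\<close>
  innermost, Fubini integrates a countable set against a law without atoms, which gives 0.\<close>

lemma (in prob_space) AE_not_in_countable_fibers:
  fixes X :: "'i \<Rightarrow> 'a \<Rightarrow> real"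
  assumes I: "finite I" "i \<in> I" and ind: "indep_vars (\<lambda>_. borel) X I"
    and noatom: "\<And>c. emeasure (distr M borel (X i)) {c} = 0"
    and A: "A \<in> sets (PiM I (\<lambda>_. borel))"
    and fib: "\<And>x. countable {y. x(i := y) \<in> A}"
  shows "AE \<omega> in M. (\<lambda>k\<in>I. X k \<omega>) \<notin> A"
proof -
  have X[measurable]: "X k \<in> borel_measurable M" if "k \<in> I" for k using ind that by (simp add: indep_vars_def)
  \<comment> \<open>A product family needs a measure at every index; the point mass only fills the
    places outside \<open>I\<close>.\<close>
  define N where "N k = (if k \<in> I then distr M borel (X k) else return borel 0)" for k
  have N_prob: "prob_space (N k)" for k
    by (auto simp: N_def intro: prob_space_distr prob_space_return)
  have [simp, measurable_cong]: "sets (N k) = sets borel" for k by (simp add: N_def)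
  interpret product_sigma_finite N
    by (intro product_sigma_finite.intro prob_space_imp_sigma_finite N_prob)
  have sN: "sets (PiM I N) = sets (PiM I (\<lambda>_. borel))" by (rule sets_PiM_cong) auto
  have d: "distr M (PiM I (\<lambda>_. borel)) (\<lambda>\<omega>. \<lambda>k\<in>I. X k \<omega>) = PiM I N"
  proof -
    have "distr M (PiM I (\<lambda>_. borel)) (\<lambda>\<omega>. \<lambda>k\<in>I. X k \<omega>) = PiM I (\<lambda>k. distr M borel (X k))"
      using ind I by (subst (asm) indep_vars_iff_distr_eq_PiM') auto
    also have "\<dots> = PiM I N" by (rule PiM_cong) (auto simp: N_def)
    finally show ?thesis .
  qed
  have I_eq: "insert i (I - {i}) = I" using I by auto
  have AN: "A \<in> sets (PiM (insert i (I - {i})) N)" unfolding I_eq sN by (rule A)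
  have "emeasure (PiM (insert i (I - {i})) N) A = (\<integral>\<^sup>+x. indicator A x \<partial>PiM (insert i (I - {i})) N)"
    using AN by simp
  also have "\<dots> = (\<integral>\<^sup>+x. (\<integral>\<^sup>+y. indicator A (x(i := y)) \<partial>N i) \<partial>PiM (I - {i}) N)"
    using I AN by (intro product_nn_integral_insert) auto
  also have "\<dots> = (\<integral>\<^sup>+x. 0 \<partial>PiM (I - {i}) N)"
  proof (intro nn_integral_cong)
    fix x assume x: "x \<in> space (PiM (I - {i}) N)"
    have "{y. x(i := y) \<in> A} \<in> null_sets (N i)"
    proof -
      have "{y. x(i := y) \<in> A} = (\<Union>y\<in>{y. x(i := y) \<in> A}. {y})" by auto
      also have "\<dots> \<in> null_sets (N i)"
        using fib[of x] I noatom by (intro null_sets_UN') (auto simp: null_sets_def N_def)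
      finally show ?thesis .
    qed
    then have "(\<integral>\<^sup>+y. indicator {y. x(i := y) \<in> A} y \<partial>N i) = 0"
      by (simp add: null_sets_def)
    then show "(\<integral>\<^sup>+y. indicator A (x(i := y)) \<partial>N i) = 0" by (simp add: indicator_def)
  qed
  finally have "emeasure (PiM (insert i (I - {i})) N) A = 0" by simp
  then have "emeasure (distr M (PiM I (\<lambda>_. borel)) (\<lambda>\<omega>. \<lambda>k\<in>I. X k \<omega>)) A = 0" unfolding I_eq d .
  moreover have m: "(\<lambda>\<omega>. \<lambda>k\<in>I. X k \<omega>) \<in> measurable M (PiM I (\<lambda>_. borel))"
    by (rule measurable_restrict) measurable
  ultimately have "emeasure M ((\<lambda>\<omega>. \<lambda>k\<in>I. X k \<omega>) -` A \<inter> space M) = 0"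
    using A by (simp add: emeasure_distr)
  then have "(\<lambda>\<omega>. \<lambda>k\<in>I. X k \<omega>) -` A \<inter> space M \<in> null_sets M"
    using A m by (auto simp: null_sets_def measurable_sets)
  then show ?thesis by (rule AE_I') auto
qed

lemma PiM_component_measurable: "i < n \<Longrightarrow> (\<lambda>x. x i) \<in> borel_measurable (PiM {..<n} (\<lambda>_. borel))"
  by (rule measurable_component_singleton) simp

text \<open>Hypothesis \<open>b\<close> says that, for every \<open>i\<close>, the derivative computed in
  \<open>countable_skewness_fiber\<close> below vanishes.\<close>

lemma abs_eq_of_balanced:
  fixes u :: "nat \<Rightarrow> real"
  assumes u: "\<And>i. i < n \<Longrightarrow> u i \<noteq> 0"
    and b: "\<And>i. i < n \<Longrightarrow> \<bar>u i\<bar> * (\<Sum>j\<in>{..<n} - {i}. \<bar>u j\<bar> powr (p - 1)) = (\<Sum>j\<in>{..<n} - {i}. \<bar>u j\<bar> powr p)"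
    and ij: "i < n" "j < n"
  shows "\<bar>u i\<bar> = \<bar>u j\<bar>"
proof -
  \<comment> \<open>Adding the \<open>i\<close>-th term to both sides completes the sums, because
    \<open>\<bar>u i\<bar> * \<bar>u i\<bar> powr (p - 1) = \<bar>u i\<bar> powr p\<close>. Then
    \<open>\<bar>u i\<bar>\<close> is the same quotient of full sums for every
    \<open>i\<close>.\<close>
  have eq: "\<bar>u i\<bar> * (\<Sum>j<n. \<bar>u j\<bar> powr (p - 1)) = (\<Sum>j<n. \<bar>u j\<bar> powr p)" if i: "i < n" for i
  proof -
    have "\<bar>u i\<bar> * \<bar>u i\<bar> powr (p - 1) = \<bar>u i\<bar> powr p" using u[OF i] by (simp add: powr_diff)
    then show ?thesis using b[OF i] i by (simp add: sum.remove[of "{..<n}" i] distrib_left)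
  qed
  have "0 < (\<Sum>j<n. \<bar>u j\<bar> powr (p - 1))" using ij u by (intro sum_pos) auto
  then show ?thesis using eq[OF ij(1)] eq[OF ij(2)] by (metis mult_right_cancel less_irrefl)
qed

text \<open>With the other observations fixed, observation \<open>i\<close> is a function of the estimate \<open>m\<close>,
  and the numerator becomes a function of \<open>m\<close> alone.\<close>

lemma countable_skewness_fiber:
  fixes x :: "nat \<Rightarrow> real"
  assumes lam: "1 < lam" and i: "i < n"
  defines "u \<equiv> \<lambda>x j. x j - mu_hat lam n x"
  shows "countable {y. (\<Sum>j<n. spow lam (u (x(i := y)) j)) = 0 \<and> (\<forall>j<n. u (x(i := y)) j \<noteq> 0) \<and>
    \<bar>u (x(i := y)) i\<bar> * (\<Sum>j\<in>{..<n} - {i}. \<bar>u (x(i := y)) j\<bar> powr (lam - 1 - 1))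
      \<noteq> (\<Sum>j\<in>{..<n} - {i}. \<bar>u (x(i := y)) j\<bar> powr (lam - 1))}" (is "countable ?F")
proof -
  let ?J = "{..<n} - {i}"
  define A where "A m = (\<Sum>j\<in>?J. spow (lam - 1) (x j - m))" for m
  \<comment> \<open>The score equation gives \<open>spow (lam - 1) (z i - m) = - A m\<close>, and
    the power \<open>q\<close> of this is \<open>spow lam (z i - m)\<close>. So \<open>G\<close> is
    the skewness numerator with observation \<open>i\<close> eliminated.\<close>
  define q where "q = lam / (lam - 1)"
  define G where "G m = (\<Sum>j\<in>?J. spow lam (x j - m)) + spow q (- A m)" for m
  let ?Z = "{m. G m = 0 \<and> (\<exists>D. D \<noteq> 0 \<and> (G has_real_derivative D) (at m))}"
  have n: "0 < n" using i by simp
  have "?F \<subseteq> (\<lambda>m. m + spow (1 / (lam - 1)) (- A m)) ` ?Z"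
  proof
    fix y assume y: "y \<in> ?F"
    define z where "z = x(i := y)"
    define m where "m = mu_hat lam n z"
    have zj: "z j = x j" if "j \<in> ?J" for j using that by (simp add: z_def)
    have uz: "u z j = z j - m" for j by (simp add: u_def m_def)
    have y0: "(\<Sum>j<n. spow lam (z j - m)) = 0" and y1: "\<And>j. j < n \<Longrightarrow> z j - m \<noteq> 0"
      and y2: "\<bar>z i - m\<bar> * (\<Sum>j\<in>?J. \<bar>x j - m\<bar> powr (lam - 1 - 1)) \<noteq> (\<Sum>j\<in>?J. \<bar>x j - m\<bar> powr (lam - 1))"
    proof -
      have y': "(\<Sum>j<n. spow lam (u z j)) = 0 \<and> (\<forall>j<n. u z j \<noteq> 0) \<and>
          \<bar>u z i\<bar> * (\<Sum>j\<in>?J. \<bar>u z j\<bar> powr (lam - 1 - 1)) \<noteq> (\<Sum>j\<in>?J. \<bar>u z j\<bar> powr (lam - 1))"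
        using y unfolding z_def mem_Collect_eq .
      have s: "(\<Sum>j\<in>?J. \<bar>z j - m\<bar> powr r) = (\<Sum>j\<in>?J. \<bar>x j - m\<bar> powr r)" for r
        by (rule sum.cong) (simp_all add: zj)
      show "(\<Sum>j<n. spow lam (z j - m)) = 0" "\<And>j. j < n \<Longrightarrow> z j - m \<noteq> 0"
        "\<bar>z i - m\<bar> * (\<Sum>j\<in>?J. \<bar>x j - m\<bar> powr (lam - 1 - 1)) \<noteq> (\<Sum>j\<in>?J. \<bar>x j - m\<bar> powr (lam - 1))"
        using y' unfolding uz s by blast+
    qed
    have split: "(\<Sum>j<n. f (z j)) = f (z i) + (\<Sum>j\<in>?J. f (x j))" for f :: "real \<Rightarrow> real"
      using i zj by (simp add: sum.remove[of "{..<n}" i])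
    have "spow (lam - 1) (z i - m) + A m = 0"
      using mu_hat_zero(1)[OF lam n, of z] split[of "\<lambda>w. spow (lam - 1) (w - m)"] by (simp add: m_def A_def)
    then have sA: "- A m = spow (lam - 1) (z i - m)" by simp
    then have zi: "z i - m = spow (1 / (lam - 1)) (- A m)" using lam by (simp add: spow_inverse)
    have A0: "- A m \<noteq> 0" using y1[OF i] zi by auto
    have sq: "spow q (- A m) = spow lam (z i - m)"
    proof -
      have "spow q (spow (lam - 1) w) = spow lam w" for w
      proof (cases w "0::real" rule: linorder_cases)
        case less then show ?thesis using lam by (simp add: spow_neg spow_pos powr_powr q_def)
      next
        case greater then show ?thesis using lam by (simp add: spow_neg spow_pos powr_powr q_def)
      qed simp
      then show ?thesis by (simp add: sA)
    qed
    have G0: "G m = 0" using y0 split[of "\<lambda>w. spow lam (w - m)"] sq by (simp add: G_def)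
    have shift: "((\<lambda>m. spow p (x j - m)) has_real_derivative - (p * \<bar>x j - m\<bar> powr (p - 1))) (at m)" if j: "j \<in> ?J" for j p
    proof -
      have "x j - m \<noteq> 0" using y1[of j] j zj[OF j] by auto
      then have "((\<lambda>m. spow p (x j - m)) has_real_derivative (p * \<bar>x j - m\<bar> powr (p - 1)) * (- 1)) (at m)"
        by (intro DERIV_chain2[where f = "spow p" and g = "\<lambda>m. x j - m"] DERIV_spow)
          (auto intro!: derivative_eq_intros)
      then show ?thesis by simp
    qed
    have dA: "((\<lambda>m. - A m) has_real_derivative - (\<Sum>j\<in>?J. - ((lam - 1) * \<bar>x j - m\<bar> powr (lam - 1 - 1)))) (at m)"
      unfolding A_def by (intro DERIV_minus DERIV_sum shift)
    have dq: "((\<lambda>m. spow q (- A m)) has_real_derivative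
        (q * \<bar>- A m\<bar> powr (q - 1)) * - (\<Sum>j\<in>?J. - ((lam - 1) * \<bar>x j - m\<bar> powr (lam - 1 - 1)))) (at m)"
      by (rule DERIV_chain2[where f = "spow q" and g = "\<lambda>m. - A m", OF DERIV_spow[OF A0] dA])
    have dG: "(G has_real_derivative (\<Sum>j\<in>?J. - (lam * \<bar>x j - m\<bar> powr (lam - 1))) +
        (q * \<bar>- A m\<bar> powr (q - 1)) * - (\<Sum>j\<in>?J. - ((lam - 1) * \<bar>x j - m\<bar> powr (lam - 1 - 1)))) (at m)"
      unfolding G_def by (intro DERIV_add DERIV_sum shift dq)
    \<comment> \<open>The chain-rule factor becomes the residual of observation \<open>i\<close>, so
      the derivative of \<open>G\<close> is \<open>lam\<close> times the imbalance excluded in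
      \<open>abs_eq_of_balanced\<close>.\<close>
    have "\<bar>- A m\<bar> powr (q - 1) = \<bar>z i - m\<bar>"
    proof -
      have "q - 1 = 1 / (lam - 1)" using lam by (simp add: q_def field_simps)
      then have "\<bar>- A m\<bar> powr (q - 1) = \<bar>spow (1 / (lam - 1)) (- A m)\<bar>" by (simp only: abs_spow)
      then show ?thesis by (simp only: zi)
    qed
    moreover have "q * (lam - 1) = lam" using lam by (simp add: q_def)
    ultimately have eq: "(\<Sum>j\<in>?J. - (lam * \<bar>x j - m\<bar> powr (lam - 1))) +
        (q * \<bar>- A m\<bar> powr (q - 1)) * - (\<Sum>j\<in>?J. - ((lam - 1) * \<bar>x j - m\<bar> powr (lam - 1 - 1)))
      = lam * (\<bar>z i - m\<bar> * (\<Sum>j\<in>?J. \<bar>x j - m\<bar> powr (lam - 1 - 1)) - (\<Sum>j\<in>?J. \<bar>x j - m\<bar> powr (lam - 1)))"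
      by (simp add: sum_negf sum_distrib_left[symmetric] right_diff_distrib)
    have "lam * (\<bar>z i - m\<bar> * (\<Sum>j\<in>?J. \<bar>x j - m\<bar> powr (lam - 1 - 1)) - (\<Sum>j\<in>?J. \<bar>x j - m\<bar> powr (lam - 1))) \<noteq> 0"
      using y2 lam by simp
    then have "m \<in> ?Z" using G0 dG[unfolded eq] by (intro CollectI conjI exI)
    moreover have "y = m + spow (1 / (lam - 1)) (- A m)" using zi by (simp add: z_def)
    ultimately show "y \<in> (\<lambda>m. m + spow (1 / (lam - 1)) (- A m)) ` ?Z" by blast
  qed
  then show ?thesis by (rule countable_subset) (intro countable_image countable_simple_zeros)
qed

text \<open>Three observations are really needed: for \<open>n = 2\<close> the residuals are
  opposite and the numerator is always 0. For \<open>lam = 1\<close> the third observation is one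
  that does not enter the median; for \<open>lam > 1\<close> it forces two of three residuals with
  equal absolute value to coincide.\<close>

lemma (in prob_space) AE_skewness_numerator_neq_0:
  fixes X :: "nat \<Rightarrow> 'a \<Rightarrow> real"
  assumes lam: "1 \<le> lam" and n: "3 \<le> n" and ind: "indep_vars (\<lambda>_. borel) X UNIV"
    and noatom: "\<And>i c. emeasure (distr M borel (X i)) {c} = 0"
  shows "AE \<omega> in M. (\<Sum>j<n. spow lam (X j \<omega> - mu_hat lam n (\<lambda>i. X i \<omega>))) \<noteq> 0"
proof -
  let ?P = "PiM {..<n} (\<lambda>_. borel :: real measure)"
  have ind': "indep_vars (\<lambda>_. borel) X {..<n}" using ind by (rule indep_vars_subset) auto
  note [measurable] = PiM_component_measurable
  have muP[measurable]: "(\<lambda>x. mu_hat lam n x) \<in> borel_measurable ?P"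
    using mu_hat_measurable[OF lam, of n "\<lambda>i x. x i" ?P] PiM_component_measurable by simp
  have restr: "mu_hat lam n (\<lambda>k\<in>{..<n}. X k \<omega>) = mu_hat lam n (\<lambda>i. X i \<omega>)" for \<omega>
    by (rule mu_hat_cong) simp
  note fibers = AE_not_in_countable_fibers[OF finite_lessThan _ ind' noatom]
  show ?thesis
  proof (cases "lam = 1")
    case True
    define S where "S = {(i, a, b). i < n \<and> a < n \<and> b < n \<and> i \<noteq> a \<and> i \<noteq> b}"
    have "AE \<omega> in M. (\<Sum>j<n. X j \<omega>) \<noteq> real n * ((X a \<omega> + X b \<omega>) / 2)" if s: "i < n" "a < n" "b < n" "i \<noteq> a" "i \<noteq> b" for i a b
    proof -
      let ?A = "{x \<in> space ?P. (\<Sum>j<n. x j) = real n * ((x a + x b) / 2)}"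
      have "AE \<omega> in M. (\<lambda>k\<in>{..<n}. X k \<omega>) \<notin> ?A"
      proof (rule fibers[of i])
        show "?A \<in> sets ?P" using s by measurable
        fix x :: "nat \<Rightarrow> real"
        have "{y. x(i := y) \<in> ?A} \<subseteq> {real n * ((x a + x b) / 2) - (\<Sum>j\<in>{..<n} - {i}. x j)}"
        proof
          fix y assume "y \<in> {y. x(i := y) \<in> ?A}"
          then have "(\<Sum>j<n. (x(i := y)) j) = real n * ((x a + x b) / 2)" using s by simp
          moreover have "(\<Sum>j<n. (x(i := y)) j) = y + (\<Sum>j\<in>{..<n} - {i}. x j)"
            using s by (simp add: sum.remove[of "{..<n}" i])
          ultimately show "y \<in> {real n * ((x a + x b) / 2) - (\<Sum>j\<in>{..<n} - {i}. x j)}" by simp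
        qed
        then show "countable {y. x(i := y) \<in> ?A}" by (rule countable_subset) simp
      qed (use s in simp)
      then show ?thesis by eventually_elim (use s in \<open>auto simp: space_PiM\<close>)
    qed
    then have "AE \<omega> in M. \<forall>i\<in>{..<n}. \<forall>a\<in>{..<n}. \<forall>b\<in>{..<n}. i \<noteq> a \<longrightarrow> i \<noteq> b \<longrightarrow> (\<Sum>j<n. X j \<omega>) \<noteq> real n * ((X a \<omega> + X b \<omega>) / 2)"
      by (intro AE_finite_allI finite_lessThan AE_impI) auto
    then show ?thesis
    proof eventually_elim
      \<comment> \<open>The median involves at most two observations, so the sum contains a third
        one, which is free in the linear relation.\<close>
      case (elim \<omega>)
      have n0: "0 < n" using n by simp
      obtain a b where ab: "a < n" "b < n" "sample_median n (\<lambda>i. X i \<omega>) = (X a \<omega> + X b \<omega>) / 2"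
        using sample_median_average[OF n0] by blast
      obtain i where i: "i < n" "i \<noteq> a" "i \<noteq> b"
      proof -
        have "\<exists>i\<in>{0, 1, 2::nat}. i \<noteq> a \<and> i \<noteq> b" by auto
        then obtain i where i: "i \<in> {0, 1, 2::nat}" "i \<noteq> a" "i \<noteq> b" by blast
        moreover have "i < n" using i(1) n by auto
        ultimately show thesis using that by blast
      qed
      have "(\<Sum>j<n. X j \<omega>) \<noteq> real n * ((X a \<omega> + X b \<omega>) / 2)" using elim ab i by simp
      then show ?case by (simp add: True spow_exponent_1 mu_hat_1 ab(3) sum_subtractf)
    qed
  next
    case False
    then have lam1: "1 < lam" using lam by simp
    have n0: "0 < n" using n by simp
    define u where "u x j = x j - mu_hat lam n x" for x :: "nat \<Rightarrow> real" and j
    have um: "(\<lambda>x. u x j) \<in> borel_measurable ?P" if "j < n" for j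
      unfolding u_def using that by measurable
    note [measurable] = um
    have E1: "AE \<omega> in M. X i \<omega> \<noteq> X j \<omega>" if ij: "i < n" "j < n" "i \<noteq> j" for i j
    proof -
      have "AE \<omega> in M. (\<lambda>k\<in>{..<n}. X k \<omega>) \<notin> {x \<in> space ?P. x i = x j}"
      proof (rule fibers[of i])
        show "{x \<in> space ?P. x i = x j} \<in> sets ?P" using ij by measurable
        show "countable {y. x(i := y) \<in> {x \<in> space ?P. x i = x j}}" for x
          by (rule countable_subset[of _ "{x j}"]) (use ij in auto)
      qed (use ij in simp)
      then show ?thesis by eventually_elim (use ij in \<open>auto simp: space_PiM\<close>)
    qed
    \<comment> \<open>If observation \<open>i\<close> equals the estimate, it is a root of the score
      of the remaining observations, and such a root is unique.\<close>
    have E2: "AE \<omega> in M. u (\<lambda>i. X i \<omega>) i \<noteq> 0" if i: "i < n" for i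
    proof -
      have "AE \<omega> in M. (\<lambda>k\<in>{..<n}. X k \<omega>) \<notin> {x \<in> space ?P. u x i = 0}"
      proof (rule fibers[of i])
        show "{x \<in> space ?P. u x i = 0} \<in> sets ?P" using i by measurable
        fix x :: "nat \<Rightarrow> real"
        let ?f = "\<lambda>y. \<Sum>j\<in>{..<n} - {i}. spow (lam - 1) (x j - y)"
        have z: "?f y = 0" if "y \<in> {y. x(i := y) \<in> {x \<in> space ?P. u x i = 0}}" for y
        proof -
          from that have y: "y = mu_hat lam n (x(i := y))" by (simp add: u_def)
          have "(\<Sum>j<n. spow (lam - 1) ((x(i := y)) j - y)) = 0"
            using mu_hat_zero(1)[OF lam1 n0, of "x(i := y)"] y by simp
          then show ?thesis using i by (simp add: sum.remove[of "{..<n}" i])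
        qed
        obtain k where k: "k \<in> {..<n} - {i}"
        proof -
          have "(if i = 0 then 1 else 0) \<in> {..<n} - {i}" using n by auto
          then show thesis by (rule that)
        qed
        have dec: "?f b < ?f a" if "a < b" for a b
          using k that lam1 by (intro sum_strict_mono spow_strict_mono) auto
        define F where "F = {y. x(i := y) \<in> {x \<in> space ?P. u x i = 0}}"
        have uniq: "y = y'" if "y \<in> F" "y' \<in> F" for y y'
          using dec[of y y'] dec[of y' y] z that unfolding F_def by (cases y y' rule: linorder_cases) auto
        have "countable F"
        proof (cases "F = {}")
          case False
          then obtain c where "c \<in> F" by auto
          then have "F \<subseteq> {c}" using uniq by auto
          then show ?thesis by (rule countable_subset) simp
        qed simp
        then show "countable {y. x(i := y) \<in> {x \<in> space ?P. u x i = 0}}" unfolding F_def .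
      qed (use i in simp)
      then show ?thesis by eventually_elim (use i in \<open>auto simp: space_PiM u_def restr\<close>)
    qed
    define B where "B i x \<longleftrightarrow> (\<Sum>j<n. spow lam (u x j)) = 0 \<and> (\<forall>j<n. u x j \<noteq> 0) \<and>
      \<bar>u x i\<bar> * (\<Sum>j\<in>{..<n} - {i}. \<bar>u x j\<bar> powr (lam - 1 - 1)) \<noteq> (\<Sum>j\<in>{..<n} - {i}. \<bar>u x j\<bar> powr (lam - 1))" for i x
    have u_restr: "u (\<lambda>k\<in>{..<n}. X k \<omega>) j = u (\<lambda>i. X i \<omega>) j" if "j < n" for j \<omega>
      using that by (simp add: u_def restr)
    have E3: "AE \<omega> in M. \<not> B i (\<lambda>i. X i \<omega>)" if i: "i < n" for i
    proof -
      have "AE \<omega> in M. (\<lambda>k\<in>{..<n}. X k \<omega>) \<notin> {x \<in> space ?P. B i x}"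
      proof (rule fibers[of i])
        define f where "f x = (\<Sum>j<n. spow lam (u x j))" for x
        define g where "g x = \<bar>u x i\<bar> * (\<Sum>j\<in>{..<n} - {i}. \<bar>u x j\<bar> powr (lam - 1 - 1))" for x
        define h where "h x = (\<Sum>j\<in>{..<n} - {i}. \<bar>u x j\<bar> powr (lam - 1))" for x
        have w: "(\<lambda>x. \<bar>u x j\<bar> powr r) \<in> borel_measurable ?P" if "j < n" for j r
          using um[OF that] by measurable
        have f[measurable]: "f \<in> borel_measurable ?P"
          unfolding f_def by (intro borel_measurable_sum measurable_compose[OF um spow_measurable]) simp
        have g[measurable]: "g \<in> borel_measurable ?P"
          unfolding g_def using i by (intro borel_measurable_times borel_measurable_abs borel_measurable_sum w um) auto
        have h[measurable]: "h \<in> borel_measurable ?P"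
          unfolding h_def by (intro borel_measurable_sum w) auto
        have S1: "{x \<in> space ?P. f x = 0} \<in> sets ?P" by measurable
        have S2: "{x \<in> space ?P. \<forall>j\<in>{..<n}. u x j \<noteq> 0} \<in> sets ?P"
        proof (rule sets.sets_Collect_finite_All)
          fix j assume "j \<in> {..<n}"
          then have [measurable]: "(\<lambda>x. u x j) \<in> borel_measurable ?P" using um by simp
          show "{x \<in> space ?P. u x j \<noteq> 0} \<in> sets ?P" by measurable
        qed simp
        have "{x \<in> space ?P. g x - h x \<noteq> 0} \<in> sets ?P" by measurable
        then have S3: "{x \<in> space ?P. g x \<noteq> h x} \<in> sets ?P" by simp
        have "{x \<in> space ?P. B i x} = {x \<in> space ?P. f x = 0} \<inter> {x \<in> space ?P. \<forall>j\<in>{..<n}. u x j \<noteq> 0}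
            \<inter> {x \<in> space ?P. g x \<noteq> h x}"
          unfolding B_def f_def g_def h_def
          by (rule set_eqI) (simp only: mem_Collect_eq Int_iff lessThan_iff Ball_def, blast)
        from sets.Int[OF sets.Int[OF S1 S2] S3, folded this]
        show "{x \<in> space ?P. B i x} \<in> sets ?P" .
        show "countable {y. x(i := y) \<in> {x \<in> space ?P. B i x}}" for x
          by (rule countable_subset[OF _ countable_skewness_fiber[OF lam1 i, of x]]) (auto simp: B_def u_def)
      qed (use i in simp)
      then show ?thesis
      proof eventually_elim
        case (elim \<omega>)
        have "B i (\<lambda>k\<in>{..<n}. X k \<omega>) \<longleftrightarrow> B i (\<lambda>i. X i \<omega>)"
        proof -
          have "(\<Sum>j<n. spow lam (u (\<lambda>k\<in>{..<n}. X k \<omega>) j)) = (\<Sum>j<n. spow lam (u (\<lambda>i. X i \<omega>) j))"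
            by (rule sum.cong) (simp_all add: u_restr)
          moreover have "(\<Sum>j\<in>{..<n} - {i}. \<bar>u (\<lambda>k\<in>{..<n}. X k \<omega>) j\<bar> powr p)
              = (\<Sum>j\<in>{..<n} - {i}. \<bar>u (\<lambda>i. X i \<omega>) j\<bar> powr p)" for p
            by (rule sum.cong) (simp_all add: u_restr)
          moreover have "(\<forall>j<n. u (\<lambda>k\<in>{..<n}. X k \<omega>) j \<noteq> 0) \<longleftrightarrow> (\<forall>j<n. u (\<lambda>i. X i \<omega>) j \<noteq> 0)"
            using u_restr by auto
          ultimately show ?thesis unfolding B_def u_restr[OF i] by (simp only:)
        qed
        then show ?case using elim by (auto simp: space_PiM)
      qed
    qed
    have "AE \<omega> in M. (\<forall>i\<in>{..<n}. \<forall>j\<in>{..<n}. i \<noteq> j \<longrightarrow> X i \<omega> \<noteq> X j \<omega>)"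
      using E1 by (intro AE_finite_allI finite_lessThan AE_impI) auto
    moreover have "AE \<omega> in M. (\<forall>i\<in>{..<n}. u (\<lambda>i. X i \<omega>) i \<noteq> 0)"
      using E2 by (intro AE_finite_allI) auto
    moreover have "AE \<omega> in M. (\<forall>i\<in>{..<n}. \<not> B i (\<lambda>i. X i \<omega>))"
      using E3 by (intro AE_finite_allI) auto
    ultimately show ?thesis
    proof eventually_elim
      case (elim \<omega>)
      let ?u = "u (\<lambda>i. X i \<omega>)"
      show ?case
      proof
        assume z: "(\<Sum>j<n. spow lam (X j \<omega> - mu_hat lam n (\<lambda>i. X i \<omega>))) = 0"
        have u0: "?u i \<noteq> 0" if "i < n" for i using elim that by simp
        have bal: "\<bar>?u i\<bar> * (\<Sum>j\<in>{..<n} - {i}. \<bar>?u j\<bar> powr (lam - 1 - 1)) = (\<Sum>j\<in>{..<n} - {i}. \<bar>?u j\<bar> powr (lam - 1))"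
          if "i < n" for i
          using elim(3) that z u0 unfolding B_def by (auto simp: u_def)
        have abs: "\<bar>?u i\<bar> = \<bar>?u j\<bar>" if "i < n" "j < n" for i j
          using abs_eq_of_balanced[of n ?u "lam - 1", OF u0 bal that] .
        have ne: "?u i \<noteq> ?u j" if "i < n" "j < n" "i \<noteq> j" for i j
          using elim that by (auto simp: u_def)
        \<comment> \<open>Among three distinct numbers of equal absolute value the second and the
          third would both be the negative of the first.\<close>
        have "?u 0 = - ?u 1" "?u 0 = - ?u 2" "?u 1 \<noteq> ?u 2"
          using abs[of 0 1] abs[of 0 2] ne[of 0 1] ne[of 0 2] ne[of 1 2] n by (auto simp: abs_eq_iff)
        then show False by simp
      qed
    qed
  qed
qed

section \<open>Influence functions\<close>

lemma spow_mult_spow: "spow p y * spow q y = \<bar>y\<bar> powr (p + q)"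
proof (cases "y = 0")
  case False
  then have "sgn y * sgn y = 1" by (simp add: sgn_mult[symmetric])
  then show ?thesis by (simp add: spow_def powr_add mult_ac)
qed simp

text \<open>Continuity at one point of positivity yields an interval of positivity, which is not a
  null set because the density is positive. This is the source of positivity for \<open>E_K\<close>,
  \<open>V_S\<close> and \<open>V_K\<close>.\<close>

lemma integral_epd_pos:
  fixes g :: "real \<Rightarrow> real"
  assumes lam: "0 < lam" and i: "integrable (epd lam) g" and nn: "\<And>y. 0 \<le> g y"
    and pos: "0 < g a" and c: "isCont g a"
  shows "0 < (\<integral>y. g y \<partial>epd lam)"
proof (rule ccontr)
  have m[measurable]: "g \<in> borel_measurable borel" using i borel_measurable_integrable by fastforce
  assume "\<not> ?thesis"
  moreover have "0 \<le> (\<integral>y. g y \<partial>epd lam)" using nn by simp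
  ultimately have "(\<integral>y. g y \<partial>epd lam) = 0" by simp
  then have "AE y in epd lam. g y = 0" using integral_nonneg_eq_0_iff_AE[OF i] nn by simp
  then have "AE y in lborel. g y = 0"
    unfolding epd_def by (subst (asm) AE_density) (auto simp: EPD_density_pos[OF lam])
  then have null: "{y. g y \<noteq> 0} \<in> null_sets lborel"
    by (subst AE_iff_null_sets) auto
  have "\<forall>\<^sub>F y in at a. 0 < g y" using c pos by (auto simp: isCont_def intro: order_tendstoD)
  then obtain e where e: "0 < e" "\<And>y. y \<noteq> a \<Longrightarrow> dist y a < e \<Longrightarrow> 0 < g y" unfolding eventually_at by auto
  have "{a<..<a+e} \<subseteq> {y. g y \<noteq> 0}"
  proof
    fix y assume "y \<in> {a<..<a+e}"
    then have "0 < g y" by (intro e(2)) (auto simp: dist_real_def)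
    then show "y \<in> {y. g y \<noteq> 0}" by simp
  qed
  then have "{a<..<a+e} \<in> null_sets lborel" using null by (rule null_sets_subset[rotated -1]) auto
  then show False using e(1) by (simp add: null_sets_def)
qed

text \<open>The numerator is the mean derivative of \<open>spow lam\<close>, the denominator the
  Fisher information: a location error changes the mean of \<open>spow lam\<close> by this multiple
  of the mean score.\<close>

definition score_slope :: "real \<Rightarrow> real" where
  "score_slope lam = lam * epd_moment lam (lam - 1) / epd_moment lam (2 * lam - 2)"

text \<open>By \<open>epd_moment_double_minus_1\<close>, \<open>score_slope lam\<close> is also the
  regression coefficient of \<open>spow lam\<close> on the score, so this is the part of
  \<open>spow lam\<close> uncorrelated with the score.\<close>

definition S_influence :: "real \<Rightarrow> real \<Rightarrow> real" where
  "S_influence lam y = spow lam y - score_slope lam * spow (lam - 1) y"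

text \<open>Equal to \<open>(logpow lam y - E_K lam) - (E_K lam + 1 / lam) * (\<bar>y\<bar> powr lam
  - 1)\<close>, where the coefficients are the partial derivatives of
  \<open>l / m - ln m / lam\<close> at \<open>l = E_K lam\<close>, \<open>m = 1\<close>.\<close>

definition K_influence :: "real \<Rightarrow> real \<Rightarrow> real" where
  "K_influence lam y = logpow lam y - (E_K lam + 1 / lam) * \<bar>y\<bar> powr lam + 1 / lam"

lemma influence_measurable [measurable]:
  "S_influence lam \<in> borel_measurable borel" "K_influence lam \<in> borel_measurable borel"
  unfolding S_influence_def[abs_def] K_influence_def[abs_def] by measurable

context
  fixes lam :: real
  assumes lam: "1 \<le> lam"
begin

lemma lam_gt_0: "0 < lam" using lam by simp

lemma Gamma_lam_gt_0: "0 < Gamma (1 / lam)" using lam_gt_0 by (rule Gamma_inverse_pos)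

lemma epd_moment_pos: "-1 < p \<Longrightarrow> 0 < epd_moment lam p"
  unfolding epd_moment_def using lam_gt_0
  by (intro divide_pos_pos mult_pos_pos) (auto intro!: Gamma_real_pos divide_pos_pos)

lemma epd_moment_lam: "epd_moment lam lam = 1"
proof -
  have "(lam + 1) / lam = 1 + 1 / lam" using lam_gt_0 by (simp add: field_simps)
  then show ?thesis using lam_gt_0 less_imp_neq[OF Gamma_lam_gt_0] by (simp add: epd_moment_def Gamma_one_plus_inverse)
qed

lemma epd_moment_double: "epd_moment lam (2 * lam) = lam + 1"
proof -
  have e: "(2 * lam + 1) / lam = (1 + 1 / lam) + 1" using lam_gt_0 by (simp add: field_simps)
  have "0 < 1 + 1 / lam" using lam_gt_0 by (simp add: add_pos_pos)
  then have "1 + 1 / lam \<notin> \<int>\<^sub>\<le>\<^sub>0" using nonpos_Ints_nonpos[of "1 + 1 / lam"] by force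
  then have "Gamma ((2 * lam + 1) / lam) = (1 + 1 / lam) * (Gamma (1 / lam) / lam)"
    unfolding e by (subst Gamma_plus1) (simp_all add: Gamma_one_plus_inverse[OF lam_gt_0])
  moreover have "lam powr (2 * lam / lam) = lam * lam"
    using lam_gt_0 powr_add[of lam 1 1] by simp
  ultimately show ?thesis using lam_gt_0 less_imp_neq[OF Gamma_lam_gt_0] by (simp add: epd_moment_def field_simps)
qed

lemma epd_moment_lam_minus_1: "epd_moment lam (lam - 1) = lam powr ((lam - 1) / lam) / Gamma (1 / lam)"
  using lam_gt_0 by (simp add: epd_moment_def)

lemma epd_moment_double_minus_1: "epd_moment lam (2 * lam - 1) = lam * epd_moment lam (lam - 1)"
proof -
  have "(2 * lam - 1) / lam = 1 + (lam - 1) / lam" using lam_gt_0 by (simp add: field_simps)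
  then have "lam powr ((2 * lam - 1) / lam) = lam * lam powr ((lam - 1) / lam)"
    using lam_gt_0 by (simp only: powr_add) simp
  moreover have "(2 * lam - 1 + 1) / lam = 2" using lam_gt_0 by simp
  moreover have "Gamma (2::real) = 1" using Gamma_fact[of 1, where 'a = real] by simp
  ultimately show ?thesis by (simp add: epd_moment_lam_minus_1) (simp add: epd_moment_def)
qed

text \<open>The variance removed by projecting out the score is \<open>lam\<^sup>2\<close> times
  this ratio; it explains the product of Gamma values in \<open>V_S\<close>.\<close>

lemma moment_ratio:
  "(epd_moment lam (lam - 1))\<^sup>2 / epd_moment lam (2 * lam - 2) = 1 / (Gamma (2 - 1 / lam) * Gamma (1 / lam))"
proof -
  have e: "(2 * lam - 1) / lam = 2 - 1 / lam" using lam_gt_0 by (simp add: field_simps)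
  have "(lam powr ((lam - 1) / lam))\<^sup>2 = lam powr ((2 * lam - 2) / lam)"
    by (simp add: power2_eq_square powr_add[symmetric] add_divide_distrib[symmetric])
  moreover have "0 < lam powr ((2 * lam - 2) / lam)" using lam_gt_0 by simp
  ultimately show ?thesis using less_imp_neq[OF Gamma_lam_gt_0]
    unfolding epd_moment_lam_minus_1 by (simp add: epd_moment_def e power_divide power2_eq_square)
qed

lemma integrable_abs_powr: "-1 < p \<Longrightarrow> integrable (epd lam) (\<lambda>y. \<bar>y\<bar> powr p)"
  by (rule integrable_epd_powr[OF lam_gt_0])

lemma S_influence_square:
  "(S_influence lam y)\<^sup>2 = \<bar>y\<bar> powr (2 * lam) - 2 * (score_slope lam) * \<bar>y\<bar> powr (2 * lam - 1) + (score_slope lam)\<^sup>2 * \<bar>y\<bar> powr (2 * lam - 2)"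
proof -
  have "(S_influence lam y)\<^sup>2 = spow lam y * spow lam y - 2 * (score_slope lam) * (spow lam y * spow (lam - 1) y)
      + (score_slope lam)\<^sup>2 * (spow (lam - 1) y * spow (lam - 1) y)"
    by (simp add: S_influence_def power2_eq_square algebra_simps)
  then show ?thesis by (simp add: spow_mult_spow algebra_simps)
qed

lemma S_influence_moments:
  shows "(\<integral>y. S_influence lam y \<partial>epd lam) = 0"
    and "integrable (epd lam) (\<lambda>y. (S_influence lam y)\<^sup>2)"
    and "(\<integral>y. (S_influence lam y)\<^sup>2 \<partial>epd lam) = V_S lam"
proof -
  show "(\<integral>y. S_influence lam y \<partial>epd lam) = 0"
    by (rule integral_epd_odd) (auto simp: S_influence_def)
  have i: "integrable (epd lam) (\<lambda>y. \<bar>y\<bar> powr (2 * lam))" "integrable (epd lam) (\<lambda>y. \<bar>y\<bar> powr (2 * lam - 1))"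
    "integrable (epd lam) (\<lambda>y. \<bar>y\<bar> powr (2 * lam - 2))"
    using lam by (auto intro!: integrable_abs_powr)
  show "integrable (epd lam) (\<lambda>y. (S_influence lam y)\<^sup>2)"
    unfolding S_influence_square using i by simp
  let ?m = "epd_moment lam (lam - 1)" and ?Q = "epd_moment lam (2 * lam - 2)"
  have Q: "0 < ?Q" using lam by (intro epd_moment_pos) auto
  have "(\<integral>y. (S_influence lam y)\<^sup>2 \<partial>epd lam) = (lam + 1) - 2 * (score_slope lam) * (lam * ?m) + (score_slope lam)\<^sup>2 * ?Q"
    unfolding S_influence_square using i lam
    by (simp add: integral_epd_powr lam_gt_0 epd_moment_double epd_moment_double_minus_1)
  also have "\<dots> = 1 + lam - lam\<^sup>2 * (?m\<^sup>2 / ?Q)"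
    using Q by (simp add: score_slope_def power2_eq_square field_simps)
  also have "\<dots> = V_S lam" unfolding moment_ratio V_S_def by simp
  finally show "(\<integral>y. (S_influence lam y)\<^sup>2 \<partial>epd lam) = V_S lam" .
qed

lemma Digamma_shift:
  "Digamma ((lam + 1) / lam) = Digamma (1 / lam) + lam"
  "Digamma ((2 * lam + 1) / lam) = Digamma ((lam + 1) / lam) + lam / (lam + 1)"
  "Polygamma 1 ((2 * lam + 1) / lam) = Polygamma 1 (1 + 1 / lam) - (lam / (lam + 1))\<^sup>2"
proof -
  have e1: "(lam + 1) / lam = 1 / lam + 1" and e2: "(2 * lam + 1) / lam = (1 / lam + 1) + 1"
    using lam_gt_0 by (simp_all add: field_simps)
  have e3: "1 / (1 / lam + 1) = lam / (lam + 1)" "1 / lam + 1 \<noteq> 0" using lam_gt_0 by (simp_all add: field_simps)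
  show "Digamma ((lam + 1) / lam) = Digamma (1 / lam) + lam"
    unfolding e1 using lam_gt_0 by (subst Digamma_plus1) auto
  show "Digamma ((2 * lam + 1) / lam) = Digamma ((lam + 1) / lam) + lam / (lam + 1)"
    unfolding e1 e2 by (subst Digamma_plus1[OF e3(2)]) (simp add: e3(1))
  have "Polygamma 1 (1 / lam + 1 + 1) = Polygamma 1 (1 / lam + 1) - 1 / (1 / lam + 1)\<^sup>2"
    by (subst Polygamma_plus1[OF e3(2)]) (simp add: power2_eq_square)
  also have "1 / (1 / lam + 1)\<^sup>2 = (lam / (lam + 1))\<^sup>2"
    unfolding e3(1)[symmetric] by (simp add: power_one_over)
  finally show "Polygamma 1 ((2 * lam + 1) / lam) = Polygamma 1 (1 + 1 / lam) - (lam / (lam + 1))\<^sup>2"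
    unfolding e2 by (simp add: add.commute)
qed

lemma log_factor_lam: "epd_log_factor lam lam = E_K lam"
  unfolding epd_log_factor_def Digamma_shift(1) E_K_def by (simp add: add_ac)

lemma log_factor_double: "epd_log_factor lam (2 * lam) = E_K lam + 1 / (lam + 1)"
proof -
  have "epd_log_factor lam (2 * lam) = epd_log_factor lam lam + (lam / (lam + 1)) / lam"
    unfolding epd_log_factor_def Digamma_shift(2) by (simp add: add_divide_distrib)
  then show ?thesis using lam_gt_0 by (simp add: log_factor_lam)
qed

lemma logpow_integrable: "integrable (epd lam) (logpow lam)"
  using integrable_epd_powr_ln[OF lam_gt_0, of lam 1] lam_gt_0 by (simp add: logpow_def[abs_def])

lemma integral_logpow: "(\<integral>y. logpow lam y \<partial>epd lam) = E_K lam"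
  unfolding logpow_def using integral_epd_powr_ln[OF lam_gt_0, of lam] lam_gt_0 by (simp add: epd_moment_lam log_factor_lam)

lemma logpow_products:
  "(logpow lam y)\<^sup>2 = \<bar>y\<bar> powr (2 * lam) * (ln \<bar>y\<bar>)\<^sup>2"
  "logpow lam y * \<bar>y\<bar> powr lam = \<bar>y\<bar> powr (2 * lam) * ln \<bar>y\<bar>"
  "(\<bar>y\<bar> powr lam)\<^sup>2 = \<bar>y\<bar> powr (2 * lam)"
  using powr_add[of "\<bar>y\<bar>" lam lam] by (simp_all add: logpow_def power2_eq_square mult_ac)

lemma K_influence_moments:
  shows "(\<integral>y. K_influence lam y \<partial>epd lam) = 0"
    and "integrable (epd lam) (\<lambda>y. (K_influence lam y)\<^sup>2)"
    and "(\<integral>y. (K_influence lam y)\<^sup>2 \<partial>epd lam) = V_K lam"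
proof -
  interpret E: prob_space "epd lam" by (rule prob_space_epd[OF lam_gt_0])
  define b where "b = E_K lam + 1 / lam"
  note i1 = logpow_integrable
  have i2: "integrable (epd lam) (\<lambda>y. \<bar>y\<bar> powr lam)" using lam_gt_0 by (intro integrable_abs_powr) auto
  have l2: "-1 < 2 * lam" using lam_gt_0 by simp
  have i3: "integrable (epd lam) (\<lambda>y. \<bar>y\<bar> powr (2 * lam))" by (rule integrable_abs_powr[OF l2])
  have i4: "integrable (epd lam) (\<lambda>y. \<bar>y\<bar> powr (2 * lam) * ln \<bar>y\<bar>)" using integrable_epd_powr_ln[OF lam_gt_0 l2, of 1] by simp
  have i5: "integrable (epd lam) (\<lambda>y. \<bar>y\<bar> powr (2 * lam) * (ln \<bar>y\<bar>)\<^sup>2)" by (rule integrable_epd_powr_ln[OF lam_gt_0 l2])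
  have I2: "(\<integral>y. \<bar>y\<bar> powr lam \<partial>epd lam) = 1" using lam_gt_0 by (simp add: integral_epd_powr epd_moment_lam)
  have I3: "(\<integral>y. \<bar>y\<bar> powr (2 * lam) \<partial>epd lam) = lam + 1" using lam_gt_0 by (simp add: integral_epd_powr epd_moment_double)
  have I4: "(\<integral>y. \<bar>y\<bar> powr (2 * lam) * ln \<bar>y\<bar> \<partial>epd lam) = (lam + 1) * (E_K lam + 1 / (lam + 1))"
    by (simp add: integral_epd_powr_ln[OF lam_gt_0 l2] epd_moment_double log_factor_double)
  have I5: "(\<integral>y. \<bar>y\<bar> powr (2 * lam) * (ln \<bar>y\<bar>)\<^sup>2 \<partial>epd lam)
      = (lam + 1) * ((E_K lam + 1 / (lam + 1))\<^sup>2 + (Polygamma 1 (1 + 1 / lam) - (lam / (lam + 1))\<^sup>2) / lam\<^sup>2)"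
    unfolding integral_epd_powr_ln_square[OF lam_gt_0 l2] epd_moment_double log_factor_double Digamma_shift(3) ..
  show "(\<integral>y. K_influence lam y \<partial>epd lam) = 0"
    unfolding K_influence_def using i1 i2 I2 E.prob_space by (simp add: integral_logpow)
  have sq: "(K_influence lam y)\<^sup>2 = \<bar>y\<bar> powr (2 * lam) * (ln \<bar>y\<bar>)\<^sup>2 + b\<^sup>2 * \<bar>y\<bar> powr (2 * lam) + (1 / lam)\<^sup>2
     - 2 * b * (\<bar>y\<bar> powr (2 * lam) * ln \<bar>y\<bar>) + 2 * (1 / lam) * logpow lam y - 2 * b * (1 / lam) * \<bar>y\<bar> powr lam" for y
  proof -
    have "(K_influence lam y)\<^sup>2 = (logpow lam y)\<^sup>2 + b\<^sup>2 * (\<bar>y\<bar> powr lam)\<^sup>2 + (1 / lam)\<^sup>2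
       - 2 * b * (logpow lam y * \<bar>y\<bar> powr lam) + 2 * (1 / lam) * logpow lam y - 2 * b * (1 / lam) * \<bar>y\<bar> powr lam"
      unfolding K_influence_def b_def[symmetric] by (simp add: power2_eq_square algebra_simps)
    then show ?thesis unfolding logpow_products .
  qed
  show "integrable (epd lam) (\<lambda>y. (K_influence lam y)\<^sup>2)"
    unfolding sq using i1 i2 i3 i4 i5 by simp
  have "(\<integral>y. (K_influence lam y)\<^sup>2 \<partial>epd lam)
     = (\<integral>y. \<bar>y\<bar> powr (2 * lam) * (ln \<bar>y\<bar>)\<^sup>2 \<partial>epd lam) + b\<^sup>2 * (lam + 1) + (1 / lam)\<^sup>2
     - 2 * b * ((lam + 1) * (E_K lam + 1 / (lam + 1))) + 2 * (1 / lam) * E_K lam - 2 * b * (1 / lam) * 1"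
    unfolding sq using i1 i2 i3 i4 i5 I2 I3 I4 E.prob_space by (simp add: integral_logpow)
  also have "\<dots> = V_K lam"
  proof -
    \<comment> \<open>With the trigamma value and \<open>E_K\<close> as indeterminates the claim is
      a rational identity in \<open>lam\<close>, in which \<open>E_K\<close> cancels.\<close>
    define P where "P = Polygamma 1 (1 + 1 / lam)"
    define e where "e = E_K lam"
    have "lam + 1 \<noteq> 0" using lam_gt_0 by simp
    have "(lam + 1) * ((e + 1 / (lam + 1))\<^sup>2 + (P - (lam / (lam + 1))\<^sup>2) / lam\<^sup>2)
      + (e + 1 / lam)\<^sup>2 * (lam + 1) + (1 / lam)\<^sup>2
      - 2 * (e + 1 / lam) * ((lam + 1) * (e + 1 / (lam + 1))) + 2 * (1 / lam) * e - 2 * (e + 1 / lam) * (1 / lam) * 1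
      = ((1 + 1 / lam) * P - 1) / lam"
      using lam_gt_0 \<open>lam + 1 \<noteq> 0\<close> by (simp add: divide_simps power2_eq_square) algebra
    then show ?thesis unfolding I5 V_K_def P_def e_def b_def .
  qed
  finally show "(\<integral>y. (K_influence lam y)\<^sup>2 \<partial>epd lam) = V_K lam" .
qed

lemma influence_orthogonal:
  "integrable (epd lam) (\<lambda>y. S_influence lam y * K_influence lam y)"
  "(\<integral>y. S_influence lam y * K_influence lam y \<partial>epd lam) = 0"
proof -
  show "(\<integral>y. S_influence lam y * K_influence lam y \<partial>epd lam) = 0"
    by (rule integral_epd_odd) (auto simp: S_influence_def K_influence_def algebra_simps)
  have "integrable (epd lam) (\<lambda>y. (S_influence lam y)\<^sup>2 + (K_influence lam y)\<^sup>2)"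
    using S_influence_moments(2) K_influence_moments(2) by simp
  then show "integrable (epd lam) (\<lambda>y. S_influence lam y * K_influence lam y)"
  proof (rule Bochner_Integration.integrable_bound)
    have "\<bar>a * b\<bar> \<le> a\<^sup>2 + b\<^sup>2" for a b :: real
    proof -
      have "2 * (\<bar>a\<bar> * \<bar>b\<bar>) \<le> a\<^sup>2 + b\<^sup>2"
        using zero_le_power2[of "\<bar>a\<bar> - \<bar>b\<bar>"] by (simp add: power2_diff)
      moreover have "0 \<le> \<bar>a\<bar> * \<bar>b\<bar>" by simp
      ultimately show ?thesis unfolding abs_mult by linarith
    qed
    then show "AE y in epd lam. norm (S_influence lam y * K_influence lam y) \<le> norm ((S_influence lam y)\<^sup>2 + (K_influence lam y)\<^sup>2)"
      by (intro AE_I2) simp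
  qed measurable
qed

lemma E_K_pos: "0 < E_K lam"
proof -
  interpret E: prob_space "epd lam" by (rule prob_space_epd[OF lam_gt_0])
  text \<open>With \<open>u = \<bar>y\<bar> powr lam\<close> of mean one, \<open>lam * E_K\<close> is the mean of
    \<open>u * ln u - u + 1 \<ge> 0\<close>.\<close>
  define g where "g y = lam * logpow lam y - \<bar>y\<bar> powr lam + 1" for y
  have i2: "integrable (epd lam) (\<lambda>y. \<bar>y\<bar> powr lam)" using lam_gt_0 by (intro integrable_abs_powr) auto
  have gi: "integrable (epd lam) g" unfolding g_def using logpow_integrable i2 by simp
  have gI: "(\<integral>y. g y \<partial>epd lam) = lam * E_K lam"
    unfolding g_def using logpow_integrable i2 lam_gt_0 E.prob_space
    by (simp add: integral_logpow integral_epd_powr epd_moment_lam)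
  have nn: "0 \<le> g y" for y
  proof (cases "y = 0")
    case False
    define u where "u = \<bar>y\<bar> powr lam"
    have u: "0 < u" using False by (simp add: u_def)
    have "ln (1 / u) \<le> 1 / u - 1" using u by (intro ln_le_minus_one) simp
    then have "u * (- ln u) \<le> u * (1 / u - 1)" using u by (intro mult_left_mono) (simp_all add: ln_div)
    then have "0 \<le> u * ln u - u + 1" using u by (simp add: right_diff_distrib)
    moreover have "u * ln u = lam * logpow lam y" using False by (simp add: u_def logpow_def ln_powr)
    ultimately show ?thesis unfolding g_def u_def[symmetric] by linarith
  qed (simp add: g_def logpow_def)
  \<comment> \<open>The function \<open>g\<close> vanishes at 1, so positivity is tested at another
    point; at \<open>exp 1\<close> the logarithm is 1.\<close>
  have "g (exp 1) = exp lam * (lam - 1) + 1"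
    by (simp add: g_def logpow_def powr_def algebra_simps)
  then have "0 < g (exp 1)" using lam by (simp add: add_nonneg_pos)
  moreover have "isCont g (exp 1)"
    unfolding g_def by (intro continuous_intros DERIV_isCont[OF DERIV_logpow] DERIV_isCont[OF DERIV_abs_powr]) auto
  ultimately have "0 < (\<integral>y. g y \<partial>epd lam)" using integral_epd_pos[OF lam_gt_0 gi nn] by blast
  then show ?thesis using lam_gt_0 by (simp add: gI zero_less_mult_iff)
qed

lemma V_S_pos: "0 < V_S lam"
proof -
  have c: "0 < (score_slope lam)" unfolding score_slope_def using lam
    by (intro divide_pos_pos mult_pos_pos epd_moment_pos) auto
  \<comment> \<open>On the positive axis \<open>S_influence lam y\<close> is
    \<open>y powr (lam - 1) * (y - score_slope lam)\<close>, so one unit to the right of the zero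
    \<open>score_slope lam\<close> the second factor is 1.\<close>
  have "S_influence lam ((score_slope lam) + 1) = ((score_slope lam) + 1) powr (lam - 1)"
  proof -
    have "((score_slope lam) + 1) powr lam = ((score_slope lam) + 1) powr (lam - 1) * ((score_slope lam) + 1)"
      using c by (simp add: powr_diff)
    then show ?thesis using c by (simp add: S_influence_def spow_pos algebra_simps)
  qed
  then have "0 < (S_influence lam ((score_slope lam) + 1))\<^sup>2" using c by simp
  moreover have "isCont (\<lambda>y. (S_influence lam y)\<^sup>2) ((score_slope lam) + 1)"
    unfolding S_influence_def
    using c by (intro continuous_intros DERIV_isCont[OF DERIV_spow]) auto
  ultimately have "0 < (\<integral>y. (S_influence lam y)\<^sup>2 \<partial>epd lam)"
    using integral_epd_pos[OF lam_gt_0 S_influence_moments(2)] by simp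
  then show ?thesis by (simp add: S_influence_moments)
qed

lemma V_K_pos: "0 < V_K lam"
proof -
  have "K_influence lam 1 = - E_K lam" by (simp add: K_influence_def logpow_def)
  then have "0 < (K_influence lam 1)\<^sup>2" using E_K_pos by simp
  moreover have "isCont (\<lambda>y. (K_influence lam y)\<^sup>2) 1"
    unfolding K_influence_def
    by (intro continuous_intros DERIV_isCont[OF DERIV_logpow] DERIV_isCont[OF DERIV_abs_powr]) auto
  ultimately have "0 < (\<integral>y. (K_influence lam y)\<^sup>2 \<partial>epd lam)"
    using integral_epd_pos[OF lam_gt_0 K_influence_moments(2)] by simp
  then show ?thesis by (simp add: K_influence_moments)
qed

end

section \<open>Central limit theorem for sample means\<close>

text \<open>Slutsky's argument for one test function. Bound and Lipschitz constant 1 are those of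
  sine and cosine, the only functions to which it is applied.\<close>

lemma (in prob_space) expectation_lipschitz_close:
  fixes h :: "real \<Rightarrow> real"
  assumes h: "\<And>x y. \<bar>h x - h y\<bar> \<le> \<bar>x - y\<bar>" "\<And>x. \<bar>h x\<bar> \<le> 1" and [measurable]: "h \<in> borel_measurable borel"
    and [measurable]: "\<And>n. X n \<in> borel_measurable M" "\<And>n. X' n \<in> borel_measurable M"
    and d: "converges_in_probability M (\<lambda>n \<omega>. X' n \<omega> - X n \<omega>) 0"
    and l: "(\<lambda>n. expectation (\<lambda>\<omega>. h (X n \<omega>))) \<longlonglongrightarrow> c"
  shows "(\<lambda>n. expectation (\<lambda>\<omega>. h (X' n \<omega>))) \<longlonglongrightarrow> c"
proof -
  have hi: "integrable M (\<lambda>\<omega>. h (X n \<omega>))" "integrable M (\<lambda>\<omega>. h (X' n \<omega>))" for n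
    using h(2) by (auto intro!: integrable_const_bound[where B = 1])
  have "(\<lambda>n. expectation (\<lambda>\<omega>. h (X' n \<omega>)) - expectation (\<lambda>\<omega>. h (X n \<omega>))) \<longlonglongrightarrow> 0"
  proof (rule tendstoI)
    fix e :: real assume e: "0 < e"
    have "e / 4 > 0" "e / 4 > 0" using e by auto
    from conv_probD[OF d this]
    show "\<forall>\<^sub>F n in sequentially. dist (expectation (\<lambda>\<omega>. h (X' n \<omega>)) - expectation (\<lambda>\<omega>. h (X n \<omega>))) 0 < e"
    proof eventually_elim
      case (elim n)
      let ?A = "{\<omega> \<in> space M. \<bar>X' n \<omega> - X n \<omega> - 0\<bar> > e / 4}"
      have Ai: "integrable M (indicator ?A :: _ \<Rightarrow> real)"
        by (intro integrable_real_indicator) (auto simp: emeasure_eq_measure)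
      have le: "\<bar>h (X' n \<omega>) - h (X n \<omega>)\<bar> \<le> e / 4 + 2 * indicator ?A \<omega>" if "\<omega> \<in> space M" for \<omega>
      proof (cases "\<omega> \<in> ?A")
        case True
        have "\<bar>h (X' n \<omega>) - h (X n \<omega>)\<bar> \<le> 2" using h(2)[of "X' n \<omega>"] h(2)[of "X n \<omega>"] by linarith
        then show ?thesis using True e by simp
      next
        case False
        then have "\<bar>X' n \<omega> - X n \<omega>\<bar> \<le> e / 4" using that by simp
        then show ?thesis using False h(1)[of "X' n \<omega>" "X n \<omega>"] by simp
      qed
      have "\<bar>expectation (\<lambda>\<omega>. h (X' n \<omega>)) - expectation (\<lambda>\<omega>. h (X n \<omega>))\<bar>
          = \<bar>expectation (\<lambda>\<omega>. h (X' n \<omega>) - h (X n \<omega>))\<bar>"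
        using hi by simp
      also have "\<dots> \<le> expectation (\<lambda>\<omega>. \<bar>h (X' n \<omega>) - h (X n \<omega>)\<bar>)" by (rule integral_abs_bound)
      also have "\<dots> \<le> expectation (\<lambda>\<omega>. e / 4 + 2 * indicator ?A \<omega>)"
        using hi Ai le by (intro integral_mono) auto
      also have "\<dots> = e / 4 + 2 * prob ?A" using Ai by (simp add: prob_space)
      also have "\<dots> < e" using elim e by linarith
      finally show ?case by simp
    qed
  qed
  from tendsto_add[OF this l] show ?thesis by simp
qed

context iid_epd
begin

lemma clt_weak:
  assumes [measurable]: "f \<in> borel_measurable borel" and f2: "integrable (epd lam) (\<lambda>y. (f y)\<^sup>2)"
    and f0: "(\<integral>y. f y \<partial>epd lam) = 0" and s: "(\<integral>y. (f y)\<^sup>2 \<partial>epd lam) = s\<^sup>2" "0 < s"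
  shows "weak_conv_m (\<lambda>n. distr M borel (\<lambda>\<omega>. sqrt n * sample_mean f n \<omega> / s)) std_normal_distribution"
proof -
  have "weak_conv_m (\<lambda>n. distr M borel (\<lambda>\<omega>. (\<Sum>i<n. f (Y i \<omega>)) / sqrt (n * s\<^sup>2))) std_normal_distribution"
  proof (rule central_limit_theorem_zero_mean[where \<mu> = "distr (epd lam) borel f"])
    show "indep_vars (\<lambda>i. borel) (\<lambda>i \<omega>. f (Y i \<omega>)) UNIV"
      by (rule indep_vars_compose2[OF indep]) measurable
    show e0: "expectation (\<lambda>\<omega>. f (Y i \<omega>)) = 0" for i using f0 by (simp add: expectation_Y)
    show "integrable M (\<lambda>\<omega>. (f (Y i \<omega>))\<^sup>2)" for i by (rule integrable_Y[OF _ f2]) measurable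
    show "variance (\<lambda>\<omega>. f (Y i \<omega>)) = s\<^sup>2" for i
      unfolding e0 using s(1) by (simp add: expectation_Y[where g = "\<lambda>y. (f y)\<^sup>2"])
    show "distr M borel (\<lambda>\<omega>. f (Y i \<omega>)) = distr (epd lam) borel f" for i
      unfolding distr_Y[of i, symmetric] by (subst distr_distr) (auto simp: comp_def)
  qed (rule s)
  moreover have "(\<Sum>i<n. f (Y i \<omega>)) / sqrt (n * s\<^sup>2) = sqrt n * sample_mean f n \<omega> / s" for n :: nat and \<omega>
  proof (cases "n = 0")
    case False
    have "sqrt n * ((\<Sum>i<n. f (Y i \<omega>)) / n) = (\<Sum>i<n. f (Y i \<omega>)) / sqrt n"
      using False by (simp add: field_simps real_sqrt_mult_self flip: of_nat_power)
    then show ?thesis using s(2) by (simp add: sample_mean_def real_sqrt_mult)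
  qed simp
  ultimately show ?thesis by simp
qed

text \<open>Evaluating the characteristic function of the sum normalized by \<open>s\<close> at the
  argument \<open>s\<close> removes the normalization; real and imaginary parts give the two
  limits.\<close>

lemma clt_trig:
  assumes f[measurable]: "f \<in> borel_measurable borel" and f2: "integrable (epd lam) (\<lambda>y. (f y)\<^sup>2)"
    and f0: "(\<integral>y. f y \<partial>epd lam) = 0" and s: "(\<integral>y. (f y)\<^sup>2 \<partial>epd lam) = s\<^sup>2" "0 < s"
  shows "(\<lambda>n. expectation (\<lambda>\<omega>. cos (sqrt n * sample_mean f n \<omega>))) \<longlonglongrightarrow> exp (- s\<^sup>2 / 2)"
    and "(\<lambda>n. expectation (\<lambda>\<omega>. sin (sqrt n * sample_mean f n \<omega>))) \<longlonglongrightarrow> 0"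
proof -
  let ?W = "\<lambda>n \<omega>. sqrt n * sample_mean f n \<omega>"
  have rd: "real_distribution (distr M borel (\<lambda>\<omega>. ?W n \<omega> / s))" for n
    by (rule real_distribution_distr) measurable
  have "(\<lambda>n. char (distr M borel (\<lambda>\<omega>. ?W n \<omega> / s)) s) \<longlonglongrightarrow> char std_normal_distribution s"
    by (rule levy_continuity1[OF rd _ clt_weak[OF assms]]) (rule real_dist_normal_dist)
  also have "char std_normal_distribution s = complex_of_real (exp (- s\<^sup>2 / 2))"
    by (simp add: char_std_normal_distribution)
  also have "(\<lambda>n. char (distr M borel (\<lambda>\<omega>. ?W n \<omega> / s)) s) = (\<lambda>n. \<integral>\<omega>. iexp (?W n \<omega>) \<partial>M)"
  proof
    fix n
    have "char (distr M borel (\<lambda>\<omega>. ?W n \<omega> / s)) s = (\<integral>\<omega>. iexp (s * (?W n \<omega> / s)) \<partial>M)"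
      unfolding char_def by (subst integral_distr) measurable
    then show "char (distr M borel (\<lambda>\<omega>. ?W n \<omega> / s)) s = (\<integral>\<omega>. iexp (?W n \<omega>) \<partial>M)" using s(2) by simp
  qed
  finally have L: "(\<lambda>n. \<integral>\<omega>. iexp (?W n \<omega>) \<partial>M) \<longlonglongrightarrow> complex_of_real (exp (- s\<^sup>2 / 2))" .
  have i: "integrable M (\<lambda>\<omega>. iexp (?W n \<omega>))" for n
    by (rule integrable_const_bound[where B = 1]) auto
  have Re: "Re (\<integral>\<omega>. iexp (?W n \<omega>) \<partial>M) = expectation (\<lambda>\<omega>. cos (?W n \<omega>))" for n
    by (subst integral_Re[OF i, symmetric]) (simp add: Re_exp)
  have Im: "Im (\<integral>\<omega>. iexp (?W n \<omega>) \<partial>M) = expectation (\<lambda>\<omega>. sin (?W n \<omega>))" for n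
    by (subst integral_Im[OF i, symmetric]) (simp add: Im_exp)
  show "(\<lambda>n. expectation (\<lambda>\<omega>. cos (?W n \<omega>))) \<longlonglongrightarrow> exp (- s\<^sup>2 / 2)"
    using tendsto_Re[OF L] by (simp only: Re Re_complex_of_real)
  show "(\<lambda>n. expectation (\<lambda>\<omega>. sin (?W n \<omega>))) \<longlonglongrightarrow> 0"
    using tendsto_Im[OF L] by (simp only: Im Im_complex_of_real)
qed

end

section \<open>Linearization of the test statistics\<close>

lemma powr_minus_half:
  fixes x :: real
  assumes "0 < x" shows "x powr (-1/2) = 1 / sqrt x"
proof -
  have e: "-1/2 = - (1/2 :: real)" by simp
  show ?thesis unfolding e powr_minus powr_half_sqrt[OF less_imp_le[OF assms]] inverse_eq_divide ..
qed

lemma integrable_epd_add_one_powr_ln_square: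
  assumes "0 < lam" "0 \<le> p"
  shows "integrable (epd lam) (\<lambda>y. (\<bar>y\<bar> + 1) powr p * (ln \<bar>y\<bar>)\<^sup>2)"
proof (rule Bochner_Integration.integrable_bound)
  have p1: "-1 < p" using assms by simp
  show "integrable (epd lam) (\<lambda>y. 2 powr p * (\<bar>y\<bar> powr p * (ln \<bar>y\<bar>)\<^sup>2 + \<bar>y\<bar> powr 0 * (ln \<bar>y\<bar>)\<^sup>2))"
    using integrable_epd_powr_ln[OF assms(1) p1, of 2] integrable_epd_powr_ln[of lam 0 2] assms
    by (intro integrable_mult_right Bochner_Integration.integrable_add) auto
  show "AE y in epd lam. norm ((\<bar>y\<bar> + 1) powr p * (ln \<bar>y\<bar>)\<^sup>2)
      \<le> norm (2 powr p * (\<bar>y\<bar> powr p * (ln \<bar>y\<bar>)\<^sup>2 + \<bar>y\<bar> powr 0 * (ln \<bar>y\<bar>)\<^sup>2))"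
    using AE_epd_neq[of 0 lam]
  proof eventually_elim
    case (elim y)
    have "(\<bar>y\<bar> + 1) powr p * (ln \<bar>y\<bar>)\<^sup>2 \<le> (2 powr p * (\<bar>y\<bar> powr p + 1)) * (ln \<bar>y\<bar>)\<^sup>2"
      using powr_add_one_le[of "\<bar>y\<bar>" p] assms by (intro mult_right_mono) auto
    then show ?case using elim by (simp add: abs_mult algebra_simps)
  qed
qed measurable

context
  fixes lam :: real
  assumes lam: "1 \<le> lam"
begin

lemma integrable_shift_bound:
  "integrable (epd lam) (\<lambda>y. (lam * (\<bar>y\<bar> + 1) powr (lam - 1))\<^sup>2)"
proof -
  have "(lam * (\<bar>y\<bar> + 1) powr (lam - 1))\<^sup>2 = lam\<^sup>2 * (\<bar>y\<bar> + 1) powr (2 * (lam - 1))" for y :: real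
    by (simp add: power_mult_distrib power2_eq_square powr_add[symmetric])
  then show ?thesis using integrable_epd_powr_add_one[of lam "2 * (lam - 1)"] lam by simp
qed

lemma shift_bound_le:
  assumes "\<bar>t\<bar> \<le> 1"
  shows "lam * max \<bar>y\<bar> \<bar>y - t\<bar> powr (lam - 1) * \<bar>y - t - y\<bar> \<le> \<bar>t\<bar> * (lam * (\<bar>y\<bar> + 1) powr (lam - 1))"
proof -
  have "max \<bar>y\<bar> \<bar>y - t\<bar> powr (lam - 1) \<le> (\<bar>y\<bar> + 1) powr (lam - 1)"
    using assms lam by (intro powr_mono2) auto
  then have "\<bar>t\<bar> * (lam * max \<bar>y\<bar> \<bar>y - t\<bar> powr (lam - 1)) \<le> \<bar>t\<bar> * (lam * (\<bar>y\<bar> + 1) powr (lam - 1))"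
    using lam by (intro mult_left_mono) auto
  then show ?thesis by (simp add: mult_ac)
qed

lemma shift_expansion_spow:
  "shift_expansion (spow lam) (\<lambda>y. lam * \<bar>y\<bar> powr (lam - 1)) (\<lambda>y. lam * (\<bar>y\<bar> + 1) powr (lam - 1)) lam"
proof
  fix y t :: real assume "\<bar>t\<bar> \<le> 1"
  then show "\<bar>spow lam (y - t) - spow lam y\<bar> \<le> \<bar>t\<bar> * (lam * (\<bar>y\<bar> + 1) powr (lam - 1))"
    by (rule order_trans[OF spow_diff_le[OF lam] shift_bound_le])
qed (use lam in \<open>auto intro: continuous_spow DERIV_spow integrable_shift_bound\<close>)

lemma shift_expansion_abs_powr:
  "shift_expansion (\<lambda>y. \<bar>y\<bar> powr lam) (\<lambda>y. lam * spow (lam - 1) y) (\<lambda>y. lam * (\<bar>y\<bar> + 1) powr (lam - 1)) lam"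
proof
  fix y t :: real assume "\<bar>t\<bar> \<le> 1"
  then show "\<bar>\<bar>y - t\<bar> powr lam - \<bar>y\<bar> powr lam\<bar> \<le> \<bar>t\<bar> * (lam * (\<bar>y\<bar> + 1) powr (lam - 1))"
    by (rule order_trans[OF abs_powr_diff_le[OF lam] shift_bound_le])
qed (use lam in \<open>auto intro: continuous_abs_powr DERIV_abs_powr integrable_shift_bound\<close>)

lemma shift_expansion_logpow:
  "shift_expansion (logpow lam) (\<lambda>y. lam * spow (lam - 1) y * ln \<bar>y\<bar> + spow (lam - 1) y)
    (\<lambda>y. 4 * lam * (\<bar>y\<bar> + 1) powr (lam - 1) * (\<bar>ln \<bar>y\<bar>\<bar> + \<bar>y\<bar> + 1)) lam"
proof
  show "integrable (epd lam) (\<lambda>y. (4 * lam * (\<bar>y\<bar> + 1) powr (lam - 1) * (\<bar>ln \<bar>y\<bar>\<bar> + \<bar>y\<bar> + 1))\<^sup>2)"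
  proof (rule Bochner_Integration.integrable_bound)
    \<comment> \<open>The constant is \<open>4\<^sup>2 * 2\<close>; the factor 2 comes from bounding
      the square of a sum of two terms.\<close>
    show "integrable (epd lam) (\<lambda>y. 32 * lam\<^sup>2 * ((\<bar>y\<bar> + 1) powr (2 * (lam - 1)) * (ln \<bar>y\<bar>)\<^sup>2 + (\<bar>y\<bar> + 1) powr (2 * lam)))"
      using integrable_epd_add_one_powr_ln_square[of lam "2 * (lam - 1)"] integrable_epd_powr_add_one[of lam "2 * lam"] lam
      by (intro integrable_mult_right Bochner_Integration.integrable_add) auto
    have "(4 * lam * (\<bar>y\<bar> + 1) powr (lam - 1) * (\<bar>ln \<bar>y\<bar>\<bar> + \<bar>y\<bar> + 1))\<^sup>2
        \<le> 32 * lam\<^sup>2 * ((\<bar>y\<bar> + 1) powr (2 * (lam - 1)) * (ln \<bar>y\<bar>)\<^sup>2 + (\<bar>y\<bar> + 1) powr (2 * lam))" for y :: real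
    proof -
      define r where "r = (\<bar>y\<bar> + 1) powr (2 * (lam - 1))"
      have r: "0 \<le> r" by (simp add: r_def)
      have r1: "((\<bar>y\<bar> + 1) powr (lam - 1))\<^sup>2 = r" by (simp add: r_def power2_eq_square powr_add[symmetric])
      have r2: "(\<bar>y\<bar> + 1) powr (2 * lam) = r * (\<bar>y\<bar> + 1)\<^sup>2"
      proof -
        have "r * (\<bar>y\<bar> + 1) powr 2 = (\<bar>y\<bar> + 1) powr (2 * (lam - 1) + 2)" unfolding r_def by (rule powr_add[symmetric])
        then show ?thesis by (simp add: algebra_simps)
      qed
      have "(\<bar>ln \<bar>y\<bar>\<bar> + (\<bar>y\<bar> + 1))\<^sup>2 \<le> 2 * (ln \<bar>y\<bar>)\<^sup>2 + 2 * (\<bar>y\<bar> + 1)\<^sup>2"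
        using zero_le_power2[of "\<bar>ln \<bar>y\<bar>\<bar> - (\<bar>y\<bar> + 1)"] by (simp add: power2_sum power2_diff)
      then have "(16 * lam\<^sup>2 * r) * (\<bar>ln \<bar>y\<bar>\<bar> + (\<bar>y\<bar> + 1))\<^sup>2 \<le> (16 * lam\<^sup>2 * r) * (2 * (ln \<bar>y\<bar>)\<^sup>2 + 2 * (\<bar>y\<bar> + 1)\<^sup>2)"
        using r by (intro mult_left_mono) auto
      then show ?thesis
        unfolding power_mult_distrib r1 r2 r_def[symmetric] by (simp add: algebra_simps)
    qed
    then show "AE y in epd lam. norm ((4 * lam * (\<bar>y\<bar> + 1) powr (lam - 1) * (\<bar>ln \<bar>y\<bar>\<bar> + \<bar>y\<bar> + 1))\<^sup>2)
       \<le> norm (32 * lam\<^sup>2 * ((\<bar>y\<bar> + 1) powr (2 * (lam - 1)) * (ln \<bar>y\<bar>)\<^sup>2 + (\<bar>y\<bar> + 1) powr (2 * lam)))"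
      by (intro AE_I2) (simp add: order_trans[OF _ abs_ge_self])
  qed measurable
  fix y t :: real assume "y \<noteq> 0" "\<bar>t\<bar> \<le> 1"
  then show "\<bar>logpow lam (y - t) - logpow lam y\<bar>
      \<le> \<bar>t\<bar> * (4 * lam * (\<bar>y\<bar> + 1) powr (lam - 1) * (\<bar>ln \<bar>y\<bar>\<bar> + \<bar>y\<bar> + 1))"
    by (rule logpow_diff_le[OF lam])
qed (use lam in \<open>auto intro: continuous_logpow DERIV_logpow\<close>)

end

text \<open>The estimator is kept abstract, known only through its position relative to strict signs
  of the score; in the application \<open>T n\<close> is the standardized estimation error.\<close>

locale epd_estimator = iid_epd +
  fixes T :: "nat \<Rightarrow> 'a \<Rightarrow> real"
  assumes T_measurable [measurable]: "\<And>n. T n \<in> borel_measurable M"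
    and T_le: "\<And>n \<omega> t. 0 < n \<Longrightarrow> \<omega> \<in> space M \<Longrightarrow> (\<Sum>i<n. spow (lam - 1) (Y i \<omega> - t)) < 0 \<Longrightarrow> T n \<omega> \<le> t"
    and T_ge: "\<And>n \<omega> t. 0 < n \<Longrightarrow> \<omega> \<in> space M \<Longrightarrow> (\<Sum>i<n. spow (lam - 1) (Y i \<omega> - t)) > 0 \<Longrightarrow> t \<le> T n \<omega>"
begin

definition shifted_mean :: "(real \<Rightarrow> real) \<Rightarrow> nat \<Rightarrow> 'a \<Rightarrow> real" where
  "shifted_mean g n \<omega> = (\<Sum>i<n. g (Y i \<omega> - T n \<omega>)) / real n"

lemma shifted_mean_measurable [measurable]:
  assumes [measurable]: "g \<in> borel_measurable borel"
  shows "shifted_mean g n \<in> borel_measurable M"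
  unfolding shifted_mean_def[abs_def] by measurable

lemma score_square_integrable: "integrable (epd lam) (\<lambda>y. (spow (lam - 1) y)\<^sup>2)"
  using integrable_epd_powr[of lam "2 * (lam - 1)"] lam
  by (simp add: power2_eq_square spow_mult_spow)

lemma bounded_T: "bounded_in_probability M (\<lambda>n \<omega>. sqrt n * T n \<omega>)"
proof -
  have z: "(\<integral>y. spow (lam - 1) y \<partial>epd lam) = 0" by (rule integral_epd_odd) auto
  have "bounded_in_probability M (\<lambda>n \<omega>. sqrt n * sample_mean (spow (lam - 1)) n \<omega>)"
    using bounded_in_prob_sample_mean[OF spow_measurable score_square_integrable] by (simp add: z)
  from bounded_in_prob_add_conv[OF bounded_in_prob_cmult[OF this, of "1 / epd_moment lam (2 * lam - 2)"]
      location_linearization[OF T_measurable T_le T_ge]]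
  show ?thesis by simp
qed

lemma shifted_mean_expansion:
  assumes "shift_expansion g g' B lam"
  shows "converges_in_probability M (\<lambda>n \<omega>. sqrt n * (shifted_mean g n \<omega> - sample_mean g n \<omega>)
    + (\<integral>y. g' y \<partial>epd lam) * (sqrt n * T n \<omega>)) 0"
  unfolding shifted_mean_def by (rule sample_mean_shift_expansion[OF assms T_measurable bounded_T])

text \<open>The mean derivative of \<open>spow lam\<close> multiplies \<open>T n\<close>, and
  \<open>T n\<close> is asymptotically the mean score divided by the Fisher information; the product
  of both coefficients is \<open>score_slope lam\<close>.\<close>

lemma S_numerator_linearization:
  "converges_in_probability M (\<lambda>n \<omega>. sqrt n * shifted_mean (spow lam) n \<omega>
     - sqrt n * sample_mean (S_influence lam) n \<omega>) 0"
proof -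
  let ?m = "lam * epd_moment lam (lam - 1)" and ?Q = "epd_moment lam (2 * lam - 2)"
  have e: "(\<integral>y. lam * \<bar>y\<bar> powr (lam - 1) \<partial>epd lam) = ?m"
    using lam by (simp add: integral_epd_powr)
  have 1: "converges_in_probability M (\<lambda>n \<omega>. sqrt n * (shifted_mean (spow lam) n \<omega> - sample_mean (spow lam) n \<omega>)
      + ?m * (sqrt n * T n \<omega>)) 0"
    by (rule shifted_mean_expansion[OF shift_expansion_spow[OF lam], unfolded e])
  have 2: "converges_in_probability M (\<lambda>n \<omega>. ?m * (sqrt n * T n \<omega>
      - 1 / ?Q * (sqrt n * sample_mean (spow (lam - 1)) n \<omega>))) 0"
    by (rule conv_prob_cmult[OF location_linearization[OF T_measurable T_le T_ge]])
  have eq: "sample_mean (S_influence lam) n \<omega> = sample_mean (spow lam) n \<omega> - ?m / ?Q * sample_mean (spow (lam - 1)) n \<omega>" for n \<omega>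
    unfolding S_influence_def[abs_def] sample_mean_diff sample_mean_cmult score_slope_def ..
  show ?thesis using conv_prob_diff[OF 1 2] unfolding eq by (simp add: algebra_simps)
qed

text \<open>An odd derivative has mean 0, so the estimated location leaves no trace at the scale
  \<open>sqrt n\<close>. The centering \<open>c\<close> cancels and merely fixes the form of later
  use.\<close>

lemma shifted_mean_centered:
  assumes "shift_expansion g g' B lam" and "\<And>y. g' (- y) = - g' y"
  shows "converges_in_probability M (\<lambda>n \<omega>. sqrt n * (shifted_mean g n \<omega> - c) - sqrt n * (sample_mean g n \<omega> - c)) 0"
proof -
  interpret shift_expansion g g' B lam by fact
  have "(\<integral>y. g' y \<partial>epd lam) = 0" using assms(2) by (intro integral_epd_odd) auto
  then show ?thesis using shifted_mean_expansion[OF assms(1)] by (simp add: algebra_simps)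
qed

lemma M_linearization:
  "converges_in_probability M (\<lambda>n \<omega>. sqrt n * (shifted_mean (\<lambda>y. \<bar>y\<bar> powr lam) n \<omega> - 1)
     - sqrt n * (sample_mean (\<lambda>y. \<bar>y\<bar> powr lam) n \<omega> - 1)) 0"
  by (rule shifted_mean_centered[OF shift_expansion_abs_powr[OF lam]]) simp

lemma L_linearization:
  "converges_in_probability M (\<lambda>n \<omega>. sqrt n * (shifted_mean (logpow lam) n \<omega> - E_K lam)
     - sqrt n * (sample_mean (logpow lam) n \<omega> - E_K lam)) 0"
  by (rule shifted_mean_centered[OF shift_expansion_logpow[OF lam]]) simp

abbreviation "mean_spow \<equiv> shifted_mean (spow lam)"
abbreviation "mean_abs \<equiv> shifted_mean (\<lambda>y. \<bar>y\<bar> powr lam)"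
abbreviation "mean_log \<equiv> shifted_mean (logpow lam)"

lemma bounded_Nn: "bounded_in_probability M (\<lambda>n \<omega>. sqrt n * mean_spow n \<omega>)"
proof -
  have "bounded_in_probability M (\<lambda>n \<omega>. sqrt n * sample_mean (S_influence lam) n \<omega>)"
    using bounded_in_prob_sample_mean[OF influence_measurable(1) S_influence_moments(2)[OF lam]]
    by (simp add: S_influence_moments(1)[OF lam])
  from bounded_in_prob_add_conv[OF this S_numerator_linearization] show ?thesis by simp
qed

lemma bounded_Mn: "bounded_in_probability M (\<lambda>n \<omega>. sqrt n * (mean_abs n \<omega> - 1))"
proof -
  have i: "integrable (epd lam) (\<lambda>y. (\<bar>y\<bar> powr lam)\<^sup>2)"
    using integrable_epd_powr[of lam "2 * lam"] lam by (simp add: logpow_products(3)[OF lam])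
  have "(\<integral>y. \<bar>y\<bar> powr lam \<partial>epd lam) = 1" using lam by (simp add: integral_epd_powr epd_moment_lam)
  then have "bounded_in_probability M (\<lambda>n \<omega>. sqrt n * (sample_mean (\<lambda>y. \<bar>y\<bar> powr lam) n \<omega> - 1))"
    using bounded_in_prob_sample_mean[OF _ i] by simp
  from bounded_in_prob_add_conv[OF this M_linearization] show ?thesis by simp
qed

lemma bounded_Ln: "bounded_in_probability M (\<lambda>n \<omega>. sqrt n * (mean_log n \<omega> - E_K lam))"
proof -
  have "-1 < 2 * lam" using lam by simp
  then have i: "integrable (epd lam) (\<lambda>y. (logpow lam y)\<^sup>2)"
    using integrable_epd_powr_ln[of lam "2 * lam" 2] lam by (simp add: logpow_products(1)[OF lam])
  have "bounded_in_probability M (\<lambda>n \<omega>. sqrt n * (sample_mean (logpow lam) n \<omega> - E_K lam))"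
    using bounded_in_prob_sample_mean[OF _ i] by (simp add: integral_logpow[OF lam])
  from bounded_in_prob_add_conv[OF this L_linearization] show ?thesis by simp
qed

lemma conv_prob_of_bounded_sqrt:
  fixes U :: "nat \<Rightarrow> 'a \<Rightarrow> real"
  assumes b: "bounded_in_probability M (\<lambda>n \<omega>. sqrt n * (U n \<omega> - u))" and [measurable]: "\<And>n. U n \<in> borel_measurable M"
  shows "converges_in_probability M (\<lambda>n \<omega>. U n \<omega> - u) 0"
proof -
  have s: "(\<lambda>n. 1 / sqrt (real n)) \<longlonglongrightarrow> 0"
    by (intro tendsto_divide_0[OF tendsto_const] filterlim_at_top_imp_at_infinity
        filterlim_compose[OF sqrt_at_top filterlim_real_sequentially])
  from conv_prob_mult_bounded[OF conv_prob_const[OF s] b] show ?thesis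
    by (rule conv_prob_mono) (measurable, rule eventually_sequentiallyI[of 1], simp)
qed

lemma inverse_Mn:
  "converges_in_probability M (\<lambda>n \<omega>. inverse (mean_abs n \<omega>) - 1) 0"
proof -
  have "(inverse has_real_derivative - 1) (at (1::real))" by (auto intro!: derivative_eq_intros)
  from delta_method[OF bounded_Mn this]
  have "converges_in_probability M (\<lambda>n \<omega>. sqrt n * (inverse (mean_abs n \<omega>) - inverse 1) - (- 1) * (sqrt n * (mean_abs n \<omega> - 1))) 0"
    by simp
  from bounded_in_prob_add_conv[OF bounded_in_prob_cmult[OF bounded_Mn, of "-1"] this]
  have "bounded_in_probability M (\<lambda>n \<omega>. sqrt n * (inverse (mean_abs n \<omega>) - 1))" by simp
  then show ?thesis
    by (rule conv_prob_of_bounded_sqrt[where U = "\<lambda>n \<omega>. inverse (mean_abs n \<omega>)" and u = 1]) measurable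
qed

definition Sn :: "nat \<Rightarrow> 'a \<Rightarrow> real" where
  "Sn n \<omega> = mean_spow n \<omega> / mean_abs n \<omega>"

text \<open>Rescaling the residuals by \<open>mean_abs powr (1 / lam)\<close> subtracts
  \<open>ln mean_abs / lam\<close> from every logarithm; weighted with the normalized powers this is
  the second term.\<close>

definition Kn :: "nat \<Rightarrow> 'a \<Rightarrow> real" where
  "Kn n \<omega> = mean_log n \<omega> / mean_abs n \<omega> - ln (mean_abs n \<omega>) / lam"

lemma Sn_measurable [measurable]: "Sn n \<in> borel_measurable M"
  unfolding Sn_def[abs_def] by measurable

lemma Kn_measurable [measurable]: "Kn n \<in> borel_measurable M"
  unfolding Kn_def[abs_def] by measurable

lemma Sn_linearization:
  "converges_in_probability M (\<lambda>n \<omega>. sqrt n * Sn n \<omega> - sqrt n * sample_mean (S_influence lam) n \<omega>) 0"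
proof -
  have "converges_in_probability M (\<lambda>n \<omega>. (inverse (mean_abs n \<omega>) - 1) * (sqrt n * mean_spow n \<omega>)
      + (sqrt n * mean_spow n \<omega> - sqrt n * sample_mean (S_influence lam) n \<omega>)) (0 + 0)"
    by (rule conv_prob_add[OF conv_prob_mult_bounded[OF inverse_Mn bounded_Nn] S_numerator_linearization])
  then show ?thesis by (simp add: Sn_def divide_inverse algebra_simps)
qed

text \<open>First-order expansion of \<open>l / m - ln m / lam\<close> at
  \<open>l = E_K lam\<close>, \<open>m = 1\<close>. The error consists of products of
  \<open>1 / m - 1\<close>, which tends to 0 in probability, with bounded normalized deviations, of
  the delta-method error of the logarithm, and of the errors of the shifted means.\<close>

lemma Kn_linearization:
  "converges_in_probability M (\<lambda>n \<omega>. sqrt n * (Kn n \<omega> - E_K lam) - sqrt n * sample_mean (K_influence lam) n \<omega>) 0"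
proof -
  let ?E = "E_K lam"
  have lam_gt_0: "0 < lam" using lam by simp
  have lnd: "(ln has_real_derivative 1) (at (1::real))" using DERIV_ln_divide[of 1] by simp
  have ln_M: "converges_in_probability M (\<lambda>n \<omega>. sqrt n * ln (mean_abs n \<omega>) - sqrt n * (mean_abs n \<omega> - 1)) 0"
    using delta_method[OF bounded_Mn lnd] by simp
  have 1: "converges_in_probability M (\<lambda>n \<omega>. (inverse (mean_abs n \<omega>) - 1) * (sqrt n * (mean_log n \<omega> - ?E))) 0"
    by (rule conv_prob_mult_bounded[OF inverse_Mn bounded_Ln])
  have 2: "converges_in_probability M (\<lambda>n \<omega>. (- ?E) * ((inverse (mean_abs n \<omega>) - 1) * (sqrt n * (mean_abs n \<omega> - 1)))) 0"
    by (rule conv_prob_cmult[OF conv_prob_mult_bounded[OF inverse_Mn bounded_Mn]])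
  have 3: "converges_in_probability M (\<lambda>n \<omega>. (- (1 / lam)) * (sqrt n * ln (mean_abs n \<omega>) - sqrt n * (mean_abs n \<omega> - 1))) 0"
    by (rule conv_prob_cmult[OF ln_M])
  have 4: "converges_in_probability M (\<lambda>n \<omega>. (- (?E + 1 / lam)) * (sqrt n * (mean_abs n \<omega> - 1) - sqrt n * (sample_mean (\<lambda>y. \<bar>y\<bar> powr lam) n \<omega> - 1))) 0"
    by (rule conv_prob_cmult[OF M_linearization])
  have inv: "converges_in_probability M (\<lambda>n \<omega>. inverse (mean_abs n \<omega>) - 1) 0" by (rule inverse_Mn)
  text \<open>The remaining term vanishes unless \<open>mean_abs = 0\<close>, where \<open>mean_log / mean_abs = 0\<close> by convention; that
    event is asymptotically negligible because \<open>inverse 0 = 0\<close> is far from \<open>1\<close>.\<close>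
  define R where "R n \<omega> = sqrt n * ?E * (if mean_abs n \<omega> = 0 then -1 else 0)" for n \<omega>
  have Rm[measurable]: "R n \<in> borel_measurable M" for n unfolding R_def by measurable
  have 5: "converges_in_probability M R 0"
  proof (rule conv_probI[OF Rm])
    fix \<epsilon> \<delta> :: real assume pos: "\<epsilon> > 0" "\<delta> > 0"
    have h: "(0::real) < 1 / 2" by simp
    have "\<forall>\<^sub>F n in sequentially. {\<omega> \<in> space M. \<bar>inverse (mean_abs n \<omega>) - 1 - 0\<bar> > 1 / 2} \<in> events \<and>
      prob {\<omega> \<in> space M. \<bar>inverse (mean_abs n \<omega>) - 1 - 0\<bar> > 1 / 2} \<le> \<delta> \<and>
      (\<forall>\<omega>\<in>space M - {\<omega> \<in> space M. \<bar>inverse (mean_abs n \<omega>) - 1 - 0\<bar> > 1 / 2}. \<bar>R n \<omega> - 0\<bar> \<le> \<epsilon>)"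
      using conv_probD[OF inv h pos(2)]
    proof eventually_elim
      case (elim n)
      have "{\<omega> \<in> space M. \<bar>inverse (mean_abs n \<omega>) - 1 - 0\<bar> > 1 / 2} \<in> events" by measurable
      then show ?case using elim pos by (auto simp: R_def)
    qed
    then show "\<exists>A. \<forall>\<^sub>F n in sequentially. A n \<in> events \<and> prob (A n) \<le> \<delta> \<and> (\<forall>\<omega>\<in>space M - A n. \<bar>R n \<omega> - 0\<bar> \<le> \<epsilon>)"
      by (rule exI[of _ "\<lambda>n. {\<omega> \<in> space M. \<bar>inverse (mean_abs n \<omega>) - 1 - 0\<bar> > 1 / 2}"])
  qed
  have eqK: "sample_mean (K_influence lam) n \<omega> = (sample_mean (logpow lam) n \<omega> - ?E)
      - (?E + 1 / lam) * (sample_mean (\<lambda>y. \<bar>y\<bar> powr lam) n \<omega> - 1)" if "0 < n" for n \<omega>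
    unfolding K_influence_def[abs_def] sample_mean_add sample_mean_diff sample_mean_cmult sample_mean_const[OF that]
    by (simp add: algebra_simps)
  have "converges_in_probability M (\<lambda>n \<omega>. (inverse (mean_abs n \<omega>) - 1) * (sqrt n * (mean_log n \<omega> - ?E))
      + ((- ?E) * ((inverse (mean_abs n \<omega>) - 1) * (sqrt n * (mean_abs n \<omega> - 1)))
      + ((- (1 / lam)) * (sqrt n * ln (mean_abs n \<omega>) - sqrt n * (mean_abs n \<omega> - 1))
      + ((- (?E + 1 / lam)) * (sqrt n * (mean_abs n \<omega> - 1) - sqrt n * (sample_mean (\<lambda>y. \<bar>y\<bar> powr lam) n \<omega> - 1))
      + ((sqrt n * (mean_log n \<omega> - ?E) - sqrt n * (sample_mean (logpow lam) n \<omega> - ?E)) + R n \<omega>))))) (0 + (0 + (0 + (0 + (0 + 0)))))"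
    by (intro conv_prob_add 1 2 3 4 5 L_linearization)
  then have "converges_in_probability M (\<lambda>n \<omega>. (inverse (mean_abs n \<omega>) - 1) * (sqrt n * (mean_log n \<omega> - ?E))
      + ((- ?E) * ((inverse (mean_abs n \<omega>) - 1) * (sqrt n * (mean_abs n \<omega> - 1)))
      + ((- (1 / lam)) * (sqrt n * ln (mean_abs n \<omega>) - sqrt n * (mean_abs n \<omega> - 1))
      + ((- (?E + 1 / lam)) * (sqrt n * (mean_abs n \<omega> - 1) - sqrt n * (sample_mean (\<lambda>y. \<bar>y\<bar> powr lam) n \<omega> - 1))
      + ((sqrt n * (mean_log n \<omega> - ?E) - sqrt n * (sample_mean (logpow lam) n \<omega> - ?E)) + R n \<omega>))))) 0"
    by simp
  then show ?thesis
  proof (rule conv_prob_cong)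
    show "\<forall>\<^sub>F n in sequentially. \<forall>\<omega>\<in>space M. sqrt n * (Kn n \<omega> - ?E) - sqrt n * sample_mean (K_influence lam) n \<omega>
      = (inverse (mean_abs n \<omega>) - 1) * (sqrt n * (mean_log n \<omega> - ?E))
      + ((- ?E) * ((inverse (mean_abs n \<omega>) - 1) * (sqrt n * (mean_abs n \<omega> - 1)))
      + ((- (1 / lam)) * (sqrt n * ln (mean_abs n \<omega>) - sqrt n * (mean_abs n \<omega> - 1))
      + ((- (?E + 1 / lam)) * (sqrt n * (mean_abs n \<omega> - 1) - sqrt n * (sample_mean (\<lambda>y. \<bar>y\<bar> powr lam) n \<omega> - 1))
      + ((sqrt n * (mean_log n \<omega> - ?E) - sqrt n * (sample_mean (logpow lam) n \<omega> - ?E)) + R n \<omega>))))"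
    proof (intro eventually_sequentiallyI[of 1] ballI)
      fix n :: nat and \<omega> assume "1 \<le> n"
      then have n: "0 < n" by simp
      define m l s a b where "m = mean_abs n \<omega>" "l = mean_log n \<omega>" "s = sqrt (real n)"
        "a = sample_mean (\<lambda>y. \<bar>y\<bar> powr lam) n \<omega>" "b = sample_mean (logpow lam) n \<omega>"
      define i where "i = inverse m"
      have im: "m * i = 1 + (if m = 0 then -1 else 0)" by (simp add: i_def)
      have "s * (l * i - ln m / lam - ?E) - s * ((b - ?E) - (?E + 1 / lam) * (a - 1))
        = (i - 1) * (s * (l - ?E)) + ((- ?E) * ((i - 1) * (s * (m - 1)))
        + ((- (1 / lam)) * (s * ln m - s * (m - 1)) + ((- (?E + 1 / lam)) * (s * (m - 1) - s * (a - 1))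
        + ((s * (l - ?E) - s * (b - ?E)) + s * ?E * (m * i - 1)))))"
        by (simp add: algebra_simps add_divide_distrib diff_divide_distrib)
      moreover have lm: "l / m = l * i" by (simp add: i_def divide_inverse)
      ultimately have eq: "s * (l / m - ln m / lam - ?E) - s * ((b - ?E) - (?E + 1 / lam) * (a - 1))
        = (i - 1) * (s * (l - ?E)) + ((- ?E) * ((i - 1) * (s * (m - 1)))
        + ((- (1 / lam)) * (s * ln m - s * (m - 1)) + ((- (?E + 1 / lam)) * (s * (m - 1) - s * (a - 1))
        + ((s * (l - ?E) - s * (b - ?E)) + s * ?E * (if m = 0 then -1 else 0)))))"
        unfolding im lm by simp
      show "sqrt n * (Kn n \<omega> - ?E) - sqrt n * sample_mean (K_influence lam) n \<omega>
      = (inverse (mean_abs n \<omega>) - 1) * (sqrt n * (mean_log n \<omega> - ?E))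
      + ((- ?E) * ((inverse (mean_abs n \<omega>) - 1) * (sqrt n * (mean_abs n \<omega> - 1)))
      + ((- (1 / lam)) * (sqrt n * ln (mean_abs n \<omega>) - sqrt n * (mean_abs n \<omega> - 1))
      + ((- (?E + 1 / lam)) * (sqrt n * (mean_abs n \<omega> - 1) - sqrt n * (sample_mean (\<lambda>y. \<bar>y\<bar> powr lam) n \<omega> - 1))
      + ((sqrt n * (mean_log n \<omega> - ?E) - sqrt n * (sample_mean (logpow lam) n \<omega> - ?E)) + R n \<omega>))))"
        unfolding Kn_def R_def eqK[OF n]
          m_l_s_a_b_def[symmetric] i_def[symmetric] by (rule eq)
    qed
  qed measurable
qed

lemma bounded_sample_S: "bounded_in_probability M (\<lambda>n \<omega>. sqrt n * sample_mean (S_influence lam) n \<omega>)"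
  using bounded_in_prob_sample_mean[OF influence_measurable(1) S_influence_moments(2)[OF lam]]
  by (simp add: S_influence_moments(1)[OF lam])

lemma bounded_sample_K: "bounded_in_probability M (\<lambda>n \<omega>. sqrt n * sample_mean (K_influence lam) n \<omega>)"
  using bounded_in_prob_sample_mean[OF influence_measurable(2) K_influence_moments(2)[OF lam]]
  by (simp add: K_influence_moments(1)[OF lam])

text \<open>The maximum with 0 is left out here. It returns together with the fourth root, where it
  is locally the identity because \<open>E_K\<close> is positive.\<close>

definition Knet :: "nat \<Rightarrow> 'a \<Rightarrow> real" where
  "Knet n \<omega> = Kn n \<omega> - lam / 2 * (Sn n \<omega>)\<^sup>2"

lemma Knet_measurable [measurable]: "Knet n \<in> borel_measurable M"
  unfolding Knet_def[abs_def] by measurable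

text \<open>The correction is \<open>Sn * (sqrt n * Sn)\<close> up to a constant, a factor tending
  to 0 times a bounded one.\<close>

lemma Knet_linearization:
  "converges_in_probability M (\<lambda>n \<omega>. sqrt n * (Knet n \<omega> - E_K lam) - sqrt n * sample_mean (K_influence lam) n \<omega>) 0"
proof -
  have bS: "bounded_in_probability M (\<lambda>n \<omega>. sqrt n * Sn n \<omega>)"
    using bounded_in_prob_add_conv[OF bounded_sample_S Sn_linearization] by simp
  have S0: "converges_in_probability M (\<lambda>n \<omega>. Sn n \<omega> - 0) 0"
    using bS
    by (intro conv_prob_of_bounded_sqrt[where U = Sn and u = 0]) simp_all
  have "converges_in_probability M (\<lambda>n \<omega>. (lam / 2) * (Sn n \<omega> * (sqrt n * Sn n \<omega>))) 0"
    using conv_prob_cmult[OF conv_prob_mult_bounded[OF S0 bS], of "lam / 2"] by simp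
  from conv_prob_diff[OF Kn_linearization this] show ?thesis
    by (simp add: Knet_def power2_eq_square algebra_simps)
qed

text \<open>The derivative of the fourth root at \<open>E_K\<close> is
  \<open>E_K powr (-3/4) / 4\<close>. The normalization equals
  \<open>4 * E_K powr (3/4) / sqrt (V_K lam)\<close>, so \<open>1 / sqrt (V_K lam)\<close> is left
  over.\<close>

lemma root_Knet_linearization:
  "converges_in_probability M (\<lambda>n \<omega>. sqrt n * (1 / 16 * E_K lam powr (-3/2) * V_K lam) powr (-1/2)
      * (max 0 (Knet n \<omega>) powr (1/4) - E_K lam powr (1/4))
    - sqrt n * sample_mean (K_influence lam) n \<omega> / sqrt (V_K lam)) 0"
proof -
  let ?E = "E_K lam"
  have E: "0 < ?E" by (rule E_K_pos[OF lam])
  have V: "0 < V_K lam" by (rule V_K_pos[OF lam])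
  let ?d = "1 / 4 * ?E powr (1 / 4 - 1)"
  have f: "((\<lambda>x. max 0 x powr (1/4)) has_real_derivative ?d) (at ?E)"
    by (rule has_field_derivative_transform_within_open[OF DERIV_powr_pos[OF E, of "1/4"], of "{0<..}"]) (use E in auto)
  have bK: "bounded_in_probability M (\<lambda>n \<omega>. sqrt n * (Knet n \<omega> - ?E))"
    using bounded_in_prob_add_conv[OF bounded_sample_K Knet_linearization] by simp
  have dm: "converges_in_probability M (\<lambda>n \<omega>. sqrt n * (max 0 (Knet n \<omega>) powr (1/4) - max 0 ?E powr (1/4))
      - ?d * (sqrt n * (Knet n \<omega> - ?E))) 0"
    by (rule delta_method[OF bK f]) measurable
  have 1: "converges_in_probability M (\<lambda>n \<omega>. sqrt n * (max 0 (Knet n \<omega>) powr (1/4) - max 0 ?E powr (1/4))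
      - ?d * (sqrt n * (Knet n \<omega> - ?E)) + ?d * (sqrt n * (Knet n \<omega> - ?E) - sqrt n * sample_mean (K_influence lam) n \<omega>)) (0 + 0)"
    by (rule conv_prob_add[OF dm conv_prob_cmult[OF Knet_linearization]])
  define k where "k = (1 / 16 * ?E powr (-3/2) * V_K lam) powr (-1/2)"
  have k: "k * ?d = 1 / sqrt (V_K lam)"
  proof -
    have "k = (1 / 16) powr (-1/2) * (?E powr (-3/2)) powr (-1/2) * V_K lam powr (-1/2)"
      unfolding k_def by (simp only: powr_mult)
    moreover have "(1 / 16) powr (-1/2) = (4::real)"
    proof -
      have "sqrt (1 / 16) = (1 / 4 :: real)" by (rule real_sqrt_unique) (simp_all add: power2_eq_square)
      moreover have "(1 / 16 :: real) powr (-1/2) = 1 / sqrt (1 / 16)" by (rule powr_minus_half) simp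
      ultimately have "(1 / 16 :: real) powr (-1/2) = 1 / (1 / 4)" by (simp only:)
      then show ?thesis by (simp only: divide_divide_eq_right mult_1 div_by_1)
    qed
    moreover have "(?E powr (-3/2)) powr (-1/2) = ?E powr (3/4)"
    proof -
      have "-3/2 * (-1/2) = (3/4 :: real)" by simp
      then show ?thesis by (simp only: powr_powr)
    qed
    moreover have "?E powr (3/4) * ?E powr (1 / 4 - 1) = 1"
    proof -
      have "3/4 + (1/4 - 1) = (0 :: real)" by simp
      then have "?E powr (3/4) * ?E powr (1 / 4 - 1) = ?E powr 0" by (simp only: powr_add[symmetric])
      then show ?thesis using E by simp
    qed
    ultimately show ?thesis unfolding powr_minus_half[OF V] by simp
  qed
  have eq: "sqrt n * k * (max 0 (Knet n \<omega>) powr (1/4) - ?E powr (1/4)) - sqrt n * sample_mean (K_influence lam) n \<omega> / sqrt (V_K lam)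
    = k * (sqrt n * (max 0 (Knet n \<omega>) powr (1/4) - max 0 ?E powr (1/4))
      - ?d * (sqrt n * (Knet n \<omega> - ?E)) + ?d * (sqrt n * (Knet n \<omega> - ?E) - sqrt n * sample_mean (K_influence lam) n \<omega>))" for n \<omega>
  proof -
    have gen: "k * (x - d * y + d * (y - z)) = k * x - (k * d) * z" for x y z d :: real
      by (simp add: algebra_simps)
    show ?thesis unfolding gen k using E by (simp add: mult.assoc mult.left_commute)
  qed
  show ?thesis unfolding k_def[symmetric] eq
    using conv_prob_cmult[of _ k] 1 by simp
qed

lemma Sn_standardized:
  "converges_in_probability M (\<lambda>n \<omega>. sqrt n * V_S lam powr (-1/2) * Sn n \<omega>
    - sqrt n * sample_mean (S_influence lam) n \<omega> / sqrt (V_S lam)) 0"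
proof -
  have "V_S lam powr (-1/2) = 1 / sqrt (V_S lam)"
    by (rule powr_minus_half[OF V_S_pos[OF lam]])
  moreover have "converges_in_probability M (\<lambda>n \<omega>. (1 / sqrt (V_S lam)) *
      (sqrt n * Sn n \<omega> - sqrt n * sample_mean (S_influence lam) n \<omega>)) 0"
    by (rule conv_prob_cmult[OF Sn_linearization])
  ultimately show ?thesis by (simp add: diff_divide_distrib algebra_simps)
qed

section \<open>The bivariate limit\<close>

text \<open>Stated for arbitrary \<open>A\<close> and \<open>B\<close> close to the normalized sums,
  so that the finite-sample corrections can be absorbed in the hypotheses.\<close>

theorem bivariate_limit:
  assumes A[measurable]: "\<And>n. A n \<in> borel_measurable M" and B[measurable]: "\<And>n. B n \<in> borel_measurable M"
    and dA: "converges_in_probability M (\<lambda>n \<omega>. A n \<omega> - sqrt n * sample_mean (S_influence lam) n \<omega> / sqrt (V_S lam)) 0"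
    and dB: "converges_in_probability M (\<lambda>n \<omega>. B n \<omega> - sqrt n * sample_mean (K_influence lam) n \<omega> / sqrt (V_K lam)) 0"
  shows "converges_in_distribution M (\<lambda>n \<omega>. vector [A n \<omega>, B n \<omega>] :: real^2) (multivariate_normal 0 (mat 1))"
proof (rule converges_in_distribution_trigI)
  note VS = V_S_pos[OF lam] and VK = V_K_pos[OF lam]
  have eqv: "(vector [x, y] :: real^2) = x *\<^sub>R axis 1 1 + y *\<^sub>R axis 2 1" for x y
    by (simp add: vec_eq_iff forall_2 axis_def)
  show "(\<lambda>\<omega>. vector [A n \<omega>, B n \<omega>] :: real^2) \<in> borel_measurable M" for n
    unfolding eqv by measurable
  have bA: "bounded_in_probability M A"
  proof -
    have "bounded_in_probability M (\<lambda>n \<omega>. sqrt n * sample_mean (S_influence lam) n \<omega> / sqrt (V_S lam))"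
      using bounded_in_prob_cmult[OF bounded_sample_S, of "1 / sqrt (V_S lam)"] by simp
    from bounded_in_prob_add_conv[OF this dA] show ?thesis by simp
  qed
  have bB: "bounded_in_probability M B"
  proof -
    have "bounded_in_probability M (\<lambda>n \<omega>. sqrt n * sample_mean (K_influence lam) n \<omega> / sqrt (V_K lam))"
      using bounded_in_prob_cmult[OF bounded_sample_K, of "1 / sqrt (V_K lam)"] by simp
    from bounded_in_prob_add_conv[OF this dB] show ?thesis by simp
  qed
  show "\<exists>R. \<forall>\<^sub>F n in sequentially. prob {\<omega> \<in> space M. norm (vector [A n \<omega>, B n \<omega>] :: real^2) > R} \<le> \<epsilon>"
    if e: "\<epsilon> > 0" for \<epsilon>
  proof -
    obtain C1 where C1: "\<forall>\<^sub>F n in sequentially. prob {\<omega> \<in> space M. \<bar>A n \<omega>\<bar> > C1} \<le> \<epsilon> / 2"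
      using bounded_in_probD[OF bA half_gt_zero[OF e]] by blast
    obtain C2 where C2: "\<forall>\<^sub>F n in sequentially. prob {\<omega> \<in> space M. \<bar>B n \<omega>\<bar> > C2} \<le> \<epsilon> / 2"
      using bounded_in_probD[OF bB half_gt_zero[OF e]] by blast
    have "\<forall>\<^sub>F n in sequentially. prob {\<omega> \<in> space M. norm (vector [A n \<omega>, B n \<omega>] :: real^2) > C1 + C2} \<le> \<epsilon>"
      using C1 C2
    proof eventually_elim
      case (elim n)
      have le: "norm (vector [x, y] :: real^2) \<le> \<bar>x\<bar> + \<bar>y\<bar>" for x y
        unfolding eqv by (rule order_trans[OF norm_triangle_ineq]) (simp add: norm_axis_1)
      have "prob {\<omega> \<in> space M. norm (vector [A n \<omega>, B n \<omega>] :: real^2) > C1 + C2}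
          \<le> prob ({\<omega> \<in> space M. \<bar>A n \<omega>\<bar> > C1} \<union> {\<omega> \<in> space M. \<bar>B n \<omega>\<bar> > C2})"
      proof (intro finite_measure_mono subsetI)
        fix \<omega> assume "\<omega> \<in> {\<omega> \<in> space M. norm (vector [A n \<omega>, B n \<omega>] :: real^2) > C1 + C2}"
        then have "\<omega> \<in> space M" "C1 + C2 < \<bar>A n \<omega>\<bar> + \<bar>B n \<omega>\<bar>" using le[of "A n \<omega>" "B n \<omega>"] by auto
        then show "\<omega> \<in> {\<omega> \<in> space M. \<bar>A n \<omega>\<bar> > C1} \<union> {\<omega> \<in> space M. \<bar>B n \<omega>\<bar> > C2}" by auto
      qed measurable
      also have "\<dots> \<le> prob {\<omega> \<in> space M. \<bar>A n \<omega>\<bar> > C1} + prob {\<omega> \<in> space M. \<bar>B n \<omega>\<bar> > C2}"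
        by (rule measure_Un_le) measurable
      finally show ?case using elim by linarith
    qed
    then show ?thesis by blast
  qed
  have lim: "(\<lambda>n. expectation (\<lambda>\<omega>. cos (a \<bullet> (vector [A n \<omega>, B n \<omega>] :: real^2)))) \<longlonglongrightarrow> exp (- (norm a)\<^sup>2 / 2)"
    "(\<lambda>n. expectation (\<lambda>\<omega>. sin (a \<bullet> (vector [A n \<omega>, B n \<omega>] :: real^2)))) \<longlonglongrightarrow> 0" for a :: "real^2"
  proof -
    define p q where "p = a $ 1" and "q = a $ 2"
    have na: "(norm a)\<^sup>2 = p\<^sup>2 + q\<^sup>2"
      unfolding power2_norm_eq_inner inner_vec_def sum_2 p_def q_def by (simp add: power2_eq_square)
    have ai: "a \<bullet> (vector [x, y] :: real^2) = p * x + q * y" for x y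
      by (simp add: inner_vec_def sum_2 p_def q_def)
    define f where "f y = p / sqrt (V_S lam) * S_influence lam y + q / sqrt (V_K lam) * K_influence lam y" for y
    have fm[measurable]: "f \<in> borel_measurable borel"
      unfolding f_def by measurable
    have Si: "integrable (epd lam) (S_influence lam)"
      by (rule epd_integrable_square_imp[OF S_influence_moments(2)[OF lam] influence_measurable(1)])
    have Ki: "integrable (epd lam) (K_influence lam)"
      by (rule epd_integrable_square_imp[OF K_influence_moments(2)[OF lam] influence_measurable(2)])
    have f0: "(\<integral>y. f y \<partial>epd lam) = 0"
      unfolding f_def using Si Ki by (simp add: S_influence_moments(1)[OF lam] K_influence_moments(1)[OF lam])
    have sq: "(f y)\<^sup>2 = p\<^sup>2 / V_S lam * (S_influence lam y)\<^sup>2 + q\<^sup>2 / V_K lam * (K_influence lam y)\<^sup>2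
        + 2 * (p / sqrt (V_S lam)) * (q / sqrt (V_K lam)) * (S_influence lam y * K_influence lam y)" for y
      unfolding f_def power2_sum using VS VK by (simp add: power_mult_distrib power_divide mult_ac)
    have f2: "integrable (epd lam) (\<lambda>y. (f y)\<^sup>2)"
      unfolding sq using S_influence_moments(2)[OF lam] K_influence_moments(2)[OF lam] influence_orthogonal(1)[OF lam] by simp
    \<comment> \<open>Orthogonality of the influence functions removes the mixed term; it is what
      makes the limiting covariance the identity.\<close>
    have fI: "(\<integral>y. (f y)\<^sup>2 \<partial>epd lam) = (norm a)\<^sup>2"
      unfolding sq using S_influence_moments(2)[OF lam] K_influence_moments(2)[OF lam] influence_orthogonal[OF lam] VS VK
      by (simp add: S_influence_moments(3)[OF lam] K_influence_moments(3)[OF lam] na)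
    have W: "sqrt n * sample_mean f n \<omega> = p * (sqrt n * sample_mean (S_influence lam) n \<omega> / sqrt (V_S lam))
        + q * (sqrt n * sample_mean (K_influence lam) n \<omega> / sqrt (V_K lam))" for n \<omega>
      unfolding f_def[abs_def] sample_mean_add sample_mean_cmult by (simp add: algebra_simps)
    have "converges_in_probability M (\<lambda>n \<omega>.
        p * (A n \<omega> - sqrt n * sample_mean (S_influence lam) n \<omega> / sqrt (V_S lam))
        + q * (B n \<omega> - sqrt n * sample_mean (K_influence lam) n \<omega> / sqrt (V_K lam))) (0 + 0)"
      by (intro conv_prob_add conv_prob_cmult dA dB)
    then have d: "converges_in_probability M (\<lambda>n \<omega>. (p * A n \<omega> + q * B n \<omega>) - sqrt n * sample_mean f n \<omega>) 0"
      unfolding W by (simp add: algebra_simps)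
    have base: "(\<lambda>n. expectation (\<lambda>\<omega>. cos (sqrt n * sample_mean f n \<omega>))) \<longlonglongrightarrow> exp (- (norm a)\<^sup>2 / 2)"
      "(\<lambda>n. expectation (\<lambda>\<omega>. sin (sqrt n * sample_mean f n \<omega>))) \<longlonglongrightarrow> 0"
    proof -
      show "(\<lambda>n. expectation (\<lambda>\<omega>. cos (sqrt n * sample_mean f n \<omega>))) \<longlonglongrightarrow> exp (- (norm a)\<^sup>2 / 2)"
      \<comment> \<open>In the zero direction the variance is 0 and outside the scope of the central
        limit theorem; the expectation is then constant.\<close>
      proof (cases "a = 0")
        case True then show ?thesis unfolding W by (simp add: p_def q_def prob_space)
      next
        case False then show ?thesis by (intro clt_trig(1)[OF fm f2 f0 fI]) simp
      qed
      show "(\<lambda>n. expectation (\<lambda>\<omega>. sin (sqrt n * sample_mean f n \<omega>))) \<longlonglongrightarrow> 0"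
      proof (cases "a = 0")
        case True then show ?thesis unfolding W by (simp add: p_def q_def)
      next
        case False then show ?thesis by (intro clt_trig(2)[OF fm f2 f0 fI]) simp
      qed
    qed
    have lc: "\<bar>cos x - cos y\<bar> \<le> \<bar>x - y\<bar>" and ls: "\<bar>sin x - sin y\<bar> \<le> \<bar>x - y\<bar>" for x y :: real
    proof -
      have "norm (cos x - cos y) \<le> 1 * norm (x - y)"
        by (rule field_differentiable_bound[where S = UNIV and f' = "\<lambda>x. - sin x"]) (auto intro!: derivative_eq_intros)
      then show "\<bar>cos x - cos y\<bar> \<le> \<bar>x - y\<bar>" by simp
      have "norm (sin x - sin y) \<le> 1 * norm (x - y)"
        by (rule field_differentiable_bound[where S = UNIV and f' = cos]) (auto intro!: derivative_eq_intros)
      then show "\<bar>sin x - sin y\<bar> \<le> \<bar>x - y\<bar>" by simp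
    qed
    show "(\<lambda>n. expectation (\<lambda>\<omega>. cos (a \<bullet> (vector [A n \<omega>, B n \<omega>] :: real^2)))) \<longlonglongrightarrow> exp (- (norm a)\<^sup>2 / 2)"
      unfolding ai by (rule expectation_lipschitz_close[OF lc _ _ _ _ d base(1)]) auto
    show "(\<lambda>n. expectation (\<lambda>\<omega>. sin (a \<bullet> (vector [A n \<omega>, B n \<omega>] :: real^2)))) \<longlonglongrightarrow> 0"
      unfolding ai by (rule expectation_lipschitz_close[OF ls _ _ _ _ d base(2)]) auto
  qed
  show "(\<lambda>n. expectation (\<lambda>\<omega>. cos (a \<bullet> (vector [A n \<omega>, B n \<omega>] :: real^2)))) \<longlonglongrightarrow> (\<integral>z. cos (a \<bullet> z) \<partial>multivariate_normal 0 (mat 1))" for a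
    unfolding multivariate_normal_std_trig by (rule lim)
  show "(\<lambda>n. expectation (\<lambda>\<omega>. sin (a \<bullet> (vector [A n \<omega>, B n \<omega>] :: real^2)))) \<longlonglongrightarrow> (\<integral>z. sin (a \<bullet> z) \<partial>multivariate_normal 0 (mat 1))" for a
    unfolding multivariate_normal_std_trig by (rule lim)
qed (rule prob_space_multivariate_normal_std sets_multivariate_normal_std)+

text \<open>Keeps a denominator away from 0. The standard normal density is at most 1, so an
  interval has probability at most its length, and \<open>B n\<close> differs from the normalized
  sum by more than \<open>\<delta>\<close> with probability below \<open>\<delta>\<close>
  only.\<close>

lemma prob_small_le:
  assumes B[measurable]: "\<And>n. B n \<in> borel_measurable M"
    and dB: "converges_in_probability M (\<lambda>n \<omega>. B n \<omega> - sqrt n * sample_mean (K_influence lam) n \<omega> / sqrt (V_K lam)) 0"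
    and d: "0 < \<delta>"
  shows "\<forall>\<^sub>F n in sequentially. prob {\<omega> \<in> space M. \<bar>B n \<omega>\<bar> \<le> \<delta>} < 6 * \<delta>"
proof -
  let ?W = "\<lambda>n \<omega>. sqrt n * sample_mean (K_influence lam) n \<omega> / sqrt (V_K lam)"
  let ?N = std_normal_distribution
  have V: "(\<integral>y. (K_influence lam y)\<^sup>2 \<partial>epd lam) = (sqrt (V_K lam))\<^sup>2" "0 < sqrt (V_K lam)"
    using V_K_pos[OF lam] by (simp_all add: K_influence_moments(3)[OF lam])
  interpret N: real_distribution ?N by (rule real_dist_normal_dist)
  have wc: "weak_conv_m (\<lambda>n. distr M borel (?W n)) ?N"
    by (rule clt_weak[OF influence_measurable(2) K_influence_moments(2,1)[OF lam] V])
  have Nm: "measure ?N {a<..b} \<le> b - a" if "a \<le> b" for a b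
  proof -
    have "emeasure ?N {a<..b} = (\<integral>\<^sup>+x. ennreal (std_normal_density x) * indicator {a<..b} x \<partial>lborel)"
      by (subst emeasure_density) auto
    also have "\<dots> \<le> (\<integral>\<^sup>+x. indicator {a<..b} x \<partial>lborel)"
    proof (intro nn_integral_mono)
      fix x :: real
      have "1 \<le> sqrt (2 * pi)" using pi_gt3 by simp
      then have "1 / sqrt (2 * pi) * exp (- x\<^sup>2 / 2) \<le> 1 * 1" by (intro mult_mono) auto
      then show "ennreal (std_normal_density x) * indicator {a<..b} x \<le> indicator {a<..b} x"
        by (auto simp: std_normal_density_def split: split_indicator)
    qed
    also have "\<dots> = ennreal (b - a)" using that by simp
    finally show ?thesis using that by (simp add: N.emeasure_eq_measure)
  qed
  have cont: "isCont (cdf ?N) x" for x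
  proof -
    have "emeasure ?N {x} = 0"
      by (subst emeasure_density) (auto simp: nn_integral_0_iff_AE intro!: AE_mp[OF AE_lborel_singleton[of x]])
    then show ?thesis by (simp add: N.isCont_cdf N.emeasure_eq_measure)
  qed
  have c: "(\<lambda>n. cdf (distr M borel (?W n)) x) \<longlonglongrightarrow> cdf ?N x" for x
    using wc cont unfolding weak_conv_m_def weak_conv_def by blast
  \<comment> \<open>The normalized sum may reach \<open>- 2 * \<delta>\<close>, which a half-open
    interval with that left end would miss; hence \<open>5/2\<close>. The length
    \<open>(9/2) * \<delta>\<close> still leaves the limit strictly below
    \<open>5 * \<delta>\<close>.\<close>
  have "(\<lambda>n. cdf (distr M borel (?W n)) (2 * \<delta>) - cdf (distr M borel (?W n)) (- (5/2) * \<delta>)) \<longlonglongrightarrow> cdf ?N (2 * \<delta>) - cdf ?N (- (5/2) * \<delta>)"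
    by (intro tendsto_diff c)
  moreover have "cdf ?N (2 * \<delta>) - cdf ?N (- (5/2) * \<delta>) < 5 * \<delta>"
  proof -
    have "cdf ?N (2 * \<delta>) - cdf ?N (- (5/2) * \<delta>) = measure ?N {- (5/2) * \<delta><..2 * \<delta>}"
      using d by (intro N.cdf_diff_eq) auto
    also have "\<dots> \<le> 2 * \<delta> - (- (5/2) * \<delta>)" using d by (intro Nm) auto
    finally show ?thesis using d by linarith
  qed
  ultimately have ev: "\<forall>\<^sub>F n in sequentially. cdf (distr M borel (?W n)) (2 * \<delta>) - cdf (distr M borel (?W n)) (- (5/2) * \<delta>) < 5 * \<delta>"
    by (rule order_tendstoD)
  show ?thesis
    using ev conv_probD[OF dB d d]
  proof eventually_elim
    case (elim n)
    interpret W: real_distribution "distr M borel (?W n)" by (rule real_distribution_distr) measurable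
    have m: "{\<omega> \<in> space M. - (5/2) * \<delta> < ?W n \<omega> \<and> ?W n \<omega> \<le> 2 * \<delta>} \<in> events" by measurable
    have "cdf (distr M borel (?W n)) (2 * \<delta>) - cdf (distr M borel (?W n)) (- (5/2) * \<delta>)
        = measure (distr M borel (?W n)) {- (5/2) * \<delta><..2 * \<delta>}"
      using d by (intro W.cdf_diff_eq) auto
    also have "\<dots> = prob {\<omega> \<in> space M. - (5/2) * \<delta> < ?W n \<omega> \<and> ?W n \<omega> \<le> 2 * \<delta>}"
      by (subst measure_distr) (auto intro!: arg_cong[where f = prob])
    finally have w: "prob {\<omega> \<in> space M. - (5/2) * \<delta> < ?W n \<omega> \<and> ?W n \<omega> \<le> 2 * \<delta>} < 5 * \<delta>" using elim by linarith
    have "prob {\<omega> \<in> space M. \<bar>B n \<omega>\<bar> \<le> \<delta>} \<le> prob ({\<omega> \<in> space M. - (5/2) * \<delta> < ?W n \<omega> \<and> ?W n \<omega> \<le> 2 * \<delta>}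
        \<union> {\<omega> \<in> space M. \<bar>B n \<omega> - ?W n \<omega> - 0\<bar> > \<delta>})"
    proof (intro finite_measure_mono subsetI)
      fix \<omega> assume "\<omega> \<in> {\<omega> \<in> space M. \<bar>B n \<omega>\<bar> \<le> \<delta>}"
      then have "\<omega> \<in> space M" "\<bar>B n \<omega>\<bar> \<le> \<delta>" by auto
      moreover have "- (5/2) * \<delta> < ?W n \<omega> \<and> ?W n \<omega> \<le> 2 * \<delta> \<or> \<bar>B n \<omega> - ?W n \<omega> - 0\<bar> > \<delta>"
        using \<open>\<bar>B n \<omega>\<bar> \<le> \<delta>\<close> d by linarith
      ultimately show "\<omega> \<in> {\<omega> \<in> space M. - (5/2) * \<delta> < ?W n \<omega> \<and> ?W n \<omega> \<le> 2 * \<delta>}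
        \<union> {\<omega> \<in> space M. \<bar>B n \<omega> - ?W n \<omega> - 0\<bar> > \<delta>}" by blast
    qed measurable
    also have "\<dots> \<le> prob {\<omega> \<in> space M. - (5/2) * \<delta> < ?W n \<omega> \<and> ?W n \<omega> \<le> 2 * \<delta>}
        + prob {\<omega> \<in> space M. \<bar>B n \<omega> - ?W n \<omega> - 0\<bar> > \<delta>}"
      by (rule measure_Un_le[OF m]) measurable
    finally show ?case using w elim by linarith
  qed
qed

end

section \<open>The statistics in terms of standardized residuals\<close>

text \<open>The common factor \<open>\<sigma>\<close> of residuals and estimated scale cancels, so
  both statistics are functions of three means of standardized residuals. The identities hold
  without exception, degenerate samples included.\<close>

lemma residual_statistics:
  fixes x :: "nat \<Rightarrow> real" and n :: nat
  assumes lam: "0 < lam" and \<sigma>: "0 < \<sigma>"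
  defines "v \<equiv> \<lambda>i. (x i - mu_hat lam n x) / \<sigma>"
  shows "S_stat lam n x = ((\<Sum>i<n. spow lam (v i)) / n) / ((\<Sum>i<n. \<bar>v i\<bar> powr lam) / n)"
    and "K_stat lam n x = ((\<Sum>i<n. logpow lam (v i)) / n) / ((\<Sum>i<n. \<bar>v i\<bar> powr lam) / n)
      - ln ((\<Sum>i<n. \<bar>v i\<bar> powr lam) / n) / lam"
proof -
  define A where "A = (\<Sum>i<n. \<bar>v i\<bar> powr lam) / n"
  define r where "r = A powr (1 / lam)"
  have xv: "x i - mu_hat lam n x = \<sigma> * v i" for i using \<sigma> by (simp add: v_def)
  have "sigma_hat lam n x = \<sigma> * r"
  proof -
    have "(1 / real n) * (\<Sum>i<n. \<bar>x i - mu_hat lam n x\<bar> powr lam) = \<sigma> powr lam * A"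
      unfolding xv using \<sigma> by (simp add: A_def abs_mult powr_mult sum_distrib_left[symmetric])
    then show ?thesis using \<sigma> lam by (simp add: sigma_hat_def r_def powr_mult powr_powr)
  qed
  then have Yh: "Y_hat lam n x i = v i / r" for i using \<sigma> by (simp add: Y_hat_def xv)
  have A0: "0 \<le> A" unfolding A_def by (intro divide_nonneg_nonneg sum_nonneg) auto
  have "S_stat lam n x = ((\<Sum>i<n. spow lam (v i)) / n) / A \<and>
    K_stat lam n x = ((\<Sum>i<n. logpow lam (v i)) / n) / A - ln A / lam"
  proof (cases "A = 0")
    \<comment> \<open>All residuals and the estimated scale are 0 here. Division by 0 and
      \<open>ln 0\<close> have the value 0, so both sides vanish.\<close>
    case True
    then have "r = 0" by (simp add: r_def)
    then show ?thesis using True by (simp add: S_stat_def K_stat_def Yh)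
  next
    case False
    then have A: "0 < A" using A0 by simp
    then have r: "0 < r" "r powr lam = A" using lam by (simp_all add: r_def powr_powr)
    have n: "0 < n" using False by (cases n) (simp_all add: A_def)
    have s: "\<bar>v i / r\<bar> powr lam * sgn (v i / r) = spow lam (v i) / A" for i
      using r spow_divide[of r lam "v i"] by (simp add: spow_def)
    have k: "\<bar>v i / r\<bar> powr lam * ln \<bar>v i / r\<bar> = logpow lam (v i) / A - ln A / lam * (\<bar>v i\<bar> powr lam / A)" for i
    proof (cases "v i = 0")
      case False
      have "ln r = ln A / lam" using A by (simp add: r_def ln_powr)
      then have "ln \<bar>v i / r\<bar> = ln \<bar>v i\<bar> - ln A / lam" using False r by (simp add: abs_divide ln_div)
      moreover have "\<bar>v i / r\<bar> powr lam = \<bar>v i\<bar> powr lam / A" using r by (simp add: abs_divide powr_divide)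
      ultimately have "\<bar>v i / r\<bar> powr lam * ln \<bar>v i / r\<bar> = (\<bar>v i\<bar> powr lam / A) * (ln \<bar>v i\<bar> - ln A / lam)"
        by (simp only:)
      then show ?thesis by (simp add: logpow_def right_diff_distrib mult_ac)
    qed (simp add: logpow_def)
    have "S_stat lam n x = ((\<Sum>i<n. spow lam (v i)) / n) / A"
      unfolding S_stat_def Yh s by (simp add: sum_divide_distrib[symmetric])
    moreover have "K_stat lam n x = ((\<Sum>i<n. logpow lam (v i)) / n) / A - ln A / lam * (A / A)"
      unfolding K_stat_def Yh k
      by (simp add: sum_subtractf sum_divide_distrib[symmetric] sum_distrib_left[symmetric] right_diff_distrib)
        (simp add: A_def)
    ultimately show ?thesis using False by simp
  qed
  then show "S_stat lam n x = ((\<Sum>i<n. spow lam (v i)) / n) / ((\<Sum>i<n. \<bar>v i\<bar> powr lam) / n)"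
    "K_stat lam n x = ((\<Sum>i<n. logpow lam (v i)) / n) / ((\<Sum>i<n. \<bar>v i\<bar> powr lam) / n)
      - ln ((\<Sum>i<n. \<bar>v i\<bar> powr lam) / n) / lam"
    unfolding A_def by auto
qed

text \<open>With unit scale, \<open>S_stat\<close> is the numerator divided by a mean of absolute
  powers, and that mean cannot be 0 when the numerator is not.\<close>

lemma S_stat_neq_0:
  assumes lam: "0 < lam" and s: "(\<Sum>i<n. spow lam (x i - mu_hat lam n x)) \<noteq> 0"
  shows "S_stat lam n x \<noteq> 0"
proof -
  let ?u = "\<lambda>i. x i - mu_hat lam n x"
  have n: "n \<noteq> 0" using s by (cases n) auto
  have "(\<Sum>i<n. \<bar>?u i\<bar> powr lam) \<noteq> 0"
  proof
    assume "(\<Sum>i<n. \<bar>?u i\<bar> powr lam) = 0"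
    then have "\<forall>i\<in>{..<n}. \<bar>?u i\<bar> powr lam = 0" by (subst (asm) sum_nonneg_eq_0_iff) auto
    then have "(\<Sum>i<n. spow lam (?u i)) = 0" by (intro sum.neutral) (auto simp: spow_def)
    then show False using s by simp
  qed
  then show ?thesis using residual_statistics(1)[OF lam, of 1 n x] s n by simp
qed

section \<open>Finite-sample corrections\<close>

text \<open>Uniform bounds instead of values, since for \<open>lam = 1\<close> the constants
  alternate with the parity of \<open>n\<close>. Essential is only that \<open>a2\<close> exceeds
  1/2 and the others stay above a positive number; the bound for \<open>a4\<close> is attained at
  \<open>lam = 1.5\<close>.\<close>

lemma APD_constants_bounds:
  assumes "lam \<in> {1, 1.5, 2, 2.5, 3}" and "APD_constants lam n = (a1, c1, a2, c2, a3, c3, a4, c4)"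
  shows "1 / 2 \<le> a1" "4 / 5 \<le> a2" "1 / 2 \<le> a3" "1 / 2 \<le> a4"
    and "\<bar>c1\<bar> \<le> 200" "\<bar>c2\<bar> \<le> 200" "\<bar>c3\<bar> \<le> 200" "\<bar>c4\<bar> \<le> 200"
  using assms by (auto simp: APD_constants_def split: if_splits)

text \<open>Exponent and coefficient are sequences because of the parity dependence. It serves with
  \<open>r = 0\<close> for the factors and with \<open>r = 1 / 2\<close> for the additive
  correction, which carries a factor \<open>sqrt n\<close>.\<close>

lemma correction_tendsto_0:
  fixes a c :: "nat \<Rightarrow> real"
  assumes a: "\<And>n. s \<le> a n" and c: "\<And>n. \<bar>c n\<bar> \<le> C" and rs: "r < s"
  shows "(\<lambda>n. real n powr r * (c n / real n powr a n)) \<longlonglongrightarrow> 0"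
proof (rule Lim_null_comparison)
  have "((\<lambda>x::real. x powr (r - s)) \<longlongrightarrow> 0) at_top" using rs by (intro tendsto_neg_powr filterlim_ident) auto
  then have "(\<lambda>n. real n powr (r - s)) \<longlonglongrightarrow> 0" by (rule filterlim_compose[OF _ filterlim_real_sequentially])
  from tendsto_mult_left[OF this, of C] show "(\<lambda>n. C * real n powr (r - s)) \<longlonglongrightarrow> 0" by simp
  show "\<forall>\<^sub>F n in sequentially. norm (real n powr r * (c n / real n powr a n)) \<le> C * real n powr (r - s)"
  proof (intro eventually_sequentiallyI[of 1])
    fix n :: nat assume n: "1 \<le> n"
    have p: "0 < real n powr s" "0 < real n powr a n" using n by auto
    have "real n powr s \<le> real n powr a n" using n a[of n] by (intro powr_mono) auto
    then have "\<bar>c n\<bar> / real n powr a n \<le> C / real n powr s"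
      using c[of n] p by (intro frac_le) auto
    then have "real n powr r * (\<bar>c n\<bar> / real n powr a n) \<le> real n powr r * (C / real n powr s)"
      by (intro mult_left_mono) auto
    then show "norm (real n powr r * (c n / real n powr a n)) \<le> C * real n powr (r - s)"
      by (simp add: abs_mult powr_diff mult_ac)
  qed
qed

lemma distributed_standardize:
  assumes "prob_space M" and \<sigma>: "0 < \<sigma>"
    and X: "distributed M lborel X (\<lambda>x. ennreal (EPD_density lam \<mu> \<sigma> x))"
  shows "distr M borel (\<lambda>\<omega>. (X \<omega> - \<mu>) / \<sigma>) = epd lam"
proof -
  interpret prob_space M by fact
  have D: "distributed M lborel (\<lambda>\<omega>. - \<mu> / \<sigma> + (1 / \<sigma>) * X \<omega>)
      (\<lambda>y. ennreal (EPD_density lam \<mu> \<sigma> ((y - - \<mu> / \<sigma>) / (1 / \<sigma>))) / ennreal \<bar>1 / \<sigma>\<bar>)"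
    by (rule distributed_affine[OF X]) (use \<sigma> in simp)
  have dens: "ennreal (EPD_density lam \<mu> \<sigma> ((y - - \<mu> / \<sigma>) / (1 / \<sigma>))) / ennreal \<bar>1 / \<sigma>\<bar> = ennreal (EPD_density lam 0 1 y)" for y
  \<comment> \<open>The sign of the density is unknown here, since \<open>lam\<close> is arbitrary;
    where it is negative, \<open>ennreal\<close> sends both sides to 0.\<close>
  proof (cases "0 \<le> EPD_density lam 0 1 y")
    case True
    have e: "EPD_density lam \<mu> \<sigma> ((y - - \<mu> / \<sigma>) / (1 / \<sigma>)) = EPD_density lam 0 1 y / \<sigma>"
      using \<sigma> by (simp add: EPD_density_def field_simps)
    show ?thesis unfolding e using \<sigma> True by (subst divide_ennreal) auto
  next
    case False
    have e: "EPD_density lam \<mu> \<sigma> ((y - - \<mu> / \<sigma>) / (1 / \<sigma>)) = EPD_density lam 0 1 y / \<sigma>"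
      using \<sigma> by (simp add: EPD_density_def field_simps)
    have "EPD_density lam 0 1 y / \<sigma> \<le> 0" using \<sigma> False by (simp add: divide_nonpos_pos)
    then show ?thesis unfolding e using False by (simp add: ennreal_neg)
  qed
  have "distr M lborel (\<lambda>\<omega>. - \<mu> / \<sigma> + (1 / \<sigma>) * X \<omega>) = epd lam"
    using distributed_distr_eq_density[OF D] unfolding dens epd_def .
  moreover have "- \<mu> / \<sigma> + (1 / \<sigma>) * X \<omega> = (X \<omega> - \<mu>) / \<sigma>" for \<omega>
    by (simp add: diff_divide_distrib)
  moreover have "distr M borel f = distr M lborel f" for f :: "'a \<Rightarrow> real"
    by (rule distr_cong) auto
  ultimately show ?thesis by simp
qed

section \<open>Reduction of the observed sample to the standardized one, and the four limits\<close>

theorem proposition3p8: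
  fixes M :: "'a measure" and X :: "nat \<Rightarrow> 'a \<Rightarrow> real" and lam \<mu> \<sigma> :: real
  assumes "prob_space M"
    and "lam \<in> {1, 1.5, 2, 2.5, 3}"
    and "\<sigma> > 0"
    and "prob_space.indep_vars M (\<lambda>_. borel) X UNIV"
    and "\<And>i. distributed M lborel (X i) (\<lambda>x. ennreal (EPD_density lam \<mu> \<sigma> x))"
  shows "(AE \<omega> in M. (\<lambda>n. Z_S lam n (\<lambda>i. X i \<omega>) / Z_star_S lam n (\<lambda>i. X i \<omega>)) \<longlonglongrightarrow> 1)
    \<and> converges_in_probability M
         (\<lambda>n \<omega>. Z_K lam n (\<lambda>i. X i \<omega>) / Z_star_K lam n (\<lambda>i. X i \<omega>)) 1
    \<and> converges_in_distribution M
         (\<lambda>n \<omega>. vector [Z_S lam n (\<lambda>i. X i \<omega>), Z_K lam n (\<lambda>i. X i \<omega>)] :: real ^ 2)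
         (multivariate_normal 0 (mat 1))
    \<and> weak_conv_m (\<lambda>n. distr M borel (\<lambda>\<omega>. X_APD lam n (\<lambda>i. X i \<omega>)))
         (chi_square_distribution 2)"
proof -
  interpret prob_space M by fact
  have lam: "1 \<le> lam" and lam_gt_0: "0 < lam" using assms(2) by auto
  note \<sigma> = assms(3) and ind = assms(4)
  have X[measurable]: "X i \<in> borel_measurable M" for i using ind by (simp add: indep_vars_def)
  define Y where "Y i \<omega> = (X i \<omega> - \<mu>) / \<sigma>" for i \<omega>
  define T where "T n \<omega> = (mu_hat lam n (\<lambda>i. X i \<omega>) - \<mu>) / \<sigma>" for n \<omega>
  have muX[measurable]: "(\<lambda>\<omega>. mu_hat lam n (\<lambda>i. X i \<omega>)) \<in> borel_measurable M" for n
    by (rule mu_hat_measurable[OF lam]) measurable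
  \<comment> \<open>Homogeneity of signed powers transfers the sign of the score from the
    observations to the standardized sample, so \<open>T\<close> inherits the one-sided
    conditions.\<close>
  have score: "(\<Sum>i<n. spow (lam - 1) (Y i \<omega> - t)) = (\<Sum>i<n. spow (lam - 1) (X i \<omega> - (\<mu> + \<sigma> * t))) / \<sigma> powr (lam - 1)" for n \<omega> t
  proof -
    have "Y i \<omega> - t = (X i \<omega> - (\<mu> + \<sigma> * t)) / \<sigma>" for i using \<sigma> by (simp add: Y_def field_simps)
    then show ?thesis using \<sigma> by (simp add: spow_divide sum_divide_distrib)
  qed
  interpret epd_estimator M Y lam T
  proof
    show "indep_vars (\<lambda>_. borel) Y UNIV"
      unfolding Y_def[abs_def] by (rule indep_vars_compose2[OF ind]) measurable
    show "distr M borel (Y i) = epd lam" for i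
      unfolding Y_def[abs_def] by (rule distributed_standardize[OF assms(1) \<sigma> assms(5)])
    show "T n \<in> borel_measurable M" for n unfolding T_def[abs_def] by measurable
    fix n \<omega> t assume n: "0 < (n::nat)"
    show "T n \<omega> \<le> t" if "(\<Sum>i<n. spow (lam - 1) (Y i \<omega> - t)) < 0"
    proof -
      have "(\<Sum>i<n. spow (lam - 1) (X i \<omega> - (\<mu> + \<sigma> * t))) < 0"
        using that \<sigma> unfolding score by (simp add: divide_less_0_iff)
      from mu_hat_le[OF lam n this] show ?thesis using \<sigma> by (simp add: T_def divide_le_eq algebra_simps)
    qed
    show "t \<le> T n \<omega>" if "(\<Sum>i<n. spow (lam - 1) (Y i \<omega> - t)) > 0"
    proof -
      have "0 < (\<Sum>i<n. spow (lam - 1) (X i \<omega> - (\<mu> + \<sigma> * t)))"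
        using that \<sigma> unfolding score by (simp add: zero_less_divide_iff)
      from mu_hat_ge[OF lam n this] show ?thesis using \<sigma> by (simp add: T_def le_divide_eq algebra_simps)
    qed
  qed (rule lam)
  have YT: "Y i \<omega> - T n \<omega> = (X i \<omega> - mu_hat lam n (\<lambda>i. X i \<omega>)) / \<sigma>" for i n \<omega>
    by (simp add: Y_def T_def diff_divide_distrib)
  have S_eq: "S_stat lam n (\<lambda>i. X i \<omega>) = Sn n \<omega>" for n \<omega>
    unfolding Sn_def shifted_mean_def YT by (rule residual_statistics(1)[OF lam_gt_0 \<sigma>])
  have K_eq: "K_stat lam n (\<lambda>i. X i \<omega>) = Kn n \<omega>" for n \<omega>
    unfolding Kn_def shifted_mean_def YT by (rule residual_statistics(2)[OF lam_gt_0 \<sigma>])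
  have Knet_eq: "K_net lam n (\<lambda>i. X i \<omega>) = max 0 (Knet n \<omega>)" for n \<omega>
    unfolding K_net_def Knet_def S_eq K_eq ..
  define ZS where "ZS n \<omega> = Z_star_S lam n (\<lambda>i. X i \<omega>)" for n \<omega>
  define ZK where "ZK n \<omega> = Z_star_K lam n (\<lambda>i. X i \<omega>)" for n \<omega>
  have ZS_eq: "ZS n \<omega> = sqrt n * V_S lam powr (-1/2) * Sn n \<omega>" for n \<omega>
    by (simp add: ZS_def Z_star_S_def S_eq)
  have ZK_eq: "ZK n \<omega> = sqrt n * (1 / 16 * E_K lam powr (-3/2) * V_K lam) powr (-1/2)
      * (max 0 (Knet n \<omega>) powr (1/4) - E_K lam powr (1/4))" for n \<omega>
    unfolding ZK_def Z_star_K_def Knet_eq ..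
  have ZSm[measurable]: "ZS n \<in> borel_measurable M" for n unfolding ZS_eq[abs_def] by measurable
  have ZKm[measurable]: "ZK n \<in> borel_measurable M" for n unfolding ZK_eq[abs_def] by measurable
  have ZS_lin: "converges_in_probability M (\<lambda>n \<omega>. ZS n \<omega> - sqrt n * sample_mean (S_influence lam) n \<omega> / sqrt (V_S lam)) 0"
    unfolding ZS_eq by (rule Sn_standardized)
  have ZK_lin: "converges_in_probability M (\<lambda>n \<omega>. ZK n \<omega> - sqrt n * sample_mean (K_influence lam) n \<omega> / sqrt (V_K lam)) 0"
    unfolding ZK_eq by (rule root_Knet_linearization)
  have bZS: "bounded_in_probability M ZS"
    using bounded_in_prob_add_conv[OF bounded_in_prob_cmult[OF bounded_sample_S, of "1 / sqrt (V_S lam)"], of "\<lambda>n \<omega>. ZS n \<omega> - sqrt n * sample_mean (S_influence lam) n \<omega> / sqrt (V_S lam)"] ZS_lin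
    by simp
  have bZK: "bounded_in_probability M ZK"
    using bounded_in_prob_add_conv[OF bounded_in_prob_cmult[OF bounded_sample_K, of "1 / sqrt (V_K lam)"], of "\<lambda>n \<omega>. ZK n \<omega> - sqrt n * sample_mean (K_influence lam) n \<omega> / sqrt (V_K lam)"] ZK_lin
    by simp
  define a1 where "a1 n = fst (APD_constants lam n)" for n
  define c1 where "c1 n = fst (snd (APD_constants lam n))" for n
  define a2 where "a2 n = fst (snd (snd (APD_constants lam n)))" for n
  define c2 where "c2 n = fst (snd (snd (snd (APD_constants lam n))))" for n
  define a3 where "a3 n = fst (snd (snd (snd (snd (APD_constants lam n)))))" for n
  define c3 where "c3 n = fst (snd (snd (snd (snd (snd (APD_constants lam n))))))" for n
  define a4 where "a4 n = fst (snd (snd (snd (snd (snd (snd (APD_constants lam n)))))))" for n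
  define c4 where "c4 n = snd (snd (snd (snd (snd (snd (snd (APD_constants lam n)))))))" for n
  have tup: "APD_constants lam n = (a1 n, c1 n, a2 n, c2 n, a3 n, c3 n, a4 n, c4 n)" for n
    by (simp add: a1_def c1_def a2_def c2_def a3_def c3_def a4_def c4_def)
  note bds = APD_constants_bounds[OF assms(2) tup]
  define e1 e2 e3 e4 where "e1 n = c1 n / real n powr a1 n" and "e2 n = c2 n / real n powr a2 n"
    and "e3 n = c3 n / real n powr a3 n" and "e4 n = c4 n / real n powr a4 n" for n
  \<comment> \<open>The factor \<open>real n powr 0\<close> is 1 except at \<open>n = 0\<close>,
    where it is 0.\<close>
  have p0: "(\<lambda>n. f n) \<longlonglongrightarrow> 0" if "(\<lambda>n. real n powr 0 * f n) \<longlonglongrightarrow> 0" for f :: "nat \<Rightarrow> real"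
    using that by (rule Lim_transform_eventually) (rule eventually_sequentiallyI[of 1], simp)
  have h: "(0::real) < 1 / 2" "(1 / 2 :: real) < 4 / 5" by simp_all
  have e1: "e1 \<longlonglongrightarrow> 0" unfolding e1_def
    by (rule p0) (rule correction_tendsto_0[OF bds(1) bds(5) h(1)])
  have e3: "e3 \<longlonglongrightarrow> 0" unfolding e3_def
    by (rule p0) (rule correction_tendsto_0[OF bds(3) bds(7) h(1)])
  have e4: "e4 \<longlonglongrightarrow> 0" unfolding e4_def
    by (rule p0) (rule correction_tendsto_0[OF bds(4) bds(8) h(1)])
  have e2: "(\<lambda>n. sqrt (real n) * e2 n) \<longlonglongrightarrow> 0"
    using correction_tendsto_0[OF bds(2) bds(6) h(2)] by (simp add: e2_def powr_half_sqrt)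
  define R1 where "R1 n = (1 + e1 n) powr (-1/2)" for n
  define R3 where "R3 n = (1 + e3 n + e4 n) powr (-1/2)" for n
  define k where "k = (1 / 16 * E_K lam powr (-3/2) * V_K lam) powr (-1/2)"
  define w where "w n = k * E_K lam powr (1/4) * (sqrt n * e2 n)" for n :: nat
  have R1: "R1 \<longlonglongrightarrow> 1"
  proof -
    have "(\<lambda>n. (1 + e1 n) powr (-1/2)) \<longlonglongrightarrow> (1 + 0) powr (-1/2)" by (intro tendsto_intros e1) simp
    then show ?thesis by (simp add: R1_def[abs_def])
  qed
  have R3: "R3 \<longlonglongrightarrow> 1"
  proof -
    have "(\<lambda>n. (1 + e3 n + e4 n) powr (-1/2)) \<longlonglongrightarrow> (1 + 0 + 0) powr (-1/2)" by (intro tendsto_intros e3 e4) simp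
    then show ?thesis by (simp add: R3_def[abs_def])
  qed
  have w: "w \<longlonglongrightarrow> 0"
    using tendsto_mult_left[OF e2, of "k * E_K lam powr (1/4)"] by (simp add: w_def[abs_def])
  \<comment> \<open>This factorization and the next are exact for every \<open>n\<close>, including
    sample sizes with a nonpositive bracket.\<close>
  have Z_S_eq: "Z_S lam n (\<lambda>i. X i \<omega>) = R1 n * ZS n \<omega>" for n \<omega>
    unfolding Z_S_def tup ZS_eq S_eq R1_def e1_def by (simp add: powr_mult)
  have Z_K_eq: "Z_K lam n (\<lambda>i. X i \<omega>) = R3 n * (ZK n \<omega> - w n)" for n \<omega>
  proof -
    have "Z_K lam n (\<lambda>i. X i \<omega>) = sqrt n * (max 0 (Knet n \<omega>) powr (1/4) - E_K lam powr (1/4) * (1 + e2 n))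
        * (1 / 16 * E_K lam powr (-3/2) * V_K lam * (1 + e3 n + e4 n)) powr (-1/2)"
      unfolding Z_K_def tup Knet_eq e2_def e3_def e4_def by simp
    also have "(1 / 16 * E_K lam powr (-3/2) * V_K lam * (1 + e3 n + e4 n)) powr (-1/2) = k * R3 n"
      unfolding k_def R3_def by (rule powr_mult)
    finally show ?thesis unfolding ZK_eq k_def[symmetric] w_def by (simp add: algebra_simps)
  qed
  have noatom: "emeasure (distr M borel (X i)) {c} = 0" for i c
  proof -
    have "distr M borel (X i) = distr M lborel (X i)" by (rule distr_cong) auto
    also have "\<dots> = density lborel (\<lambda>x. ennreal (EPD_density lam \<mu> \<sigma> x))"
      by (rule distributed_distr_eq_density[OF assms(5)])
    also have "emeasure \<dots> {c} = 0"
      by (subst emeasure_density) (auto simp: nn_integral_0_iff_AE intro!: AE_mp[OF AE_lborel_singleton[of c]] AE_I2)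
    finally show ?thesis .
  qed
  \<comment> \<open>The exceptional null sets for the countably many sample sizes are united, so one
    event serves for the whole sequence.\<close>
  have "AE \<omega> in M. \<forall>n. 3 \<le> n \<longrightarrow> (\<Sum>j<n. spow lam (X j \<omega> - mu_hat lam n (\<lambda>i. X i \<omega>))) \<noteq> 0"
    unfolding AE_all_countable using AE_skewness_numerator_neq_0[OF lam _ ind noatom] by (auto intro: AE_impI)
  then have ratio_S: "AE \<omega> in M. (\<lambda>n. Z_S lam n (\<lambda>i. X i \<omega>) / Z_star_S lam n (\<lambda>i. X i \<omega>)) \<longlonglongrightarrow> 1"
  proof eventually_elim
    case (elim \<omega>)
    have "\<forall>\<^sub>F n in sequentially. R1 n = Z_S lam n (\<lambda>i. X i \<omega>) / Z_star_S lam n (\<lambda>i. X i \<omega>)"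
    proof (intro eventually_sequentiallyI[of 3])
      fix n :: nat assume n: "3 \<le> n"
      then have "(\<Sum>j<n. spow lam (X j \<omega> - mu_hat lam n (\<lambda>i. X i \<omega>))) \<noteq> 0" using elim by blast
      from S_stat_neq_0[OF lam_gt_0 this] have "Sn n \<omega> \<noteq> 0" unfolding S_eq .
      then have "ZS n \<omega> \<noteq> 0" using n V_S_pos[OF lam] by (simp add: ZS_eq)
      then show "R1 n = Z_S lam n (\<lambda>i. X i \<omega>) / Z_star_S lam n (\<lambda>i. X i \<omega>)"
        unfolding Z_S_eq ZS_def[symmetric] by simp
    qed
    then show ?case by (rule Lim_transform_eventually[OF R1])
  qed
  have ratio_K: "converges_in_probability M (\<lambda>n \<omega>. Z_K lam n (\<lambda>i. X i \<omega>) / Z_star_K lam n (\<lambda>i. X i \<omega>)) 1"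
    unfolding Z_K_eq ZK_def[symmetric]
  proof (rule conv_probI)
    show "(\<lambda>\<omega>. R3 n * (ZK n \<omega> - w n) / ZK n \<omega>) \<in> borel_measurable M" for n by measurable
    fix \<epsilon> \<delta> :: real assume pos: "\<epsilon> > 0" "\<delta> > 0"
    \<comment> \<open>The estimate near 0 gives probability below \<open>6 * \<eta>\<close>, which
      is to equal \<open>\<delta>\<close>.\<close>
    define \<eta> where "\<eta> = \<delta> / 6"
    have \<eta>: "0 < \<eta>" using pos by (simp add: \<eta>_def)
    have "(\<lambda>n. \<bar>R3 n - 1\<bar> + \<bar>R3 n\<bar> * (\<bar>w n\<bar> / \<eta>)) \<longlonglongrightarrow> \<bar>1 - 1\<bar> + \<bar>1\<bar> * (\<bar>0\<bar> / \<eta>)"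
      using \<eta> by (intro tendsto_intros R3 w) simp
    then have "(\<lambda>n. \<bar>R3 n - 1\<bar> + \<bar>R3 n\<bar> * (\<bar>w n\<bar> / \<eta>)) \<longlonglongrightarrow> 0" by simp
    from order_tendstoD(2)[OF this pos(1)] prob_small_le[OF ZKm ZK_lin \<eta>]
    have "\<forall>\<^sub>F n in sequentially. {\<omega> \<in> space M. \<bar>ZK n \<omega>\<bar> \<le> \<eta>} \<in> events \<and> prob {\<omega> \<in> space M. \<bar>ZK n \<omega>\<bar> \<le> \<eta>} \<le> \<delta> \<and>
      (\<forall>\<omega>\<in>space M - {\<omega> \<in> space M. \<bar>ZK n \<omega>\<bar> \<le> \<eta>}. \<bar>R3 n * (ZK n \<omega> - w n) / ZK n \<omega> - 1\<bar> \<le> \<epsilon>)"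
    proof eventually_elim
      case (elim n)
      have "{\<omega> \<in> space M. \<bar>ZK n \<omega>\<bar> \<le> \<eta>} \<in> events" by measurable
      moreover have "\<bar>R3 n * (z - w n) / z - 1\<bar> \<le> \<epsilon>" if z: "\<eta> < \<bar>z\<bar>" for z
      proof -
        have z0: "z \<noteq> 0" using z \<eta> by auto
        then have "R3 n * (z - w n) / z - 1 = (R3 n - 1) - R3 n * (w n / z)" by (simp add: field_simps)
        also have "\<bar>\<dots>\<bar> \<le> \<bar>R3 n - 1\<bar> + \<bar>R3 n\<bar> * (\<bar>w n\<bar> / \<bar>z\<bar>)"
          by (rule order_trans[OF abs_triangle_ineq4]) (simp add: abs_mult)
        also have "\<dots> \<le> \<bar>R3 n - 1\<bar> + \<bar>R3 n\<bar> * (\<bar>w n\<bar> / \<eta>)"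
          using z \<eta> by (intro add_left_mono mult_left_mono divide_left_mono) auto
        finally show ?thesis using elim by linarith
      qed
      ultimately show ?case using elim by (auto simp: \<eta>_def not_le)
    qed
    then show "\<exists>A. \<forall>\<^sub>F n in sequentially. A n \<in> events \<and> prob (A n) \<le> \<delta> \<and>
      (\<forall>\<omega>\<in>space M - A n. \<bar>R3 n * (ZK n \<omega> - w n) / ZK n \<omega> - 1\<bar> \<le> \<epsilon>)"
      by (rule exI[of _ "\<lambda>n. {\<omega> \<in> space M. \<bar>ZK n \<omega>\<bar> \<le> \<eta>}"])
  qed
  have dS: "converges_in_probability M (\<lambda>n \<omega>. R1 n * ZS n \<omega> - sqrt n * sample_mean (S_influence lam) n \<omega> / sqrt (V_S lam)) 0"
  proof -
    have "(\<lambda>n. R1 n - 1) \<longlonglongrightarrow> 0" using tendsto_diff[OF R1 tendsto_const[of 1]] by simp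
    from conv_prob_add[OF conv_prob_mult_bounded[OF conv_prob_const[OF this] bZS] ZS_lin]
    show ?thesis by (simp add: algebra_simps)
  qed
  have dK: "converges_in_probability M (\<lambda>n \<omega>. R3 n * (ZK n \<omega> - w n) - sqrt n * sample_mean (K_influence lam) n \<omega> / sqrt (V_K lam)) 0"
  proof -
    have 1: "(\<lambda>n. R3 n - 1) \<longlonglongrightarrow> 0" using tendsto_diff[OF R3 tendsto_const[of 1]] by simp
    \<comment> \<open>The additive correction is deterministic and tends to 0, so it does not affect
      the limit law, although it enters the quotient.\<close>
    have 2: "(\<lambda>n. - (R3 n * w n)) \<longlonglongrightarrow> 0" using tendsto_minus[OF tendsto_mult[OF R3 w]] by simp
    from conv_prob_add[OF conv_prob_add[OF conv_prob_mult_bounded[OF conv_prob_const[OF 1] bZK] conv_prob_const[OF 2]] ZK_lin]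
    show ?thesis by (simp add: algebra_simps)
  qed
  have biv: "converges_in_distribution M
      (\<lambda>n \<omega>. vector [Z_S lam n (\<lambda>i. X i \<omega>), Z_K lam n (\<lambda>i. X i \<omega>)] :: real ^ 2) (multivariate_normal 0 (mat 1))"
    unfolding Z_S_eq Z_K_eq by (rule bivariate_limit[OF _ _ dS dK]) measurable
  have "(vector [x, y] :: real^2) \<bullet> vector [x, y] = x\<^sup>2 + y\<^sup>2" for x y
    by (simp add: inner_vec_def sum_2 power2_eq_square)
  then have "weak_conv_m (\<lambda>n. distr M borel (\<lambda>\<omega>. X_APD lam n (\<lambda>i. X i \<omega>))) (chi_square_distribution 2)"
    using converges_in_distribution_norm_square[OF biv] by (simp add: X_APD_def)
  then show ?thesis using ratio_S ratio_K biv by blast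
qed

end
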